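(* Let $\mathfrak L$ be a 2-category. The following conditions are equivalent: (i) There exist a $(1,1)$-proper factorization system $(\mathcal E,\mathcal M)$ on the 2-category $\mathfrak L$ and a biequivalence over $\mathfrak L$, given by normal pseudofunctors $K\colon\mathfrak E\to\mathfrak M$ and $C\colon\mathfrak M\to\mathfrak E$, between the weak 2-fibration of 2-quotients $\operatorname{dom}\colon\mathfrak E\to\mathfrak L$ relative to $(\mathcal E,\mathcal M)$ and the weak 2-opfibration of 2-subobjects $\operatorname{cod}\colon\mathfrak M\to\mathfrak L$ relative to $(\mathcal E,\mathcal M)$. (ii) $\mathfrak L$ has a 2-ideal $\mathcal N$ of null morphisms and null 2-cells such that - $\mathfrak L$ has all $\mathcal N$-2-kernels and all $\mathcal N$-2-cokernels; - $\mathcal N$ is a closed 2-ideal; - every $\mathcal N$-2-kernel $m$ is an $\mathcal N$-2-kernel of its $\mathcal N$-2-cokernel $c_m$, with structure invertible 2-cell between $c_m\circ m$ and a null morphism given, up to an invertible null 2-cell, by the structure 2-cell of the $\mathcal N$-2-cokernel $c_m$ of $m$; and dually every $\mathcal N$-2-cokernel is an $\mathcal N$-2-cokernel of its $\mathcal N$-2-kernel, with structure 2-cell given, up to an invertible null 2-cell, by that of the $\mathcal N$-2-kernel; - every morphism $f$ of $\mathfrak L$ is isomorphic (via an invertible 2-cell) to a composite of an $\mathcal N$-2-cokernel followed by an $\mathcal N$-2-kernel.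
   Context: Conventions. 2-categories are strict. Whiskering is written by juxtaposition; a chain $x\Rightarrow y\Rightarrow z$ of 2-cells denotes the vertical composite. 2-ideals. A 2-ideal $\mathcal N=(N,\nu)$ in $\mathfrak L$ is a normal pseudofunctor $N\colon\mathfrak L^{op}\times\mathfrak L\to\mathbf{Cat}$ with a pseudonatural transformation $\nu\colon N\Rightarrow\mathrm{Hom}(-,-)$ whose components $N(A,B)\to\mathrm{Hom}_{\mathfrak L}(A,B)$ are injective on objects and faithful. View $N(A,B)$ as a subcategory of $\mathrm{Hom}(A,B)$: its objects are the null morphisms, its morphisms the null 2-cells; an invertible null 2-cell is an isomorphism of $N(A,B)$. For $n\colon A\to B$ null, $a\colon A'\to A$, $b\colon B\to B'$, put $\widetilde{bna}:=N(a,b)(n)$ (a null morphism) and let $\nu=\nu_{a,b,n}\colon bna\Rightarrow\widetilde{bna}$ be the invertible 2-cell given by pseudonaturality (identities among $a,b$ are omitted from the notation). 2-kernels. An $\mathcal N$-2-kernel of $f\colon A\to B$ is $k\colon K\to A$ with a null $n\colon K\to B$ and an invertible 2-cell $\alpha\colon fk\Rightarrow n$ (structure 2-cell) such that: (1) for every $z\colon Z\to A$, null $p\colon Z\to B$ and invertible $\beta\colon fz\Rightarrow p$ there are $u\colon Z\to K$ and an invertible $\gamma\colon z\Rightarrow ku$ such that $p\xrightarrow{\beta^{-1}}fz\xrightarrow{f\gamma}fku\xrightarrow{\alpha u}nu\xrightarrow{\nu}\widetilde{nu}$ is an invertible null 2-cell; (2) for all $u,v\colon Z\to K$ and $\lambda\colon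 ku\Rightarrow kv$ such that $\widetilde{nu}\xrightarrow{\nu^{-1}}nu\xrightarrow{\alpha^{-1}u}fku\xrightarrow{f\lambda}fkv\xrightarrow{\alpha v}nv\xrightarrow{\nu}\widetilde{nv}$ is a null 2-cell, there is a unique $\mu\colon u\Rightarrow v$ with $k\mu=\lambda$. $\mathcal N$-2-cokernels are defined dually (reversing morphisms). Closed 2-ideals. $k\colon K\to A$ reflects null morphisms if for all $s\colon D\to K$, null $n\colon D\to A$ and invertible $\delta\colon ks\Rightarrow n$ there are a null $\hat\psi\colon D\to K$ and an invertible $\psi\colon s\Rightarrow\hat\psi$ such that $n\xrightarrow{\delta^{-1}}ks\xrightarrow{k\psi}k\hat\psi\xrightarrow{\nu}\widetilde{k\hat\psi}$ is an invertible null 2-cell. $k$ reflects null 2-cells if for every 2-cell $\mu\colon s\Rightarrow s'\colon D\to K$ between null morphisms, if $\widetilde{ks}\xrightarrow{\nu^{-1}}ks\xrightarrow{k\mu}ks'\xrightarrow{\nu}\widetilde{ks'}$ is null then $\mu$ is null. "Coreflects" is dual. If $\mathfrak L$ has all $\mathcal N$-2-kernels and $\mathcal N$-2-cokernels, $\mathcal N$ is closed if all $\mathcal N$-2-kernels reflect null morphisms and null 2-cells and all $\mathcal N$-2-cokernels coreflect null morphisms and null 2-cells. Factorization systems (Dupont–Vitale). A factorization system $(\mathcal E,\mathcal M)$ on $\mathfrak L$ consists of two classes of morphisms such that: if $m\in\mathcal M$ and $i$ is an equivalence then $mi\in\mathcal M$, and dually $ie\in\mathcal E$ for $e\in\mathcal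 E$; both classes are closed under invertible 2-cells; every morphism is isomorphic to $me$ with $e\in\mathcal E$, $m\in\mathcal M$; and orthogonality holds: for $e\colon D\to R$ in $\mathcal E$, $m\colon Q\to A$ in $\mathcal M$, $s\colon D\to Q$, $t\colon R\to A$ and invertible $\phi\colon ms\Rightarrow te$ there are $d\colon R\to Q$ and invertible $\sigma\colon s\Rightarrow de$, $\rho\colon md\Rightarrow t$ with $\phi=(\rho e)\circ(m\sigma)$; and given two such squares with fillings $(s,t,\phi;d,\sigma,\rho)$, $(s',t',\phi';d',\sigma',\rho')$ and 2-cells $\lambda\colon s\Rightarrow s'$, $\mu\colon t\Rightarrow t'$ with $\phi'\circ(m\lambda)=(\mu e)\circ\phi$, there is a unique $\iota\colon d\Rightarrow d'$ with $\rho'\circ(m\iota)=\mu\circ\rho$ and $(\iota e)\circ\sigma=\sigma'\circ\lambda$. It is $(1,1)$-proper if every $e\in\mathcal E$ is cofaithful ($-\circ e\colon\mathrm{Hom}(R,X)\to\mathrm{Hom}(D,X)$ is faithful for all $X$) and every $m\in\mathcal M$ is faithful ($m\circ-$ is faithful on hom-categories). The 2-functors dom and cod. The pseudo arrow 2-category of $\mathfrak L$ has as objects the morphisms of $\mathfrak L$, as morphisms the squares filled with an invertible 2-cell, as 2-cells the pairs of 2-cells of $\mathfrak L$ (between the two horizontal sides) compatible with the filling 2-cells. $\mathfrak E$ and $\mathfrak M$ are its full sub-2-categories on morphisms in $\mathcal E$ and in $\mathcal M$; $\operatorname{dom}\colon\mathfrak E\to\mathfrak L$ (the weak 2-fibration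 of 2-quotients) and $\operatorname{cod}\colon\mathfrak M\to\mathfrak L$ (the weak 2-opfibration of 2-subobjects) are the domain and codomain 2-functors. A biequivalence over $\mathfrak L$ between them consists of pseudofunctors $K,C$ with $\operatorname{cod}\circ K=\operatorname{dom}$, $\operatorname{dom}\circ C=\operatorname{cod}$ and pseudonatural equivalences $\eta\colon\mathrm{Id}\Rightarrow K C$, $\epsilon\colon CK\Rightarrow\mathrm{Id}$ lying over $\mathfrak L$ (components and structure 2-cells are sent to identities in $\mathfrak L$). A pseudofunctor is normal if it strictly preserves identities. *)

theory Defs
  imports "HOL-Library.FuncSet"
begin

section \<open>Strict 2-categories\<close>

text \<open>Objects, 1-cells and 2-cells are carrier sets inside three types. \<open>src1\<close>, \<open>trg1\<close> give the
  objects bounding a 1-cell, \<open>src2\<close>, \<open>trg2\<close> the 1-cells bounding a 2-cell. All compositions are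
  written in the order of function composition.\<close>

record ('o, 'm, 'c) two_cat =
  Obj :: "'o set"
  Mor :: "'m set"
  Cell :: "'c set"
  src1 :: "'m \<Rightarrow> 'o"
  trg1 :: "'m \<Rightarrow> 'o"
  src2 :: "'c \<Rightarrow> 'm"
  trg2 :: "'c \<Rightarrow> 'm"
  one :: "'o \<Rightarrow> 'm"
  comp1 :: "'m \<Rightarrow> 'm \<Rightarrow> 'm" (infixr \<open>\<cdot>\<index>\<close> 75)
  id2 :: "'m \<Rightarrow> 'c"
  vcomp :: "'c \<Rightarrow> 'c \<Rightarrow> 'c" (infixr \<open>\<bullet>\<index>\<close> 65)
  hcomp :: "'c \<Rightarrow> 'c \<Rightarrow> 'c" (infixr \<open>\<star>\<index>\<close> 70)

definition hom :: "('o, 'm, 'c) two_cat \<Rightarrow> 'o \<Rightarrow> 'o \<Rightarrow> 'm set" where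
  "hom L A B = {f \<in> Mor L. src1 L f = A \<and> trg1 L f = B}"

definition cells :: "('o, 'm, 'c) two_cat \<Rightarrow> 'm \<Rightarrow> 'm \<Rightarrow> 'c set" where
  "cells L f g = {\<alpha> \<in> Cell L. src2 L \<alpha> = f \<and> trg2 L \<alpha> = g}"

locale two_category =
  fixes L :: "('o, 'm, 'c) two_cat" (structure)
  assumes Mor_bd: "f \<in> Mor L \<Longrightarrow> src1 L f \<in> Obj L \<and> trg1 L f \<in> Obj L"
    and Cell_bd: "\<alpha> \<in> Cell L \<Longrightarrow> src2 L \<alpha> \<in> Mor L \<and> trg2 L \<alpha> \<in> Mor L"
    and Cell_parallel: "\<alpha> \<in> Cell L \<Longrightarrow>
      src1 L (src2 L \<alpha>) = src1 L (trg2 L \<alpha>) \<and> trg1 L (src2 L \<alpha>) = trg1 L (trg2 L \<alpha>)"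
    and one_hom: "A \<in> Obj L \<Longrightarrow> one L A \<in> hom L A A"
    and comp1_hom: "\<lbrakk>f \<in> hom L A B; g \<in> hom L B C\<rbrakk> \<Longrightarrow> g \<cdot> f \<in> hom L A C"
    and comp1_assoc: "\<lbrakk>f \<in> hom L A B; g \<in> hom L B C; h \<in> hom L C D\<rbrakk> \<Longrightarrow> (h \<cdot> g) \<cdot> f = h \<cdot> (g \<cdot> f)"
    and comp1_one: "f \<in> hom L A B \<Longrightarrow> f \<cdot> one L A = f"
    and one_comp1: "f \<in> hom L A B \<Longrightarrow> one L B \<cdot> f = f"
    and id2_cells: "f \<in> Mor L \<Longrightarrow> id2 L f \<in> cells L f f"
    and vcomp_cells: "\<lbrakk>\<alpha> \<in> cells L f g; \<beta> \<in> cells L g h\<rbrakk> \<Longrightarrow> \<beta> \<bullet> \<alpha> \<in> cells L f h"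
    and vcomp_assoc: "\<lbrakk>\<alpha> \<in> cells L f g; \<beta> \<in> cells L g h; \<gamma> \<in> cells L h k\<rbrakk> \<Longrightarrow>
      (\<gamma> \<bullet> \<beta>) \<bullet> \<alpha> = \<gamma> \<bullet> (\<beta> \<bullet> \<alpha>)"
    and vcomp_id2: "\<alpha> \<in> cells L f g \<Longrightarrow> \<alpha> \<bullet> id2 L f = \<alpha>"
    and id2_vcomp: "\<alpha> \<in> cells L f g \<Longrightarrow> id2 L g \<bullet> \<alpha> = \<alpha>"
    and hcomp_cells: "\<lbrakk>f \<in> hom L A B; g \<in> hom L B C; \<alpha> \<in> cells L f f'; \<beta> \<in> cells L g g'\<rbrakk> \<Longrightarrow>
      \<beta> \<star> \<alpha> \<in> cells L (g \<cdot> f) (g' \<cdot> f')"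
    and hcomp_id2: "\<lbrakk>f \<in> hom L A B; g \<in> hom L B C\<rbrakk> \<Longrightarrow> id2 L g \<star> id2 L f = id2 L (g \<cdot> f)"
    and interchange: "\<lbrakk>f \<in> hom L A B; g \<in> hom L B C; \<alpha> \<in> cells L f f'; \<alpha>' \<in> cells L f' f'';
      \<beta> \<in> cells L g g'; \<beta>' \<in> cells L g' g''\<rbrakk> \<Longrightarrow>
      (\<beta>' \<bullet> \<beta>) \<star> (\<alpha>' \<bullet> \<alpha>) = (\<beta>' \<star> \<alpha>') \<bullet> (\<beta> \<star> \<alpha>)"
    and hcomp_assoc: "\<lbrakk>f \<in> hom L A B; g \<in> hom L B C; h \<in> hom L C D;
      \<alpha> \<in> cells L f f'; \<beta> \<in> cells L g g'; \<gamma> \<in> cells L h h'\<rbrakk> \<Longrightarrow>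
      (\<gamma> \<star> \<beta>) \<star> \<alpha> = \<gamma> \<star> (\<beta> \<star> \<alpha>)"
    and hcomp_one: "\<lbrakk>f \<in> hom L A B; \<alpha> \<in> cells L f f'\<rbrakk> \<Longrightarrow> \<alpha> \<star> id2 L (one L A) = \<alpha>"
    and one_hcomp: "\<lbrakk>f \<in> hom L A B; \<alpha> \<in> cells L f f'\<rbrakk> \<Longrightarrow> id2 L (one L B) \<star> \<alpha> = \<alpha>"

abbreviation whisker_left :: "'m \<Rightarrow> ('o, 'm, 'c) two_cat \<Rightarrow> 'c \<Rightarrow> 'c" (\<open>(_ \<rhd>\<^bsub>_\<^esub> _)\<close> [72, 0, 71] 71) where
  "f \<rhd>\<^bsub>L\<^esub> \<alpha> \<equiv> id2 L f \<star>\<^bsub>L\<^esub> \<alpha>"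

abbreviation whisker_right :: "'c \<Rightarrow> ('o, 'm, 'c) two_cat \<Rightarrow> 'm \<Rightarrow> 'c" (\<open>(_ \<lhd>\<^bsub>_\<^esub> _)\<close> [72, 0, 71] 71) where
  "\<alpha> \<lhd>\<^bsub>L\<^esub> f \<equiv> \<alpha> \<star>\<^bsub>L\<^esub> id2 L f"

definition is_inv2 :: "('o, 'm, 'c) two_cat \<Rightarrow> 'c \<Rightarrow> 'c \<Rightarrow> bool" where
  "is_inv2 L \<alpha> \<beta> \<longleftrightarrow> \<beta> \<in> cells L (trg2 L \<alpha>) (src2 L \<alpha>) \<and>
     \<beta> \<bullet>\<^bsub>L\<^esub> \<alpha> = id2 L (src2 L \<alpha>) \<and> \<alpha> \<bullet>\<^bsub>L\<^esub> \<beta> = id2 L (trg2 L \<alpha>)"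

definition isos :: "('o, 'm, 'c) two_cat \<Rightarrow> 'm \<Rightarrow> 'm \<Rightarrow> 'c set" where
  "isos L f g = {\<alpha> \<in> cells L f g. \<exists>\<beta>. is_inv2 L \<alpha> \<beta>}"

definition inv2 :: "('o, 'm, 'c) two_cat \<Rightarrow> 'c \<Rightarrow> 'c" where
  "inv2 L \<alpha> = (THE \<beta>. is_inv2 L \<alpha> \<beta>)"

definition equivalence1 :: "('o, 'm, 'c) two_cat \<Rightarrow> 'm \<Rightarrow> bool" where
  "equivalence1 L f \<longleftrightarrow> f \<in> Mor L \<and>
     (\<exists>g \<in> hom L (trg1 L f) (src1 L f).
        isos L (g \<cdot>\<^bsub>L\<^esub> f) (one L (src1 L f)) \<noteq> {} \<and> isos L (f \<cdot>\<^bsub>L\<^esub> g) (one L (trg1 L f)) \<noteq> {})"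

text \<open>The dual reverses 1-cells but not 2-cells.\<close>

definition op2 :: "('o, 'm, 'c) two_cat \<Rightarrow> ('o, 'm, 'c) two_cat" where
  "op2 L = L\<lparr>src1 := trg1 L, trg1 := src1 L,
     comp1 := (\<lambda>g f. f \<cdot>\<^bsub>L\<^esub> g), hcomp := (\<lambda>\<beta> \<alpha>. \<alpha> \<star>\<^bsub>L\<^esub> \<beta>)\<rparr>"

definition prod2 :: "('o, 'm, 'c) two_cat \<Rightarrow> ('p, 'q, 'r) two_cat \<Rightarrow>
    ('o \<times> 'p, 'm \<times> 'q, 'c \<times> 'r) two_cat" where
  "prod2 L M = \<lparr>
     Obj = Obj L \<times> Obj M, Mor = Mor L \<times> Mor M, Cell = Cell L \<times> Cell M,
     src1 = map_prod (src1 L) (src1 M), trg1 = map_prod (trg1 L) (trg1 M),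
     src2 = map_prod (src2 L) (src2 M), trg2 = map_prod (trg2 L) (trg2 M),
     one = map_prod (one L) (one M),
     comp1 = (\<lambda>(g, g') (f, f'). (g \<cdot>\<^bsub>L\<^esub> f, g' \<cdot>\<^bsub>M\<^esub> f')),
     id2 = map_prod (id2 L) (id2 M),
     vcomp = (\<lambda>(\<beta>, \<beta>') (\<alpha>, \<alpha>'). (\<beta> \<bullet>\<^bsub>L\<^esub> \<alpha>, \<beta>' \<bullet>\<^bsub>M\<^esub> \<alpha>')),
     hcomp = (\<lambda>(\<beta>, \<beta>') (\<alpha>, \<alpha>'). (\<beta> \<star>\<^bsub>L\<^esub> \<alpha>, \<beta>' \<star>\<^bsub>M\<^esub> \<alpha>'))\<rparr>"

definition full_sub :: "('o, 'm, 'c) two_cat \<Rightarrow> 'o set \<Rightarrow> ('o, 'm, 'c) two_cat" where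
  "full_sub L S = L\<lparr>Obj := Obj L \<inter> S,
     Mor := {f \<in> Mor L. src1 L f \<in> S \<and> trg1 L f \<in> S},
     Cell := {\<alpha> \<in> Cell L. src1 L (src2 L \<alpha>) \<in> S \<and> trg1 L (src2 L \<alpha>) \<in> S}\<rparr>"


section \<open>Pseudofunctors and pseudonatural transformations\<close>

text \<open>The constraints point in the directions \<open>Fcomp g f : F g \<cdot> F f \<Rightarrow> F (g \<cdot> f)\<close> and
  \<open>Funit a : 1 \<Rightarrow> F 1\<close>.\<close>

record ('o, 'm, 'c, 'p, 'q, 'r) psfun =
  F0 :: "'o \<Rightarrow> 'p"
  F1 :: "'m \<Rightarrow> 'q"
  F2 :: "'c \<Rightarrow> 'r"
  Fcomp :: "'m \<Rightarrow> 'm \<Rightarrow> 'r"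
  Funit :: "'o \<Rightarrow> 'r"

locale pseudofunctor =
  fixes A :: "('o, 'm, 'c) two_cat" and B :: "('p, 'q, 'r) two_cat"
    and F :: "('o, 'm, 'c, 'p, 'q, 'r) psfun"
  assumes F0_Obj: "a \<in> Obj A \<Longrightarrow> F0 F a \<in> Obj B"
    and F1_hom: "f \<in> hom A a b \<Longrightarrow> F1 F f \<in> hom B (F0 F a) (F0 F b)"
    and F2_cells: "\<alpha> \<in> cells A f g \<Longrightarrow> F2 F \<alpha> \<in> cells B (F1 F f) (F1 F g)"
    and F2_id2: "f \<in> Mor A \<Longrightarrow> F2 F (id2 A f) = id2 B (F1 F f)"
    and F2_vcomp: "\<lbrakk>\<alpha> \<in> cells A f g; \<beta> \<in> cells A g h\<rbrakk> \<Longrightarrow>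
      F2 F (\<beta> \<bullet>\<^bsub>A\<^esub> \<alpha>) = F2 F \<beta> \<bullet>\<^bsub>B\<^esub> F2 F \<alpha>"
    and Fcomp_isos: "\<lbrakk>f \<in> hom A a b; g \<in> hom A b c\<rbrakk> \<Longrightarrow>
      Fcomp F g f \<in> isos B (F1 F g \<cdot>\<^bsub>B\<^esub> F1 F f) (F1 F (g \<cdot>\<^bsub>A\<^esub> f))"
    and Funit_isos: "a \<in> Obj A \<Longrightarrow> Funit F a \<in> isos B (one B (F0 F a)) (F1 F (one A a))"
    and Fcomp_natural: "\<lbrakk>f \<in> hom A a b; g \<in> hom A b c; \<alpha> \<in> cells A f f'; \<beta> \<in> cells A g g'\<rbrakk> \<Longrightarrow>
      Fcomp F g' f' \<bullet>\<^bsub>B\<^esub> (F2 F \<beta> \<star>\<^bsub>B\<^esub> F2 F \<alpha>) = F2 F (\<beta> \<star>\<^bsub>A\<^esub> \<alpha>) \<bullet>\<^bsub>B\<^esub> Fcomp F g f"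
    and Fcomp_assoc: "\<lbrakk>f \<in> hom A a b; g \<in> hom A b c; h \<in> hom A c d\<rbrakk> \<Longrightarrow>
      Fcomp F h (g \<cdot>\<^bsub>A\<^esub> f) \<bullet>\<^bsub>B\<^esub> (F1 F h \<rhd>\<^bsub>B\<^esub> Fcomp F g f)
      = Fcomp F (h \<cdot>\<^bsub>A\<^esub> g) f \<bullet>\<^bsub>B\<^esub> (Fcomp F h g \<lhd>\<^bsub>B\<^esub> F1 F f)"
    and Fcomp_unit_right: "f \<in> hom A a b \<Longrightarrow>
      Fcomp F f (one A a) \<bullet>\<^bsub>B\<^esub> (F1 F f \<rhd>\<^bsub>B\<^esub> Funit F a) = id2 B (F1 F f)"
    and Fcomp_unit_left: "f \<in> hom A a b \<Longrightarrow>
      Fcomp F (one A b) f \<bullet>\<^bsub>B\<^esub> (Funit F b \<lhd>\<^bsub>B\<^esub> F1 F f) = id2 B (F1 F f)"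

definition normal_psfun :: "('o, 'm, 'c) two_cat \<Rightarrow> ('p, 'q, 'r) two_cat \<Rightarrow>
    ('o, 'm, 'c, 'p, 'q, 'r) psfun \<Rightarrow> bool" where
  "normal_psfun A B F \<longleftrightarrow> (\<forall>a \<in> Obj A.
     F1 F (one A a) = one B (F0 F a) \<and> Funit F a = id2 B (one B (F0 F a)))"

text \<open>A 2-functor, regarded as a pseudofunctor with identity constraints.\<close>

definition strict_psfun :: "('o, 'm, 'c) two_cat \<Rightarrow> ('p, 'q, 'r) two_cat \<Rightarrow>
    ('o \<Rightarrow> 'p) \<Rightarrow> ('m \<Rightarrow> 'q) \<Rightarrow> ('c \<Rightarrow> 'r) \<Rightarrow> ('o, 'm, 'c, 'p, 'q, 'r) psfun" where
  "strict_psfun A B x0 x1 x2 = \<lparr>F0 = x0, F1 = x1, F2 = x2,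
     Fcomp = (\<lambda>g f. id2 B (x1 (g \<cdot>\<^bsub>A\<^esub> f))), Funit = (\<lambda>a. id2 B (one B (x0 a)))\<rparr>"

definition id_psfun :: "('o, 'm, 'c) two_cat \<Rightarrow> ('o, 'm, 'c, 'o, 'm, 'c) psfun" where
  "id_psfun A = strict_psfun A A (\<lambda>a. a) (\<lambda>f. f) (\<lambda>\<alpha>. \<alpha>)"

definition comp_psfun :: "('s, 't, 'u) two_cat \<Rightarrow> ('p, 'q, 'r, 's, 't, 'u) psfun \<Rightarrow>
    ('o, 'm, 'c, 'p, 'q, 'r) psfun \<Rightarrow> ('o, 'm, 'c, 's, 't, 'u) psfun" where
  "comp_psfun C G F = \<lparr>F0 = (\<lambda>a. F0 G (F0 F a)), F1 = (\<lambda>f. F1 G (F1 F f)), F2 = (\<lambda>\<alpha>. F2 G (F2 F \<alpha>)),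
     Fcomp = (\<lambda>g f. F2 G (Fcomp F g f) \<bullet>\<^bsub>C\<^esub> Fcomp G (F1 F g) (F1 F f)),
     Funit = (\<lambda>a. F2 G (Funit F a) \<bullet>\<^bsub>C\<^esub> Funit G (F0 F a))\<rparr>"

text \<open>Equality of pseudofunctors; the values outside the carriers of \<open>A\<close> are irrelevant.\<close>

definition eq_psfun :: "('o, 'm, 'c) two_cat \<Rightarrow>
    ('o, 'm, 'c, 'p, 'q, 'r) psfun \<Rightarrow> ('o, 'm, 'c, 'p, 'q, 'r) psfun \<Rightarrow> bool" where
  "eq_psfun A F G \<longleftrightarrow>
     (\<forall>a \<in> Obj A. F0 F a = F0 G a \<and> Funit F a = Funit G a) \<and>
     (\<forall>f \<in> Mor A. F1 F f = F1 G f) \<and>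
     (\<forall>\<alpha> \<in> Cell A. F2 F \<alpha> = F2 G \<alpha>) \<and>
     (\<forall>f \<in> Mor A. \<forall>g \<in> Mor A. trg1 A f = src1 A g \<longrightarrow> Fcomp F g f = Fcomp G g f)"

record ('o, 'm, 'q, 'r) psnat =
  T0 :: "'o \<Rightarrow> 'q"
  T1 :: "'m \<Rightarrow> 'r"

locale pseudonatural =
  fixes A :: "('o, 'm, 'c) two_cat" and B :: "('p, 'q, 'r) two_cat"
    and F G :: "('o, 'm, 'c, 'p, 'q, 'r) psfun" and T :: "('o, 'm, 'q, 'r) psnat"
  assumes T0_hom: "a \<in> Obj A \<Longrightarrow> T0 T a \<in> hom B (F0 F a) (F0 G a)"
    and T1_isos: "f \<in> hom A a b \<Longrightarrow> T1 T f \<in> isos B (F1 G f \<cdot>\<^bsub>B\<^esub> T0 T a) (T0 T b \<cdot>\<^bsub>B\<^esub> F1 F f)"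
    and T1_natural: "\<lbrakk>f \<in> hom A a b; \<alpha> \<in> cells A f f'\<rbrakk> \<Longrightarrow>
      T1 T f' \<bullet>\<^bsub>B\<^esub> (F2 G \<alpha> \<lhd>\<^bsub>B\<^esub> T0 T a) = (T0 T b \<rhd>\<^bsub>B\<^esub> F2 F \<alpha>) \<bullet>\<^bsub>B\<^esub> T1 T f"
    and T1_comp: "\<lbrakk>f \<in> hom A a b; g \<in> hom A b c\<rbrakk> \<Longrightarrow>
      T1 T (g \<cdot>\<^bsub>A\<^esub> f) \<bullet>\<^bsub>B\<^esub> (Fcomp G g f \<lhd>\<^bsub>B\<^esub> T0 T a)
      = (T0 T c \<rhd>\<^bsub>B\<^esub> Fcomp F g f) \<bullet>\<^bsub>B\<^esub> (T1 T g \<lhd>\<^bsub>B\<^esub> F1 F f) \<bullet>\<^bsub>B\<^esub> (F1 G g \<rhd>\<^bsub>B\<^esub> T1 T f)"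
    and T1_one: "a \<in> Obj A \<Longrightarrow>
      T1 T (one A a) \<bullet>\<^bsub>B\<^esub> (Funit G a \<lhd>\<^bsub>B\<^esub> T0 T a) = T0 T a \<rhd>\<^bsub>B\<^esub> Funit F a"

definition pseudonatural_equivalence :: "('o, 'm, 'c) two_cat \<Rightarrow> ('p, 'q, 'r) two_cat \<Rightarrow>
    ('o, 'm, 'c, 'p, 'q, 'r) psfun \<Rightarrow> ('o, 'm, 'c, 'p, 'q, 'r) psfun \<Rightarrow>
    ('o, 'm, 'q, 'r) psnat \<Rightarrow> bool" where
  "pseudonatural_equivalence A B F G T \<longleftrightarrow>
     pseudonatural A B F G T \<and> (\<forall>a \<in> Obj A. equivalence1 B (T0 T a))"


section \<open>The 2-category of categories and the Hom 2-functor\<close>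

record ('n, 'k) cat =
  cobj :: "'n set"
  carr :: "'k set"
  cdom :: "'k \<Rightarrow> 'n"
  ccod :: "'k \<Rightarrow> 'n"
  cid :: "'n \<Rightarrow> 'k"
  ccomp :: "'k \<Rightarrow> 'k \<Rightarrow> 'k"

definition chom :: "('n, 'k) cat \<Rightarrow> 'n \<Rightarrow> 'n \<Rightarrow> 'k set" where
  "chom X x y = {s \<in> carr X. cdom X s = x \<and> ccod X s = y}"

locale category =
  fixes X :: "('n, 'k) cat"
  assumes carr_bd: "s \<in> carr X \<Longrightarrow> cdom X s \<in> cobj X \<and> ccod X s \<in> cobj X"
    and cid_chom: "x \<in> cobj X \<Longrightarrow> cid X x \<in> chom X x x"
    and ccomp_chom: "\<lbrakk>s \<in> chom X x y; t \<in> chom X y z\<rbrakk> \<Longrightarrow> ccomp X t s \<in> chom X x z"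
    and ccomp_assoc: "\<lbrakk>s \<in> chom X x y; t \<in> chom X y z; r \<in> chom X z w\<rbrakk> \<Longrightarrow>
      ccomp X (ccomp X r t) s = ccomp X r (ccomp X t s)"
    and ccomp_cid: "s \<in> chom X x y \<Longrightarrow> ccomp X s (cid X x) = s"
    and cid_ccomp: "s \<in> chom X x y \<Longrightarrow> ccomp X (cid X y) s = s"

definition cisos :: "('n, 'k) cat \<Rightarrow> 'n \<Rightarrow> 'n \<Rightarrow> 'k set" where
  "cisos X x y = {s \<in> chom X x y. \<exists>t \<in> chom X y x. ccomp X t s = cid X x \<and> ccomp X s t = cid X y}"

text \<open>The maps of a functor and the family of a natural transformation are required to be
  \<open>undefined\<close> outside their domains, so that equality in HOL is equality of functors and of
  natural transformations.\<close>

record ('n, 'k) func =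
  fdom :: "('n, 'k) cat"
  fcod :: "('n, 'k) cat"
  fob :: "'n \<Rightarrow> 'n"
  far :: "'k \<Rightarrow> 'k"

locale cat_functor =
  fixes F :: "('n, 'k) func"
  assumes fdom_category: "category (fdom F)"
    and fcod_category: "category (fcod F)"
    and fob_extensional: "fob F \<in> extensional (cobj (fdom F))"
    and far_extensional: "far F \<in> extensional (carr (fdom F))"
    and fob_cobj: "x \<in> cobj (fdom F) \<Longrightarrow> fob F x \<in> cobj (fcod F)"
    and far_chom: "s \<in> chom (fdom F) x y \<Longrightarrow> far F s \<in> chom (fcod F) (fob F x) (fob F y)"
    and far_cid: "x \<in> cobj (fdom F) \<Longrightarrow> far F (cid (fdom F) x) = cid (fcod F) (fob F x)"
    and far_ccomp: "\<lbrakk>s \<in> chom (fdom F) x y; t \<in> chom (fdom F) y z\<rbrakk> \<Longrightarrow>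
      far F (ccomp (fdom F) t s) = ccomp (fcod F) (far F t) (far F s)"

definition injective_on_objects :: "('n, 'k) func \<Rightarrow> bool" where
  "injective_on_objects F \<longleftrightarrow> inj_on (fob F) (cobj (fdom F))"

definition faithful_functor :: "('n, 'k) func \<Rightarrow> bool" where
  "faithful_functor F \<longleftrightarrow>
     (\<forall>x \<in> cobj (fdom F). \<forall>y \<in> cobj (fdom F). inj_on (far F) (chom (fdom F) x y))"

record ('n, 'k) nattrans =
  nsrc :: "('n, 'k) func"
  ntrg :: "('n, 'k) func"
  ncomp :: "'n \<Rightarrow> 'k"

locale natural_transformation =
  fixes S :: "('n, 'k) nattrans"
  assumes nsrc_functor: "cat_functor (nsrc S)"
    and ntrg_functor: "cat_functor (ntrg S)"
    and fdom_eq: "fdom (nsrc S) = fdom (ntrg S)"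
    and fcod_eq: "fcod (nsrc S) = fcod (ntrg S)"
    and ncomp_extensional: "ncomp S \<in> extensional (cobj (fdom (nsrc S)))"
    and ncomp_chom: "x \<in> cobj (fdom (nsrc S)) \<Longrightarrow>
      ncomp S x \<in> chom (fcod (nsrc S)) (fob (nsrc S) x) (fob (ntrg S) x)"
    and natural: "s \<in> chom (fdom (nsrc S)) x y \<Longrightarrow>
      ccomp (fcod (nsrc S)) (ncomp S y) (far (nsrc S) s)
      = ccomp (fcod (nsrc S)) (far (ntrg S) s) (ncomp S x)"

definition Cat :: "(('n, 'k) cat, ('n, 'k) func, ('n, 'k) nattrans) two_cat" where
  "Cat = \<lparr>
     Obj = Collect category, Mor = Collect cat_functor, Cell = Collect natural_transformation,
     src1 = fdom, trg1 = fcod, src2 = nsrc, trg2 = ntrg,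
     one = (\<lambda>X. \<lparr>fdom = X, fcod = X, fob = restrict (\<lambda>x. x) (cobj X), far = restrict (\<lambda>s. s) (carr X)\<rparr>),
     comp1 = (\<lambda>G F. \<lparr>fdom = fdom F, fcod = fcod G,
       fob = restrict (\<lambda>x. fob G (fob F x)) (cobj (fdom F)),
       far = restrict (\<lambda>s. far G (far F s)) (carr (fdom F))\<rparr>),
     id2 = (\<lambda>F. \<lparr>nsrc = F, ntrg = F,
       ncomp = restrict (\<lambda>x. cid (fcod F) (fob F x)) (cobj (fdom F))\<rparr>),
     vcomp = (\<lambda>T S. \<lparr>nsrc = nsrc S, ntrg = ntrg T,
       ncomp = restrict (\<lambda>x. ccomp (fcod (nsrc S)) (ncomp T x) (ncomp S x)) (cobj (fdom (nsrc S)))\<rparr>),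
     hcomp = (\<lambda>T S. \<lparr>
       nsrc = \<lparr>fdom = fdom (nsrc S), fcod = fcod (nsrc T),
         fob = restrict (\<lambda>x. fob (nsrc T) (fob (nsrc S) x)) (cobj (fdom (nsrc S))),
         far = restrict (\<lambda>s. far (nsrc T) (far (nsrc S) s)) (carr (fdom (nsrc S)))\<rparr>,
       ntrg = \<lparr>fdom = fdom (ntrg S), fcod = fcod (ntrg T),
         fob = restrict (\<lambda>x. fob (ntrg T) (fob (ntrg S) x)) (cobj (fdom (ntrg S))),
         far = restrict (\<lambda>s. far (ntrg T) (far (ntrg S) s)) (carr (fdom (ntrg S)))\<rparr>,
       ncomp = restrict
         (\<lambda>x. ccomp (fcod (nsrc T)) (ncomp T (fob (ntrg S) x)) (far (nsrc T) (ncomp S x)))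
         (cobj (fdom (nsrc S)))\<rparr>)\<rparr>"

definition hom_cat :: "('o, 'm, 'c) two_cat \<Rightarrow> 'o \<Rightarrow> 'o \<Rightarrow> ('m, 'c) cat" where
  "hom_cat L A B = \<lparr>cobj = hom L A B, carr = {\<theta> \<in> Cell L. src2 L \<theta> \<in> hom L A B},
     cdom = src2 L, ccod = trg2 L, cid = id2 L, ccomp = vcomp L\<rparr>"

text \<open>A 1-cell \<open>(a, b)\<close> of \<open>L\<^sup>o\<^sup>p \<times> L\<close> from \<open>(A, B)\<close> to \<open>(A', B')\<close> consists of \<open>a : A' \<rightarrow> A\<close> and
  \<open>b : B \<rightarrow> B'\<close> in \<open>L\<close>; it is sent to \<open>n \<mapsto> b \<cdot> n \<cdot> a\<close>.\<close>

definition hom_func :: "('o, 'm, 'c) two_cat \<Rightarrow> 'm \<Rightarrow> 'm \<Rightarrow> ('m, 'c) func" where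
  "hom_func L a b = \<lparr>
     fdom = hom_cat L (trg1 L a) (src1 L b), fcod = hom_cat L (src1 L a) (trg1 L b),
     fob = restrict (\<lambda>n. b \<cdot>\<^bsub>L\<^esub> n \<cdot>\<^bsub>L\<^esub> a) (cobj (hom_cat L (trg1 L a) (src1 L b))),
     far = restrict (\<lambda>\<theta>. id2 L b \<star>\<^bsub>L\<^esub> \<theta> \<star>\<^bsub>L\<^esub> id2 L a) (carr (hom_cat L (trg1 L a) (src1 L b)))\<rparr>"

definition hom_nattrans :: "('o, 'm, 'c) two_cat \<Rightarrow> 'c \<Rightarrow> 'c \<Rightarrow> ('m, 'c) nattrans" where
  "hom_nattrans L \<alpha> \<beta> = \<lparr>
     nsrc = hom_func L (src2 L \<alpha>) (src2 L \<beta>), ntrg = hom_func L (trg2 L \<alpha>) (trg2 L \<beta>),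
     ncomp = restrict (\<lambda>n. \<beta> \<star>\<^bsub>L\<^esub> id2 L n \<star>\<^bsub>L\<^esub> \<alpha>)
       (cobj (hom_cat L (trg1 L (src2 L \<alpha>)) (src1 L (src2 L \<beta>))))\<rparr>"

definition hom_psfun :: "('o, 'm, 'c) two_cat \<Rightarrow>
    ('o \<times> 'o, 'm \<times> 'm, 'c \<times> 'c, ('m, 'c) cat, ('m, 'c) func, ('m, 'c) nattrans) psfun" where
  "hom_psfun L = strict_psfun (prod2 (op2 L) L) Cat
     (\<lambda>(A, B). hom_cat L A B) (\<lambda>(a, b). hom_func L a b) (\<lambda>(\<alpha>, \<beta>). hom_nattrans L \<alpha> \<beta>)"


section \<open>2-ideals\<close>

text \<open>Since the components of \<open>\<nu>\<close> are injective on objects and faithful, hence injective on arrows,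
  letting the categories \<open>N(A, B)\<close> have objects in \<open>'m\<close> and arrows in \<open>'c\<close> loses no generality.\<close>

record ('o, 'm, 'c) ideal =
  idN :: "('o \<times> 'o, 'm \<times> 'm, 'c \<times> 'c, ('m, 'c) cat, ('m, 'c) func, ('m, 'c) nattrans) psfun"
  idnu :: "('o \<times> 'o, 'm \<times> 'm, ('m, 'c) func, ('m, 'c) nattrans) psnat"

definition two_ideal :: "('o, 'm, 'c) two_cat \<Rightarrow> ('o, 'm, 'c) ideal \<Rightarrow> bool" where
  "two_ideal L I \<longleftrightarrow>
     pseudofunctor (prod2 (op2 L) L) Cat (idN I) \<and>
     normal_psfun (prod2 (op2 L) L) Cat (idN I) \<and>
     pseudonatural (prod2 (op2 L) L) Cat (idN I) (hom_psfun L) (idnu I) \<and>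
     (\<forall>A \<in> Obj L. \<forall>B \<in> Obj L.
        injective_on_objects (T0 (idnu I) (A, B)) \<and> faithful_functor (T0 (idnu I) (A, B)))"

text \<open>The subcategory of \<open>Hom(A, B)\<close> with which \<open>N(A, B)\<close> is identified.\<close>

definition null_mor :: "('o, 'm, 'c) ideal \<Rightarrow> 'o \<Rightarrow> 'o \<Rightarrow> 'm set" where
  "null_mor I A B = fob (T0 (idnu I) (A, B)) ` cobj (F0 (idN I) (A, B))"

definition null_cells :: "('o, 'm, 'c) ideal \<Rightarrow> 'o \<Rightarrow> 'o \<Rightarrow> 'c set" where
  "null_cells I A B = far (T0 (idnu I) (A, B)) ` carr (F0 (idN I) (A, B))"

definition null_isos :: "('o, 'm, 'c) ideal \<Rightarrow> 'o \<Rightarrow> 'o \<Rightarrow> 'c set" where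
  "null_isos I A B = far (T0 (idnu I) (A, B)) `
     (\<Union>x \<in> cobj (F0 (idN I) (A, B)). \<Union>y \<in> cobj (F0 (idN I) (A, B)). cisos (F0 (idN I) (A, B)) x y)"

definition null_obj :: "('o, 'm, 'c) ideal \<Rightarrow> 'o \<Rightarrow> 'o \<Rightarrow> 'm \<Rightarrow> 'm" where
  "null_obj I A B n = inv_into (cobj (F0 (idN I) (A, B))) (fob (T0 (idnu I) (A, B))) n"

text \<open>For a null \<open>n : A \<rightarrow> B\<close>, \<open>a : A' \<rightarrow> A\<close> and \<open>b : B \<rightarrow> B'\<close>, \<open>tilde L I b n a\<close> is the null morphism
  $\widetilde{bna}$ and \<open>nu L I b n a\<close> is the invertible 2-cell \<open>b \<cdot> n \<cdot> a \<Rightarrow> tilde L I b n a\<close>.\<close>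

definition tilde :: "('o, 'm, 'c) two_cat \<Rightarrow> ('o, 'm, 'c) ideal \<Rightarrow> 'm \<Rightarrow> 'm \<Rightarrow> 'm \<Rightarrow> 'm" where
  "tilde L I b n a = fob (T0 (idnu I) (src1 L a, trg1 L b))
     (fob (F1 (idN I) (a, b)) (null_obj I (trg1 L a) (src1 L b) n))"

definition nu :: "('o, 'm, 'c) two_cat \<Rightarrow> ('o, 'm, 'c) ideal \<Rightarrow> 'm \<Rightarrow> 'm \<Rightarrow> 'm \<Rightarrow> 'c" where
  "nu L I b n a = ncomp (T1 (idnu I) (a, b)) (null_obj I (trg1 L a) (src1 L b) n)"

definition op_ideal :: "('o, 'm, 'c) ideal \<Rightarrow> ('o, 'm, 'c) ideal" where
  "op_ideal I = \<lparr>
     idN = \<lparr>F0 = (\<lambda>(A, B). F0 (idN I) (B, A)), F1 = (\<lambda>(a, b). F1 (idN I) (b, a)),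
       F2 = (\<lambda>(\<alpha>, \<beta>). F2 (idN I) (\<beta>, \<alpha>)),
       Fcomp = (\<lambda>(a', b') (a, b). Fcomp (idN I) (b', a') (b, a)),
       Funit = (\<lambda>(A, B). Funit (idN I) (B, A))\<rparr>,
     idnu = \<lparr>T0 = (\<lambda>(A, B). T0 (idnu I) (B, A)), T1 = (\<lambda>(a, b). T1 (idnu I) (b, a))\<rparr>\<rparr>"


section \<open>2-kernels, 2-cokernels and closed 2-ideals\<close>

text \<open>\<open>two_kernel L I f k n \<alpha>\<close>: the morphism \<open>k\<close>, with the null morphism \<open>n\<close> and the structure
  2-cell \<open>\<alpha> : f \<cdot> k \<Rightarrow> n\<close>, is a 2-kernel of \<open>f\<close>.\<close>

definition two_kernel :: "('o, 'm, 'c) two_cat \<Rightarrow> ('o, 'm, 'c) ideal \<Rightarrow>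
    'm \<Rightarrow> 'm \<Rightarrow> 'm \<Rightarrow> 'c \<Rightarrow> bool" where
  "two_kernel L I f k n \<alpha> \<longleftrightarrow> (\<exists>A B K.
     f \<in> hom L A B \<and> k \<in> hom L K A \<and> n \<in> null_mor I K B \<and> \<alpha> \<in> isos L (f \<cdot>\<^bsub>L\<^esub> k) n \<and>
     (\<forall>Z. \<forall>z \<in> hom L Z A. \<forall>p \<in> null_mor I Z B. \<forall>\<beta> \<in> isos L (f \<cdot>\<^bsub>L\<^esub> z) p.
        \<exists>u \<in> hom L Z K. \<exists>\<gamma> \<in> isos L z (k \<cdot>\<^bsub>L\<^esub> u).
          nu L I (one L B) n u \<bullet>\<^bsub>L\<^esub> (\<alpha> \<lhd>\<^bsub>L\<^esub> u) \<bullet>\<^bsub>L\<^esub> (f \<rhd>\<^bsub>L\<^esub> \<gamma>) \<bullet>\<^bsub>L\<^esub> inv2 L \<beta> \<in> null_isos I Z B) \<and>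
     (\<forall>Z. \<forall>u \<in> hom L Z K. \<forall>v \<in> hom L Z K. \<forall>\<kappa> \<in> cells L (k \<cdot>\<^bsub>L\<^esub> u) (k \<cdot>\<^bsub>L\<^esub> v).
        nu L I (one L B) n v \<bullet>\<^bsub>L\<^esub> (\<alpha> \<lhd>\<^bsub>L\<^esub> v) \<bullet>\<^bsub>L\<^esub> (f \<rhd>\<^bsub>L\<^esub> \<kappa>) \<bullet>\<^bsub>L\<^esub> (inv2 L \<alpha> \<lhd>\<^bsub>L\<^esub> u)
          \<bullet>\<^bsub>L\<^esub> inv2 L (nu L I (one L B) n u) \<in> null_cells I Z B \<longrightarrow>
        (\<exists>!\<mu>. \<mu> \<in> cells L u v \<and> k \<rhd>\<^bsub>L\<^esub> \<mu> = \<kappa>)))"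

text \<open>\<open>two_cokernel L I f c n \<alpha>\<close>: here \<open>\<alpha> : c \<cdot> f \<Rightarrow> n\<close>.\<close>

definition two_cokernel :: "('o, 'm, 'c) two_cat \<Rightarrow> ('o, 'm, 'c) ideal \<Rightarrow>
    'm \<Rightarrow> 'm \<Rightarrow> 'm \<Rightarrow> 'c \<Rightarrow> bool" where
  "two_cokernel L I f c n \<alpha> \<longleftrightarrow> two_kernel (op2 L) (op_ideal I) f c n \<alpha>"

definition is_two_kernel :: "('o, 'm, 'c) two_cat \<Rightarrow> ('o, 'm, 'c) ideal \<Rightarrow> 'm \<Rightarrow> bool" where
  "is_two_kernel L I k \<longleftrightarrow> (\<exists>f n \<alpha>. two_kernel L I f k n \<alpha>)"

definition is_two_cokernel :: "('o, 'm, 'c) two_cat \<Rightarrow> ('o, 'm, 'c) ideal \<Rightarrow> 'm \<Rightarrow> bool" where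
  "is_two_cokernel L I c \<longleftrightarrow> (\<exists>f n \<alpha>. two_cokernel L I f c n \<alpha>)"

definition has_two_kernels :: "('o, 'm, 'c) two_cat \<Rightarrow> ('o, 'm, 'c) ideal \<Rightarrow> bool" where
  "has_two_kernels L I \<longleftrightarrow> (\<forall>f \<in> Mor L. \<exists>k n \<alpha>. two_kernel L I f k n \<alpha>)"

definition has_two_cokernels :: "('o, 'm, 'c) two_cat \<Rightarrow> ('o, 'm, 'c) ideal \<Rightarrow> bool" where
  "has_two_cokernels L I \<longleftrightarrow> (\<forall>f \<in> Mor L. \<exists>c n \<alpha>. two_cokernel L I f c n \<alpha>)"

definition reflects_null_mor :: "('o, 'm, 'c) two_cat \<Rightarrow> ('o, 'm, 'c) ideal \<Rightarrow> 'm \<Rightarrow> bool" where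
  "reflects_null_mor L I k \<longleftrightarrow>
     (\<forall>D. \<forall>s \<in> hom L D (src1 L k). \<forall>n \<in> null_mor I D (trg1 L k). \<forall>\<delta> \<in> isos L (k \<cdot>\<^bsub>L\<^esub> s) n.
        \<exists>p \<in> null_mor I D (src1 L k). \<exists>\<psi> \<in> isos L s p.
          nu L I k p (one L D) \<bullet>\<^bsub>L\<^esub> (k \<rhd>\<^bsub>L\<^esub> \<psi>) \<bullet>\<^bsub>L\<^esub> inv2 L \<delta> \<in> null_isos I D (trg1 L k))"

definition reflects_null_cells :: "('o, 'm, 'c) two_cat \<Rightarrow> ('o, 'm, 'c) ideal \<Rightarrow> 'm \<Rightarrow> bool" where
  "reflects_null_cells L I k \<longleftrightarrow>
     (\<forall>D \<in> Obj L. \<forall>s \<in> null_mor I D (src1 L k). \<forall>s' \<in> null_mor I D (src1 L k). \<forall>\<mu> \<in> cells L s s'.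
        nu L I k s' (one L D) \<bullet>\<^bsub>L\<^esub> (k \<rhd>\<^bsub>L\<^esub> \<mu>) \<bullet>\<^bsub>L\<^esub> inv2 L (nu L I k s (one L D))
          \<in> null_cells I D (trg1 L k) \<longrightarrow>
        \<mu> \<in> null_cells I D (src1 L k))"

definition closed_ideal :: "('o, 'm, 'c) two_cat \<Rightarrow> ('o, 'm, 'c) ideal \<Rightarrow> bool" where
  "closed_ideal L I \<longleftrightarrow>
     (\<forall>k. is_two_kernel L I k \<longrightarrow> reflects_null_mor L I k \<and> reflects_null_cells L I k) \<and>
     (\<forall>c. is_two_cokernel L I c \<longrightarrow>
        reflects_null_mor (op2 L) (op_ideal I) c \<and> reflects_null_cells (op2 L) (op_ideal I) c)"

text \<open>``Its'' 2-cokernel (2-kernel) is any 2-cokernel (2-kernel), with any structure 2-cell.\<close>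

definition kernels_normal :: "('o, 'm, 'c) two_cat \<Rightarrow> ('o, 'm, 'c) ideal \<Rightarrow> bool" where
  "kernels_normal L I \<longleftrightarrow>
     (\<forall>m c n \<alpha>. is_two_kernel L I m \<and> two_cokernel L I m c n \<alpha> \<longrightarrow>
        (\<exists>n' \<theta>. \<theta> \<in> null_isos I (src1 L m) (trg1 L c) \<inter> cells L n n' \<and>
                two_kernel L I c m n' (\<theta> \<bullet>\<^bsub>L\<^esub> \<alpha>)))"

definition cokernels_normal :: "('o, 'm, 'c) two_cat \<Rightarrow> ('o, 'm, 'c) ideal \<Rightarrow> bool" where
  "cokernels_normal L I \<longleftrightarrow>
     (\<forall>e k n \<alpha>. is_two_cokernel L I e \<and> two_kernel L I e k n \<alpha> \<longrightarrow>
        (\<exists>n' \<theta>. \<theta> \<in> null_isos I (src1 L k) (trg1 L e) \<inter> cells L n n' \<and>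
                two_cokernel L I k e n' (\<theta> \<bullet>\<^bsub>L\<^esub> \<alpha>)))"

definition cokernel_kernel_factorizations :: "('o, 'm, 'c) two_cat \<Rightarrow> ('o, 'm, 'c) ideal \<Rightarrow> bool" where
  "cokernel_kernel_factorizations L I \<longleftrightarrow>
     (\<forall>f \<in> Mor L. \<exists>c m. is_two_cokernel L I c \<and> is_two_kernel L I m \<and>
        trg1 L c = src1 L m \<and> isos L f (m \<cdot>\<^bsub>L\<^esub> c) \<noteq> {})"


section \<open>Factorization systems\<close>

definition filling :: "('o, 'm, 'c) two_cat \<Rightarrow> 'm \<Rightarrow> 'm \<Rightarrow> 'm \<Rightarrow> 'm \<Rightarrow> 'c \<Rightarrow> 'm \<Rightarrow> 'c \<Rightarrow> 'c \<Rightarrow> bool" where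
  "filling L e m s t \<phi> d \<sigma> \<rho> \<longleftrightarrow>
     d \<in> hom L (trg1 L e) (src1 L m) \<and> \<sigma> \<in> isos L s (d \<cdot>\<^bsub>L\<^esub> e) \<and> \<rho> \<in> isos L (m \<cdot>\<^bsub>L\<^esub> d) t \<and>
     \<phi> = (\<rho> \<lhd>\<^bsub>L\<^esub> e) \<bullet>\<^bsub>L\<^esub> (m \<rhd>\<^bsub>L\<^esub> \<sigma>)"

definition is_square :: "('o, 'm, 'c) two_cat \<Rightarrow> 'm \<Rightarrow> 'm \<Rightarrow> 'm \<Rightarrow> 'm \<Rightarrow> 'c \<Rightarrow> bool" where
  "is_square L e m s t \<phi> \<longleftrightarrow> e \<in> Mor L \<and> m \<in> Mor L \<and>
     s \<in> hom L (src1 L e) (src1 L m) \<and> t \<in> hom L (trg1 L e) (trg1 L m) \<and>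
     \<phi> \<in> isos L (m \<cdot>\<^bsub>L\<^esub> s) (t \<cdot>\<^bsub>L\<^esub> e)"

definition orthogonal :: "('o, 'm, 'c) two_cat \<Rightarrow> 'm \<Rightarrow> 'm \<Rightarrow> bool" where
  "orthogonal L e m \<longleftrightarrow>
     (\<forall>s t \<phi>. is_square L e m s t \<phi> \<longrightarrow> (\<exists>d \<sigma> \<rho>. filling L e m s t \<phi> d \<sigma> \<rho>)) \<and>
     (\<forall>s t \<phi> d \<sigma> \<rho> s' t' \<phi>' d' \<sigma>' \<rho>'. \<forall>\<kappa> \<in> cells L s s'. \<forall>\<mu> \<in> cells L t t'.
        is_square L e m s t \<phi> \<and> filling L e m s t \<phi> d \<sigma> \<rho> \<and>
        is_square L e m s' t' \<phi>' \<and> filling L e m s' t' \<phi>' d' \<sigma>' \<rho>' \<and>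
        \<phi>' \<bullet>\<^bsub>L\<^esub> (m \<rhd>\<^bsub>L\<^esub> \<kappa>) = (\<mu> \<lhd>\<^bsub>L\<^esub> e) \<bullet>\<^bsub>L\<^esub> \<phi> \<longrightarrow>
        (\<exists>!\<iota>. \<iota> \<in> cells L d d' \<and> \<rho>' \<bullet>\<^bsub>L\<^esub> (m \<rhd>\<^bsub>L\<^esub> \<iota>) = \<mu> \<bullet>\<^bsub>L\<^esub> \<rho> \<and>
               (\<iota> \<lhd>\<^bsub>L\<^esub> e) \<bullet>\<^bsub>L\<^esub> \<sigma> = \<sigma>' \<bullet>\<^bsub>L\<^esub> \<kappa>))"

definition factorization_system :: "('o, 'm, 'c) two_cat \<Rightarrow> 'm set \<Rightarrow> 'm set \<Rightarrow> bool" where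
  "factorization_system L E M \<longleftrightarrow> E \<subseteq> Mor L \<and> M \<subseteq> Mor L \<and>
     (\<forall>m \<in> M. \<forall>i. equivalence1 L i \<and> trg1 L i = src1 L m \<longrightarrow> m \<cdot>\<^bsub>L\<^esub> i \<in> M) \<and>
     (\<forall>e \<in> E. \<forall>i. equivalence1 L i \<and> src1 L i = trg1 L e \<longrightarrow> i \<cdot>\<^bsub>L\<^esub> e \<in> E) \<and>
     (\<forall>m \<in> M. \<forall>m'. isos L m m' \<noteq> {} \<longrightarrow> m' \<in> M) \<and>
     (\<forall>e \<in> E. \<forall>e'. isos L e e' \<noteq> {} \<longrightarrow> e' \<in> E) \<and>
     (\<forall>f \<in> Mor L. \<exists>e \<in> E. \<exists>m \<in> M. trg1 L e = src1 L m \<and> isos L f (m \<cdot>\<^bsub>L\<^esub> e) \<noteq> {}) \<and>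
     (\<forall>e \<in> E. \<forall>m \<in> M. orthogonal L e m)"

definition faithful1 :: "('o, 'm, 'c) two_cat \<Rightarrow> 'm \<Rightarrow> bool" where
  "faithful1 L m \<longleftrightarrow> (\<forall>X. \<forall>x \<in> hom L X (src1 L m). \<forall>y \<in> hom L X (src1 L m).
     inj_on (\<lambda>\<alpha>. m \<rhd>\<^bsub>L\<^esub> \<alpha>) (cells L x y))"

definition cofaithful1 :: "('o, 'm, 'c) two_cat \<Rightarrow> 'm \<Rightarrow> bool" where
  "cofaithful1 L e \<longleftrightarrow> (\<forall>X. \<forall>x \<in> hom L (trg1 L e) X. \<forall>y \<in> hom L (trg1 L e) X.
     inj_on (\<lambda>\<alpha>. \<alpha> \<lhd>\<^bsub>L\<^esub> e) (cells L x y))"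

definition proper_11 :: "('o, 'm, 'c) two_cat \<Rightarrow> 'm set \<Rightarrow> 'm set \<Rightarrow> bool" where
  "proper_11 L E M \<longleftrightarrow> (\<forall>e \<in> E. cofaithful1 L e) \<and> (\<forall>m \<in> M. faithful1 L m)"


section \<open>The pseudo arrow 2-category\<close>

text \<open>A square from \<open>e = sqsrc\<close> to \<open>m = sqtrg\<close> has sides \<open>s = sqs\<close> between the domains and \<open>t = sqt\<close>
  between the codomains, filled by \<open>sqphi : m \<cdot> s \<Rightarrow> t \<cdot> e\<close>.\<close>

record ('m, 'c) square =
  sqsrc :: 'm
  sqtrg :: 'm
  sqs :: 'm
  sqt :: 'm
  sqphi :: 'c

record ('m, 'c) square_cell =
  scsrc :: "('m, 'c) square"
  sctrg :: "('m, 'c) square"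
  scs :: 'c
  sct :: 'c

definition arrow2 :: "('o, 'm, 'c) two_cat \<Rightarrow> ('m, ('m, 'c) square, ('m, 'c) square_cell) two_cat" where
  "arrow2 L = \<lparr>
     Obj = Mor L,
     Mor = {q. is_square L (sqsrc q) (sqtrg q) (sqs q) (sqt q) (sqphi q)},
     Cell = {w.
       is_square L (sqsrc (scsrc w)) (sqtrg (scsrc w)) (sqs (scsrc w)) (sqt (scsrc w)) (sqphi (scsrc w)) \<and>
       is_square L (sqsrc (sctrg w)) (sqtrg (sctrg w)) (sqs (sctrg w)) (sqt (sctrg w)) (sqphi (sctrg w)) \<and>
       sqsrc (scsrc w) = sqsrc (sctrg w) \<and> sqtrg (scsrc w) = sqtrg (sctrg w) \<and>
       scs w \<in> cells L (sqs (scsrc w)) (sqs (sctrg w)) \<and>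
       sct w \<in> cells L (sqt (scsrc w)) (sqt (sctrg w)) \<and>
       sqphi (sctrg w) \<bullet>\<^bsub>L\<^esub> (sqtrg (scsrc w) \<rhd>\<^bsub>L\<^esub> scs w)
         = (sct w \<lhd>\<^bsub>L\<^esub> sqsrc (scsrc w)) \<bullet>\<^bsub>L\<^esub> sqphi (scsrc w)},
     src1 = sqsrc, trg1 = sqtrg, src2 = scsrc, trg2 = sctrg,
     one = (\<lambda>m. \<lparr>sqsrc = m, sqtrg = m, sqs = one L (src1 L m), sqt = one L (trg1 L m), sqphi = id2 L m\<rparr>),
     comp1 = (\<lambda>r q. \<lparr>sqsrc = sqsrc q, sqtrg = sqtrg r,
       sqs = sqs r \<cdot>\<^bsub>L\<^esub> sqs q, sqt = sqt r \<cdot>\<^bsub>L\<^esub> sqt q,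
       sqphi = (sqt r \<rhd>\<^bsub>L\<^esub> sqphi q) \<bullet>\<^bsub>L\<^esub> (sqphi r \<lhd>\<^bsub>L\<^esub> sqs q)\<rparr>),
     id2 = (\<lambda>q. \<lparr>scsrc = q, sctrg = q, scs = id2 L (sqs q), sct = id2 L (sqt q)\<rparr>),
     vcomp = (\<lambda>v w. \<lparr>scsrc = scsrc w, sctrg = sctrg v,
       scs = scs v \<bullet>\<^bsub>L\<^esub> scs w, sct = sct v \<bullet>\<^bsub>L\<^esub> sct w\<rparr>),
     hcomp = (\<lambda>v w. \<lparr>
       scsrc = \<lparr>sqsrc = sqsrc (scsrc w), sqtrg = sqtrg (scsrc v),
         sqs = sqs (scsrc v) \<cdot>\<^bsub>L\<^esub> sqs (scsrc w), sqt = sqt (scsrc v) \<cdot>\<^bsub>L\<^esub> sqt (scsrc w),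
         sqphi = (sqt (scsrc v) \<rhd>\<^bsub>L\<^esub> sqphi (scsrc w)) \<bullet>\<^bsub>L\<^esub> (sqphi (scsrc v) \<lhd>\<^bsub>L\<^esub> sqs (scsrc w))\<rparr>,
       sctrg = \<lparr>sqsrc = sqsrc (sctrg w), sqtrg = sqtrg (sctrg v),
         sqs = sqs (sctrg v) \<cdot>\<^bsub>L\<^esub> sqs (sctrg w), sqt = sqt (sctrg v) \<cdot>\<^bsub>L\<^esub> sqt (sctrg w),
         sqphi = (sqt (sctrg v) \<rhd>\<^bsub>L\<^esub> sqphi (sctrg w)) \<bullet>\<^bsub>L\<^esub> (sqphi (sctrg v) \<lhd>\<^bsub>L\<^esub> sqs (sctrg w))\<rparr>,
       scs = scs v \<star>\<^bsub>L\<^esub> scs w, sct = sct v \<star>\<^bsub>L\<^esub> sct w\<rparr>)\<rparr>"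

text \<open>For a class \<open>S\<close> of 1-cells, \<open>full_sub (arrow2 L) S\<close> is the full sub-2-category on \<open>S\<close>; \<open>dom2\<close> and
  \<open>cod2\<close> are its domain and codomain 2-functors to \<open>L\<close>.\<close>

definition dom2 :: "('o, 'm, 'c) two_cat \<Rightarrow> 'm set \<Rightarrow>
    ('m, ('m, 'c) square, ('m, 'c) square_cell, 'o, 'm, 'c) psfun" where
  "dom2 L S = strict_psfun (full_sub (arrow2 L) S) L (src1 L) sqs scs"

definition cod2 :: "('o, 'm, 'c) two_cat \<Rightarrow> 'm set \<Rightarrow>
    ('m, ('m, 'c) square, ('m, 'c) square_cell, 'o, 'm, 'c) psfun" where
  "cod2 L S = strict_psfun (full_sub (arrow2 L) S) L (trg1 L) sqt sct"


section \<open>Biequivalences over a 2-category\<close>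

text \<open>A transformation between endo-pseudofunctors of \<open>X\<close> lies over \<open>L\<close> (along \<open>P : X \<rightarrow> L\<close>).\<close>

definition lies_over :: "('p, 'q, 'r) two_cat \<Rightarrow> ('o, 'm, 'c) two_cat \<Rightarrow>
    ('p, 'q, 'r, 'o, 'm, 'c) psfun \<Rightarrow> ('p, 'q, 'q, 'r) psnat \<Rightarrow> bool" where
  "lies_over X L P T \<longleftrightarrow>
     (\<forall>x \<in> Obj X. F1 P (T0 T x) = one L (F0 P x)) \<and>
     (\<forall>f \<in> Mor X. F2 P (T1 T f) = id2 L (F1 P f))"

definition biequivalence_over :: "('o, 'm, 'c) two_cat \<Rightarrow>
    ('p, 'q, 'r) two_cat \<Rightarrow> ('p, 'q, 'r, 'o, 'm, 'c) psfun \<Rightarrow>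
    ('s, 't, 'u) two_cat \<Rightarrow> ('s, 't, 'u, 'o, 'm, 'c) psfun \<Rightarrow>
    ('p, 'q, 'r, 's, 't, 'u) psfun \<Rightarrow> ('s, 't, 'u, 'p, 'q, 'r) psfun \<Rightarrow>
    ('s, 't, 't, 'u) psnat \<Rightarrow> ('p, 'q, 'q, 'r) psnat \<Rightarrow> bool" where
  "biequivalence_over L X P Y Q K C \<eta> \<epsilon> \<longleftrightarrow>
     pseudofunctor X Y K \<and> pseudofunctor Y X C \<and>
     eq_psfun X (comp_psfun L Q K) P \<and> eq_psfun Y (comp_psfun L P C) Q \<and>
     pseudonatural_equivalence Y Y (id_psfun Y) (comp_psfun Y K C) \<eta> \<and> lies_over Y L Q \<eta> \<and>
     pseudonatural_equivalence X X (comp_psfun X C K) (id_psfun X) \<epsilon> \<and> lies_over X L P \<epsilon>"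

end

theory Submission imports Defs begin

text \<open>A closed 2-ideal whose kernels and cokernels match yields the factorization system in which \<open>E\<close> consists
  of the cokernels and \<open>M\<close> of the kernels: a cokernel is orthogonal to every morphism that reflects null
  morphisms and null 2-cells. A pair \<open>(m, e)\<close> in which \<open>m\<close> is a kernel of \<open>e\<close> and \<open>e\<close> a cokernel of \<open>m\<close> with the same
  structure 2-cell connects an object of \<open>M\<close> with an object of \<open>E\<close>. Every object occurs in such a pair, and
  squares and their 2-cells transfer between the two ends by the universal properties, so choosing a pair for
  each object gives the pseudofunctors of the biequivalence.

  Conversely, a biequivalence over \<open>L\<close> given by \<open>ker\<close> and \<open>cok\<close> identifies squares from \<open>cok m\<close> to \<open>e\<close> over \<open>s\<close>
  with squares from \<open>m\<close> to \<open>ker e\<close> over \<open>s\<close>. Call \<open>f : A \<rightarrow> B\<close> null if it factors, up to an invertible 2-cell, through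
  \<open>cok 1\<^sub>A\<close>; by the identification for \<open>m = 1\<^sub>A\<close> and \<open>e = 1\<^sub>B\<close> this is the same as factoring through \<open>ker 1\<^sub>B\<close>, and
  likewise for 2-cells. Null morphisms are then closed under isomorphism, so they form a 2-ideal on which
  composition acts strictly, and the general identification says that \<open>ker e\<close> is a kernel of \<open>e\<close> and
  \<open>cok m\<close> a cokernel of \<open>m\<close> for it.\<close>

section \<open>Calculus in a strict 2-category\<close>

text \<open>Properness shapes the development: the domain 2-functor on E and the codomain 2-functor
  on M are injective on 2-cells with a fixed boundary, so a coherence equation over \<open>L\<close>
  holds as soon as its two sides have the same image, and matching two kinds of squares comes down
  to asking which 2-cells of \<open>L\<close> lift.

  The obstacle in the converse is that a factorization through \<open>cok (one L A)\<close> is a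
  datum, and a cofaithful morphism need not be full: two factorizations of one null morphism might
  not be comparable, and then null 2-cells would not compose. The remedy is the notion of a null
  object. The target of \<open>cok (one L A)\<close> is null, every morphism out of a null object
  lies in M, and orthogonality against such a morphism produces the comparison.

  The situation is symmetric under reversal of 1-cells. Structures are oriented so that statements
  about quotients become instances, in \<open>op2 L\<close>, of statements about subobjects.\<close>

definition iso2 :: "('o, 'm, 'c) two_cat \<Rightarrow> 'c \<Rightarrow> bool" where
  "iso2 L \<alpha> \<longleftrightarrow> \<alpha> \<in> Cell L \<and> (\<exists>\<beta>. is_inv2 L \<alpha> \<beta>)"

lemma hom_iff: "f \<in> hom L A B \<longleftrightarrow> f \<in> Mor L \<and> src1 L f = A \<and> trg1 L f = B"
  by (simp add: hom_def)

lemma cells_iff: "\<alpha> \<in> cells L f g \<longleftrightarrow> \<alpha> \<in> Cell L \<and> src2 L \<alpha> = f \<and> trg2 L \<alpha> = g"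
  by (simp add: cells_def)

lemma isos_iff: "\<alpha> \<in> isos L f g \<longleftrightarrow> iso2 L \<alpha> \<and> src2 L \<alpha> = f \<and> trg2 L \<alpha> = g"
  by (auto simp: isos_def iso2_def cells_def)

lemma iso2_Cell [simp]: "iso2 L \<alpha> \<Longrightarrow> \<alpha> \<in> Cell L"
  by (simp add: iso2_def)

context two_category
begin

text \<open>The axioms bind objects that their conclusions do not mention. With membership and each
  boundary equation as separate premises they become conditional rewrite rules that the simplifier
  can discharge by itself.\<close>

lemma src1_Obj [simp]: "f \<in> Mor L \<Longrightarrow> src1 L f \<in> Obj L"
  and trg1_Obj [simp]: "f \<in> Mor L \<Longrightarrow> trg1 L f \<in> Obj L"
  using Mor_bd by auto

lemma src2_Mor [simp]: "\<alpha> \<in> Cell L \<Longrightarrow> src2 L \<alpha> \<in> Mor L"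
  and trg2_Mor [simp]: "\<alpha> \<in> Cell L \<Longrightarrow> trg2 L \<alpha> \<in> Mor L"
  and src1_trg2 [simp]: "\<alpha> \<in> Cell L \<Longrightarrow> src1 L (trg2 L \<alpha>) = src1 L (src2 L \<alpha>)"
  and trg1_trg2 [simp]: "\<alpha> \<in> Cell L \<Longrightarrow> trg1 L (trg2 L \<alpha>) = trg1 L (src2 L \<alpha>)"
  using Cell_bd Cell_parallel by auto

lemma one_Mor [simp]: "A \<in> Obj L \<Longrightarrow> one L A \<in> Mor L"
  and src1_one [simp]: "A \<in> Obj L \<Longrightarrow> src1 L (one L A) = A"
  and trg1_one [simp]: "A \<in> Obj L \<Longrightarrow> trg1 L (one L A) = A"
  using one_hom by (auto simp: hom_iff)

lemma comp_Mor [simp]: "\<lbrakk>f \<in> Mor L; g \<in> Mor L; trg1 L f = src1 L g\<rbrakk> \<Longrightarrow> g \<cdot> f \<in> Mor L"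
  and src1_comp [simp]: "\<lbrakk>f \<in> Mor L; g \<in> Mor L; trg1 L f = src1 L g\<rbrakk> \<Longrightarrow> src1 L (g \<cdot> f) = src1 L f"
  and trg1_comp [simp]: "\<lbrakk>f \<in> Mor L; g \<in> Mor L; trg1 L f = src1 L g\<rbrakk> \<Longrightarrow> trg1 L (g \<cdot> f) = trg1 L g"
  using comp1_hom by (auto simp: hom_iff)

lemma comp_assoc [simp]: "\<lbrakk>f \<in> Mor L; g \<in> Mor L; h \<in> Mor L; trg1 L f = src1 L g; trg1 L g = src1 L h\<rbrakk>
    \<Longrightarrow> (h \<cdot> g) \<cdot> f = h \<cdot> g \<cdot> f"
  using comp1_assoc by (auto simp: hom_iff)

lemma comp_one [simp]: "\<lbrakk>f \<in> Mor L; src1 L f = A\<rbrakk> \<Longrightarrow> f \<cdot> one L A = f"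
  and one_comp [simp]: "\<lbrakk>f \<in> Mor L; trg1 L f = B\<rbrakk> \<Longrightarrow> one L B \<cdot> f = f"
  using comp1_one one_comp1 by (auto simp: hom_iff)

lemma id2_Cell [simp]: "f \<in> Mor L \<Longrightarrow> id2 L f \<in> Cell L"
  and src2_id2 [simp]: "f \<in> Mor L \<Longrightarrow> src2 L (id2 L f) = f"
  and trg2_id2 [simp]: "f \<in> Mor L \<Longrightarrow> trg2 L (id2 L f) = f"
  using id2_cells by (auto simp: cells_iff)

lemma vcomp_Cell [simp]: "\<lbrakk>\<alpha> \<in> Cell L; \<beta> \<in> Cell L; trg2 L \<alpha> = src2 L \<beta>\<rbrakk> \<Longrightarrow> \<beta> \<bullet> \<alpha> \<in> Cell L"
  and src2_vcomp [simp]: "\<lbrakk>\<alpha> \<in> Cell L; \<beta> \<in> Cell L; trg2 L \<alpha> = src2 L \<beta>\<rbrakk> \<Longrightarrow> src2 L (\<beta> \<bullet> \<alpha>) = src2 L \<alpha>"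
  and trg2_vcomp [simp]: "\<lbrakk>\<alpha> \<in> Cell L; \<beta> \<in> Cell L; trg2 L \<alpha> = src2 L \<beta>\<rbrakk> \<Longrightarrow> trg2 L (\<beta> \<bullet> \<alpha>) = trg2 L \<beta>"
  using vcomp_cells by (auto simp: cells_iff)

lemma vassoc [simp]: "\<lbrakk>\<alpha> \<in> Cell L; \<beta> \<in> Cell L; \<gamma> \<in> Cell L; trg2 L \<alpha> = src2 L \<beta>; trg2 L \<beta> = src2 L \<gamma>\<rbrakk>
    \<Longrightarrow> (\<gamma> \<bullet> \<beta>) \<bullet> \<alpha> = \<gamma> \<bullet> \<beta> \<bullet> \<alpha>"
  using vcomp_assoc by (auto simp: cells_iff)

lemma vid [simp]: "\<lbrakk>\<alpha> \<in> Cell L; src2 L \<alpha> = f\<rbrakk> \<Longrightarrow> \<alpha> \<bullet> id2 L f = \<alpha>"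
  and idv [simp]: "\<lbrakk>\<alpha> \<in> Cell L; trg2 L \<alpha> = f\<rbrakk> \<Longrightarrow> id2 L f \<bullet> \<alpha> = \<alpha>"
  using vcomp_id2 id2_vcomp by (auto simp: cells_iff)

lemma hcomp_Cell [simp]: "\<lbrakk>\<alpha> \<in> Cell L; \<beta> \<in> Cell L; trg1 L (src2 L \<alpha>) = src1 L (src2 L \<beta>)\<rbrakk> \<Longrightarrow> \<beta> \<star> \<alpha> \<in> Cell L"
  and src2_hcomp [simp]: "\<lbrakk>\<alpha> \<in> Cell L; \<beta> \<in> Cell L; trg1 L (src2 L \<alpha>) = src1 L (src2 L \<beta>)\<rbrakk>
    \<Longrightarrow> src2 L (\<beta> \<star> \<alpha>) = src2 L \<beta> \<cdot> src2 L \<alpha>"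
  and trg2_hcomp [simp]: "\<lbrakk>\<alpha> \<in> Cell L; \<beta> \<in> Cell L; trg1 L (src2 L \<alpha>) = src1 L (src2 L \<beta>)\<rbrakk>
    \<Longrightarrow> trg2 L (\<beta> \<star> \<alpha>) = trg2 L \<beta> \<cdot> trg2 L \<alpha>"
  using hcomp_cells[of "src2 L \<alpha>" _ _ "src2 L \<beta>"] by (auto simp: cells_iff hom_iff)

lemma hcomp_id2' [simp]: "\<lbrakk>f \<in> Mor L; g \<in> Mor L; trg1 L f = src1 L g\<rbrakk> \<Longrightarrow> id2 L g \<star> id2 L f = id2 L (g \<cdot> f)"
  using hcomp_id2 by (auto simp: hom_iff)

lemma interchange': "\<lbrakk>\<alpha> \<in> Cell L; \<alpha>' \<in> Cell L; \<beta> \<in> Cell L; \<beta>' \<in> Cell L; trg2 L \<alpha> = src2 L \<alpha>'; trg2 L \<beta> = src2 L \<beta>';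
    trg1 L (src2 L \<alpha>) = src1 L (src2 L \<beta>)\<rbrakk> \<Longrightarrow> (\<beta>' \<bullet> \<beta>) \<star> (\<alpha>' \<bullet> \<alpha>) = (\<beta>' \<star> \<alpha>') \<bullet> (\<beta> \<star> \<alpha>)"
  using interchange[of "src2 L \<alpha>" _ _ "src2 L \<beta>"] by (auto simp: cells_iff hom_iff)

lemma hassoc [simp]: "\<lbrakk>\<alpha> \<in> Cell L; \<beta> \<in> Cell L; \<gamma> \<in> Cell L; trg1 L (src2 L \<alpha>) = src1 L (src2 L \<beta>);
    trg1 L (src2 L \<beta>) = src1 L (src2 L \<gamma>)\<rbrakk> \<Longrightarrow> (\<gamma> \<star> \<beta>) \<star> \<alpha> = \<gamma> \<star> \<beta> \<star> \<alpha>"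
  using hcomp_assoc[of "src2 L \<alpha>" _ _ "src2 L \<beta>" _ "src2 L \<gamma>"] by (auto simp: cells_iff hom_iff)

lemma hone [simp]: "\<lbrakk>\<alpha> \<in> Cell L; src1 L (src2 L \<alpha>) = A\<rbrakk> \<Longrightarrow> \<alpha> \<star> id2 L (one L A) = \<alpha>"
  and oneh [simp]: "\<lbrakk>\<alpha> \<in> Cell L; trg1 L (src2 L \<alpha>) = B\<rbrakk> \<Longrightarrow> id2 L (one L B) \<star> \<alpha> = \<alpha>"
  using hcomp_one[of "src2 L \<alpha>"] one_hcomp[of "src2 L \<alpha>"] by (auto simp: cells_iff hom_iff)

text \<open>With the associativity and distribution rules this fixes a normal form for pasting
  diagrams: a right-nested vertical composite of cells, each whiskered by at most one composite
  morphism per side.\<close>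

lemma wl_wl [simp]: "\<lbrakk>\<alpha> \<in> Cell L; g \<in> Mor L; h \<in> Mor L; trg1 L (src2 L \<alpha>) = src1 L g; trg1 L g = src1 L h\<rbrakk>
    \<Longrightarrow> id2 L h \<star> id2 L g \<star> \<alpha> = id2 L (h \<cdot> g) \<star> \<alpha>"
  by (simp flip: hassoc)

lemma wl_vcomp [simp]: "\<lbrakk>\<alpha> \<in> Cell L; \<beta> \<in> Cell L; g \<in> Mor L; trg2 L \<alpha> = src2 L \<beta>; trg1 L (src2 L \<alpha>) = src1 L g\<rbrakk>
    \<Longrightarrow> id2 L g \<star> (\<beta> \<bullet> \<alpha>) = (id2 L g \<star> \<beta>) \<bullet> (id2 L g \<star> \<alpha>)"
  using interchange'[of \<alpha> \<beta> "id2 L g" "id2 L g"] by simp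

lemma wr_vcomp [simp]: "\<lbrakk>\<alpha> \<in> Cell L; \<beta> \<in> Cell L; f \<in> Mor L; trg2 L \<alpha> = src2 L \<beta>; trg1 L f = src1 L (src2 L \<alpha>)\<rbrakk>
    \<Longrightarrow> (\<beta> \<bullet> \<alpha>) \<star> id2 L f = (\<beta> \<star> id2 L f) \<bullet> (\<alpha> \<star> id2 L f)"
  using interchange'[of "id2 L f" "id2 L f" \<alpha> \<beta>] by simp

lemma hcomp_wr_wl: "\<lbrakk>\<alpha> \<in> Cell L; \<beta> \<in> Cell L; trg1 L (src2 L \<alpha>) = src1 L (src2 L \<beta>)\<rbrakk>
    \<Longrightarrow> \<beta> \<star> \<alpha> = (\<beta> \<star> id2 L (trg2 L \<alpha>)) \<bullet> (id2 L (src2 L \<beta>) \<star> \<alpha>)"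
  using interchange'[of \<alpha> "id2 L (trg2 L \<alpha>)" "id2 L (src2 L \<beta>)" \<beta>] by simp

lemma hcomp_wl_wr: "\<lbrakk>\<alpha> \<in> Cell L; \<beta> \<in> Cell L; trg1 L (src2 L \<alpha>) = src1 L (src2 L \<beta>)\<rbrakk>
    \<Longrightarrow> \<beta> \<star> \<alpha> = (id2 L (trg2 L \<beta>) \<star> \<alpha>) \<bullet> (\<beta> \<star> id2 L (src2 L \<alpha>))"
  using interchange'[of "id2 L (src2 L \<alpha>)" \<alpha> \<beta> "id2 L (trg2 L \<beta>)"] by simp

text \<open>A law without a preferred direction, hence no default rewrite rule: it is invoked
  explicitly where two 2-cells have to slide past each other.\<close>

lemma exch: "\<lbrakk>\<alpha> \<in> Cell L; \<beta> \<in> Cell L; trg1 L (src2 L \<alpha>) = src1 L (src2 L \<beta>)\<rbrakk>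
    \<Longrightarrow> (\<beta> \<star> id2 L (trg2 L \<alpha>)) \<bullet> (id2 L (src2 L \<beta>) \<star> \<alpha>) = (id2 L (trg2 L \<beta>) \<star> \<alpha>) \<bullet> (\<beta> \<star> id2 L (src2 L \<alpha>))"
  using hcomp_wr_wl hcomp_wl_wr by metis

lemma is_inv2_unique: "\<lbrakk>\<alpha> \<in> Cell L; is_inv2 L \<alpha> \<beta>; is_inv2 L \<alpha> \<gamma>\<rbrakk> \<Longrightarrow> \<beta> = \<gamma>"
proof -
  assume a: "\<alpha> \<in> Cell L" "is_inv2 L \<alpha> \<beta>" "is_inv2 L \<alpha> \<gamma>"
  have "\<beta> = \<beta> \<bullet> \<alpha> \<bullet> \<gamma>" using a by (auto simp: is_inv2_def cells_iff)
  also have "\<dots> = (\<beta> \<bullet> \<alpha>) \<bullet> \<gamma>" using a by (subst vassoc) (auto simp: is_inv2_def cells_iff)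
  also have "\<dots> = \<gamma>" using a by (auto simp: is_inv2_def cells_iff)
  finally show ?thesis .
qed

lemma inv2_eq: "\<lbrakk>\<alpha> \<in> Cell L; \<beta> \<in> Cell L; src2 L \<beta> = trg2 L \<alpha>; trg2 L \<beta> = src2 L \<alpha>;
    \<beta> \<bullet> \<alpha> = id2 L (src2 L \<alpha>); \<alpha> \<bullet> \<beta> = id2 L (trg2 L \<alpha>)\<rbrakk> \<Longrightarrow> iso2 L \<alpha> \<and> inv2 L \<alpha> = \<beta>"
proof -
  assume a: "\<alpha> \<in> Cell L" "\<beta> \<in> Cell L" "src2 L \<beta> = trg2 L \<alpha>" "trg2 L \<beta> = src2 L \<alpha>"
    "\<beta> \<bullet> \<alpha> = id2 L (src2 L \<alpha>)" "\<alpha> \<bullet> \<beta> = id2 L (trg2 L \<alpha>)"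
  then have "is_inv2 L \<alpha> \<beta>" by (simp add: is_inv2_def cells_iff)
  then show ?thesis
    unfolding inv2_def iso2_def using a(1) is_inv2_unique by blast
qed

lemma inv2_is_inv2: "iso2 L \<alpha> \<Longrightarrow> is_inv2 L \<alpha> (inv2 L \<alpha>)"
proof -
  assume "iso2 L \<alpha>"
  then obtain \<beta> where "is_inv2 L \<alpha> \<beta>" "\<alpha> \<in> Cell L" by (auto simp: iso2_def)
  then show ?thesis
    unfolding inv2_def by (rule_tac theI[of _ \<beta>]) (auto intro: is_inv2_unique)
qed

lemma inv2_Cell [simp]: "iso2 L \<alpha> \<Longrightarrow> inv2 L \<alpha> \<in> Cell L"
  and src2_inv2 [simp]: "iso2 L \<alpha> \<Longrightarrow> src2 L (inv2 L \<alpha>) = trg2 L \<alpha>"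
  and trg2_inv2 [simp]: "iso2 L \<alpha> \<Longrightarrow> trg2 L (inv2 L \<alpha>) = src2 L \<alpha>"
  and inv2_left [simp]: "iso2 L \<alpha> \<Longrightarrow> inv2 L \<alpha> \<bullet> \<alpha> = id2 L (src2 L \<alpha>)"
  and inv2_right [simp]: "iso2 L \<alpha> \<Longrightarrow> \<alpha> \<bullet> inv2 L \<alpha> = id2 L (trg2 L \<alpha>)"
  using inv2_is_inv2[of \<alpha>] by (simp_all add: is_inv2_def cells_iff)

lemma iso2_inv2 [simp]: "iso2 L \<alpha> \<Longrightarrow> iso2 L (inv2 L \<alpha>)"
  and inv2_inv2 [simp]: "iso2 L \<alpha> \<Longrightarrow> inv2 L (inv2 L \<alpha>) = \<alpha>"
  using inv2_eq[of "inv2 L \<alpha>" \<alpha>] by simp_all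

text \<open>In a right-nested composite an inverse pair followed by a tail is no subterm, so
  cancellation needs a version that carries the tail.\<close>

lemma inv2_left_assoc [simp]: "\<lbrakk>iso2 L \<alpha>; \<beta> \<in> Cell L; trg2 L \<beta> = src2 L \<alpha>\<rbrakk> \<Longrightarrow> inv2 L \<alpha> \<bullet> \<alpha> \<bullet> \<beta> = \<beta>"
  and inv2_right_assoc [simp]: "\<lbrakk>iso2 L \<alpha>; \<beta> \<in> Cell L; trg2 L \<beta> = trg2 L \<alpha>\<rbrakk> \<Longrightarrow> \<alpha> \<bullet> inv2 L \<alpha> \<bullet> \<beta> = \<beta>"
  by (simp_all flip: vassoc)

lemma iso2_id2 [simp]: "f \<in> Mor L \<Longrightarrow> iso2 L (id2 L f)"
  and inv2_id2 [simp]: "f \<in> Mor L \<Longrightarrow> inv2 L (id2 L f) = id2 L f"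
  using inv2_eq[of "id2 L f" "id2 L f"] by simp_all

lemma vcomp_inv_aux: "\<lbrakk>iso2 L \<alpha>; iso2 L \<beta>; trg2 L \<alpha> = src2 L \<beta>\<rbrakk> \<Longrightarrow> iso2 L (\<beta> \<bullet> \<alpha>) \<and> inv2 L (\<beta> \<bullet> \<alpha>) = inv2 L \<alpha> \<bullet> inv2 L \<beta>"
  by (rule inv2_eq) simp_all

lemma iso2_vcomp [simp]: "\<lbrakk>iso2 L \<alpha>; iso2 L \<beta>; trg2 L \<alpha> = src2 L \<beta>\<rbrakk> \<Longrightarrow> iso2 L (\<beta> \<bullet> \<alpha>)"
  and inv2_vcomp [simp]: "\<lbrakk>iso2 L \<alpha>; iso2 L \<beta>; trg2 L \<alpha> = src2 L \<beta>\<rbrakk> \<Longrightarrow> inv2 L (\<beta> \<bullet> \<alpha>) = inv2 L \<alpha> \<bullet> inv2 L \<beta>"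
  by (simp_all add: vcomp_inv_aux)

lemma hcomp_inv_aux: "\<lbrakk>iso2 L \<alpha>; iso2 L \<beta>; trg1 L (src2 L \<alpha>) = src1 L (src2 L \<beta>)\<rbrakk>
    \<Longrightarrow> iso2 L (\<beta> \<star> \<alpha>) \<and> inv2 L (\<beta> \<star> \<alpha>) = inv2 L \<beta> \<star> inv2 L \<alpha>"
  using interchange'[of \<alpha> "inv2 L \<alpha>" \<beta> "inv2 L \<beta>"] interchange'[of "inv2 L \<alpha>" \<alpha> "inv2 L \<beta>" \<beta>]
  by (intro inv2_eq) simp_all

lemma iso2_hcomp [simp]: "\<lbrakk>iso2 L \<alpha>; iso2 L \<beta>; trg1 L (src2 L \<alpha>) = src1 L (src2 L \<beta>)\<rbrakk> \<Longrightarrow> iso2 L (\<beta> \<star> \<alpha>)"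
  and inv2_hcomp [simp]: "\<lbrakk>iso2 L \<alpha>; iso2 L \<beta>; trg1 L (src2 L \<alpha>) = src1 L (src2 L \<beta>)\<rbrakk>
    \<Longrightarrow> inv2 L (\<beta> \<star> \<alpha>) = inv2 L \<beta> \<star> inv2 L \<alpha>"
  by (simp_all add: hcomp_inv_aux)

lemma wl_inv_cancel [simp]: "\<lbrakk>iso2 L \<alpha>; g \<in> Mor L; trg1 L (src2 L \<alpha>) = src1 L g\<rbrakk>
    \<Longrightarrow> (id2 L g \<star> inv2 L \<alpha>) \<bullet> (id2 L g \<star> \<alpha>) = id2 L (g \<cdot> src2 L \<alpha>)"
  "\<lbrakk>iso2 L \<alpha>; g \<in> Mor L; trg1 L (src2 L \<alpha>) = src1 L g\<rbrakk>
    \<Longrightarrow> (id2 L g \<star> \<alpha>) \<bullet> (id2 L g \<star> inv2 L \<alpha>) = id2 L (g \<cdot> trg2 L \<alpha>)"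
  "\<lbrakk>iso2 L \<alpha>; f \<in> Mor L; trg1 L f = src1 L (src2 L \<alpha>)\<rbrakk>
    \<Longrightarrow> (inv2 L \<alpha> \<star> id2 L f) \<bullet> (\<alpha> \<star> id2 L f) = id2 L (src2 L \<alpha> \<cdot> f)"
  "\<lbrakk>iso2 L \<alpha>; f \<in> Mor L; trg1 L f = src1 L (src2 L \<alpha>)\<rbrakk>
    \<Longrightarrow> (\<alpha> \<star> id2 L f) \<bullet> (inv2 L \<alpha> \<star> id2 L f) = id2 L (trg2 L \<alpha> \<cdot> f)"
  by (simp_all flip: wl_vcomp wr_vcomp)

lemma wl_inv_cancel_assoc [simp]: "\<lbrakk>iso2 L \<alpha>; g \<in> Mor L; trg1 L (src2 L \<alpha>) = src1 L g; \<gamma> \<in> Cell L; trg2 L \<gamma> = g \<cdot> src2 L \<alpha>\<rbrakk>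
    \<Longrightarrow> (id2 L g \<star> inv2 L \<alpha>) \<bullet> (id2 L g \<star> \<alpha>) \<bullet> \<gamma> = \<gamma>"
  "\<lbrakk>iso2 L \<alpha>; g \<in> Mor L; trg1 L (src2 L \<alpha>) = src1 L g; \<gamma> \<in> Cell L; trg2 L \<gamma> = g \<cdot> trg2 L \<alpha>\<rbrakk>
    \<Longrightarrow> (id2 L g \<star> \<alpha>) \<bullet> (id2 L g \<star> inv2 L \<alpha>) \<bullet> \<gamma> = \<gamma>"
  "\<lbrakk>iso2 L \<alpha>; f \<in> Mor L; trg1 L f = src1 L (src2 L \<alpha>); \<gamma> \<in> Cell L; trg2 L \<gamma> = src2 L \<alpha> \<cdot> f\<rbrakk>
    \<Longrightarrow> (inv2 L \<alpha> \<star> id2 L f) \<bullet> (\<alpha> \<star> id2 L f) \<bullet> \<gamma> = \<gamma>"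
  "\<lbrakk>iso2 L \<alpha>; f \<in> Mor L; trg1 L f = src1 L (src2 L \<alpha>); \<gamma> \<in> Cell L; trg2 L \<gamma> = trg2 L \<alpha> \<cdot> f\<rbrakk>
    \<Longrightarrow> (\<alpha> \<star> id2 L f) \<bullet> (inv2 L \<alpha> \<star> id2 L f) \<bullet> \<gamma> = \<gamma>"
  by (simp_all flip: vassoc)

lemma iso2_cancel_left: "\<lbrakk>iso2 L \<theta>; \<alpha> \<in> Cell L; \<beta> \<in> Cell L; trg2 L \<alpha> = src2 L \<theta>; trg2 L \<beta> = src2 L \<theta>\<rbrakk>
    \<Longrightarrow> \<theta> \<bullet> \<alpha> = \<theta> \<bullet> \<beta> \<longleftrightarrow> \<alpha> = \<beta>"
  by (auto dest: arg_cong[of _ _ "\<lambda>\<gamma>. inv2 L \<theta> \<bullet> \<gamma>"])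

lemma iso2_cancel_right: "\<lbrakk>iso2 L \<theta>; \<alpha> \<in> Cell L; \<beta> \<in> Cell L; src2 L \<alpha> = trg2 L \<theta>; src2 L \<beta> = trg2 L \<theta>\<rbrakk>
    \<Longrightarrow> \<alpha> \<bullet> \<theta> = \<beta> \<bullet> \<theta> \<longleftrightarrow> \<alpha> = \<beta>"
proof -
  assume a: "iso2 L \<theta>" "\<alpha> \<in> Cell L" "\<beta> \<in> Cell L" "src2 L \<alpha> = trg2 L \<theta>" "src2 L \<beta> = trg2 L \<theta>"
  have h: "(\<alpha> \<bullet> \<theta>) \<bullet> inv2 L \<theta> = \<alpha>" "(\<beta> \<bullet> \<theta>) \<bullet> inv2 L \<theta> = \<beta>" using a by simp_all
  show ?thesis
  proof
    assume "\<alpha> \<bullet> \<theta> = \<beta> \<bullet> \<theta>"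
    then have "(\<alpha> \<bullet> \<theta>) \<bullet> inv2 L \<theta> = (\<beta> \<bullet> \<theta>) \<bullet> inv2 L \<theta>" by (rule arg_cong)
    then show "\<alpha> = \<beta>" unfolding h .
  qed simp
qed

lemma move_right: "\<lbrakk>iso2 L \<theta>; \<alpha> \<in> Cell L; \<beta> \<in> Cell L; src2 L \<alpha> = trg2 L \<theta>; src2 L \<beta> = src2 L \<theta>\<rbrakk>
    \<Longrightarrow> \<alpha> \<bullet> \<theta> = \<beta> \<longleftrightarrow> \<alpha> = \<beta> \<bullet> inv2 L \<theta>"
proof -
  assume a: "iso2 L \<theta>" "\<alpha> \<in> Cell L" "\<beta> \<in> Cell L" "src2 L \<alpha> = trg2 L \<theta>" "src2 L \<beta> = src2 L \<theta>"
  have "(\<beta> \<bullet> inv2 L \<theta>) \<bullet> \<theta> = \<beta>" using a by simp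
  then show ?thesis using iso2_cancel_right[of \<theta> \<alpha> "\<beta> \<bullet> inv2 L \<theta>"] a by simp
qed

end

section \<open>The dual 2-category\<close>

lemma op2_sel [simp]:
  "Obj (op2 L) = Obj L" "Mor (op2 L) = Mor L" "Cell (op2 L) = Cell L"
  "src1 (op2 L) = trg1 L" "trg1 (op2 L) = src1 L" "src2 (op2 L) = src2 L" "trg2 (op2 L) = trg2 L"
  "one (op2 L) = one L" "id2 (op2 L) = id2 L" "vcomp (op2 L) = vcomp L"
  "comp1 (op2 L) g f = comp1 L f g" "hcomp (op2 L) \<beta> \<alpha> = hcomp L \<alpha> \<beta>"
  by (simp_all add: op2_def)

lemma op2_hom [simp]: "hom (op2 L) A B = hom L B A"
  by (auto simp: hom_def)

lemma op2_cells [simp]: "cells (op2 L) = cells L"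
  by (auto simp: cells_def fun_eq_iff)

lemma op2_is_inv2 [simp]: "is_inv2 (op2 L) = is_inv2 L"
  by (auto simp: is_inv2_def fun_eq_iff)

lemma op2_isos [simp]: "isos (op2 L) = isos L"
  by (auto simp: isos_def fun_eq_iff)

lemma op2_inv2 [simp]: "inv2 (op2 L) = inv2 L"
  by (auto simp: inv2_def fun_eq_iff)

lemma op2_iso2 [simp]: "iso2 (op2 L) = iso2 L"
  by (auto simp: iso2_def fun_eq_iff)

lemma op2_op2 [simp]: "op2 (op2 L) = L"
  by (simp add: op2_def)

lemma op2_equivalence1 [simp]: "equivalence1 (op2 L) = equivalence1 L"
  by (auto simp: equivalence1_def fun_eq_iff)

text \<open>Vertical composition is untouched by the dual, so \<open>is_inv2\<close>,
  \<open>isos\<close> and \<open>inv2\<close> are literally the same on both sides. This is what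
  lets each lemma on kernels be reused for cokernels by instantiation.\<close>

lemma (in two_category) op2_two_category: "two_category (op2 L)"
proof unfold_locales
  fix f A B g C \<alpha> f' \<alpha>' f'' \<beta> g' \<beta>' g''
  assume a: "f \<in> hom (op2 L) A B" "g \<in> hom (op2 L) B C" "\<alpha> \<in> cells (op2 L) f f'"
       "\<alpha>' \<in> cells (op2 L) f' f''" "\<beta> \<in> cells (op2 L) g g'" "\<beta>' \<in> cells (op2 L) g' g''"
  then show "(\<beta>' \<bullet>\<^bsub>op2 L\<^esub> \<beta>) \<star>\<^bsub>op2 L\<^esub> (\<alpha>' \<bullet>\<^bsub>op2 L\<^esub> \<alpha>) = (\<beta>' \<star>\<^bsub>op2 L\<^esub> \<alpha>') \<bullet>\<^bsub>op2 L\<^esub> (\<beta> \<star>\<^bsub>op2 L\<^esub> \<alpha>)"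
    by (simp add: cells_iff hom_iff interchange')
qed (auto simp: hom_iff cells_iff)

section \<open>Equivalences\<close>

context two_category
begin

lemma equivalence1D:
  assumes "equivalence1 L f"
  obtains g \<eta> \<epsilon> where "g \<in> Mor L" "src1 L g = trg1 L f" "trg1 L g = src1 L f"
    "iso2 L \<eta>" "src2 L \<eta> = g \<cdot> f" "trg2 L \<eta> = one L (src1 L f)"
    "iso2 L \<epsilon>" "src2 L \<epsilon> = f \<cdot> g" "trg2 L \<epsilon> = one L (trg1 L f)"
  using assms unfolding equivalence1_def by (auto simp: hom_iff isos_iff set_eq_iff)

lemma equivalence1I:
  assumes "f \<in> Mor L" "g \<in> Mor L" "src1 L g = trg1 L f" "trg1 L g = src1 L f"
    "iso2 L \<eta>" "src2 L \<eta> = g \<cdot> f" "trg2 L \<eta> = one L (src1 L f)"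
    "iso2 L \<epsilon>" "src2 L \<epsilon> = f \<cdot> g" "trg2 L \<epsilon> = one L (trg1 L f)"
  shows "equivalence1 L f"
  using assms unfolding equivalence1_def by (auto simp: hom_iff isos_iff set_eq_iff)

lemma equivalence1_Mor [simp]: "equivalence1 L f \<Longrightarrow> f \<in> Mor L"
  by (simp add: equivalence1_def)

lemma equivalence1_one [simp]: "A \<in> Obj L \<Longrightarrow> equivalence1 L (one L A)"
  by (rule equivalence1I[of _ "one L A" "id2 L (one L A)" "id2 L (one L A)"]) simp_all

lemma equivalence1_inverse:
  assumes "equivalence1 L f"
  obtains g \<eta> \<epsilon> where "equivalence1 L g" "src1 L g = trg1 L f" "trg1 L g = src1 L f"
    "iso2 L \<eta>" "src2 L \<eta> = g \<cdot> f" "trg2 L \<eta> = one L (src1 L f)"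
    "iso2 L \<epsilon>" "src2 L \<epsilon> = f \<cdot> g" "trg2 L \<epsilon> = one L (trg1 L f)"
proof -
  have f: "f \<in> Mor L" using assms by simp
  from assms obtain g \<eta> \<epsilon> where *: "g \<in> Mor L" "src1 L g = trg1 L f" "trg1 L g = src1 L f"
    "iso2 L \<eta>" "src2 L \<eta> = g \<cdot> f" "trg2 L \<eta> = one L (src1 L f)"
    "iso2 L \<epsilon>" "src2 L \<epsilon> = f \<cdot> g" "trg2 L \<epsilon> = one L (trg1 L f)" by (rule equivalence1D)
  then have "equivalence1 L g" using f
    by (intro equivalence1I[of g f \<epsilon> \<eta>]) simp_all
  with * that show thesis by blast
qed

text \<open>Conjugation by the 2-cell \<open>\<eta>\<close> from \<open>g \<cdot> f\<close> to the
  identity recovers a 2-cell from its image under \<open>g \<cdot> f\<close>, by naturality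
  alone.\<close>

lemma equivalence1_faithful:
  assumes "equivalence1 L f" and a: "\<alpha> \<in> Cell L" "\<beta> \<in> Cell L" "src2 L \<alpha> = src2 L \<beta>" "trg2 L \<alpha> = trg2 L \<beta>"
    "trg1 L (src2 L \<alpha>) = src1 L f" and eq: "id2 L f \<star> \<alpha> = id2 L f \<star> \<beta>"
  shows "\<alpha> = \<beta>"
proof -
  have f: "f \<in> Mor L" using assms by simp
  obtain g \<eta> \<epsilon> where g: "g \<in> Mor L" "src1 L g = trg1 L f" "trg1 L g = src1 L f"
    "iso2 L \<eta>" "src2 L \<eta> = g \<cdot> f" "trg2 L \<eta> = one L (src1 L f)"
    "iso2 L \<epsilon>" "src2 L \<epsilon> = f \<cdot> g" "trg2 L \<epsilon> = one L (trg1 L f)" using assms(1) by (rule equivalence1D)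
  have p: "\<gamma> \<bullet> (\<eta> \<star> id2 L (src2 L \<gamma>)) = (\<eta> \<star> id2 L (trg2 L \<gamma>)) \<bullet> (id2 L g \<star> id2 L f \<star> \<gamma>)"
    if "\<gamma> \<in> Cell L" "trg1 L (src2 L \<gamma>) = src1 L f" for \<gamma>
    using exch[of \<gamma> \<eta>] that g f by simp
  have "\<alpha> \<bullet> (\<eta> \<star> id2 L (src2 L \<alpha>)) = \<beta> \<bullet> (\<eta> \<star> id2 L (src2 L \<alpha>))"
    using p[of \<alpha>] p[of \<beta>] a eq by simp
  then show ?thesis
    by (rule iffD1[OF iso2_cancel_right, rotated -1]) (use a g f in simp_all)
qed

text \<open>The preimage is the conjugate by \<open>\<eta>\<close> of \<open>\<kappa>\<close>
  whiskered with \<open>g\<close>. Since \<open>\<eta>\<close> and \<open>\<epsilon>\<close> satisfy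
  no triangle identity, its image under \<open>f\<close> is not computed directly: it agrees with
  \<open>\<kappa>\<close> after whiskering with \<open>g\<close>, and \<open>g\<close> is
  faithful.\<close>

lemma equivalence1_full:
  assumes "equivalence1 L f" and u: "u \<in> Mor L" "v \<in> Mor L" "trg1 L u = src1 L f" "trg1 L v = src1 L f"
    and k: "\<kappa> \<in> Cell L" "src2 L \<kappa> = f \<cdot> u" "trg2 L \<kappa> = f \<cdot> v"
  obtains \<mu> where "\<mu> \<in> Cell L" "src2 L \<mu> = u" "trg2 L \<mu> = v" "id2 L f \<star> \<mu> = \<kappa>"
proof -
  have f: "f \<in> Mor L" using assms by simp
  obtain g \<eta> \<epsilon> where eg: "equivalence1 L g" and g: "src1 L g = trg1 L f" "trg1 L g = src1 L f"
    "iso2 L \<eta>" "src2 L \<eta> = g \<cdot> f" "trg2 L \<eta> = one L (src1 L f)"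
    "iso2 L \<epsilon>" "src2 L \<epsilon> = f \<cdot> g" "trg2 L \<epsilon> = one L (trg1 L f)" using assms(1) by (rule equivalence1_inverse)
  have gm: "g \<in> Mor L" using eg by simp
  have sk: "src1 L v = src1 L u" using k src1_trg2[of \<kappa>] u f by simp
  define \<mu> where "\<mu> = (\<eta> \<star> id2 L v) \<bullet> (id2 L g \<star> \<kappa>) \<bullet> (inv2 L \<eta> \<star> id2 L u)"
  have m: "\<mu> \<in> Cell L" "src2 L \<mu> = u" "trg2 L \<mu> = v" using g gm u k f by (simp_all add: \<mu>_def)
  have "\<mu> \<bullet> (\<eta> \<star> id2 L u) = (\<eta> \<star> id2 L v) \<bullet> (id2 L g \<star> \<kappa>)"
    using g gm u k f by (simp add: \<mu>_def)
  moreover have "\<mu> \<bullet> (\<eta> \<star> id2 L u) = (\<eta> \<star> id2 L v) \<bullet> (id2 L g \<star> id2 L f \<star> \<mu>)"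
    using exch[of \<mu> \<eta>] g gm u m f by simp
  ultimately have "(\<eta> \<star> id2 L v) \<bullet> (id2 L g \<star> \<kappa>) = (\<eta> \<star> id2 L v) \<bullet> (id2 L g \<star> id2 L f \<star> \<mu>)"
    by (simp only:)
  then have "id2 L g \<star> \<kappa> = id2 L g \<star> id2 L f \<star> \<mu>"
    by (rule iffD1[OF iso2_cancel_left, rotated -1]) (use m f g gm k u sk in simp_all)
  then have "\<kappa> = id2 L f \<star> \<mu>"
    by (rule equivalence1_faithful[OF eg, rotated -1]) (use m f g gm k u in simp_all)
  then have "id2 L f \<star> \<mu> = \<kappa>" by (rule sym)
  with m that show thesis by blast
qed

lemma equivalence1_iso2:
  assumes "equivalence1 L f" "\<alpha> \<in> Cell L" "trg1 L (src2 L \<alpha>) = src1 L f" "iso2 L (id2 L f \<star> \<alpha>)"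
  shows "iso2 L \<alpha>"
proof -
  have f: "f \<in> Mor L" using assms by simp
  obtain \<mu> where m: "\<mu> \<in> Cell L" "src2 L \<mu> = trg2 L \<alpha>" "trg2 L \<mu> = src2 L \<alpha>" "id2 L f \<star> \<mu> = inv2 L (id2 L f \<star> \<alpha>)"
    using equivalence1_full[OF assms(1), of "trg2 L \<alpha>" "src2 L \<alpha>" "inv2 L (id2 L f \<star> \<alpha>)"] assms f by auto
  have "\<mu> \<bullet> \<alpha> = id2 L (src2 L \<alpha>)"
    by (rule equivalence1_faithful[OF assms(1)]) (use m f assms in \<open>simp_all\<close>)
  moreover have "\<alpha> \<bullet> \<mu> = id2 L (trg2 L \<alpha>)"
    by (rule equivalence1_faithful[OF assms(1)]) (use m f assms in \<open>simp_all\<close>)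
  ultimately show ?thesis using inv2_eq[of \<alpha> \<mu>] m assms by simp
qed

text \<open>A one-sided quasi-inverse of an equivalence is two-sided: \<open>\<theta>\<close>
  whiskered with \<open>r\<close> is a 2-cell from \<open>r \<cdot> c \<cdot> r\<close> to
  \<open>r\<close>, and \<open>r\<close> is full and reflects invertibility, so it comes from an
  invertible 2-cell \<open>c \<cdot> r \<Rightarrow> 1\<close>.\<close>

lemma equivalence1_inverse_of:
  assumes "equivalence1 L r" "c \<in> Mor L" "trg1 L c = src1 L r"
    and "iso2 L \<theta>" "src2 L \<theta> = r \<cdot> c" "trg2 L \<theta> = one L (src1 L c)"
  shows "equivalence1 L c"
proof -
  have r: "r \<in> Mor L" using assms by simp
  have tr: "trg1 L r = src1 L c" using trg1_trg2[of \<theta>] assms r by simp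
  obtain \<mu> where m: "\<mu> \<in> Cell L" "src2 L \<mu> = c \<cdot> r" "trg2 L \<mu> = one L (src1 L r)" "id2 L r \<star> \<mu> = \<theta> \<star> id2 L r"
    using equivalence1_full[OF assms(1), of "c \<cdot> r" "one L (src1 L r)" "\<theta> \<star> id2 L r"] assms r tr by auto
  have "iso2 L (\<theta> \<star> id2 L r)" using assms r tr by simp
  with m have "iso2 L \<mu>" using equivalence1_iso2[OF assms(1), of \<mu>] assms r tr by simp
  then show ?thesis
    by (intro equivalence1I[of c r \<theta> \<mu>]) (use m assms r tr in simp_all)
qed

end

lemmas equivalence1_cofull = two_category.equivalence1_full[OF two_category.op2_two_category, simplified]

section \<open>Null structures\<close>

text \<open>\<open>N(A, B)\<close> need not be full in \<open>Hom(A, B)\<close>, so a null 2-cell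
  that is invertible in \<open>L\<close> may have an inverse that is not null. The isomorphisms of
  \<open>N(A, B)\<close> are the 2-cells that are null in both directions.\<close>

definition nci :: "('o, 'm, 'c) two_cat \<Rightarrow> ('c \<Rightarrow> 'c \<Rightarrow> 'c \<Rightarrow> bool) \<Rightarrow> 'c \<Rightarrow> 'c \<Rightarrow> 'c \<Rightarrow> bool" where
  "nci L nc x \<alpha> y \<longleftrightarrow> iso2 L \<alpha> \<and> nc x \<alpha> y \<and> nc y (inv2 L \<alpha>) x"

text \<open>A null structure on a morphism \<open>f\<close> is an invertible 2-cell \<open>x\<close> from \<open>f\<close> to a null morphism, and
  \<open>nc x \<alpha> y\<close> says that \<open>\<alpha>\<close> becomes a null 2-cell after conjugation by \<open>x\<close> and \<open>y\<close>. The actions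
  \<open>al b x\<close> and \<open>ar x a\<close> are the structures induced on \<open>b \<cdot> f\<close> and \<open>f \<cdot> a\<close>. Unlike the null morphisms of
  a 2-ideal, the morphisms that carry a structure are closed under isomorphism.\<close>

locale nullity = two_category L for L :: "('o, 'm, 'c) two_cat" (structure) +
  fixes NS :: "'c set" and nc :: "'c \<Rightarrow> 'c \<Rightarrow> 'c \<Rightarrow> bool"
    and al :: "'m \<Rightarrow> 'c \<Rightarrow> 'c" and ar :: "'c \<Rightarrow> 'm \<Rightarrow> 'c"
  assumes NS_iso: "x \<in> NS \<Longrightarrow> iso2 L x"
    and nc_bd: "nc x \<alpha> y \<Longrightarrow> x \<in> NS \<and> y \<in> NS \<and> \<alpha> \<in> Cell L \<and> src2 L \<alpha> = src2 L x \<and> trg2 L \<alpha> = src2 L y"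
    and nc_id: "x \<in> NS \<Longrightarrow> nc x (id2 L (src2 L x)) x"
    and nc_vcomp: "nc x \<alpha> y \<Longrightarrow> nc y \<beta> z \<Longrightarrow> nc x (\<beta> \<bullet> \<alpha>) z"
    and transport: "\<lbrakk>x \<in> NS; iso2 L \<alpha>; src2 L \<alpha> = src2 L x\<rbrakk> \<Longrightarrow> \<exists>y. nci L nc x \<alpha> y"
    and ar_NS: "\<lbrakk>x \<in> NS; a \<in> Mor L; trg1 L a = src1 L (src2 L x)\<rbrakk> \<Longrightarrow> ar x a \<in> NS \<and> src2 L (ar x a) = src2 L x \<cdot> a"
    and al_NS: "\<lbrakk>x \<in> NS; b \<in> Mor L; src1 L b = trg1 L (src2 L x)\<rbrakk> \<Longrightarrow> al b x \<in> NS \<and> src2 L (al b x) = b \<cdot> src2 L x"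
    and nc_ar: "\<lbrakk>nc x \<alpha> y; a \<in> Mor L; trg1 L a = src1 L (src2 L x)\<rbrakk> \<Longrightarrow> nc (ar x a) (\<alpha> \<star> id2 L a) (ar y a)"
    and nc_al: "\<lbrakk>nc x \<alpha> y; b \<in> Mor L; src1 L b = trg1 L (src2 L x)\<rbrakk> \<Longrightarrow> nc (al b x) (id2 L b \<star> \<alpha>) (al b y)"
    and nc_ar2: "\<lbrakk>x \<in> NS; \<alpha> \<in> Cell L; trg1 L (src2 L \<alpha>) = src1 L (src2 L x)\<rbrakk>
      \<Longrightarrow> nc (ar x (src2 L \<alpha>)) (id2 L (src2 L x) \<star> \<alpha>) (ar x (trg2 L \<alpha>))"
    and nc_al2: "\<lbrakk>x \<in> NS; \<alpha> \<in> Cell L; src1 L (src2 L \<alpha>) = trg1 L (src2 L x)\<rbrakk>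
      \<Longrightarrow> nc (al (src2 L \<alpha>) x) (\<alpha> \<star> id2 L (src2 L x)) (al (trg2 L \<alpha>) x)"
    and ar_ar: "\<lbrakk>x \<in> NS; a \<in> Mor L; trg1 L a = src1 L (src2 L x); a' \<in> Mor L; trg1 L a' = src1 L a\<rbrakk>
      \<Longrightarrow> nci L nc (ar (ar x a) a') (id2 L (src2 L x \<cdot> a \<cdot> a')) (ar x (a \<cdot> a'))"
    and al_al: "\<lbrakk>x \<in> NS; b \<in> Mor L; src1 L b = trg1 L (src2 L x); b' \<in> Mor L; src1 L b' = trg1 L b\<rbrakk>
      \<Longrightarrow> nci L nc (al b' (al b x)) (id2 L (b' \<cdot> b \<cdot> src2 L x)) (al (b' \<cdot> b) x)"
    and al_ar: "\<lbrakk>x \<in> NS; b \<in> Mor L; src1 L b = trg1 L (src2 L x); a \<in> Mor L; trg1 L a = src1 L (src2 L x)\<rbrakk>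
      \<Longrightarrow> nci L nc (ar (al b x) a) (id2 L (b \<cdot> src2 L x \<cdot> a)) (al b (ar x a))"
    and ar_one: "\<lbrakk>x \<in> NS; src1 L (src2 L x) = A\<rbrakk> \<Longrightarrow> nci L nc (ar x (one L A)) (id2 L (src2 L x)) x"
    and al_one: "\<lbrakk>x \<in> NS; trg1 L (src2 L x) = B\<rbrakk> \<Longrightarrow> nci L nc (al (one L B) x) (id2 L (src2 L x)) x"
begin

lemma nci_bd: "nci L nc x \<alpha> y \<Longrightarrow> x \<in> NS \<and> y \<in> NS \<and> iso2 L \<alpha> \<and> src2 L \<alpha> = src2 L x \<and> trg2 L \<alpha> = src2 L y"
  using nc_bd by (auto simp: nci_def)

lemma nci_nc: "nci L nc x \<alpha> y \<Longrightarrow> nc x \<alpha> y"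
  by (simp add: nci_def)

lemma nci_sym: "nci L nc x \<alpha> y \<Longrightarrow> nci L nc y (inv2 L \<alpha>) x"
  by (simp add: nci_def)

lemma nci_vcomp: "nci L nc x \<alpha> y \<Longrightarrow> nci L nc y \<beta> z \<Longrightarrow> nci L nc x (\<beta> \<bullet> \<alpha>) z"
  using nci_bd[of x \<alpha> y] nci_bd[of y \<beta> z] by (auto simp: nci_def intro: nc_vcomp)

lemma nci_ar: "\<lbrakk>nci L nc x \<alpha> y; a \<in> Mor L; trg1 L a = src1 L (src2 L x)\<rbrakk> \<Longrightarrow> nci L nc (ar x a) (\<alpha> \<star> id2 L a) (ar y a)"
  using nci_bd[of x \<alpha> y] src1_trg2[of \<alpha>] nc_ar[of y "inv2 L \<alpha>" x a] by (auto simp: nci_def intro: nc_ar)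

lemma nci_al: "\<lbrakk>nci L nc x \<alpha> y; b \<in> Mor L; src1 L b = trg1 L (src2 L x)\<rbrakk> \<Longrightarrow> nci L nc (al b x) (id2 L b \<star> \<alpha>) (al b y)"
  using nci_bd[of x \<alpha> y] trg1_trg2[of \<alpha>] nc_al[of y "inv2 L \<alpha>" x b] by (auto simp: nci_def intro: nc_al)

lemma nci_ar2: "\<lbrakk>x \<in> NS; iso2 L \<alpha>; trg1 L (src2 L \<alpha>) = src1 L (src2 L x)\<rbrakk>
    \<Longrightarrow> nci L nc (ar x (src2 L \<alpha>)) (id2 L (src2 L x) \<star> \<alpha>) (ar x (trg2 L \<alpha>))"
  using nc_ar2[of x \<alpha>] nc_ar2[of x "inv2 L \<alpha>"] NS_iso by (simp add: nci_def)

lemma nc_conj: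
  assumes "nci L nc x \<theta> x'" "nci L nc y \<eta> y'" "nc x \<alpha> y"
  shows "nc x' (\<eta> \<bullet> \<alpha> \<bullet> inv2 L \<theta>) y'"
  using assms nci_bd[of x \<theta> x'] nci_bd[of y \<eta> y'] nc_bd[of x \<alpha> y] by (blast intro: nc_vcomp nci_nc nci_sym)

lemma nc_conj_iff:
  assumes "nci L nc x \<theta> x'" "nci L nc y \<eta> y'" "\<alpha> \<in> Cell L" "src2 L \<alpha> = src2 L x" "trg2 L \<alpha> = src2 L y"
  shows "nc x' (\<eta> \<bullet> \<alpha> \<bullet> inv2 L \<theta>) y' \<longleftrightarrow> nc x \<alpha> y"
proof
  assume "nc x' (\<eta> \<bullet> \<alpha> \<bullet> inv2 L \<theta>) y'"
  then have "nc x (inv2 L \<eta> \<bullet> (\<eta> \<bullet> \<alpha> \<bullet> inv2 L \<theta>) \<bullet> inv2 L (inv2 L \<theta>)) y"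
    using assms nc_conj nci_sym by blast
  then show "nc x \<alpha> y" using assms nci_bd[of x \<theta> x'] nci_bd[of y \<eta> y'] by simp
qed (use assms nc_conj in blast)

text \<open>Two structures on one morphism that are linked by a null identity admit the same null
  2-cells. The actions \<open>al\<close> and \<open>ar\<close> are associative and unital only up to
  such links, so this is the rule for replacing one bracketing by another.\<close>

lemma nc_eqv_iff:
  assumes "nci L nc x (id2 L f) x'" "nci L nc y (id2 L g) y'" "src2 L x = f" "src2 L y = g"
  shows "nc x' \<alpha> y' \<longleftrightarrow> nc x \<alpha> y"
proof -
  have "\<alpha> \<in> Cell L \<and> src2 L \<alpha> = f \<and> trg2 L \<alpha> = g" if "nc x \<alpha> y \<or> nc x' \<alpha> y'"
    using that nc_bd[of x \<alpha> y] nc_bd[of x' \<alpha> y'] assms nci_bd[of x "id2 L f" x'] nci_bd[of y "id2 L g" y'] NS_iso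
    by auto
  moreover have "f \<in> Mor L" "g \<in> Mor L" using assms nci_bd[of x "id2 L f" x'] nci_bd[of y "id2 L g" y'] NS_iso by auto
  ultimately show ?thesis
    using nc_conj_iff[OF assms(1,2), of \<alpha>] assms by auto
qed

lemma nullity_op: "nullity (op2 L) NS nc (\<lambda>b x. ar x b) (\<lambda>x a. al a x)"
proof -
  interpret op: two_category "op2 L" by (rule op2_two_category)
  have [simp]: "nci (op2 L) nc = nci L nc" by (auto simp: nci_def fun_eq_iff)
  show ?thesis
  proof unfold_locales
    fix x b a
    assume a: "x \<in> NS" "b \<in> Mor (op2 L)" "src1 (op2 L) b = trg1 (op2 L) (src2 (op2 L) x)" "a \<in> Mor (op2 L)"
       "trg1 (op2 L) a = src1 (op2 L) (src2 (op2 L) x)"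
    \<comment> \<open>The other axioms are exchanged in pairs by duality. \<open>al_ar\<close> is
      its own dual with its two ends swapped, whence the symmetry.\<close>
    show "nci (op2 L) nc (al a (ar x b)) (id2 (op2 L) (b \<cdot>\<^bsub>op2 L\<^esub> src2 (op2 L) x \<cdot>\<^bsub>op2 L\<^esub> a)) (ar (al a x) b)"
      using nci_sym[OF al_ar[of x a b]] a NS_iso by simp
  next
    fix x a a'
    assume a: "x \<in> NS" "a \<in> Mor (op2 L)" "trg1 (op2 L) a = src1 (op2 L) (src2 (op2 L) x)" "a' \<in> Mor (op2 L)"
       "trg1 (op2 L) a' = src1 (op2 L) a"
    show "nci (op2 L) nc (al a' (al a x)) (id2 (op2 L) (src2 (op2 L) x \<cdot>\<^bsub>op2 L\<^esub> a \<cdot>\<^bsub>op2 L\<^esub> a')) (al (a \<cdot>\<^bsub>op2 L\<^esub> a') x)"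
      using al_al[of x a a'] a NS_iso by simp
  next
    fix x b b'
    assume a: "x \<in> NS" "b \<in> Mor (op2 L)" "src1 (op2 L) b = trg1 (op2 L) (src2 (op2 L) x)" "b' \<in> Mor (op2 L)"
       "src1 (op2 L) b' = trg1 (op2 L) b"
    show "nci (op2 L) nc (ar (ar x b) b') (id2 (op2 L) (b' \<cdot>\<^bsub>op2 L\<^esub> b \<cdot>\<^bsub>op2 L\<^esub> src2 (op2 L) x)) (ar x (b' \<cdot>\<^bsub>op2 L\<^esub> b))"
      using ar_ar[of x b b'] a NS_iso by simp
  qed (simp_all only: op2_sel op2_iso2 \<open>nci (op2 L) nc = nci L nc\<close>,
      (blast intro: NS_iso nc_id nc_vcomp transport ar_NS[THEN conjunct1] al_NS[THEN conjunct1]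
       ar_NS[THEN conjunct2] al_NS[THEN conjunct2] nc_ar nc_al nc_ar2 nc_al2 ar_one al_one dest: nc_bd)+)
qed

end

lemma op2_nci [simp]: "nci (op2 L) nc = nci L nc"
  by (auto simp: nci_def fun_eq_iff)

section \<open>Kernels with respect to null structures\<close>

text \<open>The universal property of a 2-kernel in which one structure \<open>x\<close> on
  \<open>f \<cdot> k\<close> replaces the pair of null morphism and structure 2-cell; the composites
  with \<open>nu\<close> are absorbed by \<open>ar\<close>.\<close>

definition kernel :: "('o, 'm, 'c) two_cat \<Rightarrow> 'c set \<Rightarrow> ('c \<Rightarrow> 'c \<Rightarrow> 'c \<Rightarrow> bool) \<Rightarrow> ('c \<Rightarrow> 'm \<Rightarrow> 'c)
    \<Rightarrow> 'm \<Rightarrow> 'm \<Rightarrow> 'c \<Rightarrow> bool" where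
  "kernel L NS nc ar f k x \<longleftrightarrow> f \<in> Mor L \<and> k \<in> Mor L \<and> trg1 L k = src1 L f \<and> x \<in> NS \<and> src2 L x = f \<cdot>\<^bsub>L\<^esub> k \<and>
     (\<forall>z y. z \<in> Mor L \<and> trg1 L z = src1 L f \<and> y \<in> NS \<and> src2 L y = f \<cdot>\<^bsub>L\<^esub> z \<longrightarrow>
        (\<exists>u \<gamma>. u \<in> Mor L \<and> src1 L u = src1 L z \<and> trg1 L u = src1 L k \<and>
          iso2 L \<gamma> \<and> src2 L \<gamma> = z \<and> trg2 L \<gamma> = k \<cdot>\<^bsub>L\<^esub> u \<and> nci L nc y (f \<rhd>\<^bsub>L\<^esub> \<gamma>) (ar x u))) \<and>
     (\<forall>u v \<kappa>. u \<in> Mor L \<and> v \<in> Mor L \<and> trg1 L u = src1 L k \<and> trg1 L v = src1 L k \<and> src1 L u = src1 L v \<and>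
        \<kappa> \<in> Cell L \<and> src2 L \<kappa> = k \<cdot>\<^bsub>L\<^esub> u \<and> trg2 L \<kappa> = k \<cdot>\<^bsub>L\<^esub> v \<and> nc (ar x u) (f \<rhd>\<^bsub>L\<^esub> \<kappa>) (ar x v) \<longrightarrow>
        (\<exists>!\<mu>. \<mu> \<in> cells L u v \<and> k \<rhd>\<^bsub>L\<^esub> \<mu> = \<kappa>))"

abbreviation cokernel :: "('o, 'm, 'c) two_cat \<Rightarrow> 'c set \<Rightarrow> ('c \<Rightarrow> 'c \<Rightarrow> 'c \<Rightarrow> bool) \<Rightarrow> ('m \<Rightarrow> 'c \<Rightarrow> 'c)
    \<Rightarrow> 'm \<Rightarrow> 'm \<Rightarrow> 'c \<Rightarrow> bool" where
  "cokernel L NS nc al f c x \<equiv> kernel (op2 L) NS nc (\<lambda>x a. al a x) f c x"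

text \<open>In terms of structures the isomorphism from \<open>s\<close> to a null morphism is
  itself a structure \<open>y\<close> on \<open>s\<close>, so reflecting null morphisms becomes
  lifting a structure on \<open>k \<cdot> s\<close> to one on \<open>s\<close>.\<close>

definition reflects_structures :: "('o, 'm, 'c) two_cat \<Rightarrow> 'c set \<Rightarrow> ('c \<Rightarrow> 'c \<Rightarrow> 'c \<Rightarrow> bool) \<Rightarrow> ('m \<Rightarrow> 'c \<Rightarrow> 'c)
    \<Rightarrow> 'm \<Rightarrow> bool" where
  "reflects_structures L NS nc al k \<longleftrightarrow>
     (\<forall>s x. s \<in> Mor L \<and> trg1 L s = src1 L k \<and> x \<in> NS \<and> src2 L x = k \<cdot>\<^bsub>L\<^esub> s \<longrightarrow>
        (\<exists>y \<in> NS. src2 L y = s \<and> nci L nc x (id2 L (k \<cdot>\<^bsub>L\<^esub> s)) (al k y))) \<and>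
     (\<forall>x y \<alpha>. x \<in> NS \<and> y \<in> NS \<and> \<alpha> \<in> Cell L \<and> src2 L \<alpha> = src2 L x \<and> trg2 L \<alpha> = src2 L y \<and>
        trg1 L (src2 L x) = src1 L k \<and> nc (al k x) (k \<rhd>\<^bsub>L\<^esub> \<alpha>) (al k y) \<longrightarrow> nc x \<alpha> y)"

context nullity
begin

lemma kernelD:
  assumes "kernel L NS nc ar f k x"
  shows "f \<in> Mor L" "k \<in> Mor L" "trg1 L k = src1 L f" "x \<in> NS" "src2 L x = f \<cdot> k"
  using assms by (simp_all add: kernel_def)

lemma kernel_factor:
  assumes "kernel L NS nc ar f k x" "z \<in> Mor L" "trg1 L z = src1 L f" "y \<in> NS" "src2 L y = f \<cdot> z"
  obtains u \<gamma> where "u \<in> Mor L" "src1 L u = src1 L z" "trg1 L u = src1 L k"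
     "iso2 L \<gamma>" "src2 L \<gamma> = z" "trg2 L \<gamma> = k \<cdot> u" "nci L nc y (id2 L f \<star> \<gamma>) (ar x u)"
  using assms unfolding kernel_def by blast

lemma kernel_lift:
  assumes "kernel L NS nc ar f k x" "u \<in> Mor L" "v \<in> Mor L" "trg1 L u = src1 L k" "trg1 L v = src1 L k"
    "src1 L u = src1 L v" "\<kappa> \<in> Cell L" "src2 L \<kappa> = k \<cdot> u" "trg2 L \<kappa> = k \<cdot> v" "nc (ar x u) (id2 L f \<star> \<kappa>) (ar x v)"
  shows "\<exists>!\<mu>. \<mu> \<in> cells L u v \<and> id2 L k \<star> \<mu> = \<kappa>"
  using assms unfolding kernel_def by blast

text \<open>Whiskering the null morphism \<open>f \<cdot> k\<close> with any 2-cell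
  \<open>\<mu>\<close> gives a null 2-cell by \<open>nc_ar2\<close>. Hence the lifting clause
  applies to the image of \<open>\<mu>\<close> under \<open>k\<close>, and its uniqueness part is
  faithfulness.\<close>

lemma kernel_faithful:
  assumes k: "kernel L NS nc ar f k x" and "\<mu> \<in> Cell L" "\<mu>' \<in> Cell L" "src2 L \<mu> = src2 L \<mu>'" "trg2 L \<mu> = trg2 L \<mu>'"
    "trg1 L (src2 L \<mu>) = src1 L k" "id2 L k \<star> \<mu> = id2 L k \<star> \<mu>'"
  shows "\<mu> = \<mu>'"
proof -
  note kd [simp] = kernelD[OF k]
  have "nc (ar x (src2 L \<mu>)) (id2 L (src2 L x) \<star> \<mu>) (ar x (trg2 L \<mu>))"
    using assms by (intro nc_ar2) simp_all
  then have "\<exists>!\<nu>. \<nu> \<in> cells L (src2 L \<mu>) (trg2 L \<mu>) \<and> id2 L k \<star> \<nu> = id2 L k \<star> \<mu>"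
    using assms(2-6) by (intro kernel_lift[OF k]) simp_all
  then show ?thesis using assms by (metis cells_iff)
qed

lemma kernel_lift_iso:
  assumes k: "kernel L NS nc ar f k x" and u: "u \<in> Mor L" "v \<in> Mor L" "trg1 L u = src1 L k" "trg1 L v = src1 L k"
    "src1 L u = src1 L v" and \<kappa>: "iso2 L \<kappa>" "src2 L \<kappa> = k \<cdot> u" "trg2 L \<kappa> = k \<cdot> v"
    "nci L nc (ar x u) (id2 L f \<star> \<kappa>) (ar x v)"
  obtains \<mu> where "iso2 L \<mu>" "src2 L \<mu> = u" "trg2 L \<mu> = v" "id2 L k \<star> \<mu> = \<kappa>"
proof -
  note kd [simp] = kernelD[OF k]
  obtain \<mu> where m: "\<mu> \<in> Cell L" "src2 L \<mu> = u" "trg2 L \<mu> = v" "id2 L k \<star> \<mu> = \<kappa>"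
    using kernel_lift[OF k u, of \<kappa>] \<kappa> by (auto simp: nci_def cells_iff)
  have "nc (ar x v) (id2 L f \<star> inv2 L \<kappa>) (ar x u)"
    using nci_nc[OF nci_sym[OF \<kappa>(4)]] \<kappa> u by simp
  then obtain \<nu> where n: "\<nu> \<in> Cell L" "src2 L \<nu> = v" "trg2 L \<nu> = u" "id2 L k \<star> \<nu> = inv2 L \<kappa>"
    using kernel_lift[OF k, of v u "inv2 L \<kappa>"] \<kappa> u by (auto simp: cells_iff)
  have "\<nu> \<bullet> \<mu> = id2 L u"
    by (rule kernel_faithful[OF k]) (use m n u \<kappa> in simp_all)
  moreover have "\<mu> \<bullet> \<nu> = id2 L v"
    by (rule kernel_faithful[OF k]) (use m n u \<kappa> in simp_all)
  ultimately have "iso2 L \<mu>" using inv2_eq[of \<mu> \<nu>] m n by simp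
  with m that show thesis by blast
qed

text \<open>One statement for two closure properties of the class of kernels: with
  \<open>\<theta>\<close> an identity it gives stability under composition with equivalences, with
  \<open>i\<close> an identity stability under isomorphism. The structure is transported along
  \<open>\<theta>\<close>.\<close>

lemma kernel_equivalence:
  assumes k: "kernel L NS nc ar f k x" and i: "equivalence1 L i" "trg1 L i = src1 L k"
    and \<theta>: "iso2 L \<theta>" "src2 L \<theta> = k \<cdot> i" "trg2 L \<theta> = k'"
  shows "\<exists>x'. kernel L NS nc ar f k' x'"
proof -
  note kd [simp] = kernelD[OF k]
  have im [simp]: "i \<in> Mor L" using i by simp
  have [simp]: "trg1 L i = src1 L k" by fact
  note \<theta> [simp]
  have k' [simp]: "k' \<in> Mor L" "trg1 L k' = src1 L f" "src1 L k' = src1 L i"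
    using trg2_Mor[of \<theta>] src1_trg2[of \<theta>] trg1_trg2[of \<theta>] by simp_all
  obtain x' where x': "nci L nc (ar x i) (id2 L f \<star> \<theta>) x'"
    using transport[of "ar x i" "id2 L f \<star> \<theta>"] ar_NS[of x i] by auto
  have x'b [simp]: "x' \<in> NS" "src2 L x' = f \<cdot> k'"
    using nci_bd[OF x'] by simp_all
  obtain i' \<eta> \<zeta> where i'e: "equivalence1 L i'" and i' [simp]: "src1 L i' = trg1 L i" "trg1 L i' = src1 L i"
    "iso2 L \<eta>" "src2 L \<eta> = i' \<cdot> i" "trg2 L \<eta> = one L (src1 L i)"
    "iso2 L \<zeta>" "src2 L \<zeta> = i \<cdot> i'" "trg2 L \<zeta> = one L (src1 L k)"
    using i by (auto elim: equivalence1_inverse)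
  have i'm [simp]: "i' \<in> Mor L" using i'e by simp
  have arx: "nci L nc (ar x (i \<cdot> u)) (id2 L f \<star> \<theta> \<star> id2 L u) (ar x' u)" if "u \<in> Mor L" "trg1 L u = src1 L i" for u
  proof -
    have "nci L nc (ar x (i \<cdot> u)) (id2 L (f \<cdot> k \<cdot> i \<cdot> u)) (ar (ar x i) u)"
      using nci_sym[OF ar_ar[of x i u]] that by simp
    from nci_vcomp[OF this nci_ar[OF x', of u]] show ?thesis using that ar_NS[of x i] by simp
  qed
  have "kernel L NS nc ar f k' x'"
    unfolding kernel_def
  proof (intro conjI allI impI)
    fix z y
    assume a: "z \<in> Mor L \<and> trg1 L z = src1 L f \<and> y \<in> NS \<and> src2 L y = f \<cdot> z"
    then obtain u \<gamma> where u [simp]: "u \<in> Mor L" "src1 L u = src1 L z" "trg1 L u = src1 L k"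
     "iso2 L \<gamma>" "src2 L \<gamma> = z" "trg2 L \<gamma> = k \<cdot> u" and n: "nci L nc y (id2 L f \<star> \<gamma>) (ar x u)"
      using kernel_factor[OF k] by metis
    \<comment> \<open>The factorization found goes through \<open>k\<close>. To continue it through
      \<open>k \<cdot> i\<close>, the identity is replaced by \<open>i \<cdot> i'\<close> via the
      inverse of \<open>\<zeta>\<close>.\<close>
    have 1: "nci L nc (ar x u) (id2 L (f \<cdot> k) \<star> inv2 L \<zeta> \<star> id2 L u) (ar x (i \<cdot> i' \<cdot> u))"
      using nci_ar2[of x "inv2 L \<zeta> \<star> id2 L u"] by simp
    let ?\<gamma> = "(\<theta> \<star> id2 L (i' \<cdot> u)) \<bullet> (id2 L k \<star> inv2 L \<zeta> \<star> id2 L u) \<bullet> \<gamma>"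
    have "nci L nc y (id2 L f \<star> ?\<gamma>) (ar x' (i' \<cdot> u))"
      using nci_vcomp[OF n nci_vcomp[OF 1 arx[of "i' \<cdot> u"]]] a by simp
    then show "\<exists>u \<gamma>. u \<in> Mor L \<and> src1 L u = src1 L z \<and> trg1 L u = src1 L k' \<and>
          iso2 L \<gamma> \<and> src2 L \<gamma> = z \<and> trg2 L \<gamma> = k' \<cdot> u \<and> nci L nc y (id2 L f \<star> \<gamma>) (ar x' u)"
      using a by (intro exI[of _ "i' \<cdot> u"] exI[of _ ?\<gamma>]) simp
  next
    fix u v \<kappa>
    assume a: "u \<in> Mor L \<and> v \<in> Mor L \<and> trg1 L u = src1 L k' \<and> trg1 L v = src1 L k' \<and> src1 L u = src1 L v \<and>
        \<kappa> \<in> Cell L \<and> src2 L \<kappa> = k' \<cdot> u \<and> trg2 L \<kappa> = k' \<cdot> v \<and> nc (ar x' u) (id2 L f \<star> \<kappa>) (ar x' v)"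
    then have u [simp]: "u \<in> Mor L" "v \<in> Mor L" "trg1 L u = src1 L i" "trg1 L v = src1 L i" "src1 L u = src1 L v"
      "\<kappa> \<in> Cell L" "src2 L \<kappa> = k' \<cdot> u" "trg2 L \<kappa> = k' \<cdot> v" by simp_all
    \<comment> \<open>Conjugating by \<open>\<theta>\<close> turns the given 2-cell into one between
      \<open>k \<cdot> i \<cdot> u\<close> and \<open>k \<cdot> i \<cdot> v\<close>, which lifts
      first along the kernel \<open>k\<close> and then along the full morphism
      \<open>i\<close>.\<close>
    let ?\<kappa> = "(inv2 L \<theta> \<star> id2 L v) \<bullet> \<kappa> \<bullet> (\<theta> \<star> id2 L u)"
    have "nc (ar x (i \<cdot> u)) ((inv2 L (id2 L f \<star> \<theta> \<star> id2 L v)) \<bullet> (id2 L f \<star> \<kappa>) \<bullet> inv2 L (inv2 L (id2 L f \<star> \<theta> \<star> id2 L u))) (ar x (i \<cdot> v))"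
      using a by (intro nc_conj[OF nci_sym[OF arx] nci_sym[OF arx]]) simp_all
    then have "nc (ar x (i \<cdot> u)) (id2 L f \<star> ?\<kappa>) (ar x (i \<cdot> v))" by simp
    then have "\<exists>!\<mu>. \<mu> \<in> cells L (i \<cdot> u) (i \<cdot> v) \<and> id2 L k \<star> \<mu> = ?\<kappa>"
      by (intro kernel_lift[OF k]) simp_all
    then obtain \<tau> where l: "\<tau> \<in> Cell L" "src2 L \<tau> = i \<cdot> u" "trg2 L \<tau> = i \<cdot> v" "id2 L k \<star> \<tau> = ?\<kappa>"
      by (auto simp: cells_iff)
    then obtain \<mu> where m: "\<mu> \<in> Cell L" "src2 L \<mu> = u" "trg2 L \<mu> = v" "id2 L i \<star> \<mu> = \<tau>"
      using equivalence1_full[OF i(1), of u v \<tau>] by auto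
    have ex: "(id2 L k' \<star> \<nu>) \<bullet> (\<theta> \<star> id2 L u) = (\<theta> \<star> id2 L v) \<bullet> (id2 L k \<star> id2 L i \<star> \<nu>)"
      if "\<nu> \<in> Cell L" "src2 L \<nu> = u" "trg2 L \<nu> = v" for \<nu>
      using exch[of \<nu> \<theta>] that by simp
    have "(id2 L k' \<star> \<mu>) \<bullet> (\<theta> \<star> id2 L u) = \<kappa> \<bullet> (\<theta> \<star> id2 L u)"
      unfolding ex[OF m(1-3)] m(4) l(4) by simp
    then have km: "id2 L k' \<star> \<mu> = \<kappa>"
      by (rule iffD1[OF iso2_cancel_right, rotated -1]) (use m(1-3) in simp_all)
    show "\<exists>!\<mu>. \<mu> \<in> cells L u v \<and> id2 L k' \<star> \<mu> = \<kappa>"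
    proof (intro ex1I[of _ \<mu>] conjI)
      fix \<nu> assume n: "\<nu> \<in> cells L u v \<and> id2 L k' \<star> \<nu> = \<kappa>"
      then have "(\<theta> \<star> id2 L v) \<bullet> (id2 L k \<star> id2 L i \<star> \<nu>) = (\<theta> \<star> id2 L v) \<bullet> (id2 L k \<star> id2 L i \<star> \<mu>)"
        using ex[of \<nu>] ex[OF m(1-3)] km by (simp add: cells_iff del: wl_wl)
      then have "id2 L k \<star> id2 L i \<star> \<nu> = id2 L k \<star> id2 L i \<star> \<mu>"
        by (rule iffD1[OF iso2_cancel_left, rotated -1]) (use m(1-3) n in \<open>simp_all add: cells_iff\<close>)
      then have "id2 L i \<star> \<nu> = id2 L i \<star> \<mu>"
        by (rule kernel_faithful[OF k, rotated -1]) (use m(1-3) n in \<open>simp_all add: cells_iff\<close>)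
      then show "\<nu> = \<mu>"
        by (rule equivalence1_faithful[OF i(1), rotated -1]) (use m(1-3) n in \<open>simp_all add: cells_iff\<close>)
    qed (use m(1-3) km in \<open>simp_all add: cells_iff\<close>)
  qed simp_all
  then show ?thesis by blast
qed

text \<open>Normality relates the structures of a kernel and of a cokernel only up to a null
  isomorphism. This moves both universal properties to one common structure.\<close>

lemma kernel_change:
  assumes k: "kernel L NS nc ar f k x" and x': "nci L nc x (id2 L (f \<cdot> k)) x'"
  shows "kernel L NS nc ar f k x'"
proof -
  note kd [simp] = kernelD[OF k]
  have x'b [simp]: "x' \<in> NS" "src2 L x' = f \<cdot> k"
    using nci_bd[OF x'] by simp_all
  have arx: "nci L nc (ar x u) (id2 L (f \<cdot> k \<cdot> u)) (ar x' u)" if "u \<in> Mor L" "trg1 L u = src1 L k" for u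
    using nci_ar[OF x', of u] that by simp
  show ?thesis
    unfolding kernel_def
  proof (intro conjI allI impI)
    fix z y
    assume a: "z \<in> Mor L \<and> trg1 L z = src1 L f \<and> y \<in> NS \<and> src2 L y = f \<cdot> z"
    then obtain u \<gamma> where u [simp]: "u \<in> Mor L" "src1 L u = src1 L z" "trg1 L u = src1 L k"
     "iso2 L \<gamma>" "src2 L \<gamma> = z" "trg2 L \<gamma> = k \<cdot> u" and n: "nci L nc y (id2 L f \<star> \<gamma>) (ar x u)"
      using kernel_factor[OF k] by metis
    have "nci L nc y (id2 L f \<star> \<gamma>) (ar x' u)"
      using nci_vcomp[OF n arx[of u]] a by simp
    then show "\<exists>u \<gamma>. u \<in> Mor L \<and> src1 L u = src1 L z \<and> trg1 L u = src1 L k \<and>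
          iso2 L \<gamma> \<and> src2 L \<gamma> = z \<and> trg2 L \<gamma> = k \<cdot> u \<and> nci L nc y (id2 L f \<star> \<gamma>) (ar x' u)"
      using a by (intro exI[of _ u] exI[of _ \<gamma>]) simp
  next
    fix u v \<kappa>
    assume a: "u \<in> Mor L \<and> v \<in> Mor L \<and> trg1 L u = src1 L k \<and> trg1 L v = src1 L k \<and> src1 L u = src1 L v \<and>
        \<kappa> \<in> Cell L \<and> src2 L \<kappa> = k \<cdot> u \<and> trg2 L \<kappa> = k \<cdot> v \<and> nc (ar x' u) (id2 L f \<star> \<kappa>) (ar x' v)"
    then have "nc (ar x u) (id2 L f \<star> \<kappa>) (ar x v)"
      using nc_eqv_iff[OF arx[of u] arx[of v]] ar_NS[of x u] ar_NS[of x v] by simp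
    then show "\<exists>!\<mu>. \<mu> \<in> cells L u v \<and> id2 L k \<star> \<mu> = \<kappa>" using kernel_lift[OF k] a by blast
  qed simp_all
qed

end

section \<open>Orthogonality of cokernels, and transfer of squares between kernels and
  cokernels\<close>

context nullity
begin

lemmas cokernelD = nullity.kernelD[OF nullity_op, unfolded op2_sel]
lemmas cokernel_factor = nullity.kernel_factor[OF nullity_op, unfolded op2_sel op2_iso2 op2_nci]
lemmas cokernel_lift = nullity.kernel_lift[OF nullity_op, unfolded op2_sel op2_cells]
lemmas cokernel_faithful = nullity.kernel_faithful[OF nullity_op, unfolded op2_sel]
lemmas cokernel_lift_iso = nullity.kernel_lift_iso[OF nullity_op, unfolded op2_sel op2_iso2 op2_nci]

lemma reflects_structuresD1:
  assumes "reflects_structures L NS nc al k" "s \<in> Mor L" "trg1 L s = src1 L k" "x \<in> NS" "src2 L x = k \<cdot> s"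
  obtains y where "y \<in> NS" "src2 L y = s" "nci L nc x (id2 L (k \<cdot> s)) (al k y)"
  using assms unfolding reflects_structures_def by blast

lemma reflects_structuresD2:
  assumes "reflects_structures L NS nc al k" "x \<in> NS" "y \<in> NS" "\<alpha> \<in> Cell L" "src2 L \<alpha> = src2 L x" "trg2 L \<alpha> = src2 L y"
    "trg1 L (src2 L x) = src1 L k" "nc (al k x) (id2 L k \<star> \<alpha>) (al k y)"
  shows "nc x \<alpha> y"
  using assms unfolding reflects_structures_def by blast

text \<open>A cokernel \<open>e\<close> of \<open>j\<close> is orthogonal to \<open>m\<close>: the null structure of \<open>e \<cdot> j\<close> gives one on \<open>m \<cdot> s \<cdot> j\<close>, which
  \<open>m\<close> reflects to one on \<open>s \<cdot> j\<close>.\<close>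

lemma orthogonal_cokernel:
  assumes e: "cokernel L NS nc al j e x" and m: "m \<in> Mor L" "reflects_structures L NS nc al m"
  shows "orthogonal L e m"
  unfolding orthogonal_def
proof (intro conjI allI ballI impI)
  note cd [simp] = cokernelD[OF e] and m(1) [simp]
  fix s t \<phi>
  assume "is_square L e m s t \<phi>"
  then have [simp]: "s \<in> Mor L" "src1 L s = src1 L e" "trg1 L s = src1 L m" "t \<in> Mor L" "src1 L t = trg1 L e"
    "trg1 L t = trg1 L m" "iso2 L \<phi>" "src2 L \<phi> = m \<cdot> s" "trg2 L \<phi> = t \<cdot> e"
    by (auto simp: is_square_def hom_iff isos_iff)
  obtain y where y: "nci L nc (al t x) (inv2 L \<phi> \<star> id2 L j) y"
    using transport[of "al t x" "inv2 L \<phi> \<star> id2 L j"] al_NS[of x t] by auto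
  then have [simp]: "y \<in> NS" "src2 L y = m \<cdot> s \<cdot> j" using nci_bd[OF y] by simp_all
  obtain p where p [simp]: "p \<in> NS" "src2 L p = s \<cdot> j" and yp: "nci L nc y (id2 L (m \<cdot> s \<cdot> j)) (al m p)"
    by (rule reflects_structuresD1[OF m(2), of "s \<cdot> j" y]) simp_all
  obtain d \<gamma> where d [simp]: "d \<in> Mor L" "src1 L d = trg1 L e" "trg1 L d = src1 L m"
    "iso2 L \<gamma>" "src2 L \<gamma> = s" "trg2 L \<gamma> = d \<cdot> e" and n: "nci L nc p (\<gamma> \<star> id2 L j) (al d x)"
    by (rule cokernel_factor[OF e, of s p]) simp_all
  \<comment> \<open>The equation of a filling forces \<open>\<rho>\<close> whiskered with
    \<open>e\<close> to be this 2-cell, so \<open>\<rho>\<close> can only be its lift along the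
    cokernel. The chain of null isomorphisms below verifies the condition for lifting.\<close>
  let ?\<kappa> = "\<phi> \<bullet> (id2 L m \<star> inv2 L \<gamma>)"
  have "nci L nc (al (m \<cdot> d) x) (id2 L (m \<cdot> d \<cdot> e \<cdot> j)) (al m (al d x))"
    using nci_sym[OF al_al[of x d m]] by simp
  from nci_vcomp[OF nci_vcomp[OF this nci_al[OF nci_sym[OF n], of m]] nci_vcomp[OF nci_sym[OF yp] nci_sym[OF y]]]
  have "nci L nc (al (m \<cdot> d) x) (?\<kappa> \<star> id2 L j) (al t x)" using al_NS[of x d] by simp
  then obtain \<rho> where r [simp]: "iso2 L \<rho>" "src2 L \<rho> = m \<cdot> d" "trg2 L \<rho> = t" and re: "\<rho> \<star> id2 L e = ?\<kappa>"
    by (elim cokernel_lift_iso[OF e, rotated -2]) simp_all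
  have "filling L e m s t \<phi> d \<gamma> \<rho>"
    unfolding filling_def re by (simp add: hom_iff isos_iff)
  then show "\<exists>d \<sigma> \<rho>. filling L e m s t \<phi> d \<sigma> \<rho>" by blast
next
  note cd [simp] = cokernelD[OF e] and m(1) [simp]
  fix s t \<phi> d \<sigma> \<rho> s' t' \<phi>' d' \<sigma>' \<rho>' \<kappa> \<mu>
  assume km: "\<kappa> \<in> cells L s s'" "\<mu> \<in> cells L t t'"
    and a: "is_square L e m s t \<phi> \<and> filling L e m s t \<phi> d \<sigma> \<rho> \<and>
        is_square L e m s' t' \<phi>' \<and> filling L e m s' t' \<phi>' d' \<sigma>' \<rho>' \<and>
        \<phi>' \<bullet> (m \<rhd>\<^bsub>L\<^esub> \<kappa>) = (\<mu> \<lhd>\<^bsub>L\<^esub> e) \<bullet> \<phi>"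
  from a have [simp]: "s \<in> Mor L" "src1 L s = src1 L e" "trg1 L s = src1 L m" "t \<in> Mor L" "src1 L t = trg1 L e"
    "trg1 L t = trg1 L m" "iso2 L \<phi>" "src2 L \<phi> = m \<cdot> s" "trg2 L \<phi> = t \<cdot> e"
    "d \<in> Mor L" "src1 L d = trg1 L e" "trg1 L d = src1 L m" "iso2 L \<sigma>" "src2 L \<sigma> = s" "trg2 L \<sigma> = d \<cdot> e"
    "iso2 L \<rho>" "src2 L \<rho> = m \<cdot> d" "trg2 L \<rho> = t"
    by (auto simp: is_square_def hom_iff isos_iff filling_def)
  from a have [simp]: "s' \<in> Mor L" "src1 L s' = src1 L e" "trg1 L s' = src1 L m" "t' \<in> Mor L" "src1 L t' = trg1 L e"
    "trg1 L t' = trg1 L m" "iso2 L \<phi>'" "src2 L \<phi>' = m \<cdot> s'" "trg2 L \<phi>' = t' \<cdot> e"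
    "d' \<in> Mor L" "src1 L d' = trg1 L e" "trg1 L d' = src1 L m" "iso2 L \<sigma>'" "src2 L \<sigma>' = s'" "trg2 L \<sigma>' = d' \<cdot> e"
    "iso2 L \<rho>'" "src2 L \<rho>' = m \<cdot> d'" "trg2 L \<rho>' = t'"
    by (auto simp: is_square_def hom_iff isos_iff filling_def)
  from km have [simp]: "\<kappa> \<in> Cell L" "src2 L \<kappa> = s" "trg2 L \<kappa> = s'" "\<mu> \<in> Cell L" "src2 L \<mu> = t" "trg2 L \<mu> = t'"
    by (simp_all add: cells_iff)
  from a have phi: "\<phi> = (\<rho> \<star> id2 L e) \<bullet> (id2 L m \<star> \<sigma>)" "\<phi>' = (\<rho>' \<star> id2 L e) \<bullet> (id2 L m \<star> \<sigma>')"
    and eq: "\<phi>' \<bullet> (id2 L m \<star> \<kappa>) = (\<mu> \<star> id2 L e) \<bullet> \<phi>"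
    by (auto simp: filling_def)
  let ?l = "\<sigma>' \<bullet> \<kappa> \<bullet> inv2 L \<sigma>"
  let ?n = "inv2 L \<rho>' \<bullet> \<mu> \<bullet> \<rho>"
  have eq': "(\<rho>' \<star> id2 L e) \<bullet> (id2 L m \<star> \<sigma>') \<bullet> (id2 L m \<star> \<kappa>) = (\<mu> \<star> id2 L e) \<bullet> (\<rho> \<star> id2 L e) \<bullet> (id2 L m \<star> \<sigma>)"
    using eq unfolding phi by simp
  have ml: "(\<rho>' \<star> id2 L e) \<bullet> (id2 L m \<star> ?l) = ((\<mu> \<bullet> \<rho>) \<star> id2 L e)"
    using arg_cong[OF eq', of "\<lambda>\<gamma>. \<gamma> \<bullet> (id2 L m \<star> inv2 L \<sigma>)"] by simp
  have mln: "id2 L m \<star> ?l = ?n \<star> id2 L e"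
    using arg_cong[OF ml, of "\<lambda>\<gamma>. (inv2 L \<rho>' \<star> id2 L e) \<bullet> \<gamma>"] by simp
  \<comment> \<open>Any 2-cell whiskered with the null morphism \<open>e \<cdot> j\<close> is null.
    By \<open>mln\<close> this null 2-cell is also \<open>?l\<close> whiskered with \<open>j\<close>
    and \<open>m\<close>; reflection along \<open>m\<close> makes \<open>?l\<close> whiskered with
    \<open>j\<close> null, so \<open>?l\<close> lifts along \<open>e\<close>.\<close>
  have n: "nc (al (m \<cdot> d) x) (?n \<star> id2 L (e \<cdot> j)) (al (m \<cdot> d') x)"
    using nc_al2[of x ?n] by simp
  have aa: "nci L nc (al m (al d x)) (id2 L (m \<cdot> d \<cdot> e \<cdot> j)) (al (m \<cdot> d) x)"
    "nci L nc (al m (al d' x)) (id2 L (m \<cdot> d' \<cdot> e \<cdot> j)) (al (m \<cdot> d') x)"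
    using al_al[of x d m] al_al[of x d' m] by simp_all
  have "?n \<star> id2 L (e \<cdot> j) = (?n \<star> id2 L e) \<star> id2 L j" by simp
  also have "\<dots> = (id2 L m \<star> ?l) \<star> id2 L j" by (simp only: mln)
  also have "\<dots> = id2 L m \<star> ?l \<star> id2 L j" by simp
  finally have "nc (al m (al d x)) (id2 L m \<star> ?l \<star> id2 L j) (al m (al d' x))"
    using n nc_eqv_iff[OF aa] al_NS[of x d] al_NS[of x d'] al_NS[of "al d x" m] al_NS[of "al d' x" m] by simp
  then have "nc (al d x) (?l \<star> id2 L j) (al d' x)"
    by (elim reflects_structuresD2[OF m(2), rotated -1]) (use al_NS[of x d] al_NS[of x d'] in simp_all)
  then have "\<exists>!\<iota>. \<iota> \<in> cells L d d' \<and> \<iota> \<star> id2 L e = ?l"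
    by (intro cokernel_lift[OF e]) simp_all
  then obtain \<iota> where i: "\<iota> \<in> cells L d d'" and il: "\<iota> \<star> id2 L e = ?l"
    and u: "\<And>\<iota>'. \<iota>' \<in> cells L d d' \<Longrightarrow> \<iota>' \<star> id2 L e = ?l \<Longrightarrow> \<iota>' = \<iota>" by metis
  from i have [simp]: "\<iota> \<in> Cell L" "src2 L \<iota> = d" "trg2 L \<iota> = d'" by (simp_all add: cells_iff)
  \<comment> \<open>The second condition on \<open>\<iota>\<close> is visible only after whiskering
    with \<open>e\<close>, where it is \<open>ml\<close>; cofaithfulness of the cokernel removes
    \<open>e\<close>.\<close>
  have "(\<rho>' \<bullet> (id2 L m \<star> \<iota>)) \<star> id2 L e = (\<rho>' \<star> id2 L e) \<bullet> (id2 L m \<star> (\<iota> \<star> id2 L e))"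
    by simp
  also have "\<dots> = (\<mu> \<bullet> \<rho>) \<star> id2 L e" unfolding il by (rule ml)
  finally have r: "\<rho>' \<bullet> (id2 L m \<star> \<iota>) = \<mu> \<bullet> \<rho>"
    by (rule cokernel_faithful[OF e, rotated -1]) simp_all
  show "\<exists>!\<iota>. \<iota> \<in> cells L d d' \<and> \<rho>' \<bullet> (m \<rhd>\<^bsub>L\<^esub> \<iota>) = \<mu> \<bullet> \<rho> \<and> (\<iota> \<lhd>\<^bsub>L\<^esub> e) \<bullet> \<sigma> = \<sigma>' \<bullet> \<kappa>"
  proof (intro ex1I[of _ \<iota>] conjI)
    show "(\<iota> \<star> id2 L e) \<bullet> \<sigma> = \<sigma>' \<bullet> \<kappa>" unfolding il by simp
    fix \<iota>' assume i': "\<iota>' \<in> cells L d d' \<and> \<rho>' \<bullet> (m \<rhd>\<^bsub>L\<^esub> \<iota>') = \<mu> \<bullet> \<rho> \<and> (\<iota>' \<lhd>\<^bsub>L\<^esub> e) \<bullet> \<sigma> = \<sigma>' \<bullet> \<kappa>"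
    then have [simp]: "\<iota>' \<in> Cell L" "src2 L \<iota>' = d" "trg2 L \<iota>' = d'" and e': "(\<iota>' \<star> id2 L e) \<bullet> \<sigma> = \<sigma>' \<bullet> \<kappa>"
      by (simp_all add: cells_iff)
    have "\<iota>' \<star> id2 L e = ((\<iota>' \<star> id2 L e) \<bullet> \<sigma>) \<bullet> inv2 L \<sigma>" by simp
    also have "\<dots> = ?l" unfolding e' by simp
    finally show "\<iota>' = \<iota>" using i' u by blast
  qed (use i r in simp_all)
qed

text \<open>The square \<open>\<phi>\<close> from \<open>e\<close> to \<open>e'\<close> and the
  square \<open>\<psi>\<close> from \<open>m\<close> to \<open>m'\<close> share the side
  \<open>s\<close>. Pasted along it they give a 2-cell from \<open>e' \<cdot> m' \<cdot> u\<close>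
  to \<open>t \<cdot> e \<cdot> m\<close>, both null; requiring it to be a null isomorphism makes
  the pair a morphism between the sequences \<open>(m, e, x)\<close> and
  \<open>(m', e', x')\<close>.\<close>

definition compatible :: "'m \<Rightarrow> 'c \<Rightarrow> 'm \<Rightarrow> 'c \<Rightarrow> 'm \<Rightarrow> 'c \<Rightarrow> 'm \<Rightarrow> 'c \<Rightarrow> bool" where
  "compatible m x e' x' t \<phi> u \<psi> \<longleftrightarrow> nci L nc (ar x' u) ((\<phi> \<star> id2 L m) \<bullet> (id2 L e' \<star> \<psi>)) (al t x)"

lemma is_squareD:
  assumes "is_square L e m s t \<phi>"
  shows "e \<in> Mor L" "m \<in> Mor L" "s \<in> Mor L" "src1 L s = src1 L e" "trg1 L s = src1 L m"
    "t \<in> Mor L" "src1 L t = trg1 L e" "trg1 L t = trg1 L m" "iso2 L \<phi>" "src2 L \<phi> = m \<cdot> s" "trg2 L \<phi> = t \<cdot> e"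
  using assms by (simp_all add: is_square_def hom_iff isos_iff)

lemma is_squareI:
  assumes "e \<in> Mor L" "m \<in> Mor L" "s \<in> Mor L" "src1 L s = src1 L e" "trg1 L s = src1 L m"
    "t \<in> Mor L" "src1 L t = trg1 L e" "trg1 L t = trg1 L m" "iso2 L \<phi>" "src2 L \<phi> = m \<cdot> s" "trg2 L \<phi> = t \<cdot> e"
  shows "is_square L e m s t \<phi>"
  using assms by (simp add: is_square_def hom_iff isos_iff)

text \<open>The structure \<open>x\<close>, acted on by \<open>t\<close> and transported along
  \<open>\<phi>\<close>, is a null structure on \<open>e' \<cdot> s \<cdot> m\<close>. The
  factorization of \<open>s \<cdot> m\<close> through the kernel \<open>m'\<close> is the wanted
  square, and the condition on that factorization is compatibility.\<close>

lemma compatible_exists: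
  assumes x: "m \<in> Mor L" "trg1 L m = src1 L e" "x \<in> NS" "src2 L x = e \<cdot> m"
    and k: "kernel L NS nc ar e' m' x'" and q: "is_square L e e' s t \<phi>"
  shows "\<exists>u \<psi>. is_square L m m' u s \<psi> \<and> compatible m x e' x' t \<phi> u \<psi>"
proof -
  note [simp] = x is_squareD[OF q] kernelD[OF k]
  obtain y where y: "nci L nc (al t x) (inv2 L \<phi> \<star> id2 L m) y"
    using transport[of "al t x" "inv2 L \<phi> \<star> id2 L m"] al_NS[of x t] by auto
  then have [simp]: "y \<in> NS" "src2 L y = e' \<cdot> s \<cdot> m" using nci_bd[OF y] by simp_all
  obtain u \<gamma> where [simp]: "u \<in> Mor L" "src1 L u = src1 L m" "trg1 L u = src1 L m'"
     "iso2 L \<gamma>" "src2 L \<gamma> = s \<cdot> m" "trg2 L \<gamma> = m' \<cdot> u" and n: "nci L nc y (id2 L e' \<star> \<gamma>) (ar x' u)"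
    by (rule kernel_factor[OF k, of "s \<cdot> m" y]) simp_all
  have "compatible m x e' x' t \<phi> u (inv2 L \<gamma>)"
    using nci_vcomp[OF nci_sym[OF n] nci_sym[OF y]] by (simp add: compatible_def)
  moreover have "is_square L m m' u s (inv2 L \<gamma>)"
    by (rule is_squareI) simp_all
  ultimately show ?thesis by blast
qed

text \<open>The candidate for the image of \<open>\<iota>\<close> under \<open>m'\<close> is forced.
  After whiskering with \<open>e'\<close> it is a conjugate, by the two compatible pastings, of
  \<open>\<mu>\<close> whiskered with the null morphism \<open>e \<cdot> m\<close>, hence null, so
  it lifts.\<close>

lemma compatible_cells:
  assumes x: "m \<in> Mor L" "trg1 L m = src1 L e" "x \<in> NS" "src2 L x = e \<cdot> m"
    and k: "kernel L NS nc ar e' m' x'"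
    and q: "is_square L e e' s t \<phi>" "is_square L m m' u s \<psi>" "compatible m x e' x' t \<phi> u \<psi>"
    and q1: "is_square L e e' s1 t1 \<phi>1" "is_square L m m' u1 s1 \<psi>1" "compatible m x e' x' t1 \<phi>1 u1 \<psi>1"
    and \<kappa>: "\<kappa> \<in> cells L s s1" "\<mu> \<in> cells L t t1" "\<phi>1 \<bullet> (id2 L e' \<star> \<kappa>) = (\<mu> \<star> id2 L e) \<bullet> \<phi>"
  shows "\<exists>\<iota> \<in> cells L u u1. \<psi>1 \<bullet> (id2 L m' \<star> \<iota>) = (\<kappa> \<star> id2 L m) \<bullet> \<psi>"
proof -
  note [simp] = x is_squareD[OF q(1)] is_squareD[OF q(2)] is_squareD[OF q1(1)] is_squareD[OF q1(2)] kernelD[OF k]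
  have [simp]: "\<kappa> \<in> Cell L" "src2 L \<kappa> = s" "trg2 L \<kappa> = s1" "\<mu> \<in> Cell L" "src2 L \<mu> = t" "trg2 L \<mu> = t1"
    using \<kappa> by (simp_all add: cells_iff)
  let ?l = "inv2 L \<psi>1 \<bullet> (\<kappa> \<star> id2 L m) \<bullet> \<psi>"
  have "nc (al t x) (\<mu> \<star> id2 L (e \<cdot> m)) (al t1 x)" using nc_al2[of x \<mu>] by simp
  from nc_conj[OF nci_sym[OF q(3)[unfolded compatible_def]] nci_sym[OF q1(3)[unfolded compatible_def]] this]
  have "nc (ar x' u) ((id2 L e' \<star> inv2 L \<psi>1) \<bullet> (inv2 L \<phi>1 \<star> id2 L m) \<bullet> (\<mu> \<star> id2 L (e \<cdot> m)) \<bullet> (\<phi> \<star> id2 L m) \<bullet> (id2 L e' \<star> \<psi>)) (ar x' u1)"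
    by simp
  moreover have "(\<mu> \<star> id2 L (e \<cdot> m)) \<bullet> (\<phi> \<star> id2 L m) = (\<phi>1 \<star> id2 L m) \<bullet> (id2 L e' \<star> \<kappa> \<star> id2 L m)"
    using arg_cong[OF \<kappa>(3), of "\<lambda>\<gamma>. \<gamma> \<star> id2 L m"] by simp
  then have "(\<mu> \<star> id2 L (e \<cdot> m)) \<bullet> (\<phi> \<star> id2 L m) \<bullet> (id2 L e' \<star> \<psi>) = (\<phi>1 \<star> id2 L m) \<bullet> (id2 L e' \<star> \<kappa> \<star> id2 L m) \<bullet> (id2 L e' \<star> \<psi>)"
    by (simp flip: vassoc)
  ultimately have "nc (ar x' u) (id2 L e' \<star> ?l) (ar x' u1)" by simp
  then have "\<exists>!\<iota>. \<iota> \<in> cells L u u1 \<and> id2 L m' \<star> \<iota> = ?l"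
    by (intro kernel_lift[OF k]) simp_all
  then obtain \<iota> where i: "\<iota> \<in> cells L u u1" "id2 L m' \<star> \<iota> = ?l" by blast
  have "\<psi>1 \<bullet> ?l = (\<kappa> \<star> id2 L m) \<bullet> \<psi>" by simp
  with i show ?thesis by metis
qed

lemma compatible_id:
  assumes x: "e \<in> Mor L" "m \<in> Mor L" "trg1 L m = src1 L e" "x \<in> NS" "src2 L x = e \<cdot> m"
  shows "compatible m x e x (one L (trg1 L e)) (id2 L e) (one L (src1 L m)) (id2 L m)"
proof -
  note [simp] = x
  have "nci L nc (ar x (one L (src1 L m))) (id2 L (e \<cdot> m)) x" "nci L nc x (id2 L (e \<cdot> m)) (al (one L (trg1 L e)) x)"
    using ar_one[of x] nci_sym[OF al_one[of x]] by simp_all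
  from nci_vcomp[OF this] show ?thesis by (simp add: compatible_def)
qed

lemma compatible_comp:
  assumes x: "m \<in> Mor L" "trg1 L m = src1 L e" "x \<in> NS" "src2 L x = e \<cdot> m"
     "m' \<in> Mor L" "trg1 L m' = src1 L e'" "x' \<in> NS" "src2 L x' = e' \<cdot> m'"
     "m'' \<in> Mor L" "trg1 L m'' = src1 L e''" "x'' \<in> NS" "src2 L x'' = e'' \<cdot> m''"
    and q: "is_square L e e' s t \<phi>" "is_square L m m' u s \<psi>" "compatible m x e' x' t \<phi> u \<psi>"
    and q2: "is_square L e' e'' s2 t2 \<phi>2" "is_square L m' m'' u2 s2 \<psi>2" "compatible m' x' e'' x'' t2 \<phi>2 u2 \<psi>2"
  shows "compatible m x e'' x'' (t2 \<cdot> t) ((id2 L t2 \<star> \<phi>) \<bullet> (\<phi>2 \<star> id2 L s)) (u2 \<cdot> u) ((id2 L s2 \<star> \<psi>) \<bullet> (\<psi>2 \<star> id2 L u))"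
proof -
  note [simp] = x is_squareD[OF q(1)] is_squareD[OF q(2)] is_squareD[OF q2(1)] is_squareD[OF q2(2)]
  let ?A = "(\<phi> \<star> id2 L m) \<bullet> (id2 L e' \<star> \<psi>)" and ?B = "(\<phi>2 \<star> id2 L m') \<bullet> (id2 L e'' \<star> \<psi>2)"
  have A: "nci L nc (ar x' u) ?A (al t x)" and B: "nci L nc (ar x'' u2) ?B (al t2 x')"
    using q(3) q2(3) by (simp_all add: compatible_def)
  have [simp]: "ar x'' u2 \<in> NS" "src2 L (ar x'' u2) = e'' \<cdot> m'' \<cdot> u2" "ar x' u \<in> NS" "src2 L (ar x' u) = e' \<cdot> m' \<cdot> u"
    using ar_NS[of x'' u2] ar_NS[of x' u] by simp_all
  have 1: "nci L nc (ar x'' (u2 \<cdot> u)) (id2 L (e'' \<cdot> m'' \<cdot> u2 \<cdot> u)) (ar (ar x'' u2) u)"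
    using nci_sym[OF ar_ar[of x'' u2 u]] by simp
  have 2: "nci L nc (ar (al t2 x') u) (id2 L (t2 \<cdot> e' \<cdot> m' \<cdot> u)) (al t2 (ar x' u))"
    using al_ar[of x' t2 u] by simp
  have 3: "nci L nc (al t2 (al t x)) (id2 L (t2 \<cdot> t \<cdot> e \<cdot> m)) (al (t2 \<cdot> t) x)"
    using al_al[of x t t2] by simp
  have 4: "nci L nc (ar (ar x'' u2) u) (?B \<star> id2 L u) (ar (al t2 x') u)" by (rule nci_ar[OF B]) simp_all
  have 5: "nci L nc (al t2 (ar x' u)) (id2 L t2 \<star> ?A) (al t2 (al t x))" by (rule nci_al[OF A]) simp_all
  have "nci L nc (ar x'' (u2 \<cdot> u)) ((id2 L t2 \<star> ?A) \<bullet> (?B \<star> id2 L u)) (al (t2 \<cdot> t) x)"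
    using nci_vcomp[OF nci_vcomp[OF 1 4] nci_vcomp[OF 2 nci_vcomp[OF 5 3]]] by simp
  moreover have "(id2 L t2 \<star> ?A) \<bullet> (?B \<star> id2 L u)
    = (((id2 L t2 \<star> \<phi>) \<bullet> (\<phi>2 \<star> id2 L s)) \<star> id2 L m) \<bullet> (id2 L e'' \<star> ((id2 L s2 \<star> \<psi>) \<bullet> (\<psi>2 \<star> id2 L u)))"
  proof -
    \<comment> \<open>Both sides paste the same four squares; they differ by sliding
      \<open>\<psi>\<close> past \<open>\<phi>2\<close>.\<close>
    have "(id2 L (t2 \<cdot> e') \<star> \<psi>) \<bullet> (\<phi>2 \<star> id2 L (m' \<cdot> u)) = (\<phi>2 \<star> id2 L (s \<cdot> m)) \<bullet> (id2 L (e'' \<cdot> s2) \<star> \<psi>)"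
      using exch[of \<psi> \<phi>2] by simp
    then have "(id2 L (t2 \<cdot> e') \<star> \<psi>) \<bullet> (\<phi>2 \<star> id2 L (m' \<cdot> u)) \<bullet> (id2 L e'' \<star> \<psi>2 \<star> id2 L u)
       = (\<phi>2 \<star> id2 L (s \<cdot> m)) \<bullet> (id2 L (e'' \<cdot> s2) \<star> \<psi>) \<bullet> (id2 L e'' \<star> \<psi>2 \<star> id2 L u)"
      by (simp flip: vassoc)
    then show ?thesis by simp
  qed
  ultimately show ?thesis by (simp add: compatible_def)
qed

text \<open>Reversing 1-cells exchanges the two ends of each sequence and turns every filling
  around, so squares dualize with inverted fillings. Compatibility then concerns the inverse
  pasting, and null isomorphisms are closed under inversion.\<close>

lemma compatible_op:
  assumes "is_square L e e' s t \<phi>" "is_square L m m' u s \<psi>" "trg1 L m = src1 L e" "trg1 L m' = src1 L e'"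
  shows "is_square (op2 L) m' m s u (inv2 L \<psi>)" "is_square (op2 L) e' e t s (inv2 L \<phi>)"
    "nullity.compatible (op2 L) nc (\<lambda>b x. ar x b) (\<lambda>x a. al a x) e' x' m x u (inv2 L \<psi>) t (inv2 L \<phi>)
      \<longleftrightarrow> compatible m x e' x' t \<phi> u \<psi>"
proof -
  interpret op: nullity "op2 L" NS nc "\<lambda>b x. ar x b" "\<lambda>x a. al a x" by (rule nullity_op)
  note [simp] = is_squareD[OF assms(1)] is_squareD[OF assms(2)] assms(3,4)
  show "is_square (op2 L) m' m s u (inv2 L \<psi>)" "is_square (op2 L) e' e t s (inv2 L \<phi>)"
    by (rule op.is_squareI; simp)+
  have *: "inv2 L ((\<phi> \<star> id2 L m) \<bullet> (id2 L e' \<star> \<psi>)) = (id2 L e' \<star> inv2 L \<psi>) \<bullet> (inv2 L \<phi> \<star> id2 L m)"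
    "inv2 L ((id2 L e' \<star> inv2 L \<psi>) \<bullet> (inv2 L \<phi> \<star> id2 L m)) = (\<phi> \<star> id2 L m) \<bullet> (id2 L e' \<star> \<psi>)"
    by simp_all
  show "op.compatible e' x' m x u (inv2 L \<psi>) t (inv2 L \<phi>) \<longleftrightarrow> compatible m x e' x' t \<phi> u \<psi>"
    unfolding op.compatible_def compatible_def op2_sel op2_nci
    using nci_sym[of "al t x" "(id2 L e' \<star> inv2 L \<psi>) \<bullet> (inv2 L \<phi> \<star> id2 L m)" "ar x' u"]
      nci_sym[of "ar x' u" "(\<phi> \<star> id2 L m) \<bullet> (id2 L e' \<star> \<psi>)" "al t x"] unfolding * by blast
qed

lemma compatible_exists':
  assumes x: "e' \<in> Mor L" "trg1 L m' = src1 L e'" "x' \<in> NS" "src2 L x' = e' \<cdot> m'"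
    and c: "cokernel L NS nc al m e x" and r: "is_square L m m' u s \<psi>"
  shows "\<exists>t \<phi>. is_square L e e' s t \<phi> \<and> compatible m x e' x' t \<phi> u \<psi>"
proof -
  interpret op: nullity "op2 L" NS nc "\<lambda>b x. ar x b" "\<lambda>x a. al a x" by (rule nullity_op)
  note [simp] = x is_squareD[OF r] cokernelD[OF c]
  have "is_square (op2 L) m' m s u (inv2 L \<psi>)"
    by (rule op.is_squareI) simp_all
  then obtain t \<phi> where t: "is_square (op2 L) e' e t s \<phi>" "op.compatible e' x' m x u (inv2 L \<psi>) t \<phi>"
    using op.compatible_exists[of e' m' x' m e x s u "inv2 L \<psi>"] c by auto
  note [simp] = op.is_squareD[OF t(1), unfolded op2_sel op2_iso2]
  have sq: "is_square L e e' s t (inv2 L \<phi>)" by (rule is_squareI) simp_all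
  have "compatible m x e' x' t (inv2 L \<phi>) u \<psi>"
    using compatible_op(3)[OF sq r, of x' x] t(2) by simp
  with sq show ?thesis by blast
qed

lemma compatible_cells':
  assumes x: "e' \<in> Mor L" "trg1 L m' = src1 L e'" "x' \<in> NS" "src2 L x' = e' \<cdot> m'"
    and c: "cokernel L NS nc al m e x"
    and q: "is_square L e e' s t \<phi>" "is_square L m m' u s \<psi>" "compatible m x e' x' t \<phi> u \<psi>"
    and q1: "is_square L e e' s1 t1 \<phi>1" "is_square L m m' u1 s1 \<psi>1" "compatible m x e' x' t1 \<phi>1 u1 \<psi>1"
    and \<kappa>: "\<kappa> \<in> cells L s s1" "\<iota> \<in> cells L u u1" "\<psi>1 \<bullet> (id2 L m' \<star> \<iota>) = (\<kappa> \<star> id2 L m) \<bullet> \<psi>"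
  shows "\<exists>\<mu> \<in> cells L t t1. \<phi>1 \<bullet> (id2 L e' \<star> \<kappa>) = (\<mu> \<star> id2 L e) \<bullet> \<phi>"
proof -
  interpret op: nullity "op2 L" NS nc "\<lambda>b x. ar x b" "\<lambda>x a. al a x" by (rule nullity_op)
  note [simp] = x is_squareD[OF q(1)] is_squareD[OF q(2)] is_squareD[OF q1(1)] is_squareD[OF q1(2)] cokernelD[OF c]
  have [simp]: "\<kappa> \<in> Cell L" "src2 L \<kappa> = s" "trg2 L \<kappa> = s1" "\<iota> \<in> Cell L" "src2 L \<iota> = u" "trg2 L \<iota> = u1"
    using \<kappa> by (simp_all add: cells_iff)
  have "inv2 L \<psi>1 \<bullet> (\<kappa> \<star> id2 L m) = (id2 L m' \<star> \<iota>) \<bullet> inv2 L \<psi>"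
    using arg_cong[OF \<kappa>(3), of "\<lambda>\<gamma>. inv2 L \<psi>1 \<bullet> \<gamma> \<bullet> inv2 L \<psi>"] by simp
  then have "\<exists>\<mu> \<in> cells L t t1. inv2 L \<phi>1 \<bullet> (\<mu> \<star> id2 L e) = (id2 L e' \<star> \<kappa>) \<bullet> inv2 L \<phi>"
    using op.compatible_cells[of e' m' x' m e x s u "inv2 L \<psi>" t "inv2 L \<phi>" s1 u1 "inv2 L \<psi>1" t1 "inv2 L \<phi>1" \<kappa> \<iota>]
      compatible_op(1,2)[OF q(1,2)] compatible_op(1,2)[OF q1(1,2)]
      compatible_op(3)[OF q(1,2), of x' x] compatible_op(3)[OF q1(1,2), of x' x] c \<kappa> q(3) q1(3) by simp
  then obtain \<mu> where m: "\<mu> \<in> cells L t t1" and eq: "inv2 L \<phi>1 \<bullet> (\<mu> \<star> id2 L e) = (id2 L e' \<star> \<kappa>) \<bullet> inv2 L \<phi>" by blast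
  from m have [simp]: "\<mu> \<in> Cell L" "src2 L \<mu> = t" "trg2 L \<mu> = t1" by (simp_all add: cells_iff)
  have "\<phi>1 \<bullet> (id2 L e' \<star> \<kappa>) = (\<mu> \<star> id2 L e) \<bullet> \<phi>"
    using arg_cong[OF eq, of "\<lambda>\<gamma>. \<phi>1 \<bullet> \<gamma> \<bullet> \<phi>"] by simp
  with m show ?thesis by blast
qed

end

section \<open>Proper factorization systems\<close>

locale proper_factorization = two_category L for L :: "('o, 'm, 'c) two_cat" (structure) +
  fixes E M :: "'m set"
  assumes factorization: "factorization_system L E M" and proper: "proper_11 L E M"
begin

lemma E_Mor [simp]: "e \<in> E \<Longrightarrow> e \<in> Mor L" and M_Mor [simp]: "m \<in> M \<Longrightarrow> m \<in> Mor L"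
  using factorization by (auto simp: factorization_system_def)

lemma M_equivalence: "\<lbrakk>m \<in> M; equivalence1 L i; trg1 L i = src1 L m\<rbrakk> \<Longrightarrow> m \<cdot> i \<in> M"
  and E_equivalence: "\<lbrakk>e \<in> E; equivalence1 L i; src1 L i = trg1 L e\<rbrakk> \<Longrightarrow> i \<cdot> e \<in> E"
  using factorization by (auto simp: factorization_system_def)

lemma M_iso: "\<lbrakk>m \<in> M; iso2 L \<theta>; src2 L \<theta> = m; trg2 L \<theta> = m'\<rbrakk> \<Longrightarrow> m' \<in> M"
  and E_iso: "\<lbrakk>e \<in> E; iso2 L \<theta>; src2 L \<theta> = e; trg2 L \<theta> = e'\<rbrakk> \<Longrightarrow> e' \<in> E"
  using factorization unfolding factorization_system_def by (metis empty_iff isos_iff)+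

lemma factor:
  assumes "f \<in> Mor L"
  obtains e m \<theta> where "e \<in> E" "m \<in> M" "trg1 L e = src1 L m" "iso2 L \<theta>" "src2 L \<theta> = f" "trg2 L \<theta> = m \<cdot> e"
  using factorization assms unfolding factorization_system_def by (metis all_not_in_conv isos_iff)

lemma orthogonal_EM: "e \<in> E \<Longrightarrow> m \<in> M \<Longrightarrow> orthogonal L e m"
  using factorization by (auto simp: factorization_system_def)

lemma filler:
  assumes "e \<in> E" "m \<in> M" "s \<in> Mor L" "src1 L s = src1 L e" "trg1 L s = src1 L m"
    "t \<in> Mor L" "src1 L t = trg1 L e" "trg1 L t = trg1 L m" "iso2 L \<phi>" "src2 L \<phi> = m \<cdot> s" "trg2 L \<phi> = t \<cdot> e"
  obtains d \<sigma> \<rho> where "d \<in> Mor L" "src1 L d = trg1 L e" "trg1 L d = src1 L m"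
    "iso2 L \<sigma>" "src2 L \<sigma> = s" "trg2 L \<sigma> = d \<cdot> e" "iso2 L \<rho>" "src2 L \<rho> = m \<cdot> d" "trg2 L \<rho> = t"
    "\<phi> = (\<rho> \<star> id2 L e) \<bullet> (id2 L m \<star> \<sigma>)"
proof -
  have "is_square L e m s t \<phi>" using assms by (simp add: is_square_def hom_iff isos_iff)
  then obtain d \<sigma> \<rho> where "filling L e m s t \<phi> d \<sigma> \<rho>"
    using orthogonal_EM[OF assms(1,2), unfolded orthogonal_def, THEN conjunct1, rule_format] by force
  then show thesis by (intro that) (auto simp: filling_def hom_iff isos_iff)
qed

lemma filler_cell:
  assumes "e \<in> E" "m \<in> M" "is_square L e m s t \<phi>" "filling L e m s t \<phi> d \<sigma> \<rho>"
    "is_square L e m s' t' \<phi>'" "filling L e m s' t' \<phi>' d' \<sigma>' \<rho>'" "\<kappa> \<in> cells L s s'" "\<mu> \<in> cells L t t'"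
    "\<phi>' \<bullet> (id2 L m \<star> \<kappa>) = (\<mu> \<star> id2 L e) \<bullet> \<phi>"
  shows "\<exists>!\<iota>. \<iota> \<in> cells L d d' \<and> \<rho>' \<bullet> (id2 L m \<star> \<iota>) = \<mu> \<bullet> \<rho> \<and> (\<iota> \<star> id2 L e) \<bullet> \<sigma> = \<sigma>' \<bullet> \<kappa>"
  using orthogonal_EM[OF assms(1,2)] assms(3-9) unfolding orthogonal_def by blast

lemma M_faithful: "\<lbrakk>m \<in> M; \<alpha> \<in> Cell L; \<beta> \<in> Cell L; src2 L \<alpha> = src2 L \<beta>; trg2 L \<alpha> = trg2 L \<beta>;
    trg1 L (src2 L \<alpha>) = src1 L m; id2 L m \<star> \<alpha> = id2 L m \<star> \<beta>\<rbrakk> \<Longrightarrow> \<alpha> = \<beta>"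
proof -
  assume a: "m \<in> M" "\<alpha> \<in> Cell L" "\<beta> \<in> Cell L" "src2 L \<alpha> = src2 L \<beta>" "trg2 L \<alpha> = trg2 L \<beta>"
    "trg1 L (src2 L \<alpha>) = src1 L m" "id2 L m \<star> \<alpha> = id2 L m \<star> \<beta>"
  have "inj_on (\<lambda>\<alpha>. id2 L m \<star> \<alpha>) (cells L (src2 L \<beta>) (trg2 L \<beta>))"
    using proper a(1-6) unfolding proper_11_def faithful1_def
    by (metis hom_iff src1_trg2 src2_Mor trg1_trg2 trg2_Mor)
  then show ?thesis using a by (auto simp: inj_on_def cells_iff)
qed

lemma E_cofaithful: "\<lbrakk>e \<in> E; \<alpha> \<in> Cell L; \<beta> \<in> Cell L; src2 L \<alpha> = src2 L \<beta>; trg2 L \<alpha> = trg2 L \<beta>;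
    src1 L (src2 L \<alpha>) = trg1 L e; \<alpha> \<star> id2 L e = \<beta> \<star> id2 L e\<rbrakk> \<Longrightarrow> \<alpha> = \<beta>"
proof -
  assume a: "e \<in> E" "\<alpha> \<in> Cell L" "\<beta> \<in> Cell L" "src2 L \<alpha> = src2 L \<beta>" "trg2 L \<alpha> = trg2 L \<beta>"
    "src1 L (src2 L \<alpha>) = trg1 L e" "\<alpha> \<star> id2 L e = \<beta> \<star> id2 L e"
  have "inj_on (\<lambda>\<alpha>. \<alpha> \<star> id2 L e) (cells L (src2 L \<beta>) (trg2 L \<beta>))"
    using proper a(1-6) unfolding proper_11_def cofaithful1_def
    by (metis hom_iff src1_trg2 src2_Mor trg1_trg2 trg2_Mor)
  then show ?thesis using a by (auto simp: inj_on_def cells_iff)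
qed

lemma E_lift_iso:
  assumes "e \<in> E" "\<tau> \<in> cells L t t'" "\<tau>' \<in> cells L t' t" "src1 L t = trg1 L e" "iso2 L \<theta>" "\<tau> \<star> id2 L e = \<theta>" "\<tau>' \<star> id2 L e = inv2 L \<theta>"
  shows "iso2 L \<tau>"
proof -
  have [simp]: "\<tau> \<in> Cell L" "src2 L \<tau> = t" "trg2 L \<tau> = t'" "\<tau>' \<in> Cell L" "src2 L \<tau>' = t'" "trg2 L \<tau>' = t"
    "src1 L t = trg1 L e" "e \<in> Mor L" using assms by (simp_all add: cells_iff)
  have t [simp]: "t \<in> Mor L" "t' \<in> Mor L" using src2_Mor[of \<tau>] trg2_Mor[of \<tau>] by simp_all
  have [simp]: "src1 L t' = trg1 L e" using src1_trg2[of \<tau>] by simp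
  have th: "src2 L \<theta> = t \<cdot> e" "trg2 L \<theta> = t' \<cdot> e" using src2_hcomp[of "id2 L e" \<tau>] trg2_hcomp[of "id2 L e" \<tau>] assms(6) by simp_all
  have "(\<tau>' \<bullet> \<tau>) \<star> id2 L e = id2 L t \<star> id2 L e"
    using th assms(5) by (simp add: assms(6,7))
  then have 1: "\<tau>' \<bullet> \<tau> = id2 L t" by (rule E_cofaithful[OF assms(1), rotated -1]) simp_all
  have "(\<tau> \<bullet> \<tau>') \<star> id2 L e = id2 L t' \<star> id2 L e"
    using th assms(5) by (simp add: assms(6,7))
  then have 2: "\<tau> \<bullet> \<tau>' = id2 L t'" by (rule E_cofaithful[OF assms(1), rotated -1]) simp_all
  show ?thesis using inv2_eq[of \<tau> \<tau>'] 1 2 by simp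
qed

text \<open>Factor the identity as \<open>m \<cdot> e\<close>. The square from \<open>e\<close> to
  \<open>m\<close> with sides \<open>e\<close> and \<open>m\<close> has two fillings, the identity
  of the middle object and \<open>e \<cdot> m\<close>. Comparison 2-cells exist both ways and are
  mutually inverse because \<open>e\<close> is cofaithful, so \<open>e\<close> is an equivalence and
  \<open>m \<cdot> e\<close> belongs to \<open>M\<close>.\<close>

lemma one_M:
  assumes A: "A \<in> Obj L"
  shows "one L A \<in> M"
proof -
  obtain e m \<theta> where em: "e \<in> E" "m \<in> M" and [simp]: "trg1 L e = src1 L m" "iso2 L \<theta>" "src2 L \<theta> = one L A" "trg2 L \<theta> = m \<cdot> e"
    using factor[of "one L A"] A by auto
  note [simp] = A E_Mor[OF em(1)] M_Mor[OF em(2)]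
  have [simp]: "src1 L e = A" "trg1 L m = A"
    using src1_trg2[of \<theta>] trg1_trg2[of \<theta>] by simp_all
  have sq: "is_square L e m e m (id2 L (m \<cdot> e))" by (simp add: is_square_def hom_iff isos_iff)
  have f1: "filling L e m e m (id2 L (m \<cdot> e)) (one L (trg1 L e)) (id2 L e) (id2 L m)"
    by (simp add: filling_def hom_iff isos_iff)
  \<comment> \<open>This is \<open>\<theta>\<close> sliding past its own inverse; it shows that the
    second diagonal really fills the square with identity filling.\<close>
  have "(inv2 L \<theta> \<star> id2 L (m \<cdot> e)) \<bullet> (id2 L (m \<cdot> e) \<star> \<theta>) = id2 L (m \<cdot> e)"
  proof -
    have e1: "\<theta> \<bullet> inv2 L \<theta> = (inv2 L \<theta> \<star> id2 L (m \<cdot> e)) \<bullet> (id2 L (m \<cdot> e) \<star> \<theta>)"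
      using exch[of \<theta> "inv2 L \<theta>"] by simp
    then show ?thesis by simp
  qed
  then have f2: "filling L e m e m (id2 L (m \<cdot> e)) (e \<cdot> m) (id2 L e \<star> \<theta>) (inv2 L \<theta> \<star> id2 L m)"
    by (simp add: filling_def hom_iff isos_iff)
  have "\<exists>!\<iota>. \<iota> \<in> cells L (one L (trg1 L e)) (e \<cdot> m) \<and> (inv2 L \<theta> \<star> id2 L m) \<bullet> (id2 L m \<star> \<iota>) = id2 L m \<bullet> id2 L m
     \<and> (\<iota> \<star> id2 L e) \<bullet> id2 L e = (id2 L e \<star> \<theta>) \<bullet> id2 L e"
    by (rule filler_cell[OF em sq f1 sq f2]) (simp_all add: cells_iff)
  then obtain \<iota> where i: "\<iota> \<in> cells L (one L (trg1 L e)) (e \<cdot> m)" and "(\<iota> \<star> id2 L e) \<bullet> id2 L e = (id2 L e \<star> \<theta>) \<bullet> id2 L e"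
    by blast
  then have i2: "\<iota> \<star> id2 L e = id2 L e \<star> \<theta>" by (simp add: cells_iff)
  have "\<exists>!\<iota>. \<iota> \<in> cells L (e \<cdot> m) (one L (trg1 L e)) \<and> id2 L m \<bullet> (id2 L m \<star> \<iota>) = id2 L m \<bullet> (inv2 L \<theta> \<star> id2 L m)
     \<and> (\<iota> \<star> id2 L e) \<bullet> (id2 L e \<star> \<theta>) = id2 L e \<bullet> id2 L e"
    by (rule filler_cell[OF em sq f2 sq f1]) (simp_all add: cells_iff)
  then obtain \<iota>' where i': "\<iota>' \<in> cells L (e \<cdot> m) (one L (trg1 L e))" and "(\<iota>' \<star> id2 L e) \<bullet> (id2 L e \<star> \<theta>) = id2 L e \<bullet> id2 L e"
    by blast
  then have i'2: "(\<iota>' \<star> id2 L e) \<bullet> (id2 L e \<star> \<theta>) = id2 L e" by simp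
  have "\<iota>' \<star> id2 L e = inv2 L (id2 L e \<star> \<theta>)"
  proof -
    have "\<iota>' \<star> id2 L e = id2 L e \<bullet> inv2 L (id2 L e \<star> \<theta>)"
      by (rule iffD1[OF move_right, rotated -1], rule i'2) (use i' in \<open>simp_all add: cells_iff\<close>)
    then show ?thesis by simp
  qed
  then have "iso2 L \<iota>"
    by (intro E_lift_iso[OF em(1) i i' _ _ i2]) simp_all
  then have "equivalence1 L e"
    using i by (intro equivalence1I[of e m "inv2 L \<theta>" "inv2 L \<iota>"]) (simp_all add: cells_iff)
  then have "m \<cdot> e \<in> M" using em by (intro M_equivalence) simp_all
  then show ?thesis by (rule M_iso[of _ "inv2 L \<theta>"]) simp_all
qed

lemma equivalence_M: "equivalence1 L i \<Longrightarrow> i \<in> M"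
  using M_equivalence[OF one_M, of "trg1 L i" i] by simp

text \<open>Duality exchanges the two triangles of a filling and inverts them. The invertibility
  conjuncts on the left guard against \<open>inv2\<close> of a non-invertible 2-cell, whose value is
  arbitrary.\<close>

lemma filling_op:
  assumes "is_square L e m s t \<phi>"
  shows "filling (op2 L) m e t s (inv2 L \<phi>) d (inv2 L \<rho>) (inv2 L \<sigma>) \<and> iso2 L \<rho> \<and> iso2 L \<sigma> \<longleftrightarrow> filling L e m s t \<phi> d \<sigma> \<rho>"
proof -
  have [simp]: "e \<in> Mor L" "m \<in> Mor L" "s \<in> Mor L" "src1 L s = src1 L e" "trg1 L s = src1 L m"
    "t \<in> Mor L" "src1 L t = trg1 L e" "trg1 L t = trg1 L m" "iso2 L \<phi>" "src2 L \<phi> = m \<cdot> s" "trg2 L \<phi> = t \<cdot> e"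
    using assms by (simp_all add: is_square_def hom_iff isos_iff)
  have "inv2 L \<phi> = (id2 L m \<star> inv2 L \<sigma>) \<bullet> (inv2 L \<rho> \<star> id2 L e) \<longleftrightarrow> \<phi> = (\<rho> \<star> id2 L e) \<bullet> (id2 L m \<star> \<sigma>)"
    if "d \<in> Mor L" "src1 L d = trg1 L e" "trg1 L d = src1 L m" "iso2 L \<sigma>" "src2 L \<sigma> = s" "trg2 L \<sigma> = d \<cdot> e"
       "iso2 L \<rho>" "src2 L \<rho> = m \<cdot> d" "trg2 L \<rho> = t"
  proof
    note [simp] = that
    assume "inv2 L \<phi> = (id2 L m \<star> inv2 L \<sigma>) \<bullet> (inv2 L \<rho> \<star> id2 L e)"
    then have "inv2 L (inv2 L \<phi>) = inv2 L ((id2 L m \<star> inv2 L \<sigma>) \<bullet> (inv2 L \<rho> \<star> id2 L e))" by (rule arg_cong)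
    then show "\<phi> = (\<rho> \<star> id2 L e) \<bullet> (id2 L m \<star> \<sigma>)" by simp
  next
    note [simp] = that
    assume "\<phi> = (\<rho> \<star> id2 L e) \<bullet> (id2 L m \<star> \<sigma>)"
    then show "inv2 L \<phi> = (id2 L m \<star> inv2 L \<sigma>) \<bullet> (inv2 L \<rho> \<star> id2 L e)" by simp
  qed
  then show ?thesis
    by (auto simp: filling_def hom_iff isos_iff)
qed

lemma orthogonal_op:
  assumes "orthogonal L e m"
  shows "orthogonal (op2 L) m e"
proof -
  interpret op: two_category "op2 L" by (rule op2_two_category)
  have sq: "is_square L e m s t (inv2 L \<phi>) \<and> iso2 L \<phi>" if "is_square (op2 L) m e t s \<phi>" for s t \<phi>
    using that by (auto simp: is_square_def hom_iff isos_iff)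
  show ?thesis
    unfolding orthogonal_def
  proof (intro conjI allI ballI impI)
    fix t s \<phi>
    assume "is_square (op2 L) m e t s \<phi>"
    then have s: "is_square L e m s t (inv2 L \<phi>)" "iso2 L \<phi>" using sq by auto
    then obtain d \<sigma> \<rho> where "filling L e m s t (inv2 L \<phi>) d \<sigma> \<rho>"
      using assms[unfolded orthogonal_def, THEN conjunct1, rule_format] by force
    then show "\<exists>d \<sigma> \<rho>. filling (op2 L) m e t s \<phi> d \<sigma> \<rho>" using filling_op[OF s(1), of d \<rho> \<sigma>] s(2) by auto
  next
    fix t s \<phi> d \<sigma> \<rho> t' s' \<phi>' d' \<sigma>' \<rho>' \<mu> \<kappa>
    assume km: "\<mu> \<in> cells (op2 L) t t'" "\<kappa> \<in> cells (op2 L) s s'"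
      and a: "is_square (op2 L) m e t s \<phi> \<and> filling (op2 L) m e t s \<phi> d \<sigma> \<rho> \<and>
        is_square (op2 L) m e t' s' \<phi>' \<and> filling (op2 L) m e t' s' \<phi>' d' \<sigma>' \<rho>' \<and>
        \<phi>' \<bullet>\<^bsub>op2 L\<^esub> (e \<rhd>\<^bsub>op2 L\<^esub> \<mu>) = (\<kappa> \<lhd>\<^bsub>op2 L\<^esub> m) \<bullet>\<^bsub>op2 L\<^esub> \<phi>"
    have s: "is_square L e m s t (inv2 L \<phi>)" "iso2 L \<phi>" "is_square L e m s' t' (inv2 L \<phi>')" "iso2 L \<phi>'"
      using a sq by auto
    have [simp]: "iso2 L \<sigma>" "iso2 L \<rho>" "iso2 L \<sigma>'" "iso2 L \<rho>'" using a by (auto simp: filling_def isos_iff)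
    have f: "filling L e m s t (inv2 L \<phi>) d (inv2 L \<rho>) (inv2 L \<sigma>)" "filling L e m s' t' (inv2 L \<phi>') d' (inv2 L \<rho>') (inv2 L \<sigma>')"
      using filling_op[OF s(1), of d "inv2 L \<sigma>" "inv2 L \<rho>"] filling_op[OF s(3), of d' "inv2 L \<sigma>'" "inv2 L \<rho>'"] a s by auto
    have [simp]: "e \<in> Mor L" "m \<in> Mor L" "s \<in> Mor L" "src1 L s = src1 L e" "trg1 L s = src1 L m"
      "t \<in> Mor L" "src1 L t = trg1 L e" "trg1 L t = trg1 L m" "trg2 L \<phi> = m \<cdot> s" "src2 L \<phi> = t \<cdot> e"
      "s' \<in> Mor L" "src1 L s' = src1 L e" "trg1 L s' = src1 L m"
      "t' \<in> Mor L" "src1 L t' = trg1 L e" "trg1 L t' = trg1 L m" "trg2 L \<phi>' = m \<cdot> s'" "src2 L \<phi>' = t' \<cdot> e"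
      "d \<in> Mor L" "src1 L d = trg1 L e" "trg1 L d = src1 L m" "d' \<in> Mor L" "src1 L d' = trg1 L e" "trg1 L d' = src1 L m"
      "src2 L \<sigma> = t" "trg2 L \<sigma> = m \<cdot> d" "src2 L \<rho> = d \<cdot> e" "trg2 L \<rho> = s"
      "src2 L \<sigma>' = t'" "trg2 L \<sigma>' = m \<cdot> d'" "src2 L \<rho>' = d' \<cdot> e" "trg2 L \<rho>' = s'"
      using a by (auto simp: is_square_def filling_def hom_iff isos_iff)
    note [simp] = s(2,4)
    have [simp]: "\<kappa> \<in> Cell L" "src2 L \<kappa> = s" "trg2 L \<kappa> = s'" "\<mu> \<in> Cell L" "src2 L \<mu> = t" "trg2 L \<mu> = t'"
      using km by (simp_all add: cells_iff)
    have eq: "\<phi>' \<bullet> (\<mu> \<star> id2 L e) = (id2 L m \<star> \<kappa>) \<bullet> \<phi>" using a by simp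
    have eq': "inv2 L \<phi>' \<bullet> (id2 L m \<star> \<kappa>) = (\<mu> \<star> id2 L e) \<bullet> inv2 L \<phi>"
      using arg_cong[OF eq, of "\<lambda>\<gamma>. inv2 L \<phi>' \<bullet> \<gamma> \<bullet> inv2 L \<phi>"] by simp
    have u: "\<exists>!\<iota>. \<iota> \<in> cells L d d' \<and> inv2 L \<sigma>' \<bullet> (id2 L m \<star> \<iota>) = \<mu> \<bullet> inv2 L \<sigma> \<and> (\<iota> \<star> id2 L e) \<bullet> inv2 L \<rho> = inv2 L \<rho>' \<bullet> \<kappa>"
      using assms s f km eq' unfolding orthogonal_def op2_cells by blast
    have 1: "inv2 L \<sigma>' \<bullet> (id2 L m \<star> \<iota>) = \<mu> \<bullet> inv2 L \<sigma> \<longleftrightarrow> (id2 L m \<star> \<iota>) \<bullet> \<sigma> = \<sigma>' \<bullet> \<mu>"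
      if "\<iota> \<in> cells L d d'" for \<iota>
    proof -
      have [simp]: "\<iota> \<in> Cell L" "src2 L \<iota> = d" "trg2 L \<iota> = d'" using that by (simp_all add: cells_iff)
      have "(id2 L m \<star> \<iota>) \<bullet> \<sigma> = \<sigma>' \<bullet> \<mu>" if h: "inv2 L \<sigma>' \<bullet> (id2 L m \<star> \<iota>) = \<mu> \<bullet> inv2 L \<sigma>"
        using arg_cong[OF h, of "\<lambda>\<gamma>. \<sigma>' \<bullet> \<gamma> \<bullet> \<sigma>"] by simp
      moreover have "inv2 L \<sigma>' \<bullet> (id2 L m \<star> \<iota>) = \<mu> \<bullet> inv2 L \<sigma>" if h: "(id2 L m \<star> \<iota>) \<bullet> \<sigma> = \<sigma>' \<bullet> \<mu>"
        using arg_cong[OF h, of "\<lambda>\<gamma>. inv2 L \<sigma>' \<bullet> \<gamma> \<bullet> inv2 L \<sigma>"] by simp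
      ultimately show ?thesis by blast
    qed
    have 2: "(\<iota> \<star> id2 L e) \<bullet> inv2 L \<rho> = inv2 L \<rho>' \<bullet> \<kappa> \<longleftrightarrow> \<rho>' \<bullet> (\<iota> \<star> id2 L e) = \<kappa> \<bullet> \<rho>"
      if "\<iota> \<in> cells L d d'" for \<iota>
    proof -
      have [simp]: "\<iota> \<in> Cell L" "src2 L \<iota> = d" "trg2 L \<iota> = d'" using that by (simp_all add: cells_iff)
      have "\<rho>' \<bullet> (\<iota> \<star> id2 L e) = \<kappa> \<bullet> \<rho>" if h: "(\<iota> \<star> id2 L e) \<bullet> inv2 L \<rho> = inv2 L \<rho>' \<bullet> \<kappa>"
        using arg_cong[OF h, of "\<lambda>\<gamma>. \<rho>' \<bullet> \<gamma> \<bullet> \<rho>"] by simp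
      moreover have "(\<iota> \<star> id2 L e) \<bullet> inv2 L \<rho> = inv2 L \<rho>' \<bullet> \<kappa>" if h: "\<rho>' \<bullet> (\<iota> \<star> id2 L e) = \<kappa> \<bullet> \<rho>"
        using arg_cong[OF h, of "\<lambda>\<gamma>. inv2 L \<rho>' \<bullet> \<gamma> \<bullet> inv2 L \<rho>"] by simp
      ultimately show ?thesis by blast
    qed
    show "\<exists>!\<iota>. \<iota> \<in> cells (op2 L) d d' \<and> \<rho>' \<bullet>\<^bsub>op2 L\<^esub> (e \<rhd>\<^bsub>op2 L\<^esub> \<iota>) = \<kappa> \<bullet>\<^bsub>op2 L\<^esub> \<rho> \<and>
               (\<iota> \<lhd>\<^bsub>op2 L\<^esub> m) \<bullet>\<^bsub>op2 L\<^esub> \<sigma> = \<sigma>' \<bullet>\<^bsub>op2 L\<^esub> \<mu>"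
      unfolding op2_sel op2_cells using u 1 2 by (elim ex1E) (rule ex1I; blast)
  qed
qed

lemma proper_factorization_op: "proper_factorization (op2 L) M E"
proof -
  interpret op: two_category "op2 L" by (rule op2_two_category)
  show ?thesis
  proof
    show "factorization_system (op2 L) M E"
      unfolding factorization_system_def op2_sel op2_equivalence1 op2_isos
      using factorization orthogonal_EM orthogonal_op unfolding factorization_system_def
      by (intro conjI) (blast | metis)+
    show "proper_11 (op2 L) M E"
      using proper by (auto simp: proper_11_def faithful1_def cofaithful1_def)
  qed
qed

end

section \<open>Factorization systems with matching quotients and subobjects\<close>

definition estruct :: "('o, 'm, 'c) two_cat \<Rightarrow> 'm \<Rightarrow> 'm \<Rightarrow> 'm \<Rightarrow> 'm \<Rightarrow> 'c \<Rightarrow> bool" where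
  "estruct L c e s t \<phi> \<longleftrightarrow> t \<in> Mor L \<and> src1 L t = trg1 L c \<and> trg1 L t = trg1 L e \<and>
     iso2 L \<phi> \<and> src2 L \<phi> = e \<cdot>\<^bsub>L\<^esub> s \<and> trg2 L \<phi> = t \<cdot>\<^bsub>L\<^esub> c"

text \<open>The 2-cell points against the filling of a square of \<open>arrow2\<close>. With this
  direction the definition is exactly \<open>estruct\<close> of the dual 2-category.\<close>

definition mstruct :: "('o, 'm, 'c) two_cat \<Rightarrow> 'm \<Rightarrow> 'm \<Rightarrow> 'm \<Rightarrow> 'm \<Rightarrow> 'c \<Rightarrow> bool" where
  "mstruct L k m s u \<chi> \<longleftrightarrow> u \<in> Mor L \<and> trg1 L u = src1 L k \<and> src1 L u = src1 L m \<and>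
     iso2 L \<chi> \<and> src2 L \<chi> = s \<cdot>\<^bsub>L\<^esub> m \<and> trg2 L \<chi> = k \<cdot>\<^bsub>L\<^esub> u"

text \<open>Extension of \<open>\<kappa>\<close> to a 2-cell of squares. Only existence is recorded:
  when \<open>c\<close> is cofaithful, the second component is determined by
  \<open>\<kappa>\<close>.\<close>

definition elift :: "('o, 'm, 'c) two_cat \<Rightarrow> 'm \<Rightarrow> 'm \<Rightarrow> 'c \<Rightarrow> 'm \<Rightarrow> 'c \<Rightarrow> 'm \<Rightarrow> 'c \<Rightarrow> bool" where
  "elift L c e \<kappa> t \<phi> t' \<phi>' \<longleftrightarrow> (\<exists>\<tau> \<in> cells L t t'. \<phi>' \<bullet>\<^bsub>L\<^esub> (e \<rhd>\<^bsub>L\<^esub> \<kappa>) = (\<tau> \<lhd>\<^bsub>L\<^esub> c) \<bullet>\<^bsub>L\<^esub> \<phi>)"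

definition mlift :: "('o, 'm, 'c) two_cat \<Rightarrow> 'm \<Rightarrow> 'm \<Rightarrow> 'c \<Rightarrow> 'm \<Rightarrow> 'c \<Rightarrow> 'm \<Rightarrow> 'c \<Rightarrow> bool" where
  "mlift L k m \<kappa> u \<chi> u' \<chi>' \<longleftrightarrow> (\<exists>\<upsilon> \<in> cells L u u'. \<chi>' \<bullet>\<^bsub>L\<^esub> (\<kappa> \<lhd>\<^bsub>L\<^esub> m) = (k \<rhd>\<^bsub>L\<^esub> \<upsilon>) \<bullet>\<^bsub>L\<^esub> \<chi>)"

lemma op2_struct [simp]:
  "estruct (op2 L) = mstruct L" "mstruct (op2 L) = estruct L" "elift (op2 L) = mlift L" "mlift (op2 L) = elift L"
  by (auto simp: fun_eq_iff estruct_def mstruct_def elift_def mlift_def)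

text \<open>In this locale \<open>ker e\<close> and \<open>cok m\<close> are the images of \<open>e\<close> and \<open>m\<close> under the two pseudofunctors of the
  biequivalence. For \<open>s : trg1 m \<rightarrow> src1 e\<close>, a square from \<open>cok m\<close> to \<open>e\<close> over \<open>s\<close> corresponds to a square
  from \<open>m\<close> to \<open>ker e\<close> over \<open>s\<close>, and the 2-cells of \<open>L\<close> that lift to the one kind of square are those that
  lift to the other kind.\<close>

locale exact_system = proper_factorization +
  fixes ker cok :: "'m \<Rightarrow> 'm"
  assumes ker_M: "e \<in> E \<Longrightarrow> ker e \<in> M \<and> trg1 L (ker e) = src1 L e"
    and cok_E: "m \<in> M \<Longrightarrow> cok m \<in> E \<and> src1 L (cok m) = trg1 L m"
    and cok_ker: "e \<in> E \<Longrightarrow> \<exists>r \<theta>. equivalence1 L r \<and> src1 L r = trg1 L (cok (ker e)) \<and> trg1 L r = trg1 L e \<and>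
      iso2 L \<theta> \<and> src2 L \<theta> = e \<and> trg2 L \<theta> = r \<cdot> cok (ker e)"
    and ker_cok: "m \<in> M \<Longrightarrow> \<exists>r \<theta>. equivalence1 L r \<and> trg1 L r = src1 L (ker (cok m)) \<and> src1 L r = src1 L m \<and>
      iso2 L \<theta> \<and> src2 L \<theta> = m \<and> trg2 L \<theta> = ker (cok m) \<cdot> r"
    and to_e: "\<lbrakk>m \<in> M; e \<in> E; s \<in> Mor L; src1 L s = trg1 L m; trg1 L s = src1 L e;
        s' \<in> Mor L; src1 L s' = trg1 L m; trg1 L s' = src1 L e;
        mstruct L (ker e) m s u \<chi>; mstruct L (ker e) m s' u' \<chi>'\<rbrakk> \<Longrightarrow>
      \<exists>t \<phi> t' \<phi>'. estruct L (cok m) e s t \<phi> \<and> estruct L (cok m) e s' t' \<phi>' \<and>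
        (\<forall>\<kappa> \<in> cells L s s'. elift L (cok m) e \<kappa> t \<phi> t' \<phi>' \<longleftrightarrow> mlift L (ker e) m \<kappa> u \<chi> u' \<chi>')"
    and to_m: "\<lbrakk>m \<in> M; e \<in> E; s \<in> Mor L; src1 L s = trg1 L m; trg1 L s = src1 L e;
        s' \<in> Mor L; src1 L s' = trg1 L m; trg1 L s' = src1 L e;
        estruct L (cok m) e s t \<phi>; estruct L (cok m) e s' t' \<phi>'\<rbrakk> \<Longrightarrow>
      \<exists>u \<chi> u' \<chi>'. mstruct L (ker e) m s u \<chi> \<and> mstruct L (ker e) m s' u' \<chi>' \<and>
        (\<forall>\<kappa> \<in> cells L s s'. mlift L (ker e) m \<kappa> u \<chi> u' \<chi>' \<longleftrightarrow> elift L (cok m) e \<kappa> t \<phi> t' \<phi>')"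
begin

lemma exact_system_op: "exact_system (op2 L) M E cok ker"
proof -
  interpret op: proper_factorization "op2 L" M E by (rule proper_factorization_op)
  show ?thesis
    by unfold_locales (use ker_M cok_E cok_ker ker_cok to_e to_m in \<open>simp_all only: op2_sel op2_struct op2_equivalence1 op2_iso2 op2_cells\<close>)
qed

lemma ker_M' [simp]: "e \<in> E \<Longrightarrow> ker e \<in> M" "e \<in> E \<Longrightarrow> trg1 L (ker e) = src1 L e"
  and cok_E' [simp]: "m \<in> M \<Longrightarrow> cok m \<in> E" "m \<in> M \<Longrightarrow> src1 L (cok m) = trg1 L m"
  using ker_M cok_E by auto

lemma one_E: "A \<in> Obj L \<Longrightarrow> one L A \<in> E"
  using proper_factorization.one_M[OF proper_factorization_op] by simp

lemma one_M' [simp]: "A \<in> Obj L \<Longrightarrow> one L A \<in> M" and one_E' [simp]: "A \<in> Obj L \<Longrightarrow> one L A \<in> E"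
  by (rule one_M one_E; simp)+

lemma to_e1:
  assumes "m \<in> M" "e \<in> E" "s \<in> Mor L" "src1 L s = trg1 L m" "trg1 L s = src1 L e" "mstruct L (ker e) m s u \<chi>"
  obtains t \<phi> where "estruct L (cok m) e s t \<phi>"
  using to_e[OF assms(1-5,3-6,6)] by blast

lemma to_m1:
  assumes "m \<in> M" "e \<in> E" "s \<in> Mor L" "src1 L s = trg1 L m" "trg1 L s = src1 L e" "estruct L (cok m) e s t \<phi>"
  obtains u \<chi> where "mstruct L (ker e) m s u \<chi>"
  using to_m[OF assms(1-5,3-6,6)] by blast

text \<open>Precomposition with an equivalence is full, so no 2-cell is obstructed. Being null will
  always be detected by reducing to this case or its dual.\<close>

lemma elift_equivalence:
  assumes "equivalence1 L c" "e \<in> Mor L" "estruct L c e s t \<phi>" "estruct L c e s' t' \<phi>'" "\<kappa> \<in> cells L s s'"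
    "s \<in> Mor L" "trg1 L s = src1 L e" "s' \<in> Mor L" "trg1 L s' = src1 L e"
  shows "elift L c e \<kappa> t \<phi> t' \<phi>'"
proof -
  have [simp]: "c \<in> Mor L" "e \<in> Mor L" "s \<in> Mor L" "trg1 L s = src1 L e" "s' \<in> Mor L" "trg1 L s' = src1 L e" using assms by simp_all
  have [simp]: "t \<in> Mor L" "src1 L t = trg1 L c" "trg1 L t = trg1 L e" "iso2 L \<phi>" "src2 L \<phi> = e \<cdot> s" "trg2 L \<phi> = t \<cdot> c"
    "t' \<in> Mor L" "src1 L t' = trg1 L c" "trg1 L t' = trg1 L e" "iso2 L \<phi>'" "src2 L \<phi>' = e \<cdot> s'" "trg2 L \<phi>' = t' \<cdot> c"
    using assms by (auto simp: estruct_def)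
  have [simp]: "\<kappa> \<in> Cell L" "src2 L \<kappa> = s" "trg2 L \<kappa> = s'" using assms by (simp_all add: cells_iff)
  obtain \<tau> where t: "\<tau> \<in> Cell L" "src2 L \<tau> = t" "trg2 L \<tau> = t'" "\<tau> \<star> id2 L c = \<phi>' \<bullet> (id2 L e \<star> \<kappa>) \<bullet> inv2 L \<phi>"
    using equivalence1_cofull[OF two_category_axioms assms(1), of t t' "\<phi>' \<bullet> (id2 L e \<star> \<kappa>) \<bullet> inv2 L \<phi>"] by auto
  have "\<phi>' \<bullet> (id2 L e \<star> \<kappa>) = (\<phi>' \<bullet> (id2 L e \<star> \<kappa>) \<bullet> inv2 L \<phi>) \<bullet> \<phi>" by simp
  then show ?thesis unfolding elift_def using t by (intro bexI[of _ \<tau>]) (simp_all add: cells_iff)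
qed

lemmas mlift_equivalence = exact_system.elift_equivalence[OF exact_system_op, unfolded op2_sel op2_struct op2_equivalence1 op2_cells]

section \<open>Null objects of an exact system\<close>

lemma cok_ker_one: "B \<in> Obj L \<Longrightarrow> equivalence1 L (cok (ker (one L B)))"
proof -
  assume [simp]: "B \<in> Obj L"
  obtain r \<theta> where r: "equivalence1 L r" and [simp]: "src1 L r = trg1 L (cok (ker (one L B)))" "trg1 L r = trg1 L (one L B)"
      "iso2 L \<theta>" "src2 L \<theta> = one L B" "trg2 L \<theta> = r \<cdot> cok (ker (one L B))"
    using cok_ker[OF one_E'[OF \<open>B \<in> Obj L\<close>]] by blast
  show ?thesis by (rule equivalence1_inverse_of[OF r, of _ "inv2 L \<theta>"]) simp_all
qed

text \<open>The quotient \<open>cok (ker (one L B))\<close> belonging to this subobject is an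
  equivalence, and over an equivalence every 2-cell lifts; the correspondence of squares carries
  this back. It is the 2-dimensional part of initiality of \<open>ker (one L B)\<close> among
  subobjects.\<close>

lemma mlift_from_ker_one:
  assumes [simp]: "B \<in> Obj L" "e \<in> E" "s \<in> Mor L" "src1 L s = B" "trg1 L s = src1 L e" "s' \<in> Mor L" "src1 L s' = B" "trg1 L s' = src1 L e"
   and u: "mstruct L (ker e) (ker (one L B)) s u \<chi>" "mstruct L (ker e) (ker (one L B)) s' u' \<chi>'" and \<kappa>: "\<kappa> \<in> cells L s s'"
  shows "mlift L (ker e) (ker (one L B)) \<kappa> u \<chi> u' \<chi>'"
proof -
  have T: "ker (one L B) \<in> M" "src1 L s = trg1 L (ker (one L B))" "src1 L s' = trg1 L (ker (one L B))" by simp_all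
  obtain t \<phi> t' \<phi>' where "estruct L (cok (ker (one L B))) e s t \<phi>" "estruct L (cok (ker (one L B))) e s' t' \<phi>'"
     "elift L (cok (ker (one L B))) e \<kappa> t \<phi> t' \<phi>' \<longleftrightarrow> mlift L (ker e) (ker (one L B)) \<kappa> u \<chi> u' \<chi>'"
    using to_e[OF T(1) assms(2,3) T(2) assms(5,6) T(3) assms(8) u] \<kappa> by blast
  then show ?thesis using elift_equivalence[OF cok_ker_one, of B e s t \<phi> s' t' \<phi>' \<kappa>] \<kappa> by simp
qed

text \<open>An object is null when its initial subobject \<open>ker (one L B)\<close> is an equivalence; a section
  is enough, since \<open>ker (one L B)\<close> is initial among the subobjects of \<open>B\<close>.\<close>

lemma ker_one_section:
  assumes [simp]: "B \<in> Obj L" "d \<in> Mor L" "src1 L d = B" "trg1 L d = src1 L (ker (one L B))"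
    "iso2 L \<theta>" "src2 L \<theta> = ker (one L B) \<cdot> d" "trg2 L \<theta> = one L B"
  shows "equivalence1 L (ker (one L B))"
proof -
  let ?w = "ker (one L B)"
  have w [simp]: "?w \<in> Mor L" by simp
  have k [simp]: "?w \<in> M" by simp
  \<comment> \<open>Two factorizations of \<open>?w\<close> through itself, by the identity and by
    \<open>d \<cdot> ?w\<close>. Lifting the identity 2-cell in both directions makes them
    isomorphic, so the section \<open>d\<close> is a quasi-inverse.\<close>
  have s1: "mstruct L ?w ?w (one L B) (one L (src1 L ?w)) (id2 L ?w)" by (simp add: mstruct_def)
  have s2: "mstruct L ?w ?w (one L B) (d \<cdot> ?w) (inv2 L \<theta> \<star> id2 L ?w)" by (simp add: mstruct_def)
  have k1: "id2 L (one L B) \<in> cells L (one L B) (one L B)" by (simp add: cells_iff)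
  have "mlift L ?w ?w (id2 L (one L B)) (one L (src1 L ?w)) (id2 L ?w) (d \<cdot> ?w) (inv2 L \<theta> \<star> id2 L ?w)"
    by (rule mlift_from_ker_one[OF _ _ _ _ _ _ _ _ s1 s2 k1]) simp_all
  then obtain \<upsilon> where u: "\<upsilon> \<in> Cell L" "src2 L \<upsilon> = one L (src1 L ?w)" "trg2 L \<upsilon> = d \<cdot> ?w" and ue: "id2 L ?w \<star> \<upsilon> = inv2 L \<theta> \<star> id2 L ?w"
    by (auto simp: mlift_def cells_iff)
  have "mlift L ?w ?w (id2 L (one L B)) (d \<cdot> ?w) (inv2 L \<theta> \<star> id2 L ?w) (one L (src1 L ?w)) (id2 L ?w)"
    by (rule mlift_from_ker_one[OF _ _ _ _ _ _ _ _ s2 s1 k1]) simp_all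
  then obtain \<upsilon>' where u': "\<upsilon>' \<in> Cell L" "trg2 L \<upsilon>' = one L (src1 L ?w)" "src2 L \<upsilon>' = d \<cdot> ?w"
     and ue': "(id2 L ?w \<star> \<upsilon>') \<bullet> (inv2 L \<theta> \<star> id2 L ?w) = id2 L ?w"
    by (auto simp: mlift_def cells_iff)
  have "id2 L ?w \<star> (\<upsilon>' \<bullet> \<upsilon>) = (id2 L ?w \<star> \<upsilon>') \<bullet> (id2 L ?w \<star> \<upsilon>)" using u u' by simp
  also have "\<dots> = id2 L ?w \<star> id2 L (one L (src1 L ?w))" unfolding ue ue' by simp
  finally have 1: "\<upsilon>' \<bullet> \<upsilon> = id2 L (one L (src1 L ?w))"
    by (rule M_faithful[OF k, rotated -1]) (use u u' in simp_all)
  have "(id2 L ?w \<star> \<upsilon>') = id2 L ?w \<bullet> inv2 L (inv2 L \<theta> \<star> id2 L ?w)"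
    by (rule iffD1[OF move_right, rotated -1], rule ue') (use u' in simp_all)
  then have "id2 L ?w \<star> \<upsilon>' = \<theta> \<star> id2 L ?w" by simp
  then have "id2 L ?w \<star> (\<upsilon> \<bullet> \<upsilon>') = id2 L ?w \<star> id2 L (d \<cdot> ?w)"
    using u u' ue by simp
  then have 2: "\<upsilon> \<bullet> \<upsilon>' = id2 L (d \<cdot> ?w)"
    by (rule M_faithful[OF k, rotated -1]) (use u u' in simp_all)
  have "iso2 L \<upsilon>" using inv2_eq[of \<upsilon> \<upsilon>'] u u' 1 2 by simp
  then show ?thesis
    by (intro equivalence1I[of ?w d "inv2 L \<upsilon>" \<theta>]) (use u in simp_all)
qed

text \<open>Morphisms in \<open>E\<close> are only cofaithful in general; into a null object,
  precomposition with them is also full. A 2-cell from \<open>t \<cdot> e\<close> to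
  \<open>t' \<cdot> e\<close> is a lifting problem for squares into \<open>one L Z\<close>, and on
  the side of subobjects it is a lifting problem along the equivalence \<open>ker (one L Z)\<close>,
  which is always solvable.\<close>

lemma lift_to_null:
  assumes w: "equivalence1 L (ker (one L Z))" and [simp]: "Z \<in> Obj L" and e [simp]: "e \<in> E"
    and t [simp]: "t \<in> Mor L" "src1 L t = trg1 L e" "trg1 L t = Z" "t' \<in> Mor L" "src1 L t' = trg1 L e" "trg1 L t' = Z"
    and \<kappa> [simp]: "\<kappa> \<in> Cell L" "src2 L \<kappa> = t \<cdot> e" "trg2 L \<kappa> = t' \<cdot> e"
  shows "\<exists>\<tau> \<in> cells L t t'. \<tau> \<star> id2 L e = \<kappa>"
proof -
  \<comment> \<open>The correspondence speaks of quotients of the form \<open>cok m\<close>; a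
    general \<open>e\<close> is \<open>cok (ker e)\<close> followed by an equivalence, along which
    the lift is carried over afterwards.\<close>
  have cok: "\<exists>\<tau> \<in> cells L t t'. \<tau> \<star> id2 L (cok m) = \<kappa>"
    if m [simp]: "m \<in> M" and [simp]: "t \<in> Mor L" "src1 L t = trg1 L (cok m)" "trg1 L t = Z" "t' \<in> Mor L" "src1 L t' = trg1 L (cok m)" "trg1 L t' = Z"
     "\<kappa> \<in> Cell L" "src2 L \<kappa> = t \<cdot> cok m" "trg2 L \<kappa> = t' \<cdot> cok m" for m t t' \<kappa>
  proof -
    have s: "estruct L (cok m) (one L Z) (t \<cdot> cok m) t (id2 L (t \<cdot> cok m))" "estruct L (cok m) (one L Z) (t' \<cdot> cok m) t' (id2 L (t' \<cdot> cok m))"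
      by (simp_all add: estruct_def)
    have k: "\<kappa> \<in> cells L (t \<cdot> cok m) (t' \<cdot> cok m)" by (simp add: cells_iff)
    have T: "one L Z \<in> E" "t \<cdot> cok m \<in> Mor L" "src1 L (t \<cdot> cok m) = trg1 L m" "trg1 L (t \<cdot> cok m) = src1 L (one L Z)"
      "t' \<cdot> cok m \<in> Mor L" "src1 L (t' \<cdot> cok m) = trg1 L m" "trg1 L (t' \<cdot> cok m) = src1 L (one L Z)" by simp_all
    obtain u \<chi> u' \<chi>' where "mstruct L (ker (one L Z)) m (t \<cdot> cok m) u \<chi>" "mstruct L (ker (one L Z)) m (t' \<cdot> cok m) u' \<chi>'"
      and "mlift L (ker (one L Z)) m \<kappa> u \<chi> u' \<chi>' \<longleftrightarrow> elift L (cok m) (one L Z) \<kappa> t (id2 L (t \<cdot> cok m)) t' (id2 L (t' \<cdot> cok m))"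
      using to_m[OF m T s] k by blast
    then have "elift L (cok m) (one L Z) \<kappa> t (id2 L (t \<cdot> cok m)) t' (id2 L (t' \<cdot> cok m))"
      using mlift_equivalence[OF w, of m "t \<cdot> cok m" u \<chi> "t' \<cdot> cok m" u' \<chi>' \<kappa>] k by simp
    then show ?thesis by (auto simp: elift_def cells_iff)
  qed
  obtain r \<theta> where r: "equivalence1 L r" and [simp]: "src1 L r = trg1 L (cok (ker e))" "trg1 L r = trg1 L e"
      "iso2 L \<theta>" "src2 L \<theta> = e" "trg2 L \<theta> = r \<cdot> cok (ker e)"
    using cok_ker[OF e] by blast
  let ?c = "cok (ker e)"
  have [simp]: "r \<in> Mor L" "?c \<in> Mor L" using r by simp_all
  let ?\<kappa> = "(id2 L t' \<star> \<theta>) \<bullet> \<kappa> \<bullet> (id2 L t \<star> inv2 L \<theta>)"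
  obtain \<tau>' where t': "\<tau>' \<in> Cell L" "src2 L \<tau>' = t \<cdot> r" "trg2 L \<tau>' = t' \<cdot> r" "\<tau>' \<star> id2 L ?c = ?\<kappa>"
    using cok[of "ker e" "t \<cdot> r" "t' \<cdot> r" ?\<kappa>] by (auto simp: cells_iff)
  then obtain \<tau> where tau: "\<tau> \<in> Cell L" "src2 L \<tau> = t" "trg2 L \<tau> = t'" and tr: "\<tau> \<star> id2 L r = \<tau>'"
    using equivalence1_cofull[OF two_category_axioms r, of t t' \<tau>'] by auto
  note [simp] = tau
  have "(id2 L t' \<star> \<theta>) \<bullet> (\<tau> \<star> id2 L e) = ((\<tau> \<star> id2 L r) \<star> id2 L ?c) \<bullet> (id2 L t \<star> \<theta>)"
    using exch[of \<theta> \<tau>] by simp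
  also have "\<dots> = (id2 L t' \<star> \<theta>) \<bullet> \<kappa>" unfolding tr t'(4) by simp
  finally have "\<tau> \<star> id2 L e = \<kappa>" by (rule iffD1[OF iso2_cancel_left, rotated -1]) simp_all
  then show ?thesis by (intro bexI[of _ \<tau>]) (simp_all add: cells_iff)
qed

lemma lift_to_null_iso:
  assumes w: "equivalence1 L (ker (one L Z))" and [simp]: "Z \<in> Obj L" and e [simp]: "e \<in> E"
    and t [simp]: "t \<in> Mor L" "src1 L t = trg1 L e" "trg1 L t = Z" "t' \<in> Mor L" "src1 L t' = trg1 L e" "trg1 L t' = Z"
    and \<kappa> [simp]: "iso2 L \<kappa>" "src2 L \<kappa> = t \<cdot> e" "trg2 L \<kappa> = t' \<cdot> e"
  obtains \<tau> where "iso2 L \<tau>" "src2 L \<tau> = t" "trg2 L \<tau> = t'" "\<tau> \<star> id2 L e = \<kappa>"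
proof -
  obtain \<tau> where 1: "\<tau> \<in> cells L t t'" "\<tau> \<star> id2 L e = \<kappa>" using lift_to_null[OF w assms(2) e t, of \<kappa>] by auto
  obtain \<tau>' where 2: "\<tau>' \<in> cells L t' t" "\<tau>' \<star> id2 L e = inv2 L \<kappa>" using lift_to_null[OF w assms(2) e t(4-6) t(1-3), of "inv2 L \<kappa>"] by auto
  have "iso2 L \<tau>" by (rule E_lift_iso[OF e 1(1) 2(1) _ _ 1(2) 2(2)]) simp_all
  with 1 that show thesis by (simp add: cells_iff)
qed

text \<open>The quotient \<open>?c\<close> with identity side is a square from \<open>?c\<close> to
  \<open>one L ?Z\<close> over \<open>?c\<close>. Its counterpart factors \<open>?c\<close> through
  \<open>ker (one L ?Z)\<close>, and the diagonal of that factorization, taken as a square from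
  \<open>?c\<close> to \<open>ker (one L ?Z)\<close>, is a section.\<close>

lemma ker_one_cok_one:
  assumes A [simp]: "A \<in> Obj L"
  shows "equivalence1 L (ker (one L (trg1 L (cok (one L A)))))"
proof -
  let ?c = "cok (one L A)"
  have [simp]: "?c \<in> E" "src1 L ?c = A" by simp_all
  then have [simp]: "?c \<in> Mor L" by simp
  let ?Z = "trg1 L ?c"
  let ?w = "ker (one L ?Z)"
  have [simp]: "?w \<in> M" "trg1 L ?w = ?Z" by simp_all
  then have [simp]: "?w \<in> Mor L" by simp
  have s: "estruct L ?c (one L ?Z) ?c (one L ?Z) (id2 L ?c)" by (simp add: estruct_def)
  obtain u \<chi> where "mstruct L ?w (one L A) ?c u \<chi>"
    by (rule to_m1[OF one_M'[OF A] one_E' _ _ _ s]) simp_all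
  then have [simp]: "u \<in> Mor L" "src1 L u = A" "trg1 L u = src1 L ?w" "iso2 L \<chi>" "src2 L \<chi> = ?c" "trg2 L \<chi> = ?w \<cdot> u"
    by (simp_all add: mstruct_def)
  obtain d \<sigma> \<rho> where "d \<in> Mor L" "src1 L d = ?Z" "trg1 L d = src1 L ?w" "iso2 L \<rho>" "src2 L \<rho> = ?w \<cdot> d" "trg2 L \<rho> = one L ?Z"
    by (rule filler[of ?c ?w u "one L ?Z" "inv2 L \<chi>"]) simp_all
  then show ?thesis by (intro ker_one_section[of ?Z d \<rho>]) simp_all
qed

text \<open>Factor \<open>t\<close> as \<open>m \<cdot> e\<close>; it suffices that \<open>e\<close>
  is an equivalence. It has a retraction because \<open>Z\<close> is null, its target is again null,
  and into a null target the retraction is also a section, since 2-cells lift along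
  \<open>e\<close>.\<close>

lemma from_null_M:
  assumes w: "equivalence1 L (ker (one L Z))" and [simp]: "t \<in> Mor L" "src1 L t = Z"
  shows "t \<in> M"
proof -
  have Z [simp]: "Z \<in> Obj L" using src1_Obj[of t] by simp
  let ?w = "ker (one L Z)"
  have [simp]: "?w \<in> Mor L" "trg1 L ?w = Z" by simp_all
  obtain e m \<theta> where e [simp]: "e \<in> E" and m: "m \<in> M" and [simp]: "trg1 L e = src1 L m" "iso2 L \<theta>" "src2 L \<theta> = t" "trg2 L \<theta> = m \<cdot> e"
    using factor[of t] by auto
  have [simp]: "e \<in> Mor L" "m \<in> Mor L" using m by simp_all
  have se [simp]: "src1 L e = Z" using src1_trg2[of \<theta>] by simp
  let ?Q = "trg1 L e"
  obtain g \<eta> \<epsilon> where [simp]: "g \<in> Mor L" "src1 L g = Z" "trg1 L g = src1 L ?w" "iso2 L \<epsilon>" "src2 L \<epsilon> = ?w \<cdot> g" "trg2 L \<epsilon> = one L Z"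
    using w by (rule equivalence1D) simp
  let ?k = "ker e" and ?c = "cok (ker e)"
  have [simp]: "?k \<in> M" "?k \<in> Mor L" "trg1 L ?k = Z" "?c \<in> Mor L" "src1 L ?c = Z" by simp_all
  \<comment> \<open>Since \<open>Z\<close> is null, \<open>?k\<close> factors through
    \<open>?w\<close> over the identity of \<open>Z\<close>. The counterpart of this square is a
    retraction \<open>t0\<close> of \<open>cok (ker e)\<close>, which the equivalence
    \<open>r\<close> turns into a retraction of \<open>e\<close>.\<close>
  have s: "mstruct L ?w ?k (one L Z) (g \<cdot> ?k) (inv2 L \<epsilon> \<star> id2 L ?k)" by (simp add: mstruct_def)
  obtain t0 \<phi> where "estruct L ?c (one L Z) (one L Z) t0 \<phi>"
    by (rule to_e1[OF _ _ _ _ _ s]) simp_all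
  then have [simp]: "t0 \<in> Mor L" "src1 L t0 = trg1 L ?c" "trg1 L t0 = Z" "iso2 L \<phi>" "src2 L \<phi> = one L Z" "trg2 L \<phi> = t0 \<cdot> ?c"
    by (simp_all add: estruct_def)
  obtain r \<theta>' where r: "equivalence1 L r" and [simp]: "src1 L r = trg1 L ?c" "trg1 L r = trg1 L e"
      "iso2 L \<theta>'" "src2 L \<theta>' = e" "trg2 L \<theta>' = r \<cdot> ?c"
    using cok_ker[OF e] by blast
  have [simp]: "r \<in> Mor L" using r by simp
  obtain r' \<eta>' \<epsilon>' where [simp]: "r' \<in> Mor L" "src1 L r' = trg1 L r" "trg1 L r' = src1 L r" "iso2 L \<eta>'" "src2 L \<eta>' = r' \<cdot> r" "trg2 L \<eta>' = one L (src1 L r)"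
    using r by (rule equivalence1D) simp
  let ?r = "t0 \<cdot> r'"
  let ?o = "inv2 L \<phi> \<bullet> (id2 L t0 \<star> \<eta>' \<star> id2 L ?c) \<bullet> (id2 L ?r \<star> \<theta>')"
  have o [simp]: "iso2 L ?o" "src2 L ?o = ?r \<cdot> e" "trg2 L ?o = one L Z" by simp_all
  let ?z = "cok (one L Z)"
  have [simp]: "?z \<in> E" "?z \<in> Mor L" "src1 L ?z = Z" by simp_all
  \<comment> \<open>For null \<open>Z\<close> the identity of \<open>Z\<close> factors through
    \<open>?z\<close>, hence so does \<open>e\<close>. The counterpart factors \<open>e\<close>
    through \<open>ker (one L ?Q)\<close>, and orthogonality yields a section of it:
    \<open>?Q\<close> is null.\<close>
  have s1: "mstruct L ?w (one L Z) (one L Z) g (inv2 L \<epsilon>)" by (simp add: mstruct_def)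
  obtain t1 \<phi>1 where "estruct L ?z (one L Z) (one L Z) t1 \<phi>1"
    by (rule to_e1[OF _ _ _ _ _ s1]) simp_all
  then have [simp]: "t1 \<in> Mor L" "src1 L t1 = trg1 L ?z" "trg1 L t1 = Z" "iso2 L \<phi>1" "src2 L \<phi>1 = one L Z" "trg2 L \<phi>1 = t1 \<cdot> ?z"
    by (simp_all add: estruct_def)
  let ?wq = "ker (one L ?Q)"
  have [simp]: "?wq \<in> M" "?wq \<in> Mor L" "trg1 L ?wq = ?Q" by simp_all
  have s2: "estruct L ?z (one L ?Q) e (e \<cdot> t1) (id2 L e \<star> \<phi>1)" by (simp add: estruct_def)
  obtain u2 \<chi>2 where "mstruct L ?wq (one L Z) e u2 \<chi>2"
    by (rule to_m1[OF _ _ _ _ _ s2]) simp_all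
  then have [simp]: "u2 \<in> Mor L" "src1 L u2 = Z" "trg1 L u2 = src1 L ?wq" "iso2 L \<chi>2" "src2 L \<chi>2 = e" "trg2 L \<chi>2 = ?wq \<cdot> u2"
    by (simp_all add: mstruct_def)
  obtain d \<sigma> \<rho> where "d \<in> Mor L" "src1 L d = ?Q" "trg1 L d = src1 L ?wq" "iso2 L \<rho>" "src2 L \<rho> = ?wq \<cdot> d" "trg2 L \<rho> = one L ?Q"
    by (rule filler[of e ?wq u2 "one L ?Q" "inv2 L \<chi>2"]) simp_all
  then have wq: "equivalence1 L ?wq" by (intro ker_one_section[of ?Q d \<rho>]) simp_all
  \<comment> \<open>The 2-cell from \<open>e \<cdot> ?r \<cdot> e\<close> to \<open>e\<close> given
    by the retraction descends along \<open>e\<close> because the target of \<open>e\<close> is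
    null.\<close>
  obtain \<tau> where [simp]: "iso2 L \<tau>" "src2 L \<tau> = e \<cdot> ?r" "trg2 L \<tau> = one L ?Q"
    by (rule lift_to_null_iso[OF wq _ e, of "e \<cdot> ?r" "one L ?Q" "id2 L e \<star> ?o"]) simp_all
  have "equivalence1 L e"
    by (rule equivalence1I[of e ?r ?o \<tau>]) simp_all
  then have "m \<cdot> e \<in> M" using m by (intro M_equivalence) simp_all
  then show ?thesis by (rule M_iso[of _ "inv2 L \<theta>"]) simp_all
qed

text \<open>Hence being null is a property of a morphism: its factorization through \<open>cok (one L A)\<close> is
  essentially unique.\<close>

lemma cok_one_full_on_isos:
  assumes A [simp]: "A \<in> Obj L" and t [simp]: "t \<in> Mor L" "src1 L t = trg1 L (cok (one L A))" "t' \<in> Mor L" "src1 L t' = trg1 L (cok (one L A))"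
    and \<theta> [simp]: "iso2 L \<theta>" "src2 L \<theta> = t \<cdot> cok (one L A)" "trg2 L \<theta> = t' \<cdot> cok (one L A)"
  shows "\<exists>\<tau> \<in> cells L t t'. \<tau> \<star> id2 L (cok (one L A)) = \<theta>"
proof -
  let ?c = "cok (one L A)"
  let ?Z = "trg1 L ?c"
  have c [simp]: "?c \<in> E" "?c \<in> Mor L" "src1 L ?c = A" by simp_all
  have [simp]: "trg1 L t' = trg1 L t" using trg1_trg2[of \<theta>] by simp
  have w: "equivalence1 L (ker (one L ?Z))" by (rule ker_one_cok_one) simp
  have tM: "t \<in> M" by (rule from_null_M[OF w]) simp_all
  \<comment> \<open>Here membership of \<open>t\<close> in \<open>M\<close> pays off:
    \<open>\<theta>\<close> is a square from \<open>?c\<close> to \<open>t\<close>, and its diagonal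
    \<open>d\<close> satisfies \<open>t \<cdot> d \<cong> t'\<close>.\<close>
  obtain d \<sigma> \<rho> where [simp]: "d \<in> Mor L" "src1 L d = ?Z" "trg1 L d = ?Z"
    "iso2 L \<sigma>" "src2 L \<sigma> = ?c" "trg2 L \<sigma> = d \<cdot> ?c" "iso2 L \<rho>" "src2 L \<rho> = t \<cdot> d" "trg2 L \<rho> = t'"
    and eq: "\<theta> = (\<rho> \<star> id2 L ?c) \<bullet> (id2 L t \<star> \<sigma>)"
    by (rule filler[OF c(1) tM, of ?c t' \<theta>]) simp_all
  \<comment> \<open>The diagonal is an endomorphism of a null object with
    \<open>d \<cdot> ?c \<cong> ?c\<close>, so a comparison from the identity to \<open>d\<close>
    lifts along \<open>?c\<close>.\<close>
  obtain \<tau> where t: "\<tau> \<in> cells L (one L ?Z) d" "\<tau> \<star> id2 L ?c = \<sigma>"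
    using lift_to_null[OF w _ c(1), of "one L ?Z" d \<sigma>] by auto
  have [simp]: "\<tau> \<in> Cell L" "src2 L \<tau> = one L ?Z" "trg2 L \<tau> = d" using t by (simp_all add: cells_iff)
  have "(\<rho> \<bullet> (id2 L t \<star> \<tau>)) \<star> id2 L ?c = (\<rho> \<star> id2 L ?c) \<bullet> (id2 L t \<star> \<tau> \<star> id2 L ?c)" by simp
  then show ?thesis unfolding eq t(2) by (intro bexI[of _ "\<rho> \<bullet> (id2 L t \<star> \<tau>)"]) (simp_all add: cells_iff)
qed

end

section \<open>Null morphisms and null 2-cells of an exact system\<close>

definition isnull :: "('o, 'm, 'c) two_cat \<Rightarrow> ('m \<Rightarrow> 'm) \<Rightarrow> 'm \<Rightarrow> bool" where
  "isnull L cok f \<longleftrightarrow> f \<in> Mor L \<and> (\<exists>t \<phi>. estruct L (cok (one L (src1 L f))) (one L (trg1 L f)) f t \<phi>)"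

text \<open>With \<open>e\<close> an identity, a structure is a factorization through
  \<open>cok\<close> of the identity of the source, and lifting means coming from a 2-cell between
  the second factors. Some pair of factorizations is asked for; \<open>ncellD\<close> shows that
  every pair then works.\<close>

definition ncell :: "('o, 'm, 'c) two_cat \<Rightarrow> ('m \<Rightarrow> 'm) \<Rightarrow> 'c \<Rightarrow> bool" where
  "ncell L cok \<kappa> \<longleftrightarrow> \<kappa> \<in> Cell L \<and> (\<exists>t \<phi> t' \<phi>'.
     estruct L (cok (one L (src1 L (src2 L \<kappa>)))) (one L (trg1 L (src2 L \<kappa>))) (src2 L \<kappa>) t \<phi> \<and>
     estruct L (cok (one L (src1 L (src2 L \<kappa>)))) (one L (trg1 L (src2 L \<kappa>))) (trg2 L \<kappa>) t' \<phi>' \<and>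
     elift L (cok (one L (src1 L (src2 L \<kappa>)))) (one L (trg1 L (src2 L \<kappa>))) \<kappa> t \<phi> t' \<phi>')"

context exact_system
begin

abbreviation cc where "cc A \<equiv> cok (one L A)"

lemma isnull_Mor: "isnull L cok f \<Longrightarrow> f \<in> Mor L"
  by (simp add: isnull_def)

lemma isnullE:
  assumes "isnull L cok f"
  obtains t \<phi> where "t \<in> Mor L" "src1 L t = trg1 L (cc (src1 L f))" "trg1 L t = trg1 L f"
    "iso2 L \<phi>" "src2 L \<phi> = f" "trg2 L \<phi> = t \<cdot> cc (src1 L f)"
  using assms by (auto simp: isnull_def estruct_def)

lemma isnullI:
  assumes "iso2 L \<phi>" "src2 L \<phi> = f" "trg2 L \<phi> = t \<cdot> cc (src1 L f)" "t \<in> Mor L" "src1 L t = trg1 L (cc (src1 L f))"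
  shows "isnull L cok f"
proof -
  have [simp]: "f \<in> Mor L" using assms src2_Mor[of \<phi>] by simp
  then have "trg1 L t = trg1 L f" using assms trg1_trg2[of \<phi>] by simp
  then show ?thesis using assms by (auto simp: isnull_def estruct_def)
qed

lemma ncell_null: "ncell L cok \<kappa> \<Longrightarrow> \<kappa> \<in> Cell L \<and> isnull L cok (src2 L \<kappa>) \<and> isnull L cok (trg2 L \<kappa>)"
  by (auto simp: ncell_def isnull_def)

lemma ncellI:
  assumes \<kappa>: "\<kappa> \<in> Cell L" "src1 L (src2 L \<kappa>) = A"
    and t: "iso2 L \<phi>" "src2 L \<phi> = src2 L \<kappa>" "trg2 L \<phi> = t \<cdot> cc A" "t \<in> Mor L" "src1 L t = trg1 L (cc A)"
    and t': "iso2 L \<phi>'" "src2 L \<phi>' = trg2 L \<kappa>" "trg2 L \<phi>' = t' \<cdot> cc A" "t' \<in> Mor L" "src1 L t' = trg1 L (cc A)"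
    and \<tau>: "\<tau> \<in> cells L t t'" "\<phi>' \<bullet> \<kappa> = (\<tau> \<star> id2 L (cc A)) \<bullet> \<phi>"
  shows "ncell L cok \<kappa>"
proof -
  have [simp]: "A \<in> Obj L" using \<kappa> by auto
  have tt: "trg1 L t = trg1 L (src2 L \<kappa>)" "trg1 L t' = trg1 L (src2 L \<kappa>)"
    using trg1_trg2[of \<phi>] trg1_trg2[of \<phi>'] t t' \<kappa> by simp_all
  have "estruct L (cc A) (one L (trg1 L (src2 L \<kappa>))) (src2 L \<kappa>) t \<phi>" "estruct L (cc A) (one L (trg1 L (src2 L \<kappa>))) (trg2 L \<kappa>) t' \<phi>'"
    using \<kappa> t t' tt by (simp_all add: estruct_def)
  moreover have "elift L (cc A) (one L (trg1 L (src2 L \<kappa>))) \<kappa> t \<phi> t' \<phi>'"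
    using \<tau> \<kappa> by (auto simp: elift_def)
  ultimately show ?thesis using \<kappa> unfolding ncell_def by blast
qed

text \<open>Factorizations of one null morphism are comparable by
  \<open>cok_one_full_on_isos\<close>. Composing the lift for one pair with these comparisons gives
  the lift for any other pair.\<close>

lemma ncellD:
  assumes n: "ncell L cok \<kappa>" and A [simp]: "src1 L (src2 L \<kappa>) = A"
    and t [simp]: "iso2 L \<phi>" "src2 L \<phi> = src2 L \<kappa>" "trg2 L \<phi> = t \<cdot> cc A" "t \<in> Mor L" "src1 L t = trg1 L (cc A)"
    and t' [simp]: "iso2 L \<phi>'" "src2 L \<phi>' = trg2 L \<kappa>" "trg2 L \<phi>' = t' \<cdot> cc A" "t' \<in> Mor L" "src1 L t' = trg1 L (cc A)"
  shows "\<exists>\<tau> \<in> cells L t t'. \<phi>' \<bullet> \<kappa> = (\<tau> \<star> id2 L (cc A)) \<bullet> \<phi>"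
proof -
  let ?B = "trg1 L (src2 L \<kappa>)"
  have k [simp]: "\<kappa> \<in> Cell L" using n by (simp add: ncell_def)
  have Ao [simp]: "A \<in> Obj L" using src1_Obj[OF src2_Mor[OF k]] by simp
  obtain s \<psi> s' \<psi>' where e: "estruct L (cc A) (one L ?B) (src2 L \<kappa>) s \<psi>" "estruct L (cc A) (one L ?B) (trg2 L \<kappa>) s' \<psi>'"
    and l: "elift L (cc A) (one L ?B) \<kappa> s \<psi> s' \<psi>'" using n unfolding ncell_def by auto
  have [simp]: "s \<in> Mor L" "src1 L s = trg1 L (cc A)" "iso2 L \<psi>" "src2 L \<psi> = src2 L \<kappa>" "trg2 L \<psi> = s \<cdot> cc A"
    "s' \<in> Mor L" "src1 L s' = trg1 L (cc A)" "iso2 L \<psi>'" "src2 L \<psi>' = trg2 L \<kappa>" "trg2 L \<psi>' = s' \<cdot> cc A"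
    using e by (auto simp: estruct_def)
  obtain \<tau> where tau: "\<tau> \<in> cells L s s'" and eq: "\<psi>' \<bullet> \<kappa> = (\<tau> \<star> id2 L (cc A)) \<bullet> \<psi>"
    using l by (auto simp: elift_def)
  have [simp]: "\<tau> \<in> Cell L" "src2 L \<tau> = s" "trg2 L \<tau> = s'" using tau by (simp_all add: cells_iff)
  obtain \<alpha> where a: "\<alpha> \<in> cells L t s" "\<alpha> \<star> id2 L (cc A) = \<psi> \<bullet> inv2 L \<phi>"
    using cok_one_full_on_isos[of A t s "\<psi> \<bullet> inv2 L \<phi>"] by auto
  obtain \<beta> where b: "\<beta> \<in> cells L s' t'" "\<beta> \<star> id2 L (cc A) = \<phi>' \<bullet> inv2 L \<psi>'"
    using cok_one_full_on_isos[of A s' t' "\<phi>' \<bullet> inv2 L \<psi>'"] by auto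
  have [simp]: "\<alpha> \<in> Cell L" "src2 L \<alpha> = t" "trg2 L \<alpha> = s" "\<beta> \<in> Cell L" "src2 L \<beta> = s'" "trg2 L \<beta> = t'"
    using a b by (simp_all add: cells_iff)
  have "((\<beta> \<bullet> \<tau> \<bullet> \<alpha>) \<star> id2 L (cc A)) \<bullet> \<phi> = (\<beta> \<star> id2 L (cc A)) \<bullet> (\<tau> \<star> id2 L (cc A)) \<bullet> (\<alpha> \<star> id2 L (cc A)) \<bullet> \<phi>" by simp
  also have "\<dots> = (\<phi>' \<bullet> inv2 L \<psi>') \<bullet> ((\<tau> \<star> id2 L (cc A)) \<bullet> \<psi>)" unfolding a(2) b(2) by simp
  also have "\<dots> = \<phi>' \<bullet> \<kappa>" unfolding eq[symmetric] by simp
  finally show ?thesis by (intro bexI[of _ "\<beta> \<bullet> \<tau> \<bullet> \<alpha>"]) (simp_all add: cells_iff)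
qed

text \<open>The correspondence of squares for \<open>m\<close> the identity of the source and
  \<open>e\<close> the identity of the target equates factoring through \<open>cok\<close> and
  through \<open>ker\<close>. Nullness is therefore self-dual, and closure properties on one side
  follow from those on the other.\<close>

lemma isnull_op [simp]: "isnull (op2 L) ker = isnull L cok"
proof
  fix f
  show "isnull (op2 L) ker f = isnull L cok f"
  proof (cases "f \<in> Mor L")
    case True
    then have T: "one L (src1 L f) \<in> M" "one L (trg1 L f) \<in> E" "f \<in> Mor L" "src1 L f = trg1 L (one L (src1 L f))"
      "trg1 L f = src1 L (one L (trg1 L f))" by simp_all
    have "(\<exists>u \<chi>. mstruct L (ker (one L (trg1 L f))) (one L (src1 L f)) f u \<chi>) \<longleftrightarrow>
       (\<exists>t \<phi>. estruct L (cc (src1 L f)) (one L (trg1 L f)) f t \<phi>)"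
      using to_m[OF T T(3-5)] to_e[OF T T(3-5)] by blast
    with True show ?thesis by (simp add: isnull_def)
  qed (simp add: isnull_def)
qed

lemma ncell_op [simp]: "ncell (op2 L) ker = ncell L cok"
proof
  fix \<kappa>
  show "ncell (op2 L) ker \<kappa> = ncell L cok \<kappa>"
  proof (cases "\<kappa> \<in> Cell L")
    case [simp]: True
    let ?m = "one L (src1 L (src2 L \<kappa>))" and ?e = "one L (trg1 L (src2 L \<kappa>))"
    have T: "?m \<in> M" "?e \<in> E" "src2 L \<kappa> \<in> Mor L" "src1 L (src2 L \<kappa>) = trg1 L ?m" "trg1 L (src2 L \<kappa>) = src1 L ?e"
      "trg2 L \<kappa> \<in> Mor L" "src1 L (trg2 L \<kappa>) = trg1 L ?m" "trg1 L (trg2 L \<kappa>) = src1 L ?e" "\<kappa> \<in> cells L (src2 L \<kappa>) (trg2 L \<kappa>)"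
      by (simp_all add: cells_iff)
    have "(\<exists>u \<chi> u' \<chi>'. mstruct L (ker ?e) ?m (src2 L \<kappa>) u \<chi> \<and> mstruct L (ker ?e) ?m (trg2 L \<kappa>) u' \<chi>' \<and> mlift L (ker ?e) ?m \<kappa> u \<chi> u' \<chi>') \<longleftrightarrow>
       (\<exists>t \<phi> t' \<phi>'. estruct L (cok ?m) ?e (src2 L \<kappa>) t \<phi> \<and> estruct L (cok ?m) ?e (trg2 L \<kappa>) t' \<phi>' \<and> elift L (cok ?m) ?e \<kappa> t \<phi> t' \<phi>')"
      using to_m[OF T(1-8)] to_e[OF T(1-8)] T(9) by blast
    then show ?thesis by (simp add: ncell_def)
  qed (simp add: ncell_def)
qed

lemma isnull_iso:
  assumes "isnull L cok f" "iso2 L \<theta>" "src2 L \<theta> = f" "trg2 L \<theta> = g"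
  shows "isnull L cok g"
proof -
  obtain t \<phi> where t: "t \<in> Mor L" "src1 L t = trg1 L (cc (src1 L f))" "iso2 L \<phi>" "src2 L \<phi> = f" "trg2 L \<phi> = t \<cdot> cc (src1 L f)"
    using assms(1) by (rule isnullE)
  have "src1 L g = src1 L f" using assms src1_trg2[of \<theta>] by simp
  then show ?thesis using assms t by (intro isnullI[of "\<phi> \<bullet> inv2 L \<theta>" g t]) simp_all
qed

lemma isnull_post:
  assumes "isnull L cok f" "b \<in> Mor L" "src1 L b = trg1 L f"
  shows "isnull L cok (b \<cdot> f)"
proof -
  have [simp]: "f \<in> Mor L" "b \<in> Mor L" "src1 L b = trg1 L f" using assms isnull_Mor by auto
  obtain t \<phi> where [simp]: "t \<in> Mor L" "src1 L t = trg1 L (cc (src1 L f))" "trg1 L t = trg1 L f" "iso2 L \<phi>" "src2 L \<phi> = f" "trg2 L \<phi> = t \<cdot> cc (src1 L f)"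
    using assms(1) by (rule isnullE)
  show ?thesis by (rule isnullI[of "id2 L b \<star> \<phi>" _ "b \<cdot> t"]) simp_all
qed

text \<open>Transport the factorization of the source along \<open>\<theta>\<close> to one of the
  target; the lift is then an identity. Invertible 2-cells out of null morphisms are thus
  automatically null, unlike in a general 2-ideal.\<close>

lemma ncell_iso:
  assumes "isnull L cok f" "iso2 L \<theta>" "src2 L \<theta> = f"
  shows "ncell L cok \<theta>"
proof -
  obtain t \<phi> where t [simp]: "t \<in> Mor L" "src1 L t = trg1 L (cc (src1 L f))" "iso2 L \<phi>" "src2 L \<phi> = f" "trg2 L \<phi> = t \<cdot> cc (src1 L f)"
    using assms(1) by (rule isnullE)
  have [simp]: "f \<in> Mor L" "iso2 L \<theta>" "src2 L \<theta> = f" using assms isnull_Mor by auto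
  show ?thesis
    by (rule ncellI[of \<theta> "src1 L f" \<phi> t "\<phi> \<bullet> inv2 L \<theta>" t "id2 L t"]) (simp_all add: cells_iff)
qed

lemma ncell_id: "isnull L cok f \<Longrightarrow> ncell L cok (id2 L f)"
  using isnull_Mor[of f] by (intro ncell_iso) simp_all

lemma ncell_vcomp:
  assumes "ncell L cok \<alpha>" "ncell L cok \<beta>" and [simp]: "trg2 L \<alpha> = src2 L \<beta>"
  shows "ncell L cok (\<beta> \<bullet> \<alpha>)"
proof -
  have n: "\<alpha> \<in> Cell L" "\<beta> \<in> Cell L" "isnull L cok (src2 L \<alpha>)" "isnull L cok (src2 L \<beta>)" "isnull L cok (trg2 L \<beta>)"
    using ncell_null assms by auto
  note [simp] = n(1,2)
  have [simp]: "src1 L (src2 L \<beta>) = src1 L (src2 L \<alpha>)" using src1_trg2[of \<alpha>] by simp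
  let ?c = "cc (src1 L (src2 L \<alpha>))"
  have [simp]: "?c \<in> Mor L" "src1 L ?c = src1 L (src2 L \<alpha>)" by simp_all
  obtain t \<phi> where [simp]: "t \<in> Mor L" "src1 L t = trg1 L ?c" "iso2 L \<phi>" "src2 L \<phi> = src2 L \<alpha>" "trg2 L \<phi> = t \<cdot> ?c"
    using n(3) by (rule isnullE)
  obtain t' \<phi>' where [simp]: "t' \<in> Mor L" "src1 L t' = trg1 L ?c" "iso2 L \<phi>'" "src2 L \<phi>' = src2 L \<beta>" "trg2 L \<phi>' = t' \<cdot> ?c"
    using n(4) by (rule isnullE) simp
  obtain t'' \<phi>'' where [simp]: "t'' \<in> Mor L" "src1 L t'' = trg1 L ?c" "iso2 L \<phi>''" "src2 L \<phi>'' = trg2 L \<beta>" "trg2 L \<phi>'' = t'' \<cdot> ?c"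
    using n(5) by (rule isnullE) simp
  obtain \<tau> where t: "\<tau> \<in> cells L t t'" "\<phi>' \<bullet> \<alpha> = (\<tau> \<star> id2 L ?c) \<bullet> \<phi>"
    using ncellD[OF assms(1) refl, of \<phi> t \<phi>' t'] by auto
  obtain \<tau>' where t': "\<tau>' \<in> cells L t' t''" "\<phi>'' \<bullet> \<beta> = (\<tau>' \<star> id2 L ?c) \<bullet> \<phi>'"
    using ncellD[OF assms(2) refl, of \<phi>' t' \<phi>'' t''] by auto
  have [simp]: "\<tau> \<in> Cell L" "src2 L \<tau> = t" "trg2 L \<tau> = t'" "\<tau>' \<in> Cell L" "src2 L \<tau>' = t'" "trg2 L \<tau>' = t''"
    using t t' by (simp_all add: cells_iff)
  have "\<phi>'' \<bullet> \<beta> \<bullet> \<alpha> = (\<phi>'' \<bullet> \<beta>) \<bullet> \<alpha>" by simp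
  also have "\<dots> = (\<tau>' \<star> id2 L ?c) \<bullet> (\<phi>' \<bullet> \<alpha>)" unfolding t'(2) by simp
  also have "\<dots> = ((\<tau>' \<bullet> \<tau>) \<star> id2 L ?c) \<bullet> \<phi>" unfolding t(2) by simp
  finally have eq: "\<phi>'' \<bullet> \<beta> \<bullet> \<alpha> = ((\<tau>' \<bullet> \<tau>) \<star> id2 L ?c) \<bullet> \<phi>" .
  show ?thesis
    by (rule ncellI[of _ "src1 L (src2 L \<alpha>)" \<phi> t \<phi>'' t'' "\<tau>' \<bullet> \<tau>", OF _ _ _ _ _ _ _ _ _ _ _ _ _ eq]) (simp_all add: cells_iff)
qed

lemma ncell_post:
  assumes "ncell L cok \<alpha>" and [simp]: "b \<in> Mor L" "src1 L b = trg1 L (src2 L \<alpha>)"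
  shows "ncell L cok (id2 L b \<star> \<alpha>)"
proof -
  have n: "\<alpha> \<in> Cell L" "isnull L cok (src2 L \<alpha>)" "isnull L cok (trg2 L \<alpha>)"
    using ncell_null assms by auto
  note [simp] = n(1)
  let ?c = "cc (src1 L (src2 L \<alpha>))"
  have [simp]: "?c \<in> Mor L" "src1 L ?c = src1 L (src2 L \<alpha>)" by simp_all
  obtain t \<phi> where [simp]: "t \<in> Mor L" "src1 L t = trg1 L ?c" "trg1 L t = trg1 L (src2 L \<alpha>)" "iso2 L \<phi>" "src2 L \<phi> = src2 L \<alpha>" "trg2 L \<phi> = t \<cdot> ?c"
    using n(2) by (rule isnullE)
  obtain t' \<phi>' where [simp]: "t' \<in> Mor L" "src1 L t' = trg1 L ?c" "trg1 L t' = trg1 L (src2 L \<alpha>)" "iso2 L \<phi>'" "src2 L \<phi>' = trg2 L \<alpha>" "trg2 L \<phi>' = t' \<cdot> ?c"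
    using n(3) by (rule isnullE) simp
  obtain \<tau> where t: "\<tau> \<in> cells L t t'" "\<phi>' \<bullet> \<alpha> = (\<tau> \<star> id2 L ?c) \<bullet> \<phi>"
    using ncellD[OF assms(1) refl, of \<phi> t \<phi>' t'] by auto
  have [simp]: "\<tau> \<in> Cell L" "src2 L \<tau> = t" "trg2 L \<tau> = t'" using t by (simp_all add: cells_iff)
  have eq: "(id2 L b \<star> \<phi>') \<bullet> (id2 L b \<star> \<alpha>) = ((id2 L b \<star> \<tau>) \<star> id2 L ?c) \<bullet> (id2 L b \<star> \<phi>)"
    using arg_cong[OF t(2), of "\<lambda>\<gamma>. id2 L b \<star> \<gamma>"] by simp
  show ?thesis
    by (rule ncellI[of _ "src1 L (src2 L \<alpha>)" "id2 L b \<star> \<phi>" "b \<cdot> t" "id2 L b \<star> \<phi>'" "b \<cdot> t'" "id2 L b \<star> \<tau>", OF _ _ _ _ _ _ _ _ _ _ _ _ _ eq])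
      (simp_all add: cells_iff)
qed

lemmas ncell_pre = exact_system.ncell_post[OF exact_system_op, unfolded op2_sel ncell_op]

text \<open>With \<open>f\<close> factored as \<open>t\<close> after the quotient, the lift is
  \<open>\<beta>\<close> whiskered with \<open>t\<close>.\<close>

lemma ncell_whisker_right:
  assumes n: "isnull L cok f" and [simp]: "\<beta> \<in> Cell L" "src1 L (src2 L \<beta>) = trg1 L f"
  shows "ncell L cok (\<beta> \<star> id2 L f)"
proof -
  let ?c = "cc (src1 L f)"
  have [simp]: "f \<in> Mor L" using n isnull_Mor by auto
  have [simp]: "?c \<in> Mor L" "src1 L ?c = src1 L f" by simp_all
  obtain t \<phi> where [simp]: "t \<in> Mor L" "src1 L t = trg1 L ?c" "trg1 L t = trg1 L f" "iso2 L \<phi>" "src2 L \<phi> = f" "trg2 L \<phi> = t \<cdot> ?c"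
    using n by (rule isnullE)
  have eq: "(id2 L (trg2 L \<beta>) \<star> \<phi>) \<bullet> (\<beta> \<star> id2 L f) = ((\<beta> \<star> id2 L t) \<star> id2 L ?c) \<bullet> (id2 L (src2 L \<beta>) \<star> \<phi>)"
    using exch[of \<phi> \<beta>] by simp
  show ?thesis
    by (rule ncellI[of _ "src1 L f" "id2 L (src2 L \<beta>) \<star> \<phi>" "src2 L \<beta> \<cdot> t" "id2 L (trg2 L \<beta>) \<star> \<phi>" "trg2 L \<beta> \<cdot> t" "\<beta> \<star> id2 L t", OF _ _ _ _ _ _ _ _ _ _ _ _ _ eq])
      (simp_all add: cells_iff)
qed

lemmas ncell_whisker_left = exact_system.ncell_whisker_right[OF exact_system_op, unfolded op2_sel ncell_op isnull_op]

text \<open>A factorization of \<open>m \<cdot> s\<close> through \<open>?c\<close> is a square from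
  \<open>?c\<close> to \<open>m\<close>, and its diagonal is a factorization of
  \<open>s\<close>.\<close>

lemma M_reflects_null:
  assumes m: "m \<in> M" and n: "isnull L cok (m \<cdot> s)" and [simp]: "s \<in> Mor L" "trg1 L s = src1 L m"
  shows "isnull L cok s"
proof -
  note [simp] = M_Mor[OF m]
  let ?c = "cc (src1 L s)"
  have [simp]: "?c \<in> E" "src1 L ?c = src1 L s" by simp_all
  then have [simp]: "?c \<in> Mor L" by simp
  obtain t \<phi> where [simp]: "t \<in> Mor L" "src1 L t = trg1 L ?c" "trg1 L t = trg1 L m" "iso2 L \<phi>" "src2 L \<phi> = m \<cdot> s" "trg2 L \<phi> = t \<cdot> ?c"
    using n by (elim isnullE) simp
  obtain d \<sigma> \<rho> where "d \<in> Mor L" "src1 L d = trg1 L ?c" "trg1 L d = src1 L m" "iso2 L \<sigma>" "src2 L \<sigma> = s" "trg2 L \<sigma> = d \<cdot> ?c"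
    by (rule filler[of ?c m s t \<phi>]) (simp_all add: m)
  then show ?thesis by (intro isnullI[of \<sigma> s d]) simp_all
qed

lemma M_reflects_ncell:
  assumes m: "m \<in> M" and n: "isnull L cok (src2 L \<mu>)" "isnull L cok (trg2 L \<mu>)" "ncell L cok (id2 L m \<star> \<mu>)"
    and [simp]: "\<mu> \<in> Cell L" "trg1 L (src2 L \<mu>) = src1 L m"
  shows "ncell L cok \<mu>"
proof -
  note [simp] = M_Mor[OF m]
  let ?c = "cc (src1 L (src2 L \<mu>))"
  have c [simp]: "?c \<in> E" "src1 L ?c = src1 L (src2 L \<mu>)" by simp_all
  then have [simp]: "?c \<in> Mor L" by simp
  obtain t \<phi> where [simp]: "t \<in> Mor L" "src1 L t = trg1 L ?c" "trg1 L t = src1 L m" "iso2 L \<phi>" "src2 L \<phi> = src2 L \<mu>" "trg2 L \<phi> = t \<cdot> ?c"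
    using n(1) by (elim isnullE) simp
  obtain t' \<phi>' where [simp]: "t' \<in> Mor L" "src1 L t' = trg1 L ?c" "trg1 L t' = src1 L m" "iso2 L \<phi>'" "src2 L \<phi>' = trg2 L \<mu>" "trg2 L \<phi>' = t' \<cdot> ?c"
    using n(2) by (elim isnullE) simp
  obtain \<tau> where t: "\<tau> \<in> cells L (m \<cdot> t) (m \<cdot> t')" and eq: "(id2 L m \<star> \<phi>') \<bullet> (id2 L m \<star> \<mu>) = (\<tau> \<star> id2 L ?c) \<bullet> (id2 L m \<star> \<phi>)"
    using ncellD[OF n(3), of "src1 L (src2 L \<mu>)" "id2 L m \<star> \<phi>" "m \<cdot> t" "id2 L m \<star> \<phi>'" "m \<cdot> t'"] by auto
  have [simp]: "\<tau> \<in> Cell L" "src2 L \<tau> = m \<cdot> t" "trg2 L \<tau> = m \<cdot> t'" using t by (simp_all add: cells_iff)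
  \<comment> \<open>The factorizations \<open>t\<close> and \<open>t'\<close> are themselves
    diagonals of squares with lower sides \<open>m \<cdot> t\<close> and
    \<open>m \<cdot> t'\<close>, so the 2-dimensional part of orthogonality turns
    \<open>\<tau>\<close> into a lift between them.\<close>
  have sq: "is_square L ?c m (src2 L \<mu>) (m \<cdot> t) (id2 L m \<star> \<phi>)" "is_square L ?c m (trg2 L \<mu>) (m \<cdot> t') (id2 L m \<star> \<phi>')"
    by (simp_all add: is_square_def hom_iff isos_iff)
  have fl: "filling L ?c m (src2 L \<mu>) (m \<cdot> t) (id2 L m \<star> \<phi>) t \<phi> (id2 L (m \<cdot> t))"
    "filling L ?c m (trg2 L \<mu>) (m \<cdot> t') (id2 L m \<star> \<phi>') t' \<phi>' (id2 L (m \<cdot> t'))"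
    by (simp_all add: filling_def hom_iff isos_iff)
  have "\<exists>!\<iota>. \<iota> \<in> cells L t t' \<and> id2 L (m \<cdot> t') \<bullet> (id2 L m \<star> \<iota>) = \<tau> \<bullet> id2 L (m \<cdot> t) \<and> (\<iota> \<star> id2 L ?c) \<bullet> \<phi> = \<phi>' \<bullet> \<mu>"
    by (rule filler_cell[OF c(1) m sq(1) fl(1) sq(2) fl(2) _ t eq]) (simp add: cells_iff)
  then obtain \<iota> where i: "\<iota> \<in> cells L t t'" "(\<iota> \<star> id2 L ?c) \<bullet> \<phi> = \<phi>' \<bullet> \<mu>" by blast
  show ?thesis
    by (rule ncellI[OF _ _ _ _ _ _ _ _ _ _ _ _ i(1) i(2)[symmetric]]) simp_all
qed

end

section \<open>Kernels and cokernels for the null structures of an exact system\<close>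

locale exact_nullity = exact_system L E M ker cok + nullity L NS nc al ar
  for L :: "('o, 'm, 'c) two_cat" (structure) and E M ker cok NS nc al ar +
  assumes NS_iff: "x \<in> NS \<longleftrightarrow> iso2 L x \<and> isnull L cok (src2 L x)"
    and nc_iff: "nc x \<kappa> y \<longleftrightarrow> x \<in> NS \<and> y \<in> NS \<and> \<kappa> \<in> Cell L \<and> src2 L \<kappa> = src2 L x \<and> trg2 L \<kappa> = src2 L y \<and> ncell L cok \<kappa>"
begin

lemma exact_nullity_op: "exact_nullity (op2 L) M E cok ker NS nc (\<lambda>b x. ar x b) (\<lambda>x a. al a x)"
proof -
  interpret op: exact_system "op2 L" M E cok ker by (rule exact_system_op)
  interpret op2: nullity "op2 L" NS nc "\<lambda>b x. ar x b" "\<lambda>x a. al a x" by (rule nullity_op)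
  show ?thesis by unfold_locales (simp_all add: NS_iff nc_iff)
qed

text \<open>Invertible 2-cells between null morphisms are null, so the condition on the first
  universal property of a kernel holds automatically. What remains is \<open>kernel_iff\<close>, in
  which a structure enters only through the morphism that carries it.\<close>

lemma nci_iff: "nci L nc x \<theta> y \<longleftrightarrow> iso2 L \<theta> \<and> x \<in> NS \<and> y \<in> NS \<and> src2 L \<theta> = src2 L x \<and> trg2 L \<theta> = src2 L y"
  using ncell_iso[of "src2 L x" \<theta>] ncell_iso[of "src2 L y" "inv2 L \<theta>"] by (auto simp: nci_def nc_iff NS_iff)

lemma reflects_structures_M: "m \<in> M \<Longrightarrow> reflects_structures L NS nc al m"
  unfolding reflects_structures_def
proof (intro conjI allI impI)
  fix s x assume m: "m \<in> M" and a: "s \<in> Mor L \<and> trg1 L s = src1 L m \<and> x \<in> NS \<and> src2 L x = m \<cdot> s"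
  then have "isnull L cok (m \<cdot> s)" by (metis NS_iff)
  then have "isnull L cok s" using a by (rule_tac M_reflects_null[OF m]) simp_all
  then have "id2 L s \<in> NS" using a by (simp add: NS_iff)
  then show "\<exists>y\<in>NS. src2 L y = s \<and> nci L nc x (id2 L (m \<cdot> s)) (al m y)"
    using a m al_NS[of "id2 L s" m] by (intro bexI[of _ "id2 L s"]) (simp_all add: nci_iff)
next
  fix x y \<alpha> assume m: "m \<in> M" and a: "x \<in> NS \<and> y \<in> NS \<and> \<alpha> \<in> Cell L \<and> src2 L \<alpha> = src2 L x \<and> trg2 L \<alpha> = src2 L y \<and>
        trg1 L (src2 L x) = src1 L m \<and> nc (al m x) (m \<rhd>\<^bsub>L\<^esub> \<alpha>) (al m y)"
  then have "ncell L cok \<alpha>" by (rule_tac M_reflects_ncell[OF m]) (simp_all add: nc_iff NS_iff)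
  then show "nc x \<alpha> y" using a by (simp add: nc_iff)
qed

lemma kernel_iff:
  "kernel L NS nc ar f k x \<longleftrightarrow> f \<in> Mor L \<and> k \<in> Mor L \<and> trg1 L k = src1 L f \<and> x \<in> NS \<and> src2 L x = f \<cdot> k \<and>
     (\<forall>z. z \<in> Mor L \<and> trg1 L z = src1 L f \<and> isnull L cok (f \<cdot> z) \<longrightarrow>
        (\<exists>u \<gamma>. u \<in> Mor L \<and> src1 L u = src1 L z \<and> trg1 L u = src1 L k \<and> iso2 L \<gamma> \<and> src2 L \<gamma> = z \<and> trg2 L \<gamma> = k \<cdot> u)) \<and>
     (\<forall>u v \<kappa>. u \<in> Mor L \<and> v \<in> Mor L \<and> trg1 L u = src1 L k \<and> trg1 L v = src1 L k \<and> src1 L u = src1 L v \<and>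
        \<kappa> \<in> Cell L \<and> src2 L \<kappa> = k \<cdot> u \<and> trg2 L \<kappa> = k \<cdot> v \<and> ncell L cok (id2 L f \<star> \<kappa>) \<longrightarrow>
        (\<exists>!\<mu>. \<mu> \<in> cells L u v \<and> id2 L k \<star> \<mu> = \<kappa>))" (is "?K \<longleftrightarrow> ?R")
proof (cases "f \<in> Mor L \<and> k \<in> Mor L \<and> trg1 L k = src1 L f \<and> x \<in> NS \<and> src2 L x = f \<cdot> k")
  case True
  then have [simp]: "f \<in> Mor L" "k \<in> Mor L" "trg1 L k = src1 L f" "x \<in> NS" "src2 L x = f \<cdot> k" by auto
  have ar [simp]: "ar x u \<in> NS" "src2 L (ar x u) = f \<cdot> k \<cdot> u" if "u \<in> Mor L" "trg1 L u = src1 L k" for u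
    using ar_NS[of x u] that by simp_all
  have 1: "(\<forall>z y. z \<in> Mor L \<and> trg1 L z = src1 L f \<and> y \<in> NS \<and> src2 L y = f \<cdot> z \<longrightarrow>
        (\<exists>u \<gamma>. u \<in> Mor L \<and> src1 L u = src1 L z \<and> trg1 L u = src1 L k \<and>
          iso2 L \<gamma> \<and> src2 L \<gamma> = z \<and> trg2 L \<gamma> = k \<cdot> u \<and> nci L nc y (id2 L f \<star> \<gamma>) (ar x u))) \<longleftrightarrow>
     (\<forall>z. z \<in> Mor L \<and> trg1 L z = src1 L f \<and> isnull L cok (f \<cdot> z) \<longrightarrow>
        (\<exists>u \<gamma>. u \<in> Mor L \<and> src1 L u = src1 L z \<and> trg1 L u = src1 L k \<and> iso2 L \<gamma> \<and> src2 L \<gamma> = z \<and> trg2 L \<gamma> = k \<cdot> u))" (is "?A \<longleftrightarrow> ?B")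
  proof
    assume A: ?A
    show ?B
    proof (intro allI impI)
      fix z assume z: "z \<in> Mor L \<and> trg1 L z = src1 L f \<and> isnull L cok (f \<cdot> z)"
      then have "id2 L (f \<cdot> z) \<in> NS \<and> src2 L (id2 L (f \<cdot> z)) = f \<cdot> z" by (simp add: NS_iff)
      with A z show "\<exists>u \<gamma>. u \<in> Mor L \<and> src1 L u = src1 L z \<and> trg1 L u = src1 L k \<and> iso2 L \<gamma> \<and> src2 L \<gamma> = z \<and> trg2 L \<gamma> = k \<cdot> u"
        by blast
    qed
  next
    assume B: ?B
    show ?A
    proof (intro allI impI)
      fix z y assume z: "z \<in> Mor L \<and> trg1 L z = src1 L f \<and> y \<in> NS \<and> src2 L y = f \<cdot> z"
      then have "isnull L cok (f \<cdot> z)" by (metis NS_iff)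
      with B z obtain u \<gamma> where u: "u \<in> Mor L" "src1 L u = src1 L z" "trg1 L u = src1 L k" "iso2 L \<gamma>" "src2 L \<gamma> = z" "trg2 L \<gamma> = k \<cdot> u"
        by blast
      then have "nci L nc y (id2 L f \<star> \<gamma>) (ar x u)" using z by (simp add: nci_iff)
      with u show "\<exists>u \<gamma>. u \<in> Mor L \<and> src1 L u = src1 L z \<and> trg1 L u = src1 L k \<and>
          iso2 L \<gamma> \<and> src2 L \<gamma> = z \<and> trg2 L \<gamma> = k \<cdot> u \<and> nci L nc y (id2 L f \<star> \<gamma>) (ar x u)" by blast
    qed
  qed
  have 2: "(u \<in> Mor L \<and> v \<in> Mor L \<and> trg1 L u = src1 L k \<and> trg1 L v = src1 L k \<and> src1 L u = src1 L v \<and>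
        \<kappa> \<in> Cell L \<and> src2 L \<kappa> = k \<cdot> u \<and> trg2 L \<kappa> = k \<cdot> v \<and> nc (ar x u) (id2 L f \<star> \<kappa>) (ar x v)) \<longleftrightarrow>
     (u \<in> Mor L \<and> v \<in> Mor L \<and> trg1 L u = src1 L k \<and> trg1 L v = src1 L k \<and> src1 L u = src1 L v \<and>
        \<kappa> \<in> Cell L \<and> src2 L \<kappa> = k \<cdot> u \<and> trg2 L \<kappa> = k \<cdot> v \<and> ncell L cok (id2 L f \<star> \<kappa>))" for u v \<kappa>
    by (auto simp: nc_iff)
  show ?thesis unfolding kernel_def 1 2 ..
qed (auto simp: kernel_def)

text \<open>The identity of the domain of \<open>?k\<close> is a factorization of \<open>?k\<close>
  through itself, that is, a square from an identity to \<open>?k\<close>. Its counterpart factors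
  \<open>e \<cdot> ?k\<close> through \<open>cok\<close> of that identity.\<close>

lemma ker_null: "e \<in> E \<Longrightarrow> isnull L cok (e \<cdot> ker e)"
proof -
  assume e [simp]: "e \<in> E"
  let ?k = "ker e"
  have k [simp]: "?k \<in> Mor L" by simp
  have s: "mstruct L ?k (one L (src1 L ?k)) ?k (one L (src1 L ?k)) (id2 L ?k)" by (simp add: mstruct_def)
  obtain t \<phi> where "estruct L (cc (src1 L ?k)) e ?k t \<phi>"
    by (rule to_e1[OF _ e k _ _ s]) simp_all
  then show ?thesis by (intro isnullI[of \<phi> _ t]) (simp_all add: estruct_def)
qed

text \<open>The correspondence of squares with \<open>m\<close> the identity of the test object is
  the universal property: factorizations of \<open>e \<cdot> z\<close> through \<open>cok\<close>
  match factorizations of \<open>z\<close> through \<open>ker e\<close>, and a 2-cell that is null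
  after \<open>e\<close> is one that lifts. Uniqueness is faithfulness of \<open>M\<close>.\<close>

lemma kernel_ker:
  assumes e [simp]: "e \<in> E" and x: "x \<in> NS" "src2 L x = e \<cdot> ker e"
  shows "kernel L NS nc ar e (ker e) x"
  unfolding kernel_iff
proof (intro conjI allI impI)
  let ?k = "ker e"
  have k [simp]: "?k \<in> Mor L" "?k \<in> M" by simp_all
  fix z assume z: "z \<in> Mor L \<and> trg1 L z = src1 L e \<and> isnull L cok (e \<cdot> z)"
  then obtain t \<phi> where "t \<in> Mor L" "src1 L t = trg1 L (cc (src1 L z))" "trg1 L t = trg1 L e" "iso2 L \<phi>" "src2 L \<phi> = e \<cdot> z" "trg2 L \<phi> = t \<cdot> cc (src1 L z)"
    by (elim conjE isnullE) simp
  then have s: "estruct L (cc (src1 L z)) e z t \<phi>" by (simp add: estruct_def)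
  obtain u \<chi> where "mstruct L ?k (one L (src1 L z)) z u \<chi>"
    by (rule to_m1[OF _ e _ _ _ s]) (use z in simp_all)
  then show "\<exists>u \<gamma>. u \<in> Mor L \<and> src1 L u = src1 L z \<and> trg1 L u = src1 L ?k \<and> iso2 L \<gamma> \<and> src2 L \<gamma> = z \<and> trg2 L \<gamma> = ?k \<cdot> u"
    using z by (intro exI[of _ u] exI[of _ \<chi>]) (simp add: mstruct_def)
next
  let ?k = "ker e"
  have k [simp]: "?k \<in> Mor L" "?k \<in> M" by simp_all
  fix u v \<kappa>
  assume a: "u \<in> Mor L \<and> v \<in> Mor L \<and> trg1 L u = src1 L ?k \<and> trg1 L v = src1 L ?k \<and> src1 L u = src1 L v \<and>
        \<kappa> \<in> Cell L \<and> src2 L \<kappa> = ?k \<cdot> u \<and> trg2 L \<kappa> = ?k \<cdot> v \<and> ncell L cok (id2 L e \<star> \<kappa>)"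
  then have [simp]: "u \<in> Mor L" "v \<in> Mor L" "trg1 L u = src1 L ?k" "trg1 L v = src1 L ?k" "src1 L u = src1 L v"
    "\<kappa> \<in> Cell L" "src2 L \<kappa> = ?k \<cdot> u" "trg2 L \<kappa> = ?k \<cdot> v" and n: "ncell L cok (id2 L e \<star> \<kappa>)" by auto
  let ?Z = "src1 L v"
  let ?c = "cc ?Z"
  have T: "one L ?Z \<in> M" "e \<in> E" "?k \<cdot> u \<in> Mor L" "src1 L (?k \<cdot> u) = trg1 L (one L ?Z)" "trg1 L (?k \<cdot> u) = src1 L e"
    "?k \<cdot> v \<in> Mor L" "src1 L (?k \<cdot> v) = trg1 L (one L ?Z)" "trg1 L (?k \<cdot> v) = src1 L e"
    "mstruct L ?k (one L ?Z) (?k \<cdot> u) u (id2 L (?k \<cdot> u))" "mstruct L ?k (one L ?Z) (?k \<cdot> v) v (id2 L (?k \<cdot> v))"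
    by (simp_all add: mstruct_def)
  have kc: "\<kappa> \<in> cells L (?k \<cdot> u) (?k \<cdot> v)" by (simp add: cells_iff)
  obtain t \<phi> t' \<phi>' where es: "estruct L ?c e (?k \<cdot> u) t \<phi>" "estruct L ?c e (?k \<cdot> v) t' \<phi>'"
    and l: "elift L ?c e \<kappa> t \<phi> t' \<phi>' \<longleftrightarrow> mlift L ?k (one L ?Z) \<kappa> u (id2 L (?k \<cdot> u)) v (id2 L (?k \<cdot> v))"
    using to_e[OF T] kc by blast
  have "elift L ?c e \<kappa> t \<phi> t' \<phi>'"
    unfolding elift_def using es by (intro ncellD[OF n]) (simp_all add: estruct_def)
  then obtain \<mu> where m: "\<mu> \<in> cells L u v" "id2 L ?k \<star> \<mu> = \<kappa>" using l by (auto simp: mlift_def cells_iff)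
  show "\<exists>!\<mu>. \<mu> \<in> cells L u v \<and> id2 L ?k \<star> \<mu> = \<kappa>"
  proof (intro ex1I[of _ \<mu>] conjI)
    fix \<nu> assume "\<nu> \<in> cells L u v \<and> id2 L ?k \<star> \<nu> = \<kappa>"
    then have n: "\<nu> \<in> cells L u v" and "id2 L ?k \<star> \<nu> = id2 L ?k \<star> \<mu>" using m by auto
    from this(2) show "\<nu> = \<mu>" by (rule M_faithful[OF k(2), rotated -1]) (use n m(1) in \<open>simp_all add: cells_iff\<close>)
  qed (use m in auto)
qed (use x in simp_all)

text \<open>A morphism in \<open>M\<close> reflects null morphisms and null 2-cells, so
  \<open>m \<cdot> e\<close> and \<open>e\<close> impose the same conditions on test data. Through
  factorizations this yields kernels of arbitrary morphisms from those of quotients.\<close>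

lemma kernel_change_morphism:
  assumes k: "kernel L NS nc ar e k x" and m: "m \<in> M" "trg1 L e = src1 L m" and \<theta>: "iso2 L \<theta>" "src2 L \<theta> = m \<cdot> e" "trg2 L \<theta> = f"
    and y: "y \<in> NS" "src2 L y = f \<cdot> k"
  shows "kernel L NS nc ar f k y"
proof -
  have k': "e \<in> Mor L" "k \<in> Mor L" "trg1 L k = src1 L e" using k by (auto simp: kernel_iff)
  note [simp] = k' m(2) \<theta> M_Mor[OF m(1)]
  have [simp]: "f \<in> Mor L" "src1 L f = src1 L e" "trg1 L f = trg1 L m"
    using trg2_Mor[of \<theta>] src1_trg2[of \<theta>] trg1_trg2[of \<theta>] by simp_all
  have 1: "isnull L cok (e \<cdot> z)" if "isnull L cok (f \<cdot> z)" "z \<in> Mor L" "trg1 L z = src1 L e" for z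
    by (rule M_reflects_null[OF m(1)], rule isnull_iso[OF that(1), of "inv2 L \<theta> \<star> id2 L z"]) (use that in simp_all)
  have 2: "ncell L cok (id2 L e \<star> \<kappa>)" if "ncell L cok (id2 L f \<star> \<kappa>)" "\<kappa> \<in> Cell L" "trg1 L (src2 L \<kappa>) = src1 L e" for \<kappa>
  proof -
    note [simp] = that(2,3)
    have n: "isnull L cok (f \<cdot> src2 L \<kappa>)" "isnull L cok (f \<cdot> trg2 L \<kappa>)" using ncell_null[OF that(1)] by simp_all
    have n': "isnull L cok (m \<cdot> e \<cdot> src2 L \<kappa>)" using isnull_iso[OF n(1), of "inv2 L \<theta> \<star> id2 L (src2 L \<kappa>)"] by simp
    have "ncell L cok ((id2 L f \<star> \<kappa>) \<bullet> (\<theta> \<star> id2 L (src2 L \<kappa>)))"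
      by (rule ncell_vcomp[OF ncell_iso[OF n'] that(1)]) simp_all
    from ncell_vcomp[OF this ncell_iso[OF n(2)], of "inv2 L \<theta> \<star> id2 L (trg2 L \<kappa>)"]
    have "ncell L cok ((inv2 L \<theta> \<star> id2 L (trg2 L \<kappa>)) \<bullet> (id2 L f \<star> \<kappa>) \<bullet> (\<theta> \<star> id2 L (src2 L \<kappa>)))"
      by simp
    moreover have "(id2 L f \<star> \<kappa>) \<bullet> (\<theta> \<star> id2 L (src2 L \<kappa>)) = (\<theta> \<star> id2 L (trg2 L \<kappa>)) \<bullet> (id2 L m \<star> id2 L e \<star> \<kappa>)"
      using exch[of \<kappa> \<theta>] by simp
    ultimately have "ncell L cok (id2 L m \<star> id2 L e \<star> \<kappa>)" by simp
    then show ?thesis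
      by (rule_tac M_reflects_ncell[OF m(1)]) (use 1[OF n(1)] 1[OF n(2)] in simp_all)
  qed
  show ?thesis
    unfolding kernel_iff
  proof (intro conjI allI impI)
    fix z assume "z \<in> Mor L \<and> trg1 L z = src1 L f \<and> isnull L cok (f \<cdot> z)"
    then have "z \<in> Mor L \<and> trg1 L z = src1 L e \<and> isnull L cok (e \<cdot> z)" using 1 by simp
    then show "\<exists>u \<gamma>. u \<in> Mor L \<and> src1 L u = src1 L z \<and> trg1 L u = src1 L k \<and> iso2 L \<gamma> \<and> src2 L \<gamma> = z \<and> trg2 L \<gamma> = k \<cdot> u"
      using k unfolding kernel_iff by blast
  next
    fix u v \<kappa>
    assume a: "u \<in> Mor L \<and> v \<in> Mor L \<and> trg1 L u = src1 L k \<and> trg1 L v = src1 L k \<and> src1 L u = src1 L v \<and>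
        \<kappa> \<in> Cell L \<and> src2 L \<kappa> = k \<cdot> u \<and> trg2 L \<kappa> = k \<cdot> v \<and> ncell L cok (id2 L f \<star> \<kappa>)"
    then have "ncell L cok (id2 L e \<star> \<kappa>)" using 2[of \<kappa>] by simp
    with a show "\<exists>!\<mu>. \<mu> \<in> cells L u v \<and> id2 L k \<star> \<mu> = \<kappa>" using k unfolding kernel_iff by blast
  qed (use y in simp_all)
qed

lemma kernel_unique:
  assumes k: "kernel L NS nc ar f k x" and k': "kernel L NS nc ar f k' x'"
  obtains i \<theta> where "equivalence1 L i" "trg1 L i = src1 L k" "iso2 L \<theta>" "src2 L \<theta> = k \<cdot> i" "trg2 L \<theta> = k'"
proof -
  note [simp] = kernelD[OF k] kernelD[OF k']
  obtain u \<gamma> where [simp]: "u \<in> Mor L" "src1 L u = src1 L k'" "trg1 L u = src1 L k" "iso2 L \<gamma>" "src2 L \<gamma> = k'" "trg2 L \<gamma> = k \<cdot> u"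
    by (rule kernel_factor[OF k, of k' x']) simp_all
  obtain v \<delta> where [simp]: "v \<in> Mor L" "src1 L v = src1 L k" "trg1 L v = src1 L k'" "iso2 L \<delta>" "src2 L \<delta> = k" "trg2 L \<delta> = k' \<cdot> v"
    by (rule kernel_factor[OF k', of k x]) simp_all
  have 1: "nci L nc (ar x (u \<cdot> v)) (id2 L f \<star> (inv2 L \<delta> \<bullet> (inv2 L \<gamma> \<star> id2 L v))) (ar x (one L (src1 L k)))"
    using ar_NS[of x "u \<cdot> v"] ar_NS[of x "one L (src1 L k)"] by (simp add: nci_iff)
  obtain \<mu> where m: "iso2 L \<mu>" "src2 L \<mu> = u \<cdot> v" "trg2 L \<mu> = one L (src1 L k)"
    by (rule kernel_lift_iso[OF k _ _ _ _ _ _ _ _ 1]) simp_all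
  have 2: "nci L nc (ar x' (v \<cdot> u)) (id2 L f \<star> (inv2 L \<gamma> \<bullet> (inv2 L \<delta> \<star> id2 L u))) (ar x' (one L (src1 L k')))"
    using ar_NS[of x' "v \<cdot> u"] ar_NS[of x' "one L (src1 L k')"] by (simp add: nci_iff)
  obtain \<nu> where n: "iso2 L \<nu>" "src2 L \<nu> = v \<cdot> u" "trg2 L \<nu> = one L (src1 L k')"
    by (rule kernel_lift_iso[OF k' _ _ _ _ _ _ _ _ 2]) simp_all
  have "equivalence1 L u" by (rule equivalence1I[of u v \<nu> \<mu>]) (use m n in simp_all)
  then show thesis by (rule that[of u "inv2 L \<gamma>"]) simp_all
qed

lemma kernel_exists:
  assumes "f \<in> Mor L"
  obtains e x where "e \<in> E" "kernel L NS nc ar f (ker e) x"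
proof -
  obtain e m \<theta> where em: "e \<in> E" "m \<in> M" and [simp]: "trg1 L e = src1 L m" "iso2 L \<theta>" "src2 L \<theta> = f" "trg2 L \<theta> = m \<cdot> e"
    using factor[OF assms] by blast
  note [simp] = em(1) E_Mor[OF em(1)] M_Mor[OF em(2)]
  have [simp]: "src1 L f = src1 L e" using src1_trg2[of \<theta>] by simp
  have k [simp]: "ker e \<in> Mor L" by simp
  have n: "id2 L (e \<cdot> ker e) \<in> NS" using ker_null[of e] by (simp add: NS_iff)
  have "isnull L cok (m \<cdot> e \<cdot> ker e)" using ker_null[of e] by (rule_tac isnull_post) simp_all
  then have "isnull L cok (f \<cdot> ker e)" by (rule isnull_iso[of _ "inv2 L \<theta> \<star> id2 L (ker e)"]) simp_all
  then have "id2 L (f \<cdot> ker e) \<in> NS \<and> src2 L (id2 L (f \<cdot> ker e)) = f \<cdot> ker e" using assms by (simp add: NS_iff)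
  then have "kernel L NS nc ar f (ker e) (id2 L (f \<cdot> ker e))"
    by (rule_tac kernel_change_morphism[OF kernel_ker[OF em(1) n] em(2), of "inv2 L \<theta>"]) (use assms in simp_all)
  then show thesis using that em by blast
qed

lemma kernel_M:
  assumes k: "kernel L NS nc ar f k x"
  shows "k \<in> M"
proof -
  obtain e y where e: "e \<in> E" "kernel L NS nc ar f (ker e) y" using kernel_exists[OF kernelD(1)[OF k]] .
  obtain i \<theta> where i: "equivalence1 L i" "trg1 L i = src1 L (ker e)" "iso2 L \<theta>" "src2 L \<theta> = ker e \<cdot> i" "trg2 L \<theta> = k"
    using kernel_unique[OF e(2) k] by blast
  have "ker e \<in> M" using e(1) by (rule ker_M')
  from M_iso[OF M_equivalence[OF this i(1,2)] i(3-5)] show ?thesis .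
qed

text \<open>The equivalence \<open>r\<close> from the unit of the biequivalence makes
  \<open>m\<close> isomorphic to \<open>ker (cok m) \<cdot> r\<close>, and kernels are stable under
  equivalence.\<close>

lemma kernel_cok:
  assumes m: "m \<in> M"
  obtains x where "kernel L NS nc ar (cok m) m x"
proof -
  obtain r \<theta> where r: "equivalence1 L r" "trg1 L r = src1 L (ker (cok m))" "iso2 L \<theta>" "src2 L \<theta> = m" "trg2 L \<theta> = ker (cok m) \<cdot> r"
    using ker_cok[OF m] by blast
  have c: "cok m \<in> E" using m by simp
  then have k: "ker (cok m) \<in> Mor L" "trg1 L (ker (cok m)) = src1 L (cok m)" by simp_all
  have "id2 L (cok m \<cdot> ker (cok m)) \<in> NS" using ker_null[OF c] k c by (simp add: NS_iff)
  then have "kernel L NS nc ar (cok m) (ker (cok m)) (id2 L (cok m \<cdot> ker (cok m)))"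
    using k c by (intro kernel_ker) simp_all
  from kernel_equivalence[OF this r(1,2), of "inv2 L \<theta>" m] r obtain x where "kernel L NS nc ar (cok m) m x" by auto
  then show thesis by (rule that)
qed

end

context exact_nullity
begin

lemmas cokernel_cok = exact_nullity.kernel_ker[OF exact_nullity_op, unfolded op2_sel]
lemmas cokernel_unique = exact_nullity.kernel_unique[OF exact_nullity_op, unfolded op2_sel op2_equivalence1 op2_iso2]
lemmas cokernel_null = exact_nullity.ker_null[OF exact_nullity_op, unfolded op2_sel isnull_op]

text \<open>An arbitrary cokernel of \<open>m\<close> is \<open>cok m\<close> followed by an
  equivalence. Equivalences lie in \<open>M\<close>, so it has the same kernels as
  \<open>cok m\<close>, and the structure is kept.\<close>

lemma kernel_of_cokernel:
  assumes m: "m \<in> M" and c: "cokernel L NS nc al m c x"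
  shows "kernel L NS nc ar c m x"
proof -
  note [simp] = cokernelD[OF c]
  have e: "cok m \<in> E" using m by simp
  have "isnull L cok (cok m \<cdot> m)" using cokernel_null[OF m] by simp
  then have "id2 L (cok m \<cdot> m) \<in> NS" using e m by (simp add: NS_iff)
  then have c': "cokernel L NS nc al m (cok m) (id2 L (cok m \<cdot> m))" using m e by (intro cokernel_cok) simp_all
  obtain i \<theta> where i: "equivalence1 L i" "src1 L i = trg1 L (cok m)" "iso2 L \<theta>" "src2 L \<theta> = i \<cdot> cok m" "trg2 L \<theta> = c"
    using cokernel_unique[OF c' c] by blast
  obtain y where "kernel L NS nc ar (cok m) m y" using kernel_cok[OF m] .
  from kernel_change_morphism[OF this equivalence_M[OF i(1)] i(2)[symmetric] i(3-5)] show ?thesis by simp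
qed

end

section \<open>The null structures of a 2-ideal\<close>

lemma Cat_sel:
  "Mor Cat = Collect cat_functor" "Cell Cat = Collect natural_transformation"
  "src1 Cat = fdom" "trg1 Cat = fcod" "src2 Cat = nsrc" "trg2 Cat = ntrg"
  by (simp_all add: Cat_def)

lemma Cat_comp1 [simp]:
  "fdom (comp1 Cat G F) = fdom F" "fcod (comp1 Cat G F) = fcod G"
  "x \<in> cobj (fdom F) \<Longrightarrow> fob (comp1 Cat G F) x = fob G (fob F x)"
  "s \<in> carr (fdom F) \<Longrightarrow> far (comp1 Cat G F) s = far G (far F s)"
  by (simp_all add: Cat_def)

lemma Cat_one [simp]:
  "fdom (one Cat X) = X" "fcod (one Cat X) = X"
  "x \<in> cobj X \<Longrightarrow> fob (one Cat X) x = x" "s \<in> carr X \<Longrightarrow> far (one Cat X) s = s"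
  by (simp_all add: Cat_def)

lemma Cat_ncomp [simp]:
  "nsrc (vcomp Cat R S) = nsrc S" "ntrg (vcomp Cat R S) = ntrg R"
  "x \<in> cobj (fdom (nsrc S)) \<Longrightarrow> ncomp (vcomp Cat R S) x = ccomp (fcod (nsrc S)) (ncomp R x) (ncomp S x)"
  "nsrc (id2 Cat F) = F" "ntrg (id2 Cat F) = F"
  "x \<in> cobj (fdom F) \<Longrightarrow> ncomp (id2 Cat F) x = cid (fcod F) (fob F x)"
  "nsrc (hcomp Cat R S) = comp1 Cat (nsrc R) (nsrc S)" "ntrg (hcomp Cat R S) = comp1 Cat (ntrg R) (ntrg S)"
  "x \<in> cobj (fdom (nsrc S)) \<Longrightarrow>
    ncomp (hcomp Cat R S) x = ccomp (fcod (nsrc R)) (ncomp R (fob (ntrg S) x)) (far (nsrc R) (ncomp S x))"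
  by (simp_all add: Cat_def)

lemma hom_cat_sel [simp]:
  "cobj (hom_cat L A B) = hom L A B" "carr (hom_cat L A B) = {\<theta> \<in> Cell L. src2 L \<theta> \<in> hom L A B}"
  "cdom (hom_cat L A B) = src2 L" "ccod (hom_cat L A B) = trg2 L" "cid (hom_cat L A B) = id2 L" "ccomp (hom_cat L A B) = vcomp L"
  by (simp_all add: hom_cat_def)

lemma hom_func_sel [simp]:
  "fdom (hom_func L a b) = hom_cat L (trg1 L a) (src1 L b)" "fcod (hom_func L a b) = hom_cat L (src1 L a) (trg1 L b)"
  "n \<in> hom L (trg1 L a) (src1 L b) \<Longrightarrow> fob (hom_func L a b) n = b \<cdot>\<^bsub>L\<^esub> n \<cdot>\<^bsub>L\<^esub> a"
  "\<lbrakk>\<theta> \<in> Cell L; src2 L \<theta> \<in> hom L (trg1 L a) (src1 L b)\<rbrakk> \<Longrightarrow> far (hom_func L a b) \<theta> = id2 L b \<star>\<^bsub>L\<^esub> \<theta> \<star>\<^bsub>L\<^esub> id2 L a"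
  by (simp_all add: hom_func_def)

lemma hom_nattrans_sel [simp]:
  "nsrc (hom_nattrans L \<alpha> \<beta>) = hom_func L (src2 L \<alpha>) (src2 L \<beta>)" "ntrg (hom_nattrans L \<alpha> \<beta>) = hom_func L (trg2 L \<alpha>) (trg2 L \<beta>)"
  "n \<in> hom L (trg1 L (src2 L \<alpha>)) (src1 L (src2 L \<beta>)) \<Longrightarrow> ncomp (hom_nattrans L \<alpha> \<beta>) n = \<beta> \<star>\<^bsub>L\<^esub> id2 L n \<star>\<^bsub>L\<^esub> \<alpha>"
  by (simp_all add: hom_nattrans_def)

lemma hom_psfun_sel [simp]:
  "F0 (hom_psfun L) (A, B) = hom_cat L A B" "F1 (hom_psfun L) (a, b) = hom_func L a b" "F2 (hom_psfun L) (\<alpha>, \<beta>) = hom_nattrans L \<alpha> \<beta>"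
  "Fcomp (hom_psfun L) g f = id2 Cat (F1 (hom_psfun L) (comp1 (prod2 (op2 L) L) g f))"
  "Funit (hom_psfun L) ab = id2 Cat (one Cat (F0 (hom_psfun L) ab))"
  by (simp_all add: hom_psfun_def strict_psfun_def)

lemma prod2_sel [simp]:
  "Obj (prod2 L M) = Obj L \<times> Obj M" "Mor (prod2 L M) = Mor L \<times> Mor M" "Cell (prod2 L M) = Cell L \<times> Cell M"
  "src1 (prod2 L M) (a, b) = (src1 L a, src1 M b)" "trg1 (prod2 L M) (a, b) = (trg1 L a, trg1 M b)"
  "src2 (prod2 L M) (\<alpha>, \<beta>) = (src2 L \<alpha>, src2 M \<beta>)" "trg2 (prod2 L M) (\<alpha>, \<beta>) = (trg2 L \<alpha>, trg2 M \<beta>)"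
  "one (prod2 L M) (A, B) = (one L A, one M B)" "comp1 (prod2 L M) (a', b') (a, b) = (comp1 L a' a, comp1 M b' b)"
  "id2 (prod2 L M) (a, b) = (id2 L a, id2 M b)" "vcomp (prod2 L M) (\<alpha>', \<beta>') (\<alpha>, \<beta>) = (vcomp L \<alpha>' \<alpha>, vcomp M \<beta>' \<beta>)"
  "hcomp (prod2 L M) (\<alpha>', \<beta>') (\<alpha>, \<beta>) = (hcomp L \<alpha>' \<alpha>, hcomp M \<beta>' \<beta>)"
  by (simp_all add: prod2_def)

locale ideal = two_category L for L :: "('o, 'm, 'c) two_cat" (structure) +
  fixes I :: "('o, 'm, 'c) ideal"
  assumes ideal: "two_ideal L I"
begin

abbreviation "P \<equiv> prod2 (op2 L) L"
abbreviation "H \<equiv> hom_psfun L"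
abbreviation "N \<equiv> idN I"
abbreviation "T \<equiv> idnu I"

lemma N_pseudofunctor: "pseudofunctor P Cat N" and N_normal: "normal_psfun P Cat N"
  and T_pseudonatural: "pseudonatural P Cat N H T"
  using ideal by (simp_all add: two_ideal_def)

lemma hom_P: "\<lbrakk>a \<in> Mor L; b \<in> Mor L\<rbrakk> \<Longrightarrow> (a, b) \<in> hom P (trg1 L a, src1 L b) (src1 L a, trg1 L b)"
  by (simp add: hom_def prod2_def)

lemma T0_functor:
  assumes "A \<in> Obj L" "B \<in> Obj L"
  shows "cat_functor (T0 T (A, B))" "fdom (T0 T (A, B)) = F0 N (A, B)" "fcod (T0 T (A, B)) = hom_cat L A B"
  using pseudonatural.T0_hom[OF T_pseudonatural, of "(A, B)"] assms
  by (simp_all add: prod2_def hom_def Cat_def hom_psfun_def strict_psfun_def)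

lemma N1_functor:
  assumes "a \<in> Mor L" "b \<in> Mor L"
  shows "cat_functor (F1 N (a, b))" "fdom (F1 N (a, b)) = F0 N (trg1 L a, src1 L b)" "fcod (F1 N (a, b)) = F0 N (src1 L a, trg1 L b)"
  using pseudofunctor.F1_hom[OF N_pseudofunctor, OF hom_P[OF assms]]
  by (simp_all add: hom_def Cat_def)

lemma T1_nattrans:
  assumes "a \<in> Mor L" "b \<in> Mor L"
  shows "natural_transformation (T1 T (a, b))"
    "nsrc (T1 T (a, b)) = comp1 Cat (hom_func L a b) (T0 T (trg1 L a, src1 L b))"
    "ntrg (T1 T (a, b)) = comp1 Cat (T0 T (src1 L a, trg1 L b)) (F1 N (a, b))"
    "\<exists>S. is_inv2 Cat (T1 T (a, b)) S"
  using pseudonatural.T1_isos[OF T_pseudonatural, OF hom_P[OF assms]]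
  by (auto simp: isos_def cells_def Cat_sel)

lemma inj_T0: "\<lbrakk>A \<in> Obj L; B \<in> Obj L\<rbrakk> \<Longrightarrow> inj_on (fob (T0 T (A, B))) (cobj (F0 N (A, B)))"
proof -
  assume AB: "A \<in> Obj L" "B \<in> Obj L"
  then have "injective_on_objects (T0 T (A, B))" using ideal by (simp add: two_ideal_def)
  then show ?thesis using T0_functor[OF AB] by (simp add: injective_on_objects_def)
qed

lemma faithful_T0: "\<lbrakk>A \<in> Obj L; B \<in> Obj L; x \<in> cobj (F0 N (A, B)); y \<in> cobj (F0 N (A, B))\<rbrakk>
    \<Longrightarrow> inj_on (far (T0 T (A, B))) (chom (F0 N (A, B)) x y)"
proof -
  assume AB: "A \<in> Obj L" "B \<in> Obj L" and xy: "x \<in> cobj (F0 N (A, B))" "y \<in> cobj (F0 N (A, B))"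
  from AB have "faithful_functor (T0 T (A, B))" using ideal by (simp add: two_ideal_def)
  then show ?thesis using T0_functor[OF AB] xy by (simp add: faithful_functor_def)
qed

lemma null_obj:
  assumes "A \<in> Obj L" "B \<in> Obj L" "n \<in> null_mor I A B"
  shows "null_obj I A B n \<in> cobj (F0 N (A, B))" "fob (T0 T (A, B)) (null_obj I A B n) = n"
  using assms by (auto simp: null_mor_def null_obj_def intro: inv_into_into f_inv_into_f)

text \<open>Injectivity on objects lets a null morphism stand for its unique preimage in
  \<open>N(A, B)\<close>; otherwise \<open>null_obj\<close> would only choose some preimage.\<close>

lemma null_obj_fob:
  assumes "A \<in> Obj L" "B \<in> Obj L" "x \<in> cobj (F0 N (A, B))"
  shows "null_obj I A B (fob (T0 T (A, B)) x) = x"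
  using inj_T0[OF assms(1,2)] assms(3) by (simp add: null_obj_def)

lemma null_mor_hom: "\<lbrakk>A \<in> Obj L; B \<in> Obj L; n \<in> null_mor I A B\<rbrakk> \<Longrightarrow> n \<in> Mor L \<and> src1 L n = A \<and> trg1 L n = B"
  using cat_functor.fob_cobj[OF T0_functor(1)[of A B], of "null_obj I A B n"] null_obj[of A B n] T0_functor[of A B]
  by (simp add: hom_cat_def hom_iff)

lemma far_null_cell:
  assumes "A \<in> Obj L" "B \<in> Obj L" "s \<in> chom (F0 N (A, B)) x y"
  shows "far (T0 T (A, B)) s \<in> null_cells I A B" "far (T0 T (A, B)) s \<in> Cell L"
    "src2 L (far (T0 T (A, B)) s) = fob (T0 T (A, B)) x" "trg2 L (far (T0 T (A, B)) s) = fob (T0 T (A, B)) y"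
    "x \<in> cobj (F0 N (A, B))" "y \<in> cobj (F0 N (A, B))"
proof -
  interpret cat_functor "T0 T (A, B)" using T0_functor assms by simp
  interpret fd: category "F0 N (A, B)" using fdom_category T0_functor assms by simp
  show "far (T0 T (A, B)) s \<in> null_cells I A B" using assms by (auto simp: null_cells_def chom_def)
  show "far (T0 T (A, B)) s \<in> Cell L"
    "src2 L (far (T0 T (A, B)) s) = fob (T0 T (A, B)) x" "trg2 L (far (T0 T (A, B)) s) = fob (T0 T (A, B)) y"
    using far_chom[of s x y] T0_functor[OF assms(1,2)] assms by (simp_all add: chom_def hom_cat_def)
  show "x \<in> cobj (F0 N (A, B))" "y \<in> cobj (F0 N (A, B))" using fd.carr_bd[of s] assms by (simp_all add: chom_def)
qed

lemma null_cellE: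
  assumes "A \<in> Obj L" "B \<in> Obj L" "\<theta> \<in> null_cells I A B"
  obtains s where "s \<in> chom (F0 N (A, B)) (null_obj I A B (src2 L \<theta>)) (null_obj I A B (trg2 L \<theta>))" "far (T0 T (A, B)) s = \<theta>"
proof -
  obtain s where s: "s \<in> carr (F0 N (A, B))" "far (T0 T (A, B)) s = \<theta>" using assms by (auto simp: null_cells_def)
  then have c: "s \<in> chom (F0 N (A, B)) (cdom (F0 N (A, B)) s) (ccod (F0 N (A, B)) s)" by (simp add: chom_def)
  show thesis
    using that[of s] far_null_cell[OF assms(1,2) c] c s null_obj_fob[OF assms(1,2)] by simp
qed

lemma null_cells_bd:
  assumes "A \<in> Obj L" "B \<in> Obj L" "\<theta> \<in> null_cells I A B"
  shows "\<theta> \<in> Cell L" "src2 L \<theta> \<in> null_mor I A B" "trg2 L \<theta> \<in> null_mor I A B"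
proof -
  obtain s where s: "s \<in> chom (F0 N (A, B)) (null_obj I A B (src2 L \<theta>)) (null_obj I A B (trg2 L \<theta>))" "far (T0 T (A, B)) s = \<theta>"
    using null_cellE[OF assms] .
  note f = far_null_cell[OF assms(1,2) s(1)]
  show "\<theta> \<in> Cell L" using f(2) s(2) by simp
  show "src2 L \<theta> \<in> null_mor I A B" "trg2 L \<theta> \<in> null_mor I A B" using f(3-6) s(2) by (auto simp: null_mor_def)
qed

lemma null_cells_id:
  assumes "A \<in> Obj L" "B \<in> Obj L" "n \<in> null_mor I A B"
  shows "id2 L n \<in> null_cells I A B"
proof -
  interpret cat_functor "T0 T (A, B)" using T0_functor assms by simp
  interpret fd: category "F0 N (A, B)" using fdom_category T0_functor assms by simp
  have "far (T0 T (A, B)) (cid (F0 N (A, B)) (null_obj I A B n)) = id2 L n"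
    using far_cid[of "null_obj I A B n"] null_obj[OF assms] T0_functor[OF assms(1,2)] by (simp add: hom_cat_def)
  then show ?thesis
    using far_null_cell(1)[OF assms(1,2) fd.cid_chom[OF null_obj(1)[OF assms]]] by simp
qed

lemma far_ccomp_T0:
  assumes "A \<in> Obj L" "B \<in> Obj L" "s \<in> chom (F0 N (A, B)) x y" "r \<in> chom (F0 N (A, B)) y z"
  shows "far (T0 T (A, B)) (ccomp (F0 N (A, B)) r s) = far (T0 T (A, B)) r \<bullet> far (T0 T (A, B)) s"
    "ccomp (F0 N (A, B)) r s \<in> chom (F0 N (A, B)) x z"
proof -
  interpret cat_functor "T0 T (A, B)" using T0_functor assms by simp
  interpret fd: category "F0 N (A, B)" using fdom_category T0_functor assms by simp
  show "far (T0 T (A, B)) (ccomp (F0 N (A, B)) r s) = far (T0 T (A, B)) r \<bullet> far (T0 T (A, B)) s"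
    using far_ccomp[of s x y r z] assms T0_functor[OF assms(1,2)] by (simp add: hom_cat_def)
  show "ccomp (F0 N (A, B)) r s \<in> chom (F0 N (A, B)) x z" using fd.ccomp_chom assms by blast
qed

lemma null_cells_vcomp:
  assumes "A \<in> Obj L" "B \<in> Obj L" "\<theta> \<in> null_cells I A B" "\<theta>' \<in> null_cells I A B" "trg2 L \<theta> = src2 L \<theta>'"
  shows "\<theta>' \<bullet> \<theta> \<in> null_cells I A B"
proof -
  obtain s where s: "s \<in> chom (F0 N (A, B)) (null_obj I A B (src2 L \<theta>)) (null_obj I A B (trg2 L \<theta>))" "far (T0 T (A, B)) s = \<theta>"
    using null_cellE[OF assms(1,2,3)] .
  obtain s' where s': "s' \<in> chom (F0 N (A, B)) (null_obj I A B (src2 L \<theta>')) (null_obj I A B (trg2 L \<theta>'))" "far (T0 T (A, B)) s' = \<theta>'"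
    using null_cellE[OF assms(1,2,4)] .
  show ?thesis
    using far_ccomp_T0[OF assms(1,2) s(1) s'(1)[folded assms(5)]] far_null_cell(1)[OF assms(1,2)] s s' by metis
qed

text \<open>From right to left, the two preimages have matching boundaries by injectivity on
  objects, and they compose to identities because faithfulness reflects the equations.\<close>

lemma null_isos_iff:
  assumes [simp]: "A \<in> Obj L" "B \<in> Obj L"
  shows "\<theta> \<in> null_isos I A B \<longleftrightarrow> iso2 L \<theta> \<and> \<theta> \<in> null_cells I A B \<and> inv2 L \<theta> \<in> null_cells I A B"
proof -
  interpret cat_functor "T0 T (A, B)" using T0_functor by simp
  interpret fd: category "F0 N (A, B)" using fdom_category T0_functor by simp
  have cid: "far (T0 T (A, B)) (cid (F0 N (A, B)) x) = id2 L (fob (T0 T (A, B)) x)" if "x \<in> cobj (F0 N (A, B))" for x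
    using far_cid[of x] that T0_functor[OF assms] by (simp add: hom_cat_def)
  show ?thesis
  proof
    assume "\<theta> \<in> null_isos I A B"
    then obtain x y s t where s: "s \<in> chom (F0 N (A, B)) x y" "t \<in> chom (F0 N (A, B)) y x"
      "ccomp (F0 N (A, B)) t s = cid (F0 N (A, B)) x" "ccomp (F0 N (A, B)) s t = cid (F0 N (A, B)) y" "far (T0 T (A, B)) s = \<theta>"
      by (auto simp: null_isos_def cisos_def)
    note f = far_null_cell[OF assms s(1)] and g = far_null_cell[OF assms s(2)]
    have "iso2 L \<theta> \<and> inv2 L \<theta> = far (T0 T (A, B)) t"
      unfolding s(5)[symmetric]
      by (rule inv2_eq) (use far_ccomp_T0(1)[OF assms s(1,2)] far_ccomp_T0(1)[OF assms s(2,1)] cid s f g in simp_all)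
    then show "iso2 L \<theta> \<and> \<theta> \<in> null_cells I A B \<and> inv2 L \<theta> \<in> null_cells I A B" using f(1) g(1) s(5) by simp
  next
    assume a: "iso2 L \<theta> \<and> \<theta> \<in> null_cells I A B \<and> inv2 L \<theta> \<in> null_cells I A B"
    obtain s where s: "s \<in> chom (F0 N (A, B)) (null_obj I A B (src2 L \<theta>)) (null_obj I A B (trg2 L \<theta>))" "far (T0 T (A, B)) s = \<theta>"
      using null_cellE[OF assms, of \<theta>] a by blast
    obtain t where t: "t \<in> chom (F0 N (A, B)) (null_obj I A B (trg2 L \<theta>)) (null_obj I A B (src2 L \<theta>))" "far (T0 T (A, B)) t = inv2 L \<theta>"
      using null_cellE[OF assms, of "inv2 L \<theta>"] a by auto
    let ?x = "null_obj I A B (src2 L \<theta>)" and ?y = "null_obj I A B (trg2 L \<theta>)"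
    note f = far_null_cell[OF assms s(1)]
    have ox: "fob (T0 T (A, B)) ?x = src2 L \<theta>" "fob (T0 T (A, B)) ?y = trg2 L \<theta>"
      using null_obj(2)[OF assms] null_cells_bd[OF assms, of \<theta>] a by auto
    have "ccomp (F0 N (A, B)) t s = cid (F0 N (A, B)) ?x"
      by (rule inj_onD[OF faithful_T0[OF assms f(5,5)]])
        (use far_ccomp_T0[OF assms s(1) t(1)] cid[OF f(5)] ox s(2) t(2) a fd.cid_chom[OF f(5)] in simp_all)
    moreover have "ccomp (F0 N (A, B)) s t = cid (F0 N (A, B)) ?y"
      by (rule inj_onD[OF faithful_T0[OF assms f(6,6)]])
        (use far_ccomp_T0[OF assms t(1) s(1)] cid[OF f(6)] ox s(2) t(2) a fd.cid_chom[OF f(6)] in simp_all)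
    ultimately have "s \<in> cisos (F0 N (A, B)) ?x ?y" using s t by (auto simp: cisos_def)
    then show "\<theta> \<in> null_isos I A B" using f(5,6) s(2) by (auto simp: null_isos_def)
  qed
qed

lemma nu_iso:
  assumes ab [simp]: "a \<in> Mor L" "b \<in> Mor L" and n: "n \<in> null_mor I (trg1 L a) (src1 L b)"
  shows "iso2 L (nu L I b n a)" "src2 L (nu L I b n a) = b \<cdot> n \<cdot> a" "trg2 L (nu L I b n a) = tilde L I b n a"
    "tilde L I b n a \<in> null_mor I (src1 L a) (trg1 L b)"
    "null_obj I (src1 L a) (trg1 L b) (tilde L I b n a) = fob (F1 N (a, b)) (null_obj I (trg1 L a) (src1 L b) n)"
proof -
  let ?A = "trg1 L a" and ?B = "src1 L b" and ?A' = "src1 L a" and ?B' = "trg1 L b"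
  let ?x = "null_obj I ?A ?B n"
  have x [simp]: "?x \<in> cobj (F0 N (?A, ?B))" "fob (T0 T (?A, ?B)) ?x = n" using null_obj n by simp_all
  note n' = null_mor_hom[OF _ _ n]
  note [simp] = T0_functor N1_functor
  have o: "fob (F1 N (a, b)) ?x \<in> cobj (F0 N (?A', ?B'))"
    using cat_functor.fob_cobj[OF N1_functor(1)[OF ab], of ?x] by simp
  then show "tilde L I b n a \<in> null_mor I ?A' ?B'" by (auto simp: tilde_def null_mor_def)
  show "null_obj I ?A' ?B' (tilde L I b n a) = fob (F1 N (a, b)) ?x" using o by (simp add: tilde_def null_obj_fob)
  note t = T1_nattrans[OF ab]
  have ts: "fdom (nsrc (T1 T (a, b))) = F0 N (?A, ?B)" "fcod (nsrc (T1 T (a, b))) = hom_cat L ?A' ?B'"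
    "fob (nsrc (T1 T (a, b))) ?x = b \<cdot> n \<cdot> a" "fob (ntrg (T1 T (a, b))) ?x = tilde L I b n a"
    unfolding t(2,3) using n' by (simp_all add: tilde_def hom_iff)
  have c: "ncomp (T1 T (a, b)) ?x \<in> chom (hom_cat L ?A' ?B') (b \<cdot> n \<cdot> a) (tilde L I b n a)"
    using natural_transformation.ncomp_chom[OF t(1), of ?x] ts by simp
  \<comment> \<open>Invertibility is given for the whole transformation in \<open>Cat\<close>.
    Evaluating the inverse and both inverse laws at the object \<open>?x\<close> yields the inverse
    of the component.\<close>
  obtain S where S: "is_inv2 Cat (T1 T (a, b)) S" using t(4) by blast
  then have S1: "natural_transformation S" "nsrc S = ntrg (T1 T (a, b))" "ntrg S = nsrc (T1 T (a, b))"
    and S2: "vcomp Cat S (T1 T (a, b)) = id2 Cat (nsrc (T1 T (a, b)))" "vcomp Cat (T1 T (a, b)) S = id2 Cat (ntrg (T1 T (a, b)))"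
    by (simp_all add: is_inv2_def cells_def Cat_sel)
  have nt: "fdom (ntrg (T1 T (a, b))) = F0 N (?A, ?B)" "fcod (ntrg (T1 T (a, b))) = hom_cat L ?A' ?B'"
    using natural_transformation.fdom_eq[OF t(1)] natural_transformation.fcod_eq[OF t(1)] ts by simp_all
  have d: "ncomp S ?x \<in> chom (hom_cat L ?A' ?B') (tilde L I b n a) (b \<cdot> n \<cdot> a)"
    using natural_transformation.ncomp_chom[OF S1(1), of ?x] S1(2,3) ts nt by simp
  have e1: "ncomp S ?x \<bullet> ncomp (T1 T (a, b)) ?x = id2 L (b \<cdot> n \<cdot> a)"
    using arg_cong[OF S2(1), of "\<lambda>V. ncomp V ?x"] ts by simp
  have e2: "ncomp (T1 T (a, b)) ?x \<bullet> ncomp S ?x = id2 L (tilde L I b n a)"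
    using arg_cong[OF S2(2), of "\<lambda>V. ncomp V ?x"] ts S1(2) nt by simp
  have "iso2 L (ncomp (T1 T (a, b)) ?x) \<and> inv2 L (ncomp (T1 T (a, b)) ?x) = ncomp S ?x"
    by (rule inv2_eq) (use c d e1 e2 in \<open>simp_all add: chom_def hom_cat_def\<close>)
  then show "iso2 L (nu L I b n a)" by (simp add: nu_def)
  show "src2 L (nu L I b n a) = b \<cdot> n \<cdot> a" "trg2 L (nu L I b n a) = tilde L I b n a"
    using c by (simp_all add: nu_def chom_def hom_cat_def)
qed

text \<open>The naturality of \<open>nu\<close> in the null 2-cell.\<close>

lemma nu_natural:
  assumes ab [simp]: "a \<in> Mor L" "b \<in> Mor L" and \<theta>: "\<theta> \<in> null_cells I (trg1 L a) (src1 L b)"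
  shows "nu L I b (trg2 L \<theta>) a \<bullet> (id2 L b \<star> \<theta> \<star> id2 L a) \<bullet> inv2 L (nu L I b (src2 L \<theta>) a) \<in> null_cells I (src1 L a) (trg1 L b)"
proof -
  let ?A = "trg1 L a" and ?B = "src1 L b" and ?A' = "src1 L a" and ?B' = "trg1 L b"
  let ?x = "null_obj I ?A ?B (src2 L \<theta>)" and ?y = "null_obj I ?A ?B (trg2 L \<theta>)"
  have AB: "?A \<in> Obj L" "?B \<in> Obj L" "?A' \<in> Obj L" "?B' \<in> Obj L" by simp_all
  obtain s where s: "s \<in> chom (F0 N (?A, ?B)) ?x ?y" "far (T0 T (?A, ?B)) s = \<theta>" using null_cellE[OF AB(1,2) \<theta>] .
  note bd = null_cells_bd[OF AB(1,2) \<theta>] and f = far_null_cell[OF AB(1,2) s(1)]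
  note [simp] = T0_functor N1_functor
  note t = T1_nattrans[OF ab]
  have ts: "fdom (nsrc (T1 T (a, b))) = F0 N (?A, ?B)" "fcod (nsrc (T1 T (a, b))) = hom_cat L ?A' ?B'"
    unfolding t(2,3) by simp_all
  have sc: "s \<in> carr (F0 N (?A, ?B))" using s(1) by (simp add: chom_def)
  have sr: "far (F1 N (a, b)) s \<in> chom (F0 N (?A', ?B')) (fob (F1 N (a, b)) ?x) (fob (F1 N (a, b)) ?y)"
    using cat_functor.far_chom[OF N1_functor(1)[OF ab], of s ?x ?y] s(1) by simp
  have "\<theta> \<in> carr (hom_cat L ?A ?B)"
    using bd null_mor_hom[OF AB(1,2) bd(2)] by (simp add: hom_iff)
  then have "far (nsrc (T1 T (a, b))) s = id2 L b \<star> \<theta> \<star> id2 L a"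
    "far (ntrg (T1 T (a, b))) s = far (T0 T (?A', ?B')) (far (F1 N (a, b)) s)"
    unfolding t(2,3) using sc s(2) by (simp_all add: hom_iff)
  then have eq: "nu L I b (trg2 L \<theta>) a \<bullet> (id2 L b \<star> \<theta> \<star> id2 L a) = far (T0 T (?A', ?B')) (far (F1 N (a, b)) s) \<bullet> nu L I b (src2 L \<theta>) a"
    using natural_transformation.natural[OF t(1), of s ?x ?y] s(1) ts by (simp add: nu_def hom_cat_def)
  note g = far_null_cell[OF AB(3,4) sr]
  note nus = nu_iso[OF ab bd(2)] and nut = nu_iso[OF ab bd(3)]
  have "nu L I b (trg2 L \<theta>) a \<bullet> (id2 L b \<star> \<theta> \<star> id2 L a) \<bullet> inv2 L (nu L I b (src2 L \<theta>) a)
    = (nu L I b (trg2 L \<theta>) a \<bullet> (id2 L b \<star> \<theta> \<star> id2 L a)) \<bullet> inv2 L (nu L I b (src2 L \<theta>) a)"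
    using nus nut bd null_mor_hom[OF AB(1,2) bd(2)] by simp
  also have "\<dots> = far (T0 T (?A', ?B')) (far (F1 N (a, b)) s)"
    unfolding eq using nus g by (simp add: tilde_def)
  finally show ?thesis using g(1) by simp
qed

end

context ideal
begin

text \<open>The conjugated 2-cell is the inclusion of the component at \<open>n\<close> of
  \<open>N\<close> applied to \<open>(\<alpha>, \<beta>)\<close>; this is naturality of the
  pseudonaturality 2-cells with respect to 2-cells of \<open>P\<close>.\<close>

lemma nu_natural2:
  assumes \<alpha> [simp]: "\<alpha> \<in> Cell L" and \<beta> [simp]: "\<beta> \<in> Cell L"
    and n: "n \<in> null_mor I (trg1 L (src2 L \<alpha>)) (src1 L (src2 L \<beta>))"
  shows "nu L I (trg2 L \<beta>) n (trg2 L \<alpha>) \<bullet> (\<beta> \<star> id2 L n \<star> \<alpha>) \<bullet> inv2 L (nu L I (src2 L \<beta>) n (src2 L \<alpha>))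
    \<in> null_cells I (src1 L (src2 L \<alpha>)) (trg1 L (src2 L \<beta>))"
proof -
  let ?a = "src2 L \<alpha>" and ?b = "src2 L \<beta>" and ?a' = "trg2 L \<alpha>" and ?b' = "trg2 L \<beta>"
  let ?A = "trg1 L ?a" and ?B = "src1 L ?b" and ?A' = "src1 L ?a" and ?B' = "trg1 L ?b"
  have AB: "?A \<in> Obj L" "?B \<in> Obj L" "?A' \<in> Obj L" "?B' \<in> Obj L" by simp_all
  let ?x = "null_obj I ?A ?B n"
  have x [simp]: "?x \<in> cobj (F0 N (?A, ?B))" "fob (T0 T (?A, ?B)) ?x = n" using null_obj[OF AB(1,2) n] by simp_all
  note n' = null_mor_hom[OF AB(1,2) n]
  note [simp] = T0_functor[OF AB(1,2)] T0_functor[OF AB(3,4)]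
  have ab: "?a \<in> Mor L" "?b \<in> Mor L" "?a' \<in> Mor L" "?b' \<in> Mor L" by simp_all
  note [simp] = N1_functor(2,3)[OF ab(1,2)]
  have N' [simp]: "fdom (F1 N (?a', ?b')) = F0 N (?A, ?B)" "fcod (F1 N (?a', ?b')) = F0 N (?A', ?B')"
    using N1_functor(2,3)[OF ab(3,4)] by simp_all
  have ca: "(\<alpha>, \<beta>) \<in> cells P (?a, ?b) (?a', ?b')" by (simp add: cells_def)
  have F2N: "natural_transformation (F2 N (\<alpha>, \<beta>))" "nsrc (F2 N (\<alpha>, \<beta>)) = F1 N (?a, ?b)" "ntrg (F2 N (\<alpha>, \<beta>)) = F1 N (?a', ?b')"
    using pseudofunctor.F2_cells[OF N_pseudofunctor ca] by (simp_all add: cells_def Cat_sel)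
  note [simp] = F2N(2,3)
  have c: "ncomp (F2 N (\<alpha>, \<beta>)) ?x \<in> chom (F0 N (?A', ?B')) (fob (F1 N (?a, ?b)) ?x) (fob (F1 N (?a', ?b')) ?x)"
    using natural_transformation.ncomp_chom[OF F2N(1), of ?x] by simp
  note g = far_null_cell[OF AB(3,4) c]
  have n2: "n \<in> null_mor I (trg1 L ?a') (src1 L ?b')" using n by simp
  note nus = nu_iso[OF ab(1,2) n] and nut = nu_iso[OF ab(3,4) n2]
  note t = T1_nattrans[OF ab(1,2)] and t' = T1_nattrans[OF ab(3,4)]
  have tsrc: "nsrc (T1 T (?a, ?b)) = comp1 Cat (hom_func L ?a ?b) (T0 T (?A, ?B))" by (rule t(2))
  have cid: "ncomp (id2 Cat (T0 T (?A, ?B))) ?x = id2 L n" using x by simp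
  have "vcomp Cat (T1 T (?a', ?b')) (hcomp Cat (hom_nattrans L \<alpha> \<beta>) (id2 Cat (T0 T (?A, ?B))))
     = vcomp Cat (hcomp Cat (id2 Cat (T0 T (?A', ?B'))) (F2 N (\<alpha>, \<beta>))) (T1 T (?a, ?b))"
    using pseudonatural.T1_natural[OF T_pseudonatural hom_P[OF ab(1,2)] ca] by simp
  then have "ncomp (vcomp Cat (T1 T (?a', ?b')) (hcomp Cat (hom_nattrans L \<alpha> \<beta>) (id2 Cat (T0 T (?A, ?B))))) ?x
     = ncomp (vcomp Cat (hcomp Cat (id2 Cat (T0 T (?A', ?B'))) (F2 N (\<alpha>, \<beta>))) (T1 T (?a, ?b))) ?x"
    by (rule arg_cong)
  then have eq: "nu L I ?b' n ?a' \<bullet> (\<beta> \<star> id2 L n \<star> \<alpha>) = far (T0 T (?A', ?B')) (ncomp (F2 N (\<alpha>, \<beta>)) ?x) \<bullet> nu L I ?b n ?a"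
    using n' g by (simp add: tsrc hom_iff nu_def cid)
  have "nu L I ?b' n ?a' \<bullet> (\<beta> \<star> id2 L n \<star> \<alpha>) \<bullet> inv2 L (nu L I ?b n ?a) = (nu L I ?b' n ?a' \<bullet> (\<beta> \<star> id2 L n \<star> \<alpha>)) \<bullet> inv2 L (nu L I ?b n ?a)"
    using nus nut n' by simp
  also have "\<dots> = far (T0 T (?A', ?B')) (ncomp (F2 N (\<alpha>, \<beta>)) ?x)"
    unfolding eq using nus g by (simp add: tilde_def)
  finally show ?thesis using g(1) by simp
qed

text \<open>The null isomorphism \<open>\<zeta>\<close> is the inclusion of the composition
  constraint of \<open>N\<close> at the preimage of \<open>n\<close>. The equation is the
  composition axiom of pseudonaturality evaluated there, where the constraint of \<open>Hom\<close>
  is an identity.\<close>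

lemma nu_comp:
  assumes [simp]: "a \<in> Mor L" "b \<in> Mor L" "a' \<in> Mor L" "b' \<in> Mor L" "trg1 L a' = src1 L a" "src1 L b' = trg1 L b"
    and n: "n \<in> null_mor I (trg1 L a) (src1 L b)"
  obtains \<zeta> where "\<zeta> \<in> null_isos I (src1 L a') (trg1 L b')" "src2 L \<zeta> = tilde L I b' (tilde L I b n a) a'"
    "nu L I (b' \<cdot> b) n (a \<cdot> a') = \<zeta> \<bullet> nu L I b' (tilde L I b n a) a' \<bullet> (id2 L b' \<star> nu L I b n a \<star> id2 L a')"
proof -
  let ?A = "trg1 L a" and ?B = "src1 L b" and ?A' = "src1 L a" and ?B' = "trg1 L b" and ?A'' = "src1 L a'" and ?B'' = "trg1 L b'"
  have AB: "?A \<in> Obj L" "?B \<in> Obj L" "?A' \<in> Obj L" "?B' \<in> Obj L" "?A'' \<in> Obj L" "?B'' \<in> Obj L" by simp_all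
  let ?x = "null_obj I ?A ?B n"
  have x [simp]: "?x \<in> cobj (F0 N (?A, ?B))" "fob (T0 T (?A, ?B)) ?x = n" using null_obj[OF AB(1,2) n] by simp_all
  note n' = null_mor_hom[OF AB(1,2) n]
  note [simp] = T0_functor[OF AB(1,2)] T0_functor[OF AB(3,4)] T0_functor[OF AB(5,6)]
  note [simp] = N1_functor(2,3)[OF assms(1,2)]
  have N' [simp]: "fdom (F1 N (a', b')) = F0 N (?A', ?B')" "fcod (F1 N (a', b')) = F0 N (?A'', ?B'')"
    using N1_functor(2,3)[OF assms(3,4)] by simp_all
  have hf: "(a, b) \<in> hom P (?A, ?B) (?A', ?B')" by (rule hom_P) simp_all
  have hg: "(a', b') \<in> hom P (?A', ?B') (?A'', ?B'')" using hom_P[of a' b'] by simp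
  let ?C = "Fcomp N (a', b') (a, b)"
  have C: "natural_transformation ?C" "nsrc ?C = comp1 Cat (F1 N (a', b')) (F1 N (a, b))" "ntrg ?C = F1 N (a \<cdot> a', b' \<cdot> b)"
    and "\<exists>S. is_inv2 Cat ?C S"
    using pseudofunctor.Fcomp_isos[OF N_pseudofunctor hf hg] by (auto simp: isos_def cells_def Cat_sel)
  then obtain S where S: "is_inv2 Cat ?C S" by blast
  then have S1: "natural_transformation S" "nsrc S = ntrg ?C" "ntrg S = nsrc ?C"
    and S2: "vcomp Cat S ?C = id2 Cat (nsrc ?C)" "vcomp Cat ?C S = id2 Cat (ntrg ?C)"
    by (simp_all add: is_inv2_def cells_def Cat_sel)
  have o1: "fob (F1 N (a, b)) ?x \<in> cobj (F0 N (?A', ?B'))"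
    using cat_functor.fob_cobj[OF N1_functor(1)[OF assms(1,2)], of ?x] by simp
  have fd: "fdom (F1 N (a \<cdot> a', b' \<cdot> b)) = F0 N (?A, ?B)" "fcod (F1 N (a \<cdot> a', b' \<cdot> b)) = F0 N (?A'', ?B'')"
    using N1_functor(2,3)[of "a \<cdot> a'" "b' \<cdot> b"] by simp_all
  let ?y = "fob (F1 N (a', b')) (fob (F1 N (a, b)) ?x)" and ?z = "fob (F1 N (a \<cdot> a', b' \<cdot> b)) ?x"
  have c: "ncomp ?C ?x \<in> chom (F0 N (?A'', ?B'')) ?y ?z"
    using natural_transformation.ncomp_chom[OF C(1), of ?x] C by simp
  have d: "ncomp S ?x \<in> chom (F0 N (?A'', ?B'')) ?z ?y"
    using natural_transformation.ncomp_chom[OF S1(1), of ?x] C S1 fd by simp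
  have "ccomp (F0 N (?A'', ?B'')) (ncomp S ?x) (ncomp ?C ?x) = cid (F0 N (?A'', ?B'')) ?y"
    using arg_cong[OF S2(1), of "\<lambda>V. ncomp V ?x"] C by simp
  moreover have "ccomp (F0 N (?A'', ?B'')) (ncomp ?C ?x) (ncomp S ?x) = cid (F0 N (?A'', ?B'')) ?z"
    using arg_cong[OF S2(2), of "\<lambda>V. ncomp V ?x"] C S1 fd by simp
  ultimately have "ncomp ?C ?x \<in> cisos (F0 N (?A'', ?B'')) ?y ?z" using c d by (auto simp: cisos_def)
  then have null: "far (T0 T (?A'', ?B'')) (ncomp ?C ?x) \<in> null_isos I ?A'' ?B''"
    using far_null_cell[OF AB(5,6) c] by (auto simp: null_isos_def)
  note nuf = nu_iso[OF assms(1,2) n]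
  have n1: "tilde L I b n a \<in> null_mor I (trg1 L a') (src1 L b')" using nuf by simp
  note nug = nu_iso[OF assms(3,4) n1]
  have no: "null_obj I ?A' ?B' (tilde L I b n a) = fob (F1 N (a, b)) ?x" by (rule nuf(5))
  have t: "nsrc (T1 T (a, b)) = comp1 Cat (hom_func L a b) (T0 T (?A, ?B))" "ntrg (T1 T (a, b)) = comp1 Cat (T0 T (?A', ?B')) (F1 N (a, b))"
    using T1_nattrans[OF assms(1,2)] by auto
  have tg: "nsrc (T1 T (a', b')) = comp1 Cat (hom_func L a' b') (T0 T (?A', ?B'))"
    using T1_nattrans[OF assms(3,4)] by simp
  have tgf: "nsrc (T1 T (a \<cdot> a', b' \<cdot> b)) = comp1 Cat (hom_func L (a \<cdot> a') (b' \<cdot> b)) (T0 T (?A, ?B))"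
    using T1_nattrans[of "a \<cdot> a'" "b' \<cdot> b"] by simp
  have "vcomp Cat (T1 T (a \<cdot> a', b' \<cdot> b)) (hcomp Cat (id2 Cat (hom_func L (a \<cdot> a') (b' \<cdot> b))) (id2 Cat (T0 T (?A, ?B))))
     = vcomp Cat (hcomp Cat (id2 Cat (T0 T (?A'', ?B''))) ?C) (vcomp Cat (hcomp Cat (T1 T (a', b')) (id2 Cat (F1 N (a, b))))
         (hcomp Cat (id2 Cat (hom_func L a' b')) (T1 T (a, b))))"
    using pseudonatural.T1_comp[OF T_pseudonatural hf hg] by simp
  then have "ncomp (vcomp Cat (T1 T (a \<cdot> a', b' \<cdot> b)) (hcomp Cat (id2 Cat (hom_func L (a \<cdot> a') (b' \<cdot> b))) (id2 Cat (T0 T (?A, ?B))))) ?x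
     = ncomp (vcomp Cat (hcomp Cat (id2 Cat (T0 T (?A'', ?B''))) ?C) (vcomp Cat (hcomp Cat (T1 T (a', b')) (id2 Cat (F1 N (a, b))))
         (hcomp Cat (id2 Cat (hom_func L a' b')) (T1 T (a, b))))) ?x"
    by (rule arg_cong)
  moreover have "ncomp (T1 T (a \<cdot> a', b' \<cdot> b)) ?x = nu L I (b' \<cdot> b) n (a \<cdot> a')" "ncomp (T1 T (a, b)) ?x = nu L I b n a"
    "ncomp (T1 T (a', b')) (fob (F1 N (a, b)) ?x) = nu L I b' (tilde L I b n a) a'"
    using no by (simp_all add: nu_def)
  moreover have "n \<in> null_mor I (trg1 L (a \<cdot> a')) (src1 L (b' \<cdot> b))" using n by simp
  note nugf = nu_iso[OF _ _ this, simplified]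
  have til: "fob (T0 T (?A', ?B')) (fob (F1 N (a, b)) ?x) = tilde L I b n a" by (simp add: tilde_def)
  have ch: "ncomp (id2 Cat (F1 N (a, b))) ?x = cid (F0 N (?A', ?B')) (fob (F1 N (a, b)) ?x)" by simp
  have T0cid: "far (T0 T (?A', ?B')) (cid (F0 N (?A', ?B')) (fob (F1 N (a, b)) ?x)) = id2 L (tilde L I b n a)"
    using cat_functor.far_cid[OF T0_functor(1)[OF AB(3,4)], of "fob (F1 N (a, b)) ?x"] o1 til by simp
  have cc: "cid (F0 N (?A', ?B')) (fob (F1 N (a, b)) ?x) \<in> carr (F0 N (?A', ?B'))"
    using category.cid_chom[OF cat_functor.fdom_category[OF T0_functor(1)[OF AB(3,4)]]] o1 by (simp add: chom_def)
  note m = null_mor_hom[OF AB(3,4) nuf(4)]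
  note f = far_null_cell[OF AB(5,6) c]
  have til2: "fob (T0 T (?A'', ?B'')) ?y = tilde L I b' (tilde L I b n a) a'"
    unfolding no[symmetric] by (simp add: tilde_def[of L I b' "tilde L I b n a" a'])
  ultimately have "nu L I (b' \<cdot> b) n (a \<cdot> a') = far (T0 T (?A'', ?B'')) (ncomp ?C ?x) \<bullet> nu L I b' (tilde L I b n a) a' \<bullet> (id2 L b' \<star> nu L I b n a \<star> id2 L a')"
    using n' o1 C(2,3) nuf nug nugf m f cc by (simp add: t tg tgf hom_iff T0cid til til2 fd)
  then show thesis using that[OF null] f(3) til2 by simp
qed

text \<open>Normality of \<open>N\<close> enters here: it makes the unit constraint an identity, so
  the unit axiom of pseudonaturality leaves an identity 2-cell.\<close>

lemma nu_one:
  assumes AB: "A \<in> Obj L" "B \<in> Obj L" and n: "n \<in> null_mor I A B"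
  shows "nu L I (one L B) n (one L A) = id2 L n"
proof -
  let ?x = "null_obj I A B n"
  have x [simp]: "?x \<in> cobj (F0 N (A, B))" "fob (T0 T (A, B)) ?x = n" using null_obj[OF AB n] by simp_all
  note n' = null_mor_hom[OF AB n]
  note [simp] = T0_functor[OF AB] AB
  have o: "(A, B) \<in> Obj P" by simp
  have u: "Funit N (A, B) = id2 Cat (one Cat (F0 N (A, B)))" and F1: "F1 N (one L A, one L B) = one Cat (F0 N (A, B))"
    using N_normal o by (auto simp: normal_psfun_def)
  have t: "nsrc (T1 T (one L A, one L B)) = comp1 Cat (hom_func L (one L A) (one L B)) (T0 T (A, B))"
    using T1_nattrans[of "one L A" "one L B"] by simp
  have "vcomp Cat (T1 T (one L A, one L B)) (hcomp Cat (id2 Cat (one Cat (hom_cat L A B))) (id2 Cat (T0 T (A, B))))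
    = hcomp Cat (id2 Cat (T0 T (A, B))) (id2 Cat (one Cat (F0 N (A, B))))"
    using pseudonatural.T1_one[OF T_pseudonatural o] u by simp
  then have "ncomp (vcomp Cat (T1 T (one L A, one L B)) (hcomp Cat (id2 Cat (one Cat (hom_cat L A B))) (id2 Cat (T0 T (A, B))))) ?x
    = ncomp (hcomp Cat (id2 Cat (T0 T (A, B))) (id2 Cat (one Cat (F0 N (A, B))))) ?x" by (rule arg_cong)
  moreover have "far (T0 T (A, B)) (cid (F0 N (A, B)) ?x) = id2 L n"
    using cat_functor.far_cid[OF T0_functor(1)[OF AB], of ?x] by simp
  moreover have "ncomp (T1 T (one L A, one L B)) ?x = nu L I (one L B) n (one L A)" by (simp add: nu_def)
  moreover have "src2 L (nu L I (one L B) n (one L A)) = n" "nu L I (one L B) n (one L A) \<in> Cell L"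
    using nu_iso[of "one L A" "one L B" n] n n' by simp_all
  ultimately show ?thesis using n' by (simp add: hom_iff)
qed

end

text \<open>The null morphism is not stored separately: it is the target of the 2-cell.\<close>

definition null_structures :: "('o, 'm, 'c) two_cat \<Rightarrow> ('o, 'm, 'c) ideal \<Rightarrow> 'c set" where
  "null_structures L I = {x. iso2 L x \<and> trg2 L x \<in> null_mor I (src1 L (src2 L x)) (trg1 L (src2 L x))}"

definition null_between :: "('o, 'm, 'c) two_cat \<Rightarrow> ('o, 'm, 'c) ideal \<Rightarrow> 'c \<Rightarrow> 'c \<Rightarrow> 'c \<Rightarrow> bool" where
  "null_between L I x \<alpha> y \<longleftrightarrow> x \<in> null_structures L I \<and> y \<in> null_structures L I \<and>
     \<alpha> \<in> Cell L \<and> src2 L \<alpha> = src2 L x \<and> trg2 L \<alpha> = src2 L y \<and>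
     y \<bullet>\<^bsub>L\<^esub> \<alpha> \<bullet>\<^bsub>L\<^esub> inv2 L x \<in> null_cells I (src1 L (src2 L x)) (trg1 L (src2 L x))"

definition act_right :: "('o, 'm, 'c) two_cat \<Rightarrow> ('o, 'm, 'c) ideal \<Rightarrow> 'c \<Rightarrow> 'm \<Rightarrow> 'c" where
  "act_right L I x a = nu L I (one L (trg1 L (src2 L x))) (trg2 L x) a \<bullet>\<^bsub>L\<^esub> (x \<lhd>\<^bsub>L\<^esub> a)"

definition act_left :: "('o, 'm, 'c) two_cat \<Rightarrow> ('o, 'm, 'c) ideal \<Rightarrow> 'm \<Rightarrow> 'c \<Rightarrow> 'c" where
  "act_left L I b x = nu L I b (trg2 L x) (one L (src1 L (src2 L x))) \<bullet>\<^bsub>L\<^esub> (b \<rhd>\<^bsub>L\<^esub> x)"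

context ideal
begin

abbreviation "NS \<equiv> null_structures L I"
abbreviation "nc \<equiv> null_between L I"
abbreviation "ar \<equiv> act_right L I"
abbreviation "al \<equiv> act_left L I"

lemma NS_bd:
  assumes "x \<in> NS"
  shows "iso2 L x" "trg2 L x \<in> null_mor I (src1 L (src2 L x)) (trg1 L (src2 L x))"
    "trg2 L x \<in> Mor L" "src2 L x \<in> Mor L" "src1 L (trg2 L x) = src1 L (src2 L x)" "trg1 L (trg2 L x) = trg1 L (src2 L x)"
  using assms by (simp_all add: null_structures_def)

text \<open>The two sides of each associativity axiom of \<open>nullity\<close> are compared by null
  isomorphisms obtained from \<open>nu_comp\<close>. This turns such a difference of structures into
  the statement that an identity is a null isomorphism between them.\<close>

lemma nci_null_iso:
  assumes x: "x \<in> NS" and y: "y \<in> Cell L" "src2 L y = src2 L x"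
    and \<zeta>: "\<zeta> \<in> null_isos I (src1 L (src2 L x)) (trg1 L (src2 L x))" and eq: "y = \<zeta> \<bullet> x" "src2 L \<zeta> = trg2 L x"
  shows "nci L nc x (id2 L (src2 L x)) y"
proof -
  note [simp] = NS_bd[OF x]
  let ?A = "src1 L (src2 L x)" and ?B = "trg1 L (src2 L x)"
  have z: "iso2 L \<zeta>" "\<zeta> \<in> null_cells I ?A ?B" "inv2 L \<zeta> \<in> null_cells I ?A ?B" using \<zeta> null_isos_iff by simp_all
  note [simp] = z(1) eq(2)
  have t: "trg2 L y = trg2 L \<zeta>" "src2 L y = src2 L x" unfolding eq(1) by simp_all
  have iy: "iso2 L y" unfolding eq(1) by simp
  have yN: "y \<in> NS" using null_cells_bd(3)[OF _ _ z(2)] t iy by (simp add: null_structures_def)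
  have 1: "y \<bullet> id2 L (src2 L x) \<bullet> inv2 L x = \<zeta>" unfolding eq(1) by simp
  have 2: "x \<bullet> id2 L (src2 L x) \<bullet> inv2 L y = inv2 L \<zeta>" unfolding eq(1) by simp
  show ?thesis using x yN t z 1 2 by (simp add: nci_def null_between_def)
qed

lemma ar_bd:
  assumes x: "x \<in> NS" and a: "a \<in> Mor L" "trg1 L a = src1 L (src2 L x)"
  shows "ar x a \<in> NS" "src2 L (ar x a) = src2 L x \<cdot> a" "trg2 L (ar x a) = tilde L I (one L (trg1 L (src2 L x))) (trg2 L x) a"
    "iso2 L (nu L I (one L (trg1 L (src2 L x))) (trg2 L x) a)" "src2 L (nu L I (one L (trg1 L (src2 L x))) (trg2 L x) a) = trg2 L x \<cdot> a"
    "trg2 L (nu L I (one L (trg1 L (src2 L x))) (trg2 L x) a) = tilde L I (one L (trg1 L (src2 L x))) (trg2 L x) a"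
    "tilde L I (one L (trg1 L (src2 L x))) (trg2 L x) a \<in> null_mor I (src1 L a) (trg1 L (src2 L x))"
proof -
  note [simp] = NS_bd(1,3-6)[OF x] a
  have n: "trg2 L x \<in> null_mor I (trg1 L a) (src1 L (one L (trg1 L (src2 L x))))" using NS_bd(2)[OF x] by simp
  note nu = nu_iso[OF a(1) _ n]
  show *: "iso2 L (nu L I (one L (trg1 L (src2 L x))) (trg2 L x) a)" "src2 L (nu L I (one L (trg1 L (src2 L x))) (trg2 L x) a) = trg2 L x \<cdot> a"
    "trg2 L (nu L I (one L (trg1 L (src2 L x))) (trg2 L x) a) = tilde L I (one L (trg1 L (src2 L x))) (trg2 L x) a"
    "tilde L I (one L (trg1 L (src2 L x))) (trg2 L x) a \<in> null_mor I (src1 L a) (trg1 L (src2 L x))"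
    using nu by simp_all
  then show "ar x a \<in> NS" "src2 L (ar x a) = src2 L x \<cdot> a" "trg2 L (ar x a) = tilde L I (one L (trg1 L (src2 L x))) (trg2 L x) a"
    by (simp_all add: act_right_def null_structures_def)
qed

lemma al_bd:
  assumes x: "x \<in> NS" and b: "b \<in> Mor L" "src1 L b = trg1 L (src2 L x)"
  shows "al b x \<in> NS" "src2 L (al b x) = b \<cdot> src2 L x" "trg2 L (al b x) = tilde L I b (trg2 L x) (one L (src1 L (src2 L x)))"
    "iso2 L (nu L I b (trg2 L x) (one L (src1 L (src2 L x))))" "src2 L (nu L I b (trg2 L x) (one L (src1 L (src2 L x)))) = b \<cdot> trg2 L x"
    "trg2 L (nu L I b (trg2 L x) (one L (src1 L (src2 L x)))) = tilde L I b (trg2 L x) (one L (src1 L (src2 L x)))"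
    "tilde L I b (trg2 L x) (one L (src1 L (src2 L x))) \<in> null_mor I (src1 L (src2 L x)) (trg1 L b)"
proof -
  note [simp] = NS_bd(1,3-6)[OF x] b
  have n: "trg2 L x \<in> null_mor I (trg1 L (one L (src1 L (src2 L x)))) (src1 L b)" using NS_bd(2)[OF x] by simp
  note nu = nu_iso[OF _ b(1) n]
  show *: "iso2 L (nu L I b (trg2 L x) (one L (src1 L (src2 L x))))" "src2 L (nu L I b (trg2 L x) (one L (src1 L (src2 L x)))) = b \<cdot> trg2 L x"
    "trg2 L (nu L I b (trg2 L x) (one L (src1 L (src2 L x)))) = tilde L I b (trg2 L x) (one L (src1 L (src2 L x)))"
    "tilde L I b (trg2 L x) (one L (src1 L (src2 L x))) \<in> null_mor I (src1 L (src2 L x)) (trg1 L b)"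
    using nu by simp_all
  then show "al b x \<in> NS" "src2 L (al b x) = b \<cdot> src2 L x" "trg2 L (al b x) = tilde L I b (trg2 L x) (one L (src1 L (src2 L x)))"
    by (simp_all add: act_left_def null_structures_def)
qed

lemma nc_vcomp':
  assumes a: "nc x \<alpha> y" "nc y \<beta> z"
  shows "nc x (\<beta> \<bullet> \<alpha>) z"
proof -
  from a have b: "x \<in> NS" "y \<in> NS" "z \<in> NS" "\<alpha> \<in> Cell L" "src2 L \<alpha> = src2 L x" "trg2 L \<alpha> = src2 L y"
    "\<beta> \<in> Cell L" "src2 L \<beta> = src2 L y" "trg2 L \<beta> = src2 L z" by (simp_all add: null_between_def)
  note [simp] = b NS_bd(1,3-6)[OF b(1)] NS_bd(1,3-6)[OF b(2)] NS_bd(1,3-6)[OF b(3)]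
  have p: "src1 L (src2 L y) = src1 L (src2 L x)" "trg1 L (src2 L y) = trg1 L (src2 L x)"
    using src1_trg2[of \<alpha>] trg1_trg2[of \<alpha>] by simp_all
  have "(z \<bullet> \<beta> \<bullet> inv2 L y) \<bullet> (y \<bullet> \<alpha> \<bullet> inv2 L x) \<in> null_cells I (src1 L (src2 L x)) (trg1 L (src2 L x))"
    using a p by (rule_tac null_cells_vcomp) (simp_all add: null_between_def)
  then show ?thesis by (simp add: null_between_def)
qed

lemma NS_iso': "x \<in> NS \<Longrightarrow> x \<in> Cell L"
  by (simp add: null_structures_def)

lemma nullity: "nullity L NS nc al ar"
proof
  fix x assume "x \<in> NS" then show "iso2 L x" by (rule NS_bd)
next
  fix x \<alpha> y assume "nc x \<alpha> y"
  then show "x \<in> NS \<and> y \<in> NS \<and> \<alpha> \<in> Cell L \<and> src2 L \<alpha> = src2 L x \<and> trg2 L \<alpha> = src2 L y" by (simp add: null_between_def)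
next
  fix x assume x: "x \<in> NS"
  note [simp] = NS_bd(1,3-6)[OF x]
  show "nc x (id2 L (src2 L x)) x"
    using x null_cells_id[OF _ _ NS_bd(2)[OF x]] by (simp add: null_between_def)
next
  fix x \<alpha> y \<beta> z assume "nc x \<alpha> y" "nc y \<beta> z"
  then show "nc x (\<beta> \<bullet> \<alpha>) z" by (rule nc_vcomp')
next
  fix x \<alpha> assume x: "x \<in> NS" and [simp]: "iso2 L \<alpha>" "src2 L \<alpha> = src2 L x"
  note [simp] = NS_bd(1,3-6)[OF x]
  have [simp]: "src1 L (trg2 L \<alpha>) = src1 L (src2 L x)" "trg1 L (trg2 L \<alpha>) = trg1 L (src2 L x)"
    using src1_trg2[of \<alpha>] trg1_trg2[of \<alpha>] by simp_all
  \<comment> \<open>The transported structure keeps the null morphism of \<open>x\<close> as its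
    target, so the conjugate of \<open>\<alpha>\<close> is the identity of that null
    morphism.\<close>
  have y: "x \<bullet> inv2 L \<alpha> \<in> NS" using NS_bd(2)[OF x] by (simp add: null_structures_def)
  have "nci L nc x \<alpha> (x \<bullet> inv2 L \<alpha>)"
    using x y null_cells_id[OF _ _ NS_bd(2)[OF x]] by (simp add: nci_def null_between_def)
  then show "\<exists>y. nci L nc x \<alpha> y" by blast
next
  fix x a assume "x \<in> NS" "a \<in> Mor L" "trg1 L a = src1 L (src2 L x)"
  then show "ar x a \<in> NS \<and> src2 L (ar x a) = src2 L x \<cdot> a" using ar_bd by simp
next
  fix x b assume "x \<in> NS" "b \<in> Mor L" "src1 L b = trg1 L (src2 L x)"
  then show "al b x \<in> NS \<and> src2 L (al b x) = b \<cdot> src2 L x" using al_bd by simp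
next
  fix x \<alpha> y a assume n: "nc x \<alpha> y" and a [simp]: "a \<in> Mor L" "trg1 L a = src1 L (src2 L x)"
  from n have b: "x \<in> NS" "y \<in> NS" "\<alpha> \<in> Cell L" "src2 L \<alpha> = src2 L x" "trg2 L \<alpha> = src2 L y"
    and z: "y \<bullet> \<alpha> \<bullet> inv2 L x \<in> null_cells I (src1 L (src2 L x)) (trg1 L (src2 L x))" by (simp_all add: null_between_def)
  note [simp] = b NS_bd(1,3-6)[OF b(1)] NS_bd(1,3-6)[OF b(2)]
  have p [simp]: "src1 L (src2 L y) = src1 L (src2 L x)" "trg1 L (src2 L y) = trg1 L (src2 L x)"
    using src1_trg2[of \<alpha>] trg1_trg2[of \<alpha>] by simp_all
  have a': "trg1 L a = src1 L (src2 L y)" by simp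
  note [simp] = ar_bd(1-6)[OF b(1) a] ar_bd(1-6)[OF b(2) a(1) a', unfolded p]
  let ?o = "one L (trg1 L (src2 L x))"
  have "nu L I ?o (trg2 L (y \<bullet> \<alpha> \<bullet> inv2 L x)) a \<bullet> (id2 L ?o \<star> (y \<bullet> \<alpha> \<bullet> inv2 L x) \<star> id2 L a) \<bullet> inv2 L (nu L I ?o (src2 L (y \<bullet> \<alpha> \<bullet> inv2 L x)) a)
     \<in> null_cells I (src1 L a) (trg1 L ?o)"
    by (rule nu_natural) (use z in simp_all)
  then show "nc (ar x a) (\<alpha> \<star> id2 L a) (ar y a)" by (simp add: null_between_def) (simp add: act_right_def)
next
  fix x \<alpha> y a assume n: "nc x \<alpha> y" and a [simp]: "a \<in> Mor L" "src1 L a = trg1 L (src2 L x)"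
  from n have b: "x \<in> NS" "y \<in> NS" "\<alpha> \<in> Cell L" "src2 L \<alpha> = src2 L x" "trg2 L \<alpha> = src2 L y"
    and z: "y \<bullet> \<alpha> \<bullet> inv2 L x \<in> null_cells I (src1 L (src2 L x)) (trg1 L (src2 L x))" by (simp_all add: null_between_def)
  note [simp] = b NS_bd(1,3-6)[OF b(1)] NS_bd(1,3-6)[OF b(2)]
  have p [simp]: "src1 L (src2 L y) = src1 L (src2 L x)" "trg1 L (src2 L y) = trg1 L (src2 L x)"
    using src1_trg2[of \<alpha>] trg1_trg2[of \<alpha>] by simp_all
  have a': "src1 L a = trg1 L (src2 L y)" by simp
  note [simp] = al_bd(1-6)[OF b(1) a] al_bd(1-6)[OF b(2) a(1) a', unfolded p]
  let ?o = "one L (src1 L (src2 L x))"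
  have "nu L I a (trg2 L (y \<bullet> \<alpha> \<bullet> inv2 L x)) ?o \<bullet> (id2 L a \<star> (y \<bullet> \<alpha> \<bullet> inv2 L x) \<star> id2 L ?o) \<bullet> inv2 L (nu L I a (src2 L (y \<bullet> \<alpha> \<bullet> inv2 L x)) ?o)
     \<in> null_cells I (src1 L ?o) (trg1 L a)"
    by (rule nu_natural) (use z in simp_all)
  then show "nc (al a x) (id2 L a \<star> \<alpha>) (al a y)" by (simp add: null_between_def) (simp add: act_left_def)
next
  fix x \<alpha> assume x: "x \<in> NS" and \<alpha> [simp]: "\<alpha> \<in> Cell L" "trg1 L (src2 L \<alpha>) = src1 L (src2 L x)"
  note [simp] = x NS_bd(1,3-6)[OF x]
  have s: "src2 L \<alpha> \<in> Mor L" "trg2 L \<alpha> \<in> Mor L" "trg1 L (trg2 L \<alpha>) = src1 L (src2 L x)" by simp_all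
  note [simp] = ar_bd(1-6)[OF x s(1) \<alpha>(2)] ar_bd(1-6)[OF x s(2,3)]
  let ?o = "one L (trg1 L (src2 L x))"
  have "nu L I (trg2 L (id2 L ?o)) (trg2 L x) (trg2 L \<alpha>) \<bullet> (id2 L ?o \<star> id2 L (trg2 L x) \<star> \<alpha>) \<bullet> inv2 L (nu L I (src2 L (id2 L ?o)) (trg2 L x) (src2 L \<alpha>))
    \<in> null_cells I (src1 L (src2 L \<alpha>)) (trg1 L (src2 L (id2 L ?o)))"
    by (rule nu_natural2) (use NS_bd(2)[OF x] in simp_all)
  moreover have "(x \<star> id2 L (trg2 L \<alpha>)) \<bullet> (id2 L (src2 L x) \<star> \<alpha>) = (id2 L (trg2 L x) \<star> \<alpha>) \<bullet> (x \<star> id2 L (src2 L \<alpha>))"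
    by (rule exch) simp_all
  \<comment> \<open>The exchange law with an arbitrary tail \<open>\<gamma>\<close>, the form in
    which it applies inside a right-nested composite.\<close>
  then have "(x \<star> id2 L (trg2 L \<alpha>)) \<bullet> (id2 L (src2 L x) \<star> \<alpha>) \<bullet> (inv2 L x \<star> id2 L (src2 L \<alpha>)) \<bullet> \<gamma> = (id2 L (trg2 L x) \<star> \<alpha>) \<bullet> \<gamma>"
    if "\<gamma> \<in> Cell L" "trg2 L \<gamma> = trg2 L x \<cdot> src2 L \<alpha>" for \<gamma>
    using that by (simp flip: vassoc) simp
  ultimately show "nc (ar x (src2 L \<alpha>)) (id2 L (src2 L x) \<star> \<alpha>) (ar x (trg2 L \<alpha>))"
    by (simp add: null_between_def) (simp add: act_right_def)
next
  fix x \<alpha> assume x: "x \<in> NS" and \<alpha> [simp]: "\<alpha> \<in> Cell L" "src1 L (src2 L \<alpha>) = trg1 L (src2 L x)"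
  note [simp] = x NS_bd(1,3-6)[OF x]
  have s: "src2 L \<alpha> \<in> Mor L" "trg2 L \<alpha> \<in> Mor L" "src1 L (trg2 L \<alpha>) = trg1 L (src2 L x)" by simp_all
  note [simp] = al_bd(1-6)[OF x s(1) \<alpha>(2)] al_bd(1-6)[OF x s(2,3)]
  let ?o = "one L (src1 L (src2 L x))"
  have "nu L I (trg2 L \<alpha>) (trg2 L x) (trg2 L (id2 L ?o)) \<bullet> (\<alpha> \<star> id2 L (trg2 L x) \<star> id2 L ?o) \<bullet> inv2 L (nu L I (src2 L \<alpha>) (trg2 L x) (src2 L (id2 L ?o)))
    \<in> null_cells I (src1 L (src2 L (id2 L ?o))) (trg1 L (src2 L \<alpha>))"
    by (rule nu_natural2) (use NS_bd(2)[OF x] in simp_all)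
  moreover have "(id2 L (trg2 L \<alpha>) \<star> x) \<bullet> (\<alpha> \<star> id2 L (src2 L x)) = (\<alpha> \<star> id2 L (trg2 L x)) \<bullet> (id2 L (src2 L \<alpha>) \<star> x)"
    by (rule exch[symmetric]) simp_all
  then have "(id2 L (trg2 L \<alpha>) \<star> x) \<bullet> (\<alpha> \<star> id2 L (src2 L x)) \<bullet> (id2 L (src2 L \<alpha>) \<star> inv2 L x) \<bullet> \<gamma> = (\<alpha> \<star> id2 L (trg2 L x)) \<bullet> \<gamma>"
    if "\<gamma> \<in> Cell L" "trg2 L \<gamma> = src2 L \<alpha> \<cdot> trg2 L x" for \<gamma>
    using that by (simp flip: vassoc) simp
  ultimately show "nc (al (src2 L \<alpha>) x) (\<alpha> \<star> id2 L (src2 L x)) (al (trg2 L \<alpha>) x)"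
    by (simp add: null_between_def) (simp add: act_left_def)
next
  fix x a a' assume x: "x \<in> NS" and a [simp]: "a \<in> Mor L" "trg1 L a = src1 L (src2 L x)" and a' [simp]: "a' \<in> Mor L" "trg1 L a' = src1 L a"
  note [simp] = x NS_bd(1,3-6)[OF x] ar_bd(1-6)[OF x a]
  have a'': "trg1 L a' = src1 L (src2 L (ar x a))" "trg1 L (a \<cdot> a') = src1 L (src2 L x)" "a \<cdot> a' \<in> Mor L" by simp_all
  have t [simp]: "trg1 L (src2 L (ar x a)) = trg1 L (src2 L x)" by simp
  note [simp] = ar_bd(1-6)[OF ar_bd(1)[OF x a] a'(1) a''(1), unfolded t ar_bd(3)[OF x a]] ar_bd(1-6)[OF x a''(3,2)]
  let ?o = "one L (trg1 L (src2 L x))"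
  obtain \<zeta> where z: "\<zeta> \<in> null_isos I (src1 L a') (trg1 L ?o)" "src2 L \<zeta> = tilde L I ?o (tilde L I ?o (trg2 L x) a) a'"
    "nu L I (?o \<cdot> ?o) (trg2 L x) (a \<cdot> a') = \<zeta> \<bullet> nu L I ?o (tilde L I ?o (trg2 L x) a) a' \<bullet> (id2 L ?o \<star> nu L I ?o (trg2 L x) a \<star> id2 L a')"
    by (rule nu_comp[of a ?o a' ?o "trg2 L x"]) (use NS_bd(2)[OF x] in simp_all)
  have [simp]: "iso2 L \<zeta>" using z(1) null_isos_iff by simp
  have e: "ar x (a \<cdot> a') = \<zeta> \<bullet> ar (ar x a) a'"
    using z by (simp add: act_right_def)
  have "nci L nc (ar (ar x a) a') (id2 L (src2 L (ar (ar x a) a'))) (ar x (a \<cdot> a'))"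
    by (rule nci_null_iso[OF _ _ _ _ e]) (use z(1,2) NS_iso' in simp_all)
  then show "nci L nc (ar (ar x a) a') (id2 L (src2 L x \<cdot> a \<cdot> a')) (ar x (a \<cdot> a'))" by simp
next
  fix x b b' assume x: "x \<in> NS" and b [simp]: "b \<in> Mor L" "src1 L b = trg1 L (src2 L x)" and b' [simp]: "b' \<in> Mor L" "src1 L b' = trg1 L b"
  note [simp] = x NS_bd(1,3-6)[OF x] al_bd(1-6)[OF x b]
  have b'': "src1 L b' = trg1 L (src2 L (al b x))" "src1 L (b' \<cdot> b) = trg1 L (src2 L x)" "b' \<cdot> b \<in> Mor L" by simp_all
  have t [simp]: "src1 L (src2 L (al b x)) = src1 L (src2 L x)" by simp
  note [simp] = al_bd(1-6)[OF al_bd(1)[OF x b] b'(1) b''(1), unfolded t al_bd(3)[OF x b]] al_bd(1-6)[OF x b''(3,2)]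
  let ?o = "one L (src1 L (src2 L x))"
  obtain \<zeta> where z: "\<zeta> \<in> null_isos I (src1 L ?o) (trg1 L b')" "src2 L \<zeta> = tilde L I b' (tilde L I b (trg2 L x) ?o) ?o"
    "nu L I (b' \<cdot> b) (trg2 L x) (?o \<cdot> ?o) = \<zeta> \<bullet> nu L I b' (tilde L I b (trg2 L x) ?o) ?o \<bullet> (id2 L b' \<star> nu L I b (trg2 L x) ?o \<star> id2 L ?o)"
    by (rule nu_comp[of ?o b ?o b' "trg2 L x"]) (use NS_bd(2)[OF x] in simp_all)
  have [simp]: "iso2 L \<zeta>" using z(1) null_isos_iff by simp
  have e: "al (b' \<cdot> b) x = \<zeta> \<bullet> al b' (al b x)"
    using z by (simp add: act_left_def)
  have "nci L nc (al b' (al b x)) (id2 L (src2 L (al b' (al b x)))) (al (b' \<cdot> b) x)"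
    by (rule nci_null_iso[OF _ _ _ _ e]) (use z(1,2) NS_iso' in simp_all)
  then show "nci L nc (al b' (al b x)) (id2 L (b' \<cdot> b \<cdot> src2 L x)) (al (b' \<cdot> b) x)" by simp
next
  fix x b a assume x: "x \<in> NS" and b [simp]: "b \<in> Mor L" "src1 L b = trg1 L (src2 L x)" and a [simp]: "a \<in> Mor L" "trg1 L a = src1 L (src2 L x)"
  note [simp] = x NS_bd(1,3-6)[OF x] al_bd(1-6)[OF x b] ar_bd(1-6)[OF x a]
  have ab: "trg1 L a = src1 L (src2 L (al b x))" "src1 L b = trg1 L (src2 L (ar x a))" by simp_all
  have t [simp]: "trg1 L (src2 L (al b x)) = trg1 L b" "src1 L (src2 L (ar x a)) = src1 L a" by simp_all
  note [simp] = ar_bd(1-6)[OF al_bd(1)[OF x b] a(1) ab(1), unfolded t al_bd(3)[OF x b]] al_bd(1-6)[OF ar_bd(1)[OF x a] b(1) ab(2), unfolded t ar_bd(3)[OF x a]]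
  let ?n = "trg2 L x" and ?o = "one L (src1 L (src2 L x))" and ?q = "one L (trg1 L (src2 L x))" and ?o' = "one L (src1 L a)" and ?q' = "one L (trg1 L b)"
  have n: "?n \<in> null_mor I (trg1 L a) (src1 L b)" using NS_bd(2)[OF x] by simp
  note [simp] = nu_iso(1-3)[OF a(1) b(1) n]
  \<comment> \<open>The structure given by acting with \<open>b\<close> and \<open>a\<close>
    simultaneously. Each iterated action differs from it by a null isomorphism, by
    \<open>nu_comp\<close> with identities inserted, so the two iterated actions are compared
    through it.\<close>
  let ?y = "nu L I b ?n a \<bullet> (id2 L b \<star> x \<star> id2 L a)"
  obtain \<zeta> where z: "\<zeta> \<in> null_isos I (src1 L a) (trg1 L ?q')" "src2 L \<zeta> = tilde L I ?q' (tilde L I b ?n ?o) a"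
    "nu L I (?q' \<cdot> b) ?n (?o \<cdot> a) = \<zeta> \<bullet> nu L I ?q' (tilde L I b ?n ?o) a \<bullet> (id2 L ?q' \<star> nu L I b ?n ?o \<star> id2 L a)"
    by (rule nu_comp[of ?o b a ?q' ?n]) (use NS_bd(2)[OF x] in simp_all)
  have [simp]: "iso2 L \<zeta>" using z(1) null_isos_iff by simp
  have e: "?y = \<zeta> \<bullet> ar (al b x) a"
    using z by (simp add: act_left_def act_right_def)
  have 1: "nci L nc (ar (al b x) a) (id2 L (src2 L (ar (al b x) a))) ?y"
    by (rule nci_null_iso[OF _ _ _ _ e]) (use z(1,2) NS_iso' in simp_all)
  obtain \<xi> where w: "\<xi> \<in> null_isos I (src1 L ?o') (trg1 L b)" "src2 L \<xi> = tilde L I b (tilde L I ?q ?n a) ?o'"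
    "nu L I (b \<cdot> ?q) ?n (a \<cdot> ?o') = \<xi> \<bullet> nu L I b (tilde L I ?q ?n a) ?o' \<bullet> (id2 L b \<star> nu L I ?q ?n a \<star> id2 L ?o')"
    by (rule nu_comp[of a ?q ?o' b ?n]) (use NS_bd(2)[OF x] in simp_all)
  have [simp]: "iso2 L \<xi>" using w(1) null_isos_iff by simp
  have e': "?y = \<xi> \<bullet> al b (ar x a)"
    using w by (simp add: act_left_def act_right_def)
  have 2: "nci L nc (al b (ar x a)) (id2 L (src2 L (al b (ar x a)))) ?y"
    by (rule nci_null_iso[OF _ _ _ _ e']) (use w(1,2) NS_iso' in simp_all)
  have yN: "?y \<in> NS" using 1 by (simp add: nci_def null_between_def)
  have k: "\<alpha> \<in> NS \<and> \<beta> \<in> NS \<and> nc \<alpha> (id2 L (src2 L \<alpha>)) \<beta> \<and> nc \<beta> (id2 L (src2 L \<alpha>)) \<alpha>" if "nci L nc \<alpha> (id2 L (src2 L \<alpha>)) \<beta>" for \<alpha> \<beta>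
  proof -
    have n: "nc \<alpha> (id2 L (src2 L \<alpha>)) \<beta>" "nc \<beta> (inv2 L (id2 L (src2 L \<alpha>))) \<alpha>" using that by (auto simp: nci_def)
    then have "\<alpha> \<in> NS" "\<beta> \<in> NS" unfolding null_between_def by blast+
    with n show ?thesis using NS_bd(4)[of \<alpha>] by simp
  qed
  have id: "id2 L (b \<cdot> src2 L x \<cdot> a) \<bullet> id2 L (b \<cdot> src2 L x \<cdot> a) = id2 L (b \<cdot> src2 L x \<cdot> a)" by simp
  show "nci L nc (ar (al b x) a) (id2 L (b \<cdot> src2 L x \<cdot> a)) (al b (ar x a))"
    using k[OF 1] k[OF 2] nc_vcomp'[of "ar (al b x) a" "id2 L (b \<cdot> src2 L x \<cdot> a)" ?y "id2 L (b \<cdot> src2 L x \<cdot> a)" "al b (ar x a)"]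
      nc_vcomp'[of "al b (ar x a)" "id2 L (b \<cdot> src2 L x \<cdot> a)" ?y "id2 L (b \<cdot> src2 L x \<cdot> a)" "ar (al b x) a"]
    by (simp add: nci_def id)
next
  fix x A assume x: "x \<in> NS" and [simp]: "src1 L (src2 L x) = A"
  note [simp] = NS_bd(1,3-6)[OF x]
  have [simp]: "A \<in> Obj L" using src1_Obj[OF NS_bd(4)[OF x]] by simp
  have "ar x (one L A) = x" using NS_bd(2)[OF x] by (simp add: act_right_def nu_one)
  then show "nci L nc (ar x (one L A)) (id2 L (src2 L x)) x"
    using x null_cells_id[OF _ _ NS_bd(2)[OF x]] by (simp add: nci_def null_between_def)
next
  fix x B assume x: "x \<in> NS" and [simp]: "trg1 L (src2 L x) = B"
  note [simp] = NS_bd(1,3-6)[OF x]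
  have [simp]: "B \<in> Obj L" using trg1_Obj[OF NS_bd(4)[OF x]] by simp
  have "al (one L B) x = x" using NS_bd(2)[OF x] by (simp add: act_left_def nu_one)
  then show "nci L nc (al (one L B) x) (id2 L (src2 L x)) x"
    using x null_cells_id[OF _ _ NS_bd(2)[OF x]] by (simp add: nci_def null_between_def)
qed

end

text \<open>The facts about null data are premises instead of coming from \<open>ideal\<close>, so
  that the equivalence can be instantiated at \<open>op_ideal I\<close> over \<open>op2 L\<close>;
  for these data the premises follow from the facts about \<open>I\<close> itself.\<close>

lemma two_kernel_iff:
  fixes L :: "('o, 'm, 'c) two_cat" (structure)
  assumes "two_category L"
    and mor: "\<And>A B n. \<lbrakk>A \<in> Obj L; B \<in> Obj L; n \<in> null_mor I A B\<rbrakk> \<Longrightarrow> n \<in> Mor L \<and> src1 L n = A \<and> trg1 L n = B"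
    and isos: "\<And>A B \<theta>. \<lbrakk>A \<in> Obj L; B \<in> Obj L\<rbrakk> \<Longrightarrow>
      \<theta> \<in> null_isos I A B \<longleftrightarrow> iso2 L \<theta> \<and> \<theta> \<in> null_cells I A B \<and> inv2 L \<theta> \<in> null_cells I A B"
    and nu: "\<And>B n a. \<lbrakk>a \<in> Mor L; B \<in> Obj L; n \<in> null_mor I (trg1 L a) B\<rbrakk> \<Longrightarrow>
      iso2 L (nu L I (one L B) n a) \<and> src2 L (nu L I (one L B) n a) = n \<cdot> a \<and> trg2 L (nu L I (one L B) n a) \<in> null_mor I (src1 L a) B"
  shows "two_kernel L I f k n \<alpha> \<longleftrightarrow> kernel L (null_structures L I) (null_between L I) (act_right L I) f k \<alpha> \<and> trg2 L \<alpha> = n"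
proof -
  interpret two_category L by fact
  let ?NS = "null_structures L I" and ?nc = "null_between L I" and ?ar = "act_right L I"
  have NSD: "iso2 L x \<and> trg2 L x \<in> null_mor I (src1 L (src2 L x)) (trg1 L (src2 L x))" if "x \<in> ?NS" for x
    using that by (simp add: null_structures_def)
  show ?thesis
  \<comment> \<open>Both notions contain these typing conditions, so outside this case both are
    false; inside it the boundary facts become rewrite rules.\<close>
  proof (cases "f \<in> Mor L \<and> k \<in> Mor L \<and> trg1 L k = src1 L f \<and> iso2 L \<alpha> \<and> src2 L \<alpha> = f \<cdot> k \<and> trg2 L \<alpha> = n \<and> n \<in> null_mor I (src1 L k) (trg1 L f)")
    case True
    then have [simp]: "f \<in> Mor L" "k \<in> Mor L" "trg1 L k = src1 L f" "iso2 L \<alpha>" "src2 L \<alpha> = f \<cdot> k" "trg2 L \<alpha> = n" by auto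
    have n: "n \<in> null_mor I (src1 L k) (trg1 L f)" using True by auto
    have aN [simp]: "\<alpha> \<in> ?NS" using n by (simp add: null_structures_def)
    have [simp]: "n \<in> Mor L" "src1 L n = src1 L k" "trg1 L n = trg1 L f" using mor[OF _ _ n] by simp_all
    let ?o = "one L (trg1 L f)"
    have nuu [simp]: "iso2 L (nu L I ?o n u)" "src2 L (nu L I ?o n u) = n \<cdot> u"
      and nuu2: "trg2 L (nu L I ?o n u) \<in> null_mor I (src1 L u) (trg1 L f)" if "u \<in> Mor L" "trg1 L u = src1 L k" for u
      using nu[of u "trg1 L f" n] that n by simp_all
    have ar: "?ar \<alpha> u = nu L I ?o n u \<bullet> (\<alpha> \<star> id2 L u)" for u by (simp add: act_right_def)
    have arN: "?ar \<alpha> u \<in> ?NS" if "u \<in> Mor L" "trg1 L u = src1 L k" for u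
      using that nuu2[OF that] by (simp add: ar null_structures_def)
    have 1: "nu L I ?o n u \<bullet> (\<alpha> \<star> id2 L u) \<bullet> (id2 L f \<star> \<gamma>) \<bullet> inv2 L \<beta> \<in> null_isos I (src1 L z) (trg1 L f) \<longleftrightarrow> nci L ?nc \<beta> (id2 L f \<star> \<gamma>) (?ar \<alpha> u)"
      if [simp]: "z \<in> Mor L" "trg1 L z = src1 L f" and b: "\<beta> \<in> ?NS" "src2 L \<beta> = f \<cdot> z"
        and [simp]: "u \<in> Mor L" "src1 L u = src1 L z" "trg1 L u = src1 L k" "iso2 L \<gamma>" "src2 L \<gamma> = z" "trg2 L \<gamma> = k \<cdot> u" for z \<beta> u \<gamma>
    proof -
      have [simp]: "iso2 L \<beta>" "src2 L \<beta> = f \<cdot> z" "\<beta> \<in> ?NS" using NSD[OF b(1)] b by auto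
      show ?thesis
        using arN[of u] by (simp add: isos nci_def null_between_def) (simp add: ar)
    qed
    have 2: "nu L I ?o n v \<bullet> (\<alpha> \<star> id2 L v) \<bullet> (id2 L f \<star> \<kappa>) \<bullet> (inv2 L \<alpha> \<star> id2 L u) \<bullet> inv2 L (nu L I ?o n u) \<in> null_cells I (src1 L v) (trg1 L f)
        \<longleftrightarrow> ?nc (?ar \<alpha> u) (id2 L f \<star> \<kappa>) (?ar \<alpha> v)"
      if [simp]: "u \<in> Mor L" "v \<in> Mor L" "trg1 L u = src1 L k" "trg1 L v = src1 L k" "src1 L u = src1 L v"
        "\<kappa> \<in> Cell L" "src2 L \<kappa> = k \<cdot> u" "trg2 L \<kappa> = k \<cdot> v" for u v \<kappa>
      using arN[of u] arN[of v] by (simp add: null_between_def) (simp add: ar)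
    have beta: "\<beta> \<in> isos L (f \<cdot> z) (trg2 L \<beta>) \<and> trg2 L \<beta> \<in> null_mor I (src1 L z) (trg1 L f) \<longleftrightarrow> \<beta> \<in> ?NS \<and> src2 L \<beta> = f \<cdot> z"
      if "z \<in> Mor L" "trg1 L z = src1 L f" for z \<beta>
      using that by (auto simp: null_structures_def isos_iff)
    have A1: "(\<forall>Z. \<forall>z \<in> hom L Z (src1 L f). \<forall>p \<in> null_mor I Z (trg1 L f). \<forall>\<beta> \<in> isos L (f \<cdot> z) p.
        \<exists>u \<in> hom L Z (src1 L k). \<exists>\<gamma> \<in> isos L z (k \<cdot> u).
          nu L I ?o n u \<bullet> (\<alpha> \<star> id2 L u) \<bullet> (id2 L f \<star> \<gamma>) \<bullet> inv2 L \<beta> \<in> null_isos I Z (trg1 L f)) \<longleftrightarrow>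
      (\<forall>z y. z \<in> Mor L \<and> trg1 L z = src1 L f \<and> y \<in> ?NS \<and> src2 L y = f \<cdot> z \<longrightarrow>
        (\<exists>u \<gamma>. u \<in> Mor L \<and> src1 L u = src1 L z \<and> trg1 L u = src1 L k \<and>
          iso2 L \<gamma> \<and> src2 L \<gamma> = z \<and> trg2 L \<gamma> = k \<cdot> u \<and> nci L ?nc y (id2 L f \<star> \<gamma>) (?ar \<alpha> u)))" (is "?P \<longleftrightarrow> ?Q")
    proof
      assume P: ?P
      show ?Q
      proof (intro allI impI)
        fix z y assume z: "z \<in> Mor L \<and> trg1 L z = src1 L f \<and> y \<in> ?NS \<and> src2 L y = f \<cdot> z"
        then have "z \<in> hom L (src1 L z) (src1 L f)" "trg2 L y \<in> null_mor I (src1 L z) (trg1 L f)" "y \<in> isos L (f \<cdot> z) (trg2 L y)"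
          using beta[of z y] by (auto simp: hom_iff)
        then obtain u \<gamma> where u: "u \<in> hom L (src1 L z) (src1 L k)" "\<gamma> \<in> isos L z (k \<cdot> u)"
          "nu L I ?o n u \<bullet> (\<alpha> \<star> id2 L u) \<bullet> (id2 L f \<star> \<gamma>) \<bullet> inv2 L y \<in> null_isos I (src1 L z) (trg1 L f)" using P by blast
        then show "\<exists>u \<gamma>. u \<in> Mor L \<and> src1 L u = src1 L z \<and> trg1 L u = src1 L k \<and>
          iso2 L \<gamma> \<and> src2 L \<gamma> = z \<and> trg2 L \<gamma> = k \<cdot> u \<and> nci L ?nc y (id2 L f \<star> \<gamma>) (?ar \<alpha> u)"
          using 1[of z y u \<gamma>] z by (intro exI[of _ u] exI[of _ \<gamma>]) (simp add: hom_iff isos_iff)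
      qed
    next
      assume Q: ?Q
      show ?P
      proof (intro allI ballI)
        fix Z z p \<beta> assume z: "z \<in> hom L Z (src1 L f)" and p: "p \<in> null_mor I Z (trg1 L f)" and b: "\<beta> \<in> isos L (f \<cdot> z) p"
        then have z': "z \<in> Mor L \<and> trg1 L z = src1 L f \<and> \<beta> \<in> ?NS \<and> src2 L \<beta> = f \<cdot> z"
          using beta[of z \<beta>] by (auto simp: hom_iff isos_iff)
        then obtain u \<gamma> where u: "u \<in> Mor L" "src1 L u = src1 L z" "trg1 L u = src1 L k" "iso2 L \<gamma>" "src2 L \<gamma> = z" "trg2 L \<gamma> = k \<cdot> u"
           "nci L ?nc \<beta> (id2 L f \<star> \<gamma>) (?ar \<alpha> u)" using Q by blast
        then show "\<exists>u \<in> hom L Z (src1 L k). \<exists>\<gamma> \<in> isos L z (k \<cdot> u).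
          nu L I ?o n u \<bullet> (\<alpha> \<star> id2 L u) \<bullet> (id2 L f \<star> \<gamma>) \<bullet> inv2 L \<beta> \<in> null_isos I Z (trg1 L f)"
          using 1[of z \<beta> u \<gamma>] z z' by (intro bexI[of _ u] bexI[of _ \<gamma>]) (simp_all add: hom_iff isos_iff)
      qed
    qed
    have A2: "(\<forall>Z. \<forall>u \<in> hom L Z (src1 L k). \<forall>v \<in> hom L Z (src1 L k). \<forall>\<kappa> \<in> cells L (k \<cdot> u) (k \<cdot> v).
        nu L I ?o n v \<bullet> (\<alpha> \<star> id2 L v) \<bullet> (id2 L f \<star> \<kappa>) \<bullet> (inv2 L \<alpha> \<star> id2 L u) \<bullet> inv2 L (nu L I ?o n u) \<in> null_cells I Z (trg1 L f) \<longrightarrow>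
        (\<exists>!\<mu>. \<mu> \<in> cells L u v \<and> id2 L k \<star> \<mu> = \<kappa>)) \<longleftrightarrow>
     (\<forall>u v \<kappa>. u \<in> Mor L \<and> v \<in> Mor L \<and> trg1 L u = src1 L k \<and> trg1 L v = src1 L k \<and> src1 L u = src1 L v \<and>
        \<kappa> \<in> Cell L \<and> src2 L \<kappa> = k \<cdot> u \<and> trg2 L \<kappa> = k \<cdot> v \<and> ?nc (?ar \<alpha> u) (id2 L f \<star> \<kappa>) (?ar \<alpha> v) \<longrightarrow>
        (\<exists>!\<mu>. \<mu> \<in> cells L u v \<and> id2 L k \<star> \<mu> = \<kappa>))" (is "?P \<longleftrightarrow> ?Q")
    proof
      assume P: ?P
      show ?Q
      proof (intro allI impI)
        fix u v \<kappa> assume u: "u \<in> Mor L \<and> v \<in> Mor L \<and> trg1 L u = src1 L k \<and> trg1 L v = src1 L k \<and> src1 L u = src1 L v \<and>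
          \<kappa> \<in> Cell L \<and> src2 L \<kappa> = k \<cdot> u \<and> trg2 L \<kappa> = k \<cdot> v \<and> ?nc (?ar \<alpha> u) (id2 L f \<star> \<kappa>) (?ar \<alpha> v)"
        have "u \<in> hom L (src1 L v) (src1 L k)" "v \<in> hom L (src1 L v) (src1 L k)" "\<kappa> \<in> cells L (k \<cdot> u) (k \<cdot> v)"
          using u by (auto simp: hom_iff cells_iff)
        then show "\<exists>!\<mu>. \<mu> \<in> cells L u v \<and> id2 L k \<star> \<mu> = \<kappa>" using P 2[of u v \<kappa>] u by blast
      qed
    next
      assume Q: ?Q
      show ?P
      proof (intro allI ballI impI)
        fix Z u v \<kappa> assume u: "u \<in> hom L Z (src1 L k)" "v \<in> hom L Z (src1 L k)" "\<kappa> \<in> cells L (k \<cdot> u) (k \<cdot> v)"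
          and c: "nu L I ?o n v \<bullet> (\<alpha> \<star> id2 L v) \<bullet> (id2 L f \<star> \<kappa>) \<bullet> (inv2 L \<alpha> \<star> id2 L u) \<bullet> inv2 L (nu L I ?o n u) \<in> null_cells I Z (trg1 L f)"
        have "u \<in> Mor L" "v \<in> Mor L" "trg1 L u = src1 L k" "trg1 L v = src1 L k" "src1 L u = src1 L v" "\<kappa> \<in> Cell L" "src2 L \<kappa> = k \<cdot> u" "trg2 L \<kappa> = k \<cdot> v" "Z = src1 L v"
          using u by (auto simp: hom_iff cells_iff)
        then show "\<exists>!\<mu>. \<mu> \<in> cells L u v \<and> id2 L k \<star> \<mu> = \<kappa>" using Q 2[of u v \<kappa>] c by blast
      qed
    qed
    have fh: "f \<in> hom L (src1 L f) (trg1 L f)" "k \<in> hom L (src1 L k) (src1 L f)" "\<alpha> \<in> isos L (f \<cdot> k) n" by (simp_all add: hom_iff isos_iff)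
    have "two_kernel L I f k n \<alpha> \<longleftrightarrow>
      (\<forall>Z. \<forall>z \<in> hom L Z (src1 L f). \<forall>p \<in> null_mor I Z (trg1 L f). \<forall>\<beta> \<in> isos L (f \<cdot> z) p.
        \<exists>u \<in> hom L Z (src1 L k). \<exists>\<gamma> \<in> isos L z (k \<cdot> u).
          nu L I ?o n u \<bullet> (\<alpha> \<star> id2 L u) \<bullet> (id2 L f \<star> \<gamma>) \<bullet> inv2 L \<beta> \<in> null_isos I Z (trg1 L f)) \<and>
      (\<forall>Z. \<forall>u \<in> hom L Z (src1 L k). \<forall>v \<in> hom L Z (src1 L k). \<forall>\<kappa> \<in> cells L (k \<cdot> u) (k \<cdot> v).
        nu L I ?o n v \<bullet> (\<alpha> \<star> id2 L v) \<bullet> (id2 L f \<star> \<kappa>) \<bullet> (inv2 L \<alpha> \<star> id2 L u) \<bullet> inv2 L (nu L I ?o n u) \<in> null_cells I Z (trg1 L f) \<longrightarrow>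
        (\<exists>!\<mu>. \<mu> \<in> cells L u v \<and> id2 L k \<star> \<mu> = \<kappa>))" (is "_ \<longleftrightarrow> ?R")
    proof
      assume "two_kernel L I f k n \<alpha>"
      then obtain A B K where t: "f \<in> hom L A B" "k \<in> hom L K A" and r:
       "(\<forall>Z. \<forall>z \<in> hom L Z A. \<forall>p \<in> null_mor I Z B. \<forall>\<beta> \<in> isos L (f \<cdot> z) p.
        \<exists>u \<in> hom L Z K. \<exists>\<gamma> \<in> isos L z (k \<cdot> u).
          nu L I (one L B) n u \<bullet> (\<alpha> \<star> id2 L u) \<bullet> (id2 L f \<star> \<gamma>) \<bullet> inv2 L \<beta> \<in> null_isos I Z B) \<and>
       (\<forall>Z. \<forall>u \<in> hom L Z K. \<forall>v \<in> hom L Z K. \<forall>\<kappa> \<in> cells L (k \<cdot> u) (k \<cdot> v).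
        nu L I (one L B) n v \<bullet> (\<alpha> \<star> id2 L v) \<bullet> (id2 L f \<star> \<kappa>) \<bullet> (inv2 L \<alpha> \<star> id2 L u) \<bullet> inv2 L (nu L I (one L B) n u) \<in> null_cells I Z B \<longrightarrow>
        (\<exists>!\<mu>. \<mu> \<in> cells L u v \<and> id2 L k \<star> \<mu> = \<kappa>))" unfolding two_kernel_def by blast
      have "A = src1 L f" "B = trg1 L f" "K = src1 L k" using t by (auto simp: hom_iff)
      then show ?R using r by blast
    next
      assume ?R
      with fh n show "two_kernel L I f k n \<alpha>" unfolding two_kernel_def
        by (intro exI[of _ "src1 L f"] exI[of _ "trg1 L f"] exI[of _ "src1 L k"]) blast
    qed
    then show ?thesis unfolding A1 A2 by (simp add: kernel_def)
  next
    case False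
    have "\<not> two_kernel L I f k n \<alpha>"
      using False unfolding two_kernel_def by (auto simp: hom_iff isos_iff)
    moreover have "\<not> (kernel L ?NS ?nc ?ar f k \<alpha> \<and> trg2 L \<alpha> = n)"
      using False NSD[of \<alpha>] by (auto simp: kernel_def)
    ultimately show ?thesis by blast
  qed
qed

lemma op_ideal_sel [simp]:
  "null_mor (op_ideal I) A B = null_mor I B A" "null_cells (op_ideal I) A B = null_cells I B A"
  "null_isos (op_ideal I) A B = null_isos I B A" "nu (op2 L) (op_ideal I) b n a = nu L I a n b"
  by (simp_all add: null_mor_def null_cells_def null_isos_def nu_def null_obj_def op_ideal_def)

lemma op_structures [simp]:
  "null_structures (op2 L) (op_ideal I) = null_structures L I" "null_between (op2 L) (op_ideal I) = null_between L I"
  "act_right (op2 L) (op_ideal I) = (\<lambda>x a. act_left L I a x)"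
  by (auto simp: null_structures_def null_between_def act_right_def act_left_def fun_eq_iff)

context ideal
begin

lemma two_kernel: "two_kernel L I f k n \<alpha> \<longleftrightarrow> kernel L NS nc ar f k \<alpha> \<and> trg2 L \<alpha> = n"
proof (rule two_kernel_iff)
  fix B n a assume "a \<in> Mor L" "B \<in> Obj L" and n: "n \<in> null_mor I (trg1 L a) B"
  then show "iso2 L (nu L I (one L B) n a) \<and> src2 L (nu L I (one L B) n a) = n \<cdot> a \<and> trg2 L (nu L I (one L B) n a) \<in> null_mor I (src1 L a) B"
    using nu_iso[of a "one L B" n] null_mor_hom[OF _ _ n] by simp
qed (use null_mor_hom null_isos_iff two_category_axioms in blast)+

lemma two_cokernel: "two_cokernel L I f c n \<alpha> \<longleftrightarrow> cokernel L NS nc al f c \<alpha> \<and> trg2 L \<alpha> = n"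
proof -
  have "two_kernel (op2 L) (op_ideal I) f c n \<alpha> \<longleftrightarrow> kernel (op2 L) (null_structures (op2 L) (op_ideal I))
    (null_between (op2 L) (op_ideal I)) (act_right (op2 L) (op_ideal I)) f c \<alpha> \<and> trg2 (op2 L) \<alpha> = n"
  proof (rule two_kernel_iff)
  fix B n a assume a: "a \<in> Mor (op2 L)" "B \<in> Obj (op2 L)" and n: "n \<in> null_mor (op_ideal I) (trg1 (op2 L) a) B"
  then have n': "n \<in> null_mor I B (src1 L a)" by simp
  show "iso2 (op2 L) (nu (op2 L) (op_ideal I) (one (op2 L) B) n a) \<and> src2 (op2 L) (nu (op2 L) (op_ideal I) (one (op2 L) B) n a) = n \<cdot>\<^bsub>op2 L\<^esub> a \<and>
    trg2 (op2 L) (nu (op2 L) (op_ideal I) (one (op2 L) B) n a) \<in> null_mor (op_ideal I) (src1 (op2 L) a) B"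
    using nu_iso[of "one L B" a n] null_mor_hom[OF _ _ n'] n' a by simp
next
  show "two_category (op2 L)" by (rule op2_two_category)
  qed (use null_mor_hom null_isos_iff in \<open>auto\<close>)
  then show ?thesis by (simp add: two_cokernel_def)
qed

end

section \<open>Pseudofunctors over a base\<close>

text \<open>The contribution of properness is \<open>P2_faithful\<close>: for squares between
  morphisms of \<open>E\<close>, or of \<open>M\<close>, the image in \<open>L\<close> of a 2-cell
  determines it.\<close>

locale strict_over = X: two_category X + L: two_category L
  for X :: "('p, 'q, 'r) two_cat" and L :: "('o, 'm, 'c) two_cat" +
  fixes P0 :: "'p \<Rightarrow> 'o" and P1 :: "'q \<Rightarrow> 'm" and P2 :: "'r \<Rightarrow> 'c"
  assumes P0 [simp]: "a \<in> Obj X \<Longrightarrow> P0 a \<in> Obj L"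
    and P1 [simp]: "f \<in> Mor X \<Longrightarrow> P1 f \<in> Mor L" "f \<in> Mor X \<Longrightarrow> src1 L (P1 f) = P0 (src1 X f)" "f \<in> Mor X \<Longrightarrow> trg1 L (P1 f) = P0 (trg1 X f)"
    and P2 [simp]: "\<alpha> \<in> Cell X \<Longrightarrow> P2 \<alpha> \<in> Cell L" "\<alpha> \<in> Cell X \<Longrightarrow> src2 L (P2 \<alpha>) = P1 (src2 X \<alpha>)" "\<alpha> \<in> Cell X \<Longrightarrow> trg2 L (P2 \<alpha>) = P1 (trg2 X \<alpha>)"
    and P1_one [simp]: "a \<in> Obj X \<Longrightarrow> P1 (one X a) = one L (P0 a)"
    and P1_comp [simp]: "\<lbrakk>f \<in> Mor X; g \<in> Mor X; trg1 X f = src1 X g\<rbrakk> \<Longrightarrow> P1 (comp1 X g f) = comp1 L (P1 g) (P1 f)"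
    and P2_id2 [simp]: "f \<in> Mor X \<Longrightarrow> P2 (id2 X f) = id2 L (P1 f)"
    and P2_vcomp [simp]: "\<lbrakk>\<alpha> \<in> Cell X; \<beta> \<in> Cell X; trg2 X \<alpha> = src2 X \<beta>\<rbrakk> \<Longrightarrow> P2 (vcomp X \<beta> \<alpha>) = vcomp L (P2 \<beta>) (P2 \<alpha>)"
    and P2_hcomp [simp]: "\<lbrakk>\<alpha> \<in> Cell X; \<beta> \<in> Cell X; trg1 X (src2 X \<alpha>) = src1 X (src2 X \<beta>)\<rbrakk> \<Longrightarrow> P2 (hcomp X \<beta> \<alpha>) = hcomp L (P2 \<beta>) (P2 \<alpha>)"
    and P2_faithful: "\<lbrakk>\<alpha> \<in> Cell X; \<beta> \<in> Cell X; src2 X \<alpha> = src2 X \<beta>; trg2 X \<alpha> = trg2 X \<beta>; P2 \<alpha> = P2 \<beta>\<rbrakk> \<Longrightarrow> \<alpha> = \<beta>"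
begin

text \<open>Data with prescribed boundaries and images in \<open>L\<close>, without coherence
  axioms. Identities and both composites of the biequivalence satisfy it by inspection, and
  faithfulness on 2-cells supplies the equations.\<close>

definition over :: "('p, 'q, 'r, 'p, 'q, 'r) psfun \<Rightarrow> bool" where
  "over F \<longleftrightarrow> (\<forall>a \<in> Obj X. F0 F a \<in> Obj X \<and> P0 (F0 F a) = P0 a \<and>
       Funit F a \<in> cells X (one X (F0 F a)) (F1 F (one X a)) \<and> P2 (Funit F a) = id2 L (one L (P0 a))) \<and>
     (\<forall>f \<in> Mor X. F1 F f \<in> hom X (F0 F (src1 X f)) (F0 F (trg1 X f)) \<and> P1 (F1 F f) = P1 f) \<and>
     (\<forall>\<alpha> \<in> Cell X. F2 F \<alpha> \<in> cells X (F1 F (src2 X \<alpha>)) (F1 F (trg2 X \<alpha>)) \<and> P2 (F2 F \<alpha>) = P2 \<alpha>) \<and>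
     (\<forall>f \<in> Mor X. \<forall>g \<in> Mor X. trg1 X f = src1 X g \<longrightarrow>
       Fcomp F g f \<in> cells X (comp1 X (F1 F g) (F1 F f)) (F1 F (comp1 X g f)) \<and> P2 (Fcomp F g f) = id2 L (P1 (comp1 X g f)))"

lemma over_id: "over (id_psfun X)"
  by (simp add: over_def id_psfun_def strict_psfun_def hom_iff cells_iff)

text \<open>A family of 2-cells over identities is pseudonatural for free, since \<open>P2\<close> is injective on 2-cells.\<close>

lemma pseudonatural_over:
  assumes F: "over F" and G: "over G"
    and T0: "\<And>a. a \<in> Obj X \<Longrightarrow> T0 T a \<in> hom X (F0 F a) (F0 G a) \<and> P1 (T0 T a) = one L (P0 a)"
    and T1: "\<And>f. f \<in> Mor X \<Longrightarrow> T1 T f \<in> isos X (comp1 X (F1 G f) (T0 T (src1 X f))) (comp1 X (T0 T (trg1 X f)) (F1 F f)) \<and>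
      P2 (T1 T f) = id2 L (P1 f)"
  shows "pseudonatural X X F G T"
proof -
  have T0' [simp]: "T0 T a \<in> Mor X" "src1 X (T0 T a) = F0 F a" "trg1 X (T0 T a) = F0 G a" "P1 (T0 T a) = one L (P0 a)" if "a \<in> Obj X" for a
    using T0[OF that] by (auto simp: hom_iff)
  have T1' [simp]: "T1 T f \<in> Cell X" "src2 X (T1 T f) = comp1 X (F1 G f) (T0 T (src1 X f))"
    "trg2 X (T1 T f) = comp1 X (T0 T (trg1 X f)) (F1 F f)" "P2 (T1 T f) = id2 L (P1 f)" if "f \<in> Mor X" for f
    using T1[OF that] by (auto simp: isos_iff)
  have o0 [simp]: "F0 F a \<in> Obj X" "P0 (F0 F a) = P0 a" "F0 G a \<in> Obj X" "P0 (F0 G a) = P0 a" if "a \<in> Obj X" for a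
    using F G that by (auto simp: over_def)
  have ou [simp]: "Funit F a \<in> Cell X" "src2 X (Funit F a) = one X (F0 F a)" "trg2 X (Funit F a) = F1 F (one X a)" "P2 (Funit F a) = id2 L (one L (P0 a))"
     "Funit G a \<in> Cell X" "src2 X (Funit G a) = one X (F0 G a)" "trg2 X (Funit G a) = F1 G (one X a)" "P2 (Funit G a) = id2 L (one L (P0 a))"
    if "a \<in> Obj X" for a using F G that by (auto simp: over_def cells_iff)
  have o1 [simp]: "F1 F f \<in> Mor X" "src1 X (F1 F f) = F0 F (src1 X f)" "trg1 X (F1 F f) = F0 F (trg1 X f)" "P1 (F1 F f) = P1 f"
     "F1 G f \<in> Mor X" "src1 X (F1 G f) = F0 G (src1 X f)" "trg1 X (F1 G f) = F0 G (trg1 X f)" "P1 (F1 G f) = P1 f"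
    if "f \<in> Mor X" for f using F G that by (auto simp: over_def hom_iff)
  have o2 [simp]: "F2 F \<alpha> \<in> Cell X" "src2 X (F2 F \<alpha>) = F1 F (src2 X \<alpha>)" "trg2 X (F2 F \<alpha>) = F1 F (trg2 X \<alpha>)" "P2 (F2 F \<alpha>) = P2 \<alpha>"
    "F2 G \<alpha> \<in> Cell X" "src2 X (F2 G \<alpha>) = F1 G (src2 X \<alpha>)" "trg2 X (F2 G \<alpha>) = F1 G (trg2 X \<alpha>)" "P2 (F2 G \<alpha>) = P2 \<alpha>"
    if "\<alpha> \<in> Cell X" for \<alpha> using F G that by (auto simp: over_def cells_iff)
  have oc [simp]: "Fcomp F g f \<in> Cell X" "src2 X (Fcomp F g f) = comp1 X (F1 F g) (F1 F f)" "trg2 X (Fcomp F g f) = F1 F (comp1 X g f)"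
     "P2 (Fcomp F g f) = id2 L (P1 (comp1 X g f))"
     "Fcomp G g f \<in> Cell X" "src2 X (Fcomp G g f) = comp1 X (F1 G g) (F1 G f)" "trg2 X (Fcomp G g f) = F1 G (comp1 X g f)"
     "P2 (Fcomp G g f) = id2 L (P1 (comp1 X g f))"
    if "f \<in> Mor X" "g \<in> Mor X" "trg1 X f = src1 X g" for f g using F G that by (auto simp: over_def cells_iff)
  show ?thesis
  proof
    fix a assume "a \<in> Obj X" then show "T0 T a \<in> hom X (F0 F a) (F0 G a)" using T0 by simp
  next
    fix f a b assume "f \<in> hom X a b"
    then show "T1 T f \<in> isos X (comp1 X (F1 G f) (T0 T a)) (comp1 X (T0 T b) (F1 F f))" using T1[of f] by (simp add: hom_iff)
  next
    fix f a b \<alpha> f' assume "f \<in> hom X a b" "\<alpha> \<in> cells X f f'"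
    then have [simp]: "\<alpha> \<in> Cell X" "src2 X \<alpha> = f" "trg2 X \<alpha> = f'" "f \<in> Mor X" "src1 X f = a" "trg1 X f = b" by (auto simp: hom_iff cells_iff)
    have [simp]: "f' \<in> Mor X" "src1 X f' = a" "trg1 X f' = b" "a \<in> Obj X" "b \<in> Obj X"
      using X.trg2_Mor[of \<alpha>] X.src1_trg2[of \<alpha>] X.trg1_trg2[of \<alpha>] X.src1_Obj[of f] X.trg1_Obj[of f] by simp_all
    show "vcomp X (T1 T f') (hcomp X (F2 G \<alpha>) (id2 X (T0 T a))) = vcomp X (hcomp X (id2 X (T0 T b)) (F2 F \<alpha>)) (T1 T f)"
      by (rule P2_faithful) simp_all
  next
    fix f a b g c assume "f \<in> hom X a b" "g \<in> hom X b c"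
    then have [simp]: "f \<in> Mor X" "src1 X f = a" "trg1 X f = b" "g \<in> Mor X" "src1 X g = b" "trg1 X g = c" by (auto simp: hom_iff)
    have [simp]: "a \<in> Obj X" "b \<in> Obj X" "c \<in> Obj X" using X.src1_Obj[of f] X.trg1_Obj[of f] X.trg1_Obj[of g] by simp_all
    show "vcomp X (T1 T (comp1 X g f)) (hcomp X (Fcomp G g f) (id2 X (T0 T a))) =
       vcomp X (hcomp X (id2 X (T0 T c)) (Fcomp F g f)) (vcomp X (hcomp X (T1 T g) (id2 X (F1 F f))) (hcomp X (id2 X (F1 G g)) (T1 T f)))"
      by (rule P2_faithful) simp_all
  next
    fix a assume [simp]: "a \<in> Obj X"
    show "vcomp X (T1 T (one X a)) (hcomp X (Funit G a) (id2 X (T0 T a))) = hcomp X (id2 X (T0 T a)) (Funit F a)"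
      by (rule P2_faithful) simp_all
  qed
qed

end

text \<open>A span of objects \<open>p \<sigma>\<close> of \<open>X\<close> and \<open>q \<sigma>\<close> of \<open>Y\<close> and of morphisms \<open>f\<close>, \<open>r\<close> related by \<open>G\<close>, along both of
  whose legs objects, morphisms and 2-cells lift. Both pseudofunctors of the biequivalence choose lifts.\<close>

locale span = SX: strict_over X L P0 P1 P2 + SY: strict_over Y L Q0 Q1 Q2
  for X :: "('p, 'q, 'r) two_cat" and Y :: "('s, 't, 'u) two_cat" and L :: "('o, 'm, 'c) two_cat"
    and P0 P1 P2 Q0 Q1 Q2 +
  fixes S :: "'z set" and p :: "'z \<Rightarrow> 'p" and q :: "'z \<Rightarrow> 's" and G :: "'z \<Rightarrow> 'q \<Rightarrow> 't \<Rightarrow> 'z \<Rightarrow> bool"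
  assumes span_obj: "\<sigma> \<in> S \<Longrightarrow> p \<sigma> \<in> Obj X \<and> q \<sigma> \<in> Obj Y \<and> P0 (p \<sigma>) = Q0 (q \<sigma>)"
    and G_bd: "G \<sigma> f r \<sigma>' \<Longrightarrow> \<sigma> \<in> S \<and> \<sigma>' \<in> S \<and> f \<in> Mor X \<and> src1 X f = p \<sigma> \<and> trg1 X f = p \<sigma>' \<and>
      r \<in> Mor Y \<and> src1 Y r = q \<sigma> \<and> trg1 Y r = q \<sigma>' \<and> P1 f = Q1 r"
    and G_one: "\<sigma> \<in> S \<Longrightarrow> G \<sigma> (one X (p \<sigma>)) (one Y (q \<sigma>)) \<sigma>"
    and G_comp: "\<lbrakk>G \<sigma> f r \<sigma>'; G \<sigma>' f' r' \<sigma>''\<rbrakk> \<Longrightarrow> G \<sigma> (comp1 X f' f) (comp1 Y r' r) \<sigma>''"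
    and G_right: "\<lbrakk>\<sigma> \<in> S; \<sigma>' \<in> S; f \<in> Mor X; src1 X f = p \<sigma>; trg1 X f = p \<sigma>'\<rbrakk> \<Longrightarrow> \<exists>r. G \<sigma> f r \<sigma>'"
    and G_left: "\<lbrakk>\<sigma> \<in> S; \<sigma>' \<in> S; r \<in> Mor Y; src1 Y r = q \<sigma>; trg1 Y r = q \<sigma>'\<rbrakk> \<Longrightarrow> \<exists>f. G \<sigma> f r \<sigma>'"
    and G_cell_right: "\<lbrakk>G \<sigma> f r \<sigma>'; G \<sigma> f' r' \<sigma>'; w \<in> cells X f f'\<rbrakk> \<Longrightarrow> \<exists>v \<in> cells Y r r'. Q2 v = P2 w"
    and G_cell_left: "\<lbrakk>G \<sigma> f r \<sigma>'; G \<sigma> f' r' \<sigma>'; v \<in> cells Y r r'\<rbrakk> \<Longrightarrow> \<exists>w \<in> cells X f f'. P2 w = Q2 v"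
    and cover_left: "a \<in> Obj X \<Longrightarrow> \<exists>\<sigma> \<in> S. p \<sigma> = a"
    and cover_right: "b \<in> Obj Y \<Longrightarrow> \<exists>\<sigma> \<in> S. q \<sigma> = b"
begin

text \<open>The axioms are symmetric in the two legs, so the pseudofunctor \<open>C\<close> in the
  other direction is the \<open>K\<close> of the flipped span.\<close>

lemma span_flip: "span Y X L Q0 Q1 Q2 P0 P1 P2 S q p (\<lambda>\<sigma> r f \<sigma>'. G \<sigma> f r \<sigma>')"
proof unfold_locales
  fix \<sigma> assume "\<sigma> \<in> S"
  then show "q \<sigma> \<in> Obj Y \<and> p \<sigma> \<in> Obj X \<and> Q0 (q \<sigma>) = P0 (p \<sigma>)" using span_obj by metis
next
  fix \<sigma> f r \<sigma>' assume "G \<sigma> r f \<sigma>'"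
  then show "\<sigma> \<in> S \<and> \<sigma>' \<in> S \<and> f \<in> Mor Y \<and> src1 Y f = q \<sigma> \<and> trg1 Y f = q \<sigma>' \<and>
      r \<in> Mor X \<and> src1 X r = p \<sigma> \<and> trg1 X r = p \<sigma>' \<and> Q1 f = P1 r" by (auto dest: G_bd)
qed (rule G_one G_comp G_left G_right G_cell_left G_cell_right cover_right cover_left, assumption+)+

text \<open>The identity of \<open>f\<close> lifts to 2-cells both ways between the two partners;
  their composites lie over identities and hence are identities.\<close>

lemma G_iso:
  assumes "G \<sigma> f r \<sigma>'" "G \<sigma> f r' \<sigma>'"
  shows "\<exists>v. iso2 Y v \<and> src2 Y v = r \<and> trg2 Y v = r' \<and> Q2 v = id2 L (P1 f)"
proof -
  note b = G_bd[OF assms(1)] G_bd[OF assms(2)]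
  have i: "id2 X f \<in> cells X f f" using b by (simp add: cells_iff)
  obtain v where v: "v \<in> Cell Y" "src2 Y v = r" "trg2 Y v = r'" "Q2 v = id2 L (P1 f)"
    using G_cell_right[OF assms i] b by (auto simp: cells_iff)
  obtain v' where v': "v' \<in> Cell Y" "src2 Y v' = r'" "trg2 Y v' = r" "Q2 v' = id2 L (P1 f)"
    using G_cell_right[OF assms(2,1) i] b by (auto simp: cells_iff)
  have "vcomp Y v' v = id2 Y r" by (rule SY.P2_faithful) (use v v' b in auto)
  moreover have "vcomp Y v v' = id2 Y r'" by (rule SY.P2_faithful) (use v v' b in auto)
  ultimately have "iso2 Y v" using SY.X.inv2_eq[of v v'] v v' by simp
  with v show ?thesis by blast
qed

definition choice :: "'p \<Rightarrow> 'z" where "choice a = (SOME \<sigma>. \<sigma> \<in> S \<and> p \<sigma> = a)"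

definition k0 :: "'p \<Rightarrow> 's" where "k0 a = q (choice a)"

text \<open>Identities are treated separately to make \<open>K\<close> strictly normal: an arbitrary
  partner of an identity would only be isomorphic to an identity.\<close>

definition k1 :: "'q \<Rightarrow> 't" where
  "k1 f = (if f = one X (src1 X f) then one Y (k0 (src1 X f)) else SOME r. G (choice (src1 X f)) f r (choice (trg1 X f)))"

definition k2 :: "'r \<Rightarrow> 'u" where
  "k2 w = (SOME v. v \<in> cells Y (k1 (src2 X w)) (k1 (trg2 X w)) \<and> Q2 v = P2 w)"

definition kc :: "'q \<Rightarrow> 'q \<Rightarrow> 'u" where
  "kc g f = (SOME v. iso2 Y v \<and> src2 Y v = comp1 Y (k1 g) (k1 f) \<and> trg2 Y v = k1 (comp1 X g f) \<and> Q2 v = id2 L (P1 (comp1 X g f)))"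

definition K :: "('p, 'q, 'r, 's, 't, 'u) psfun" where
  "K = \<lparr>F0 = k0, F1 = k1, F2 = k2, Fcomp = kc, Funit = (\<lambda>a. id2 Y (one Y (k0 a)))\<rparr>"

lemma K_sel [simp]: "F0 K = k0" "F1 K = k1" "F2 K = k2" "Fcomp K = kc" "Funit K a = id2 Y (one Y (k0 a))"
  by (simp_all add: K_def)

lemma choice: "a \<in> Obj X \<Longrightarrow> choice a \<in> S \<and> p (choice a) = a"
  unfolding choice_def using cover_left[of a] by (auto intro: someI2)

lemma k0 [simp]: "a \<in> Obj X \<Longrightarrow> k0 a \<in> Obj Y" "a \<in> Obj X \<Longrightarrow> Q0 (k0 a) = P0 a"
  using choice[of a] span_obj[of "choice a"] by (auto simp: k0_def)

lemma k1_G: "f \<in> Mor X \<Longrightarrow> G (choice (src1 X f)) f (k1 f) (choice (trg1 X f))"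
proof -
  assume f: "f \<in> Mor X"
  note c = choice[OF SX.X.src1_Obj[OF f]] choice[OF SX.X.trg1_Obj[OF f]]
  show ?thesis
  proof (cases "f = one X (src1 X f)")
    case True
    then have t: "trg1 X f = src1 X f" using f by (metis SX.X.src1_Obj SX.X.trg1_one)
    have "G (choice (src1 X f)) (one X (src1 X f)) (one Y (k0 (src1 X f))) (choice (src1 X f))"
      using G_one[of "choice (src1 X f)"] c by (simp add: k0_def)
    moreover have "k1 f = one Y (k0 (src1 X f))" using True by (simp add: k1_def)
    ultimately show ?thesis using True t by simp
  next
    case False
    then show ?thesis using G_right[of "choice (src1 X f)" "choice (trg1 X f)" f] c f by (auto simp: k1_def intro: someI2)
  qed
qed

lemma k1 [simp]: "f \<in> Mor X \<Longrightarrow> k1 f \<in> Mor Y" "f \<in> Mor X \<Longrightarrow> src1 Y (k1 f) = k0 (src1 X f)" "f \<in> Mor X \<Longrightarrow> trg1 Y (k1 f) = k0 (trg1 X f)"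
    "f \<in> Mor X \<Longrightarrow> Q1 (k1 f) = P1 f"
  using k1_G[of f] G_bd[of "choice (src1 X f)" f "k1 f" "choice (trg1 X f)"] by (auto simp: k0_def)

lemma k1_one [simp]: "a \<in> Obj X \<Longrightarrow> k1 (one X a) = one Y (k0 a)"
  by (simp add: k1_def)

lemma k2 [simp]:
  assumes w: "w \<in> Cell X"
  shows "k2 w \<in> Cell Y" "src2 Y (k2 w) = k1 (src2 X w)" "trg2 Y (k2 w) = k1 (trg2 X w)" "Q2 (k2 w) = P2 w"
proof -
  have "\<exists>v \<in> cells Y (k1 (src2 X w)) (k1 (trg2 X w)). Q2 v = P2 w"
    using k1_G[of "src2 X w"] k1_G[of "trg2 X w"] w by (intro G_cell_right[of "choice (src1 X (src2 X w))" "src2 X w" _ "choice (trg1 X (src2 X w))" "trg2 X w"]) (simp_all add: cells_iff)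
  then have "\<exists>v. v \<in> cells Y (k1 (src2 X w)) (k1 (trg2 X w)) \<and> Q2 v = P2 w" by blast
  from someI_ex[OF this] show "k2 w \<in> Cell Y" "src2 Y (k2 w) = k1 (src2 X w)" "trg2 Y (k2 w) = k1 (trg2 X w)" "Q2 (k2 w) = P2 w"
    unfolding k2_def by (simp_all add: cells_iff)
qed

lemma kc [simp]:
  assumes fg: "f \<in> Mor X" "g \<in> Mor X" "trg1 X f = src1 X g"
  shows "iso2 Y (kc g f)" "src2 Y (kc g f) = comp1 Y (k1 g) (k1 f)" "trg2 Y (kc g f) = k1 (comp1 X g f)" "Q2 (kc g f) = id2 L (P1 (comp1 X g f))"
proof -
  have 1: "G (choice (src1 X f)) (comp1 X g f) (comp1 Y (k1 g) (k1 f)) (choice (trg1 X g))"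
    using G_comp[OF k1_G[OF fg(1)]] k1_G[OF fg(2)] fg by simp
  have 2: "G (choice (src1 X f)) (comp1 X g f) (k1 (comp1 X g f)) (choice (trg1 X g))"
    using k1_G[of "comp1 X g f"] fg by simp
  from someI_ex[OF G_iso[OF 1 2]]
  show "iso2 Y (kc g f)" "src2 Y (kc g f) = comp1 Y (k1 g) (k1 f)" "trg2 Y (kc g f) = k1 (comp1 X g f)" "Q2 (kc g f) = id2 L (P1 (comp1 X g f))"
    unfolding kc_def by simp_all
qed

lemma pseudofunctor_K: "pseudofunctor X Y K"
proof
  fix a assume "a \<in> Obj X" then show "F0 K a \<in> Obj Y" by simp
next
  fix f a b assume "f \<in> hom X a b" then show "F1 K f \<in> hom Y (F0 K a) (F0 K b)" by (auto simp: hom_iff)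
next
  fix \<alpha> f g assume "\<alpha> \<in> cells X f g" then show "F2 K \<alpha> \<in> cells Y (F1 K f) (F1 K g)" by (auto simp: cells_iff)
next
  fix f assume "f \<in> Mor X" then show "F2 K (id2 X f) = id2 Y (F1 K f)" by (intro SY.P2_faithful) simp_all
next
  fix \<alpha> f g \<beta> h assume "\<alpha> \<in> cells X f g" "\<beta> \<in> cells X g h"
  then show "F2 K (vcomp X \<beta> \<alpha>) = vcomp Y (F2 K \<beta>) (F2 K \<alpha>)" by (intro SY.P2_faithful) (auto simp: cells_iff)
next
  fix f a b g c assume "f \<in> hom X a b" "g \<in> hom X b c"
  then show "Fcomp K g f \<in> isos Y (comp1 Y (F1 K g) (F1 K f)) (F1 K (comp1 X g f))" by (auto simp: hom_iff isos_iff)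
next
  fix a assume "a \<in> Obj X" then show "Funit K a \<in> isos Y (one Y (F0 K a)) (F1 K (one X a))" by (auto simp: isos_iff)
next
  fix f a b g c \<alpha> f' \<beta> g' assume "f \<in> hom X a b" "g \<in> hom X b c" "\<alpha> \<in> cells X f f'" "\<beta> \<in> cells X g g'"
  then have [simp]: "f \<in> Mor X" "src1 X f = a" "trg1 X f = b" "g \<in> Mor X" "src1 X g = b" "trg1 X g = c"
    "\<alpha> \<in> Cell X" "src2 X \<alpha> = f" "trg2 X \<alpha> = f'" "\<beta> \<in> Cell X" "src2 X \<beta> = g" "trg2 X \<beta> = g'" by (auto simp: hom_iff cells_iff)
  have [simp]: "f' \<in> Mor X" "src1 X f' = a" "trg1 X f' = b" "g' \<in> Mor X" "src1 X g' = b" "trg1 X g' = c"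
    using SX.X.trg2_Mor[of \<alpha>] SX.X.src1_trg2[of \<alpha>] SX.X.trg1_trg2[of \<alpha>] SX.X.trg2_Mor[of \<beta>] SX.X.src1_trg2[of \<beta>] SX.X.trg1_trg2[of \<beta>] by simp_all
  show "vcomp Y (Fcomp K g' f') (hcomp Y (F2 K \<beta>) (F2 K \<alpha>)) = vcomp Y (F2 K (hcomp X \<beta> \<alpha>)) (Fcomp K g f)"
    by (rule SY.P2_faithful) simp_all
next
  fix f a b g c h d assume "f \<in> hom X a b" "g \<in> hom X b c" "h \<in> hom X c d"
  then have [simp]: "f \<in> Mor X" "src1 X f = a" "trg1 X f = b" "g \<in> Mor X" "src1 X g = b" "trg1 X g = c" "h \<in> Mor X" "src1 X h = c" "trg1 X h = d" by (auto simp: hom_iff)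
  show "vcomp Y (Fcomp K h (comp1 X g f)) (hcomp Y (id2 Y (F1 K h)) (Fcomp K g f)) = vcomp Y (Fcomp K (comp1 X h g) f) (hcomp Y (Fcomp K h g) (id2 Y (F1 K f)))"
    by (rule SY.P2_faithful) simp_all
next
  fix f a b assume "f \<in> hom X a b"
  then have [simp]: "f \<in> Mor X" "src1 X f = a" "trg1 X f = b" by (auto simp: hom_iff)
  have [simp]: "a \<in> Obj X" "b \<in> Obj X" using SX.X.src1_Obj[of f] SX.X.trg1_Obj[of f] by simp_all
  show "vcomp Y (Fcomp K f (one X a)) (hcomp Y (id2 Y (F1 K f)) (Funit K a)) = id2 Y (F1 K f)"
    by (rule SY.P2_faithful) simp_all
  show "vcomp Y (Fcomp K (one X b) f) (hcomp Y (Funit K b) (id2 Y (F1 K f))) = id2 Y (F1 K f)"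
    by (rule SY.P2_faithful) simp_all
qed

lemma normal_K: "normal_psfun X Y K"
  by (simp add: normal_psfun_def)

lemma K_over: "eq_psfun X (comp_psfun L (strict_psfun Y L Q0 Q1 Q2) K) (strict_psfun X L P0 P1 P2)"
  by (simp add: eq_psfun_def comp_psfun_def strict_psfun_def)

end

section \<open>Unit and counit of the biequivalence given by a span\<close>

context span
begin

interpretation flip: span Y X L Q0 Q1 Q2 P0 P1 P2 S q p "\<lambda>\<sigma> r f \<sigma>'. G \<sigma> f r \<sigma>'"
  by (rule span_flip)

abbreviation "C \<equiv> flip.K"

lemma over_KC: "SY.over (comp_psfun Y K C)"
  unfolding SY.over_def by (simp add: comp_psfun_def hom_iff cells_iff)

lemma over_CK: "SX.over (comp_psfun X C K)"
  unfolding SX.over_def by (simp add: comp_psfun_def hom_iff cells_iff)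

text \<open>A quasi-inverse is a partner of the same identity in the opposite direction: the two
  composites and the identities are partners of one morphism, so \<open>G_iso\<close> compares
  them.\<close>

lemma G_equivalence:
  assumes "G \<sigma> (one X a) r \<sigma>'" "a \<in> Obj X"
  shows "equivalence1 Y r"
proof -
  note b = G_bd[OF assms(1)]
  have "src1 X (one X a) = a" "trg1 X (one X a) = a" using assms(2) by simp_all
  with b have a: "p \<sigma> = a" "p \<sigma>' = a" by metis+
  obtain r' where r': "G \<sigma>' (one X a) r' \<sigma>" using G_right[of \<sigma>' \<sigma> "one X a"] b a assms(2) by auto
  note b' = G_bd[OF r']
  have 1: "G \<sigma> (one X a) (comp1 Y r' r) \<sigma>" "G \<sigma>' (one X a) (comp1 Y r r') \<sigma>'"
    using G_comp[OF assms(1) r'] G_comp[OF r' assms(1)] assms(2) by simp_all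
  have 2: "G \<sigma> (one X a) (one Y (q \<sigma>)) \<sigma>" "G \<sigma>' (one X a) (one Y (q \<sigma>')) \<sigma>'"
    using G_one[of \<sigma>] G_one[of \<sigma>'] a b by simp_all
  obtain v where v: "iso2 Y v" "src2 Y v = comp1 Y r' r" "trg2 Y v = one Y (q \<sigma>)"
    using G_iso[OF 1(1) 2(1)] by blast
  obtain v' where v': "iso2 Y v'" "src2 Y v' = comp1 Y r r'" "trg2 Y v' = one Y (q \<sigma>')"
    using G_iso[OF 1(2) 2(2)] by blast
  have r: "r \<in> Mor Y" "src1 Y r = q \<sigma>" "trg1 Y r = q \<sigma>'" "r' \<in> Mor Y" "src1 Y r' = q \<sigma>'" "trg1 Y r' = q \<sigma>"
    using b b' by blast+
  show ?thesis by (rule SY.X.equivalence1I[of r r' v v']) (use v v' r in simp_all)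
qed

text \<open>The point of the span chosen for \<open>b\<close> along one leg and the point chosen for
  its image along the other leg need not coincide, but they have the same end in \<open>X\<close>.
  The unit is a partner of the identity of that end, hence an equivalence lying over an
  identity.\<close>

definition eta0 :: "'s \<Rightarrow> 't" where
  "eta0 b = (SOME r. G (flip.choice b) (one X (flip.k0 b)) r (choice (flip.k0 b)))"

definition eta1 :: "'t \<Rightarrow> 'u" where
  "eta1 f = (SOME v. iso2 Y v \<and> src2 Y v = comp1 Y (k1 (flip.k1 f)) (eta0 (src1 Y f)) \<and>
     trg2 Y v = comp1 Y (eta0 (trg1 Y f)) f \<and> Q2 v = id2 L (Q1 f))"

lemma eta0_G: "b \<in> Obj Y \<Longrightarrow> G (flip.choice b) (one X (flip.k0 b)) (eta0 b) (choice (flip.k0 b))"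
proof -
  assume b: "b \<in> Obj Y"
  then have o: "flip.k0 b \<in> Obj X" by (rule flip.k0)
  have "p (flip.choice b) = flip.k0 b" by (simp add: flip.k0_def)
  then have "\<exists>r. G (flip.choice b) (one X (flip.k0 b)) r (choice (flip.k0 b))"
    using flip.choice[OF b] choice[OF o] o by (intro G_right) simp_all
  from someI_ex[OF this] show ?thesis unfolding eta0_def .
qed

lemma eta1:
  assumes f: "f \<in> Mor Y"
  shows "iso2 Y (eta1 f) \<and> src2 Y (eta1 f) = comp1 Y (k1 (flip.k1 f)) (eta0 (src1 Y f)) \<and>
     trg2 Y (eta1 f) = comp1 Y (eta0 (trg1 Y f)) f \<and> Q2 (eta1 f) = id2 L (Q1 f)"
proof -
  let ?a = "src1 Y f" and ?b = "trg1 Y f"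
  have ab: "?a \<in> Obj Y" "?b \<in> Obj Y" using f by simp_all
  \<comment> \<open>Both sides of the naturality square are partners of \<open>flip.k1 f\<close>
    between the same two points of the span, so they are isomorphic over an identity.\<close>
  have 1: "G (flip.choice ?a) (flip.k1 f) (comp1 Y (k1 (flip.k1 f)) (eta0 ?a)) (choice (flip.k0 ?b))"
    using G_comp[OF eta0_G[OF ab(1)]] k1_G[of "flip.k1 f"] f by fastforce
  have 2: "G (flip.choice ?a) (flip.k1 f) (comp1 Y (eta0 ?b) f) (choice (flip.k0 ?b))"
    using G_comp[OF flip.k1_G[OF f] eta0_G[OF ab(2)]] f by simp
  have "\<exists>v. iso2 Y v \<and> src2 Y v = comp1 Y (k1 (flip.k1 f)) (eta0 (src1 Y f)) \<and>
     trg2 Y v = comp1 Y (eta0 (trg1 Y f)) f \<and> Q2 v = id2 L (Q1 f)"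
    using G_iso[OF 1 2] f by simp
  from someI_ex[OF this] show ?thesis unfolding eta1_def .
qed

definition eta :: "('s, 't, 't, 'u) psnat" where "eta = \<lparr>T0 = eta0, T1 = eta1\<rparr>"

lemma eta_sel [simp]: "T0 eta = eta0" "T1 eta = eta1" by (simp_all add: eta_def)

lemma eta: "pseudonatural_equivalence Y Y (id_psfun Y) (comp_psfun Y K C) eta"
  unfolding pseudonatural_equivalence_def
proof (intro conjI ballI SY.pseudonatural_over[OF SY.over_id over_KC])
  fix b assume b: "b \<in> Obj Y"
  show "equivalence1 Y (T0 eta b)" using G_equivalence[OF eta0_G[OF b]] b by simp
  show "T0 eta b \<in> hom Y (F0 (id_psfun Y) b) (F0 (comp_psfun Y K C) b)" "Q1 (T0 eta b) = one L (Q0 b)"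
    using G_bd[OF eta0_G[OF b]] flip.choice[OF b] b
    by (auto simp: hom_iff id_psfun_def strict_psfun_def comp_psfun_def k0_def)
next
  fix f assume f: "f \<in> Mor Y"
  show "T1 eta f \<in> isos Y (comp1 Y (F1 (comp_psfun Y K C) f) (T0 eta (src1 Y f))) (comp1 Y (T0 eta (trg1 Y f)) (F1 (id_psfun Y) f))"
    "Q2 (T1 eta f) = id2 L (Q1 f)"
    using eta1[OF f] by (simp_all add: isos_iff id_psfun_def strict_psfun_def comp_psfun_def)
qed

lemma eta_over: "lies_over Y L (strict_psfun Y L Q0 Q1 Q2) eta"
  unfolding lies_over_def
proof (intro conjI ballI)
  fix b assume b: "b \<in> Obj Y"
  show "F1 (strict_psfun Y L Q0 Q1 Q2) (T0 eta b) = one L (F0 (strict_psfun Y L Q0 Q1 Q2) b)"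
  proof -
    have "Q1 (eta0 b) = P1 (one X (flip.k0 b))" using G_bd[OF eta0_G[OF b]] by metis
    then show ?thesis using b by (simp add: strict_psfun_def)
  qed
next
  fix f assume f: "f \<in> Mor Y"
  show "F2 (strict_psfun Y L Q0 Q1 Q2) (T1 eta f) = id2 L (F1 (strict_psfun Y L Q0 Q1 Q2) f)"
    using eta1[OF f] by (simp add: strict_psfun_def)
qed

definition eps0 :: "'p \<Rightarrow> 'q" where
  "eps0 a = (SOME f. G (flip.choice (k0 a)) f (one Y (k0 a)) (choice a))"

definition eps1 :: "'q \<Rightarrow> 'r" where
  "eps1 f = (SOME v. iso2 X v \<and> src2 X v = comp1 X f (eps0 (src1 X f)) \<and>
     trg2 X v = comp1 X (eps0 (trg1 X f)) (flip.k1 (k1 f)) \<and> P2 v = id2 L (P1 f))"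

lemma eps0_G: "a \<in> Obj X \<Longrightarrow> G (flip.choice (k0 a)) (eps0 a) (one Y (k0 a)) (choice a)"
proof -
  assume a: "a \<in> Obj X"
  then have o: "k0 a \<in> Obj Y" by (rule k0)
  have "q (choice a) = k0 a" by (simp add: k0_def)
  then have "\<exists>f. G (flip.choice (k0 a)) f (one Y (k0 a)) (choice a)"
    using choice[OF a] flip.choice[OF o] o by (intro G_left) simp_all
  from someI_ex[OF this] show ?thesis unfolding eps0_def .
qed

lemma eps1:
  assumes f: "f \<in> Mor X"
  shows "iso2 X (eps1 f) \<and> src2 X (eps1 f) = comp1 X f (eps0 (src1 X f)) \<and>
     trg2 X (eps1 f) = comp1 X (eps0 (trg1 X f)) (flip.k1 (k1 f)) \<and> P2 (eps1 f) = id2 L (P1 f)"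
proof -
  let ?a = "src1 X f" and ?b = "trg1 X f"
  have ab: "?a \<in> Obj X" "?b \<in> Obj X" using f by simp_all
  have 1: "G (flip.choice (k0 ?a)) (comp1 X f (eps0 ?a)) (k1 f) (choice ?b)"
    using G_comp[OF eps0_G[OF ab(1)] k1_G[OF f]] f by simp
  have "G (flip.choice (k0 ?a)) (flip.k1 (k1 f)) (k1 f) (flip.choice (k0 ?b))"
    using flip.k1_G[of "k1 f"] f by simp
  from G_comp[OF this eps0_G[OF ab(2)]]
  have 2: "G (flip.choice (k0 ?a)) (comp1 X (eps0 ?b) (flip.k1 (k1 f))) (k1 f) (choice ?b)" using f by simp
  have "\<exists>v. iso2 X v \<and> src2 X v = comp1 X f (eps0 (src1 X f)) \<and>
     trg2 X v = comp1 X (eps0 (trg1 X f)) (flip.k1 (k1 f)) \<and> P2 v = id2 L (P1 f)"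
    using flip.G_iso[OF 1 2] f by simp
  from someI_ex[OF this] show ?thesis unfolding eps1_def .
qed

definition eps :: "('p, 'q, 'q, 'r) psnat" where "eps = \<lparr>T0 = eps0, T1 = eps1\<rparr>"

lemma eps_sel [simp]: "T0 eps = eps0" "T1 eps = eps1" by (simp_all add: eps_def)

lemma eps: "pseudonatural_equivalence X X (comp_psfun X C K) (id_psfun X) eps"
  unfolding pseudonatural_equivalence_def
proof (intro conjI ballI SX.pseudonatural_over[OF over_CK SX.over_id])
  fix a assume a: "a \<in> Obj X"
  show "equivalence1 X (T0 eps a)" using span.G_equivalence[OF span_flip, of "flip.choice (k0 a)" "eps0 a" "k0 a" "choice a"] eps0_G[OF a] a by simp
  show "T0 eps a \<in> hom X (F0 (comp_psfun X C K) a) (F0 (id_psfun X) a)" "P1 (T0 eps a) = one L (P0 a)"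
    using G_bd[OF eps0_G[OF a]] choice[OF a] a
    by (auto simp: hom_iff id_psfun_def strict_psfun_def comp_psfun_def flip.k0_def)
next
  fix f assume f: "f \<in> Mor X"
  show "T1 eps f \<in> isos X (comp1 X (F1 (id_psfun X) f) (T0 eps (src1 X f))) (comp1 X (T0 eps (trg1 X f)) (F1 (comp_psfun X C K) f))"
    "P2 (T1 eps f) = id2 L (P1 f)"
    using eps1[OF f] by (simp_all add: isos_iff id_psfun_def strict_psfun_def comp_psfun_def)
qed

lemma eps_over: "lies_over X L (strict_psfun X L P0 P1 P2) eps"
  unfolding lies_over_def
proof (intro conjI ballI)
  fix a assume a: "a \<in> Obj X"
  show "F1 (strict_psfun X L P0 P1 P2) (T0 eps a) = one L (F0 (strict_psfun X L P0 P1 P2) a)"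
    using G_bd[OF eps0_G[OF a]] a by (simp add: strict_psfun_def)
next
  fix f assume f: "f \<in> Mor X"
  show "F2 (strict_psfun X L P0 P1 P2) (T1 eps f) = id2 L (F1 (strict_psfun X L P0 P1 P2) f)"
    using eps1[OF f] by (simp add: strict_psfun_def)
qed

theorem span_biequivalence:
  "\<exists>K C \<eta> \<epsilon>. normal_psfun X Y K \<and> normal_psfun Y X C \<and>
     biequivalence_over L X (strict_psfun X L P0 P1 P2) Y (strict_psfun Y L Q0 Q1 Q2) K C \<eta> \<epsilon>"
  unfolding biequivalence_over_def
  using pseudofunctor_K flip.pseudofunctor_K normal_K flip.normal_K K_over flip.K_over eta eta_over eps eps_over by blast

end

section \<open>The pseudo arrow 2-category\<close>

text \<open>A named predicate keeps the long carrier conditions of \<open>arrow2\<close> folded;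
  boundary facts are then extracted on demand by \<open>square_okD\<close>.\<close>

definition square_ok :: "('o, 'm, 'c) two_cat \<Rightarrow> ('m, 'c) square \<Rightarrow> bool" where
  "square_ok L q \<longleftrightarrow> is_square L (sqsrc q) (sqtrg q) (sqs q) (sqt q) (sqphi q)"

definition square_cell_ok :: "('o, 'm, 'c) two_cat \<Rightarrow> ('m, 'c) square_cell \<Rightarrow> bool" where
  "square_cell_ok L w \<longleftrightarrow> square_ok L (scsrc w) \<and> square_ok L (sctrg w) \<and>
     sqsrc (scsrc w) = sqsrc (sctrg w) \<and> sqtrg (scsrc w) = sqtrg (sctrg w) \<and>
     scs w \<in> cells L (sqs (scsrc w)) (sqs (sctrg w)) \<and> sct w \<in> cells L (sqt (scsrc w)) (sqt (sctrg w)) \<and>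
     sqphi (sctrg w) \<bullet>\<^bsub>L\<^esub> (sqtrg (scsrc w) \<rhd>\<^bsub>L\<^esub> scs w) = (sct w \<lhd>\<^bsub>L\<^esub> sqsrc (scsrc w)) \<bullet>\<^bsub>L\<^esub> sqphi (scsrc w)"

definition square_comp :: "('o, 'm, 'c) two_cat \<Rightarrow> ('m, 'c) square \<Rightarrow> ('m, 'c) square \<Rightarrow> ('m, 'c) square" where
  "square_comp L r q = \<lparr>sqsrc = sqsrc q, sqtrg = sqtrg r, sqs = sqs r \<cdot>\<^bsub>L\<^esub> sqs q, sqt = sqt r \<cdot>\<^bsub>L\<^esub> sqt q,
     sqphi = (sqt r \<rhd>\<^bsub>L\<^esub> sqphi q) \<bullet>\<^bsub>L\<^esub> (sqphi r \<lhd>\<^bsub>L\<^esub> sqs q)\<rparr>"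

lemma square_comp_sel [simp]:
  "sqsrc (square_comp L r q) = sqsrc q" "sqtrg (square_comp L r q) = sqtrg r"
  "sqs (square_comp L r q) = sqs r \<cdot>\<^bsub>L\<^esub> sqs q" "sqt (square_comp L r q) = sqt r \<cdot>\<^bsub>L\<^esub> sqt q"
  "sqphi (square_comp L r q) = (sqt r \<rhd>\<^bsub>L\<^esub> sqphi q) \<bullet>\<^bsub>L\<^esub> (sqphi r \<lhd>\<^bsub>L\<^esub> sqs q)"
  by (simp_all add: square_comp_def)

lemma arrow2_sel [simp]:
  "Obj (arrow2 L) = Mor L" "Mor (arrow2 L) = Collect (square_ok L)" "Cell (arrow2 L) = Collect (square_cell_ok L)"
  "src1 (arrow2 L) = sqsrc" "trg1 (arrow2 L) = sqtrg" "src2 (arrow2 L) = scsrc" "trg2 (arrow2 L) = sctrg"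
  "one (arrow2 L) m = \<lparr>sqsrc = m, sqtrg = m, sqs = one L (src1 L m), sqt = one L (trg1 L m), sqphi = id2 L m\<rparr>"
  "comp1 (arrow2 L) = square_comp L"
  "id2 (arrow2 L) q = \<lparr>scsrc = q, sctrg = q, scs = id2 L (sqs q), sct = id2 L (sqt q)\<rparr>"
  "vcomp (arrow2 L) v w = \<lparr>scsrc = scsrc w, sctrg = sctrg v, scs = scs v \<bullet>\<^bsub>L\<^esub> scs w, sct = sct v \<bullet>\<^bsub>L\<^esub> sct w\<rparr>"
  "hcomp (arrow2 L) v w = \<lparr>scsrc = square_comp L (scsrc v) (scsrc w), sctrg = square_comp L (sctrg v) (sctrg w),
     scs = scs v \<star>\<^bsub>L\<^esub> scs w, sct = sct v \<star>\<^bsub>L\<^esub> sct w\<rparr>"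
  by (auto simp: arrow2_def square_ok_def square_cell_ok_def square_comp_def fun_eq_iff)

lemma full_sub_sel [simp]:
  "Obj (full_sub X S) = Obj X \<inter> S" "Mor (full_sub X S) = {f \<in> Mor X. src1 X f \<in> S \<and> trg1 X f \<in> S}"
  "Cell (full_sub X S) = {\<alpha> \<in> Cell X. src1 X (src2 X \<alpha>) \<in> S \<and> trg1 X (src2 X \<alpha>) \<in> S}"
  "src1 (full_sub X S) = src1 X" "trg1 (full_sub X S) = trg1 X" "src2 (full_sub X S) = src2 X" "trg2 (full_sub X S) = trg2 X"
  "one (full_sub X S) = one X" "comp1 (full_sub X S) = comp1 X" "id2 (full_sub X S) = id2 X" "vcomp (full_sub X S) = vcomp X"
  "hcomp (full_sub X S) = hcomp X"
  by (simp_all add: full_sub_def)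

lemma (in two_category) full_sub_two_category: "two_category (full_sub L S)"
proof unfold_locales
  fix f A B g C \<alpha> f' \<alpha>' f'' \<beta> g' \<beta>' g''
  assume a: "f \<in> hom (full_sub L S) A B" "g \<in> hom (full_sub L S) B C" "\<alpha> \<in> cells (full_sub L S) f f'"
       "\<alpha>' \<in> cells (full_sub L S) f' f''" "\<beta> \<in> cells (full_sub L S) g g'" "\<beta>' \<in> cells (full_sub L S) g' g''"
  then show "hcomp (full_sub L S) (vcomp (full_sub L S) \<beta>' \<beta>) (vcomp (full_sub L S) \<alpha>' \<alpha>)
    = vcomp (full_sub L S) (hcomp (full_sub L S) \<beta>' \<alpha>') (hcomp (full_sub L S) \<beta> \<alpha>)"
    by (simp add: cells_iff hom_iff interchange')
qed (auto simp: hom_iff cells_iff)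

context two_category
begin

lemma square_okD:
  assumes "square_ok L q"
  shows "sqsrc q \<in> Mor L" "sqtrg q \<in> Mor L" "sqs q \<in> Mor L" "src1 L (sqs q) = src1 L (sqsrc q)" "trg1 L (sqs q) = src1 L (sqtrg q)"
    "sqt q \<in> Mor L" "src1 L (sqt q) = trg1 L (sqsrc q)" "trg1 L (sqt q) = trg1 L (sqtrg q)"
    "iso2 L (sqphi q)" "src2 L (sqphi q) = sqtrg q \<cdot> sqs q" "trg2 L (sqphi q) = sqt q \<cdot> sqsrc q"
  using assms by (simp_all add: square_ok_def is_square_def hom_iff isos_iff)

lemma square_okI:
  assumes "sqsrc q \<in> Mor L" "sqtrg q \<in> Mor L" "sqs q \<in> Mor L" "src1 L (sqs q) = src1 L (sqsrc q)" "trg1 L (sqs q) = src1 L (sqtrg q)"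
    "sqt q \<in> Mor L" "src1 L (sqt q) = trg1 L (sqsrc q)" "trg1 L (sqt q) = trg1 L (sqtrg q)"
    "iso2 L (sqphi q)" "src2 L (sqphi q) = sqtrg q \<cdot> sqs q" "trg2 L (sqphi q) = sqt q \<cdot> sqsrc q"
  shows "square_ok L q"
  using assms by (simp add: square_ok_def is_square_def hom_iff isos_iff)

lemma square_cell_okD:
  assumes "square_cell_ok L w"
  shows "square_ok L (scsrc w)" "square_ok L (sctrg w)" "sqsrc (sctrg w) = sqsrc (scsrc w)" "sqtrg (sctrg w) = sqtrg (scsrc w)"
    "scs w \<in> Cell L" "src2 L (scs w) = sqs (scsrc w)" "trg2 L (scs w) = sqs (sctrg w)"
    "sct w \<in> Cell L" "src2 L (sct w) = sqt (scsrc w)" "trg2 L (sct w) = sqt (sctrg w)"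
  using assms by (simp_all add: square_cell_ok_def cells_iff)

lemma square_cell_ok_eq:
  assumes "square_cell_ok L w"
  shows "sqphi (sctrg w) \<bullet> (id2 L (sqtrg (scsrc w)) \<star> scs w) = (sct w \<star> id2 L (sqsrc (scsrc w))) \<bullet> sqphi (scsrc w)"
  using assms unfolding square_cell_ok_def by blast

lemma square_comp_ok [simp]: "\<lbrakk>square_ok L q; square_ok L r; sqtrg q = sqsrc r\<rbrakk> \<Longrightarrow> square_ok L (square_comp L r q)"
  by (rule square_okI) (simp_all add: square_okD)

lemma square_comp_assoc [simp]:
  assumes "square_ok L q" "square_ok L r" "square_ok L p" "sqtrg q = sqsrc r" "sqtrg r = sqsrc p"
  shows "square_comp L (square_comp L p r) q = square_comp L p (square_comp L r q)"
proof -
  note [simp] = square_okD[OF assms(1)] square_okD[OF assms(2)] square_okD[OF assms(3)] assms(4,5)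
  show ?thesis by (rule square.equality) simp_all
qed

lemma square_cell_ok_vcomp [simp]:
  assumes w: "square_cell_ok L w" and v: "square_cell_ok L v" and m [simp]: "scsrc v = sctrg w"
  shows "square_cell_ok L \<lparr>scsrc = scsrc w, sctrg = sctrg v, scs = scs v \<bullet> scs w, sct = sct v \<bullet> sct w\<rparr>"
proof -
  note wd [simp] = square_cell_okD[OF w]
  note vd [simp] = square_cell_okD[OF v, unfolded m]
  note [simp] = square_okD[OF wd(1)] square_okD[OF wd(2)] square_okD[OF vd(2)]
  have eq: "sqphi (sctrg w) \<bullet> (id2 L (sqtrg (scsrc w)) \<star> scs w) = (sct w \<star> id2 L (sqsrc (scsrc w))) \<bullet> sqphi (scsrc w)"
    "sqphi (sctrg v) \<bullet> (id2 L (sqtrg (scsrc w)) \<star> scs v) = (sct v \<star> id2 L (sqsrc (scsrc w))) \<bullet> sqphi (sctrg w)"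
    using square_cell_ok_eq[OF w] square_cell_ok_eq[OF v] by simp_all
  have "sqphi (sctrg v) \<bullet> (id2 L (sqtrg (scsrc w)) \<star> (scs v \<bullet> scs w))
    = (sqphi (sctrg v) \<bullet> (id2 L (sqtrg (scsrc w)) \<star> scs v)) \<bullet> (id2 L (sqtrg (scsrc w)) \<star> scs w)" by simp
  also have "\<dots> = (sct v \<star> id2 L (sqsrc (scsrc w))) \<bullet> (sqphi (sctrg w) \<bullet> (id2 L (sqtrg (scsrc w)) \<star> scs w))"
    unfolding eq(2) by simp
  also have "\<dots> = ((sct v \<bullet> sct w) \<star> id2 L (sqsrc (scsrc w))) \<bullet> sqphi (scsrc w)" unfolding eq(1) by simp
  finally show ?thesis by (simp add: square_cell_ok_def cells_iff)
qed

lemma square_cell_ok_hcomp [simp]: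
  assumes w: "square_cell_ok L w" and v: "square_cell_ok L v" and m [simp]: "sqsrc (scsrc v) = sqtrg (scsrc w)"
  shows "square_cell_ok L \<lparr>scsrc = square_comp L (scsrc v) (scsrc w), sctrg = square_comp L (sctrg v) (sctrg w), scs = scs v \<star> scs w, sct = sct v \<star> sct w\<rparr>"
proof -
  note wd = square_cell_okD[OF w]
  note vd = square_cell_okD[OF v, unfolded m]
  let ?q = "scsrc w" and ?q' = "sctrg w" and ?r = "scsrc v" and ?r' = "sctrg v"
  \<comment> \<open>Plain names in place of nested record selectors let the boundary equations act
    as rewrite rules on variables.\<close>
  define e f g s s' t t' \<phi> \<phi>' x x' y y' \<psi> \<psi>' where defs: "e = sqsrc ?q" "f = sqtrg ?q" "g = sqtrg ?r"
    "s = sqs ?q" "s' = sqs ?q'" "t = sqt ?q" "t' = sqt ?q'" "\<phi> = sqphi ?q" "\<phi>' = sqphi ?q'"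
    "x = sqs ?r" "x' = sqs ?r'" "y = sqt ?r" "y' = sqt ?r'" "\<psi> = sqphi ?r" "\<psi>' = sqphi ?r'"
  note sq = square_okD[OF wd(1)] square_okD[OF wd(2)] square_okD[OF vd(1)] square_okD[OF vd(2)]
  have [simp]: "e \<in> Mor L" "f \<in> Mor L" "g \<in> Mor L" "s \<in> Mor L" "src1 L s = src1 L e" "trg1 L s = src1 L f"
    "s' \<in> Mor L" "src1 L s' = src1 L e" "trg1 L s' = src1 L f" "t \<in> Mor L" "src1 L t = trg1 L e" "trg1 L t = trg1 L f"
    "t' \<in> Mor L" "src1 L t' = trg1 L e" "trg1 L t' = trg1 L f" "iso2 L \<phi>" "src2 L \<phi> = f \<cdot> s" "trg2 L \<phi> = t \<cdot> e"
    "iso2 L \<phi>'" "src2 L \<phi>' = f \<cdot> s'" "trg2 L \<phi>' = t' \<cdot> e"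
    "x \<in> Mor L" "src1 L x = src1 L f" "trg1 L x = src1 L g" "x' \<in> Mor L" "src1 L x' = src1 L f" "trg1 L x' = src1 L g"
    "y \<in> Mor L" "src1 L y = trg1 L f" "trg1 L y = trg1 L g" "y' \<in> Mor L" "src1 L y' = trg1 L f" "trg1 L y' = trg1 L g"
    "iso2 L \<psi>" "src2 L \<psi> = g \<cdot> x" "trg2 L \<psi> = y \<cdot> f" "iso2 L \<psi>'" "src2 L \<psi>' = g \<cdot> x'" "trg2 L \<psi>' = y' \<cdot> f"
    unfolding defs using sq wd vd m by simp_all
  define ws wt vs vt where defs2: "ws = scs w" "wt = sct w" "vs = scs v" "vt = sct v"
  have [simp]: "ws \<in> Cell L" "src2 L ws = s" "trg2 L ws = s'" "wt \<in> Cell L" "src2 L wt = t" "trg2 L wt = t'"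
    "vs \<in> Cell L" "src2 L vs = x" "trg2 L vs = x'" "vt \<in> Cell L" "src2 L vt = y" "trg2 L vt = y'"
    unfolding defs defs2 using wd vd by simp_all
  have eq: "\<phi>' \<bullet> (id2 L f \<star> ws) = (wt \<star> id2 L e) \<bullet> \<phi>" "\<psi>' \<bullet> (id2 L g \<star> vs) = (vt \<star> id2 L f) \<bullet> \<psi>"
    unfolding defs defs2 using square_cell_ok_eq[OF w] square_cell_ok_eq[OF v] m by simp_all
  \<comment> \<open>Compatibility of \<open>v\<close> is applied first. Then \<open>ws\<close>
    slides past \<open>\<psi>\<close> and \<open>vt\<close> past \<open>\<phi>'\<close>, which
    brings \<open>ws\<close> next to \<open>\<phi>'\<close> for compatibility of
    \<open>w\<close>.\<close>
  have "((id2 L y' \<star> \<phi>') \<bullet> (\<psi>' \<star> id2 L s')) \<bullet> (id2 L g \<star> vs \<star> ws)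
    = (id2 L y' \<star> \<phi>') \<bullet> ((\<psi>' \<bullet> (id2 L g \<star> vs)) \<star> id2 L s') \<bullet> (id2 L (g \<cdot> x) \<star> ws)"
    using hcomp_wr_wl[of ws vs] by simp
  also have "\<dots> = (id2 L y' \<star> \<phi>') \<bullet> (vt \<star> id2 L (f \<cdot> s')) \<bullet> ((\<psi> \<star> id2 L s') \<bullet> (id2 L (g \<cdot> x) \<star> ws))"
    unfolding eq(2) by simp
  also have "(\<psi> \<star> id2 L s') \<bullet> (id2 L (g \<cdot> x) \<star> ws) = (id2 L (y \<cdot> f) \<star> ws) \<bullet> (\<psi> \<star> id2 L s)"
    using exch[of ws \<psi>] by simp
  also have "(id2 L y' \<star> \<phi>') \<bullet> (vt \<star> id2 L (f \<cdot> s')) \<bullet> (id2 L (y \<cdot> f) \<star> ws) \<bullet> (\<psi> \<star> id2 L s)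
    = ((id2 L y' \<star> \<phi>') \<bullet> (vt \<star> id2 L (f \<cdot> s'))) \<bullet> (id2 L (y \<cdot> f) \<star> ws) \<bullet> (\<psi> \<star> id2 L s)" by simp
  also have "(id2 L y' \<star> \<phi>') \<bullet> (vt \<star> id2 L (f \<cdot> s')) = (vt \<star> id2 L (t' \<cdot> e)) \<bullet> (id2 L y \<star> \<phi>')"
    using exch[of \<phi>' vt] by simp
  also have "((vt \<star> id2 L (t' \<cdot> e)) \<bullet> (id2 L y \<star> \<phi>')) \<bullet> (id2 L (y \<cdot> f) \<star> ws) \<bullet> (\<psi> \<star> id2 L s)
    = (vt \<star> id2 L (t' \<cdot> e)) \<bullet> (id2 L y \<star> (\<phi>' \<bullet> (id2 L f \<star> ws))) \<bullet> (\<psi> \<star> id2 L s)" by simp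
  also have "\<dots> = ((vt \<star> id2 L t') \<bullet> (id2 L y \<star> wt)) \<star> id2 L e \<bullet> (id2 L y \<star> \<phi>) \<bullet> (\<psi> \<star> id2 L s)"
    unfolding eq(1) by simp
  also have "(vt \<star> id2 L t') \<bullet> (id2 L y \<star> wt) = vt \<star> wt" using hcomp_wr_wl[of wt vt] by simp
  finally have fin: "((id2 L y' \<star> \<phi>') \<bullet> (\<psi>' \<star> id2 L s')) \<bullet> (id2 L g \<star> vs \<star> ws)
    = ((vt \<star> wt) \<star> id2 L e) \<bullet> (id2 L y \<star> \<phi>) \<bullet> (\<psi> \<star> id2 L s)" .
  have ok: "square_ok L (square_comp L ?r ?q)" "square_ok L (square_comp L ?r' ?q')" using wd vd by simp_all
  show ?thesis
    using ok fin unfolding square_cell_ok_def by (simp add: cells_iff wd vd flip: defs defs2)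
qed

lemma arrow2_two_category: "two_category (arrow2 L)"
proof unfold_locales
  fix f A B g C \<alpha> f' \<alpha>' f'' \<beta> g' \<beta>' g''
  assume a: "f \<in> hom (arrow2 L) A B" "g \<in> hom (arrow2 L) B C" "\<alpha> \<in> cells (arrow2 L) f f'"
       "\<alpha>' \<in> cells (arrow2 L) f' f''" "\<beta> \<in> cells (arrow2 L) g g'" "\<beta>' \<in> cells (arrow2 L) g' g''"
  then have ok: "square_cell_ok L \<alpha>" "square_cell_ok L \<alpha>'" "square_cell_ok L \<beta>" "square_cell_ok L \<beta>'" "square_ok L f" "square_ok L g"
    and e: "scsrc \<alpha> = f" "sctrg \<alpha> = f'" "scsrc \<alpha>' = f'" "sctrg \<alpha>' = f''" "scsrc \<beta> = g" "sctrg \<beta> = g'" "scsrc \<beta>' = g'" "sctrg \<beta>' = g''"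
    "sqtrg f = sqsrc g" by (auto simp: hom_iff cells_iff)
  note [simp] = square_okD[OF ok(5)] square_okD[OF ok(6)] e
  note [simp] = square_cell_okD(5-10)[OF ok(1), unfolded e] square_cell_okD(5-10)[OF ok(2), unfolded e]
    square_cell_okD(5-10)[OF ok(3), unfolded e] square_cell_okD(5-10)[OF ok(4), unfolded e]
  show "hcomp (arrow2 L) (vcomp (arrow2 L) \<beta>' \<beta>) (vcomp (arrow2 L) \<alpha>' \<alpha>)
    = vcomp (arrow2 L) (hcomp (arrow2 L) \<beta>' \<alpha>') (hcomp (arrow2 L) \<beta> \<alpha>)"
    by (simp add: interchange')
next
  fix f assume "f \<in> Mor (arrow2 L)"
  then show "src1 (arrow2 L) f \<in> Obj (arrow2 L) \<and> trg1 (arrow2 L) f \<in> Obj (arrow2 L)" by (simp add: square_okD)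
next
  fix \<alpha> assume "\<alpha> \<in> Cell (arrow2 L)"
  then have a: "square_cell_ok L \<alpha>" by simp
  note d = square_cell_okD[OF a]
  show "src2 (arrow2 L) \<alpha> \<in> Mor (arrow2 L) \<and> trg2 (arrow2 L) \<alpha> \<in> Mor (arrow2 L)" using d by simp
  show "src1 (arrow2 L) (src2 (arrow2 L) \<alpha>) = src1 (arrow2 L) (trg2 (arrow2 L) \<alpha>) \<and> trg1 (arrow2 L) (src2 (arrow2 L) \<alpha>) = trg1 (arrow2 L) (trg2 (arrow2 L) \<alpha>)"
    using d by simp
next
  fix A assume "A \<in> Obj (arrow2 L)"
  then show "one (arrow2 L) A \<in> hom (arrow2 L) A A" by (simp add: hom_iff) (rule square_okI, simp_all)
next
  fix f A B g C assume "f \<in> hom (arrow2 L) A B" "g \<in> hom (arrow2 L) B C"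
  then show "comp1 (arrow2 L) g f \<in> hom (arrow2 L) A C" by (auto simp: hom_iff)
next
  fix f A B g C h D assume "f \<in> hom (arrow2 L) A B" "g \<in> hom (arrow2 L) B C" "h \<in> hom (arrow2 L) C D"
  then show "comp1 (arrow2 L) (comp1 (arrow2 L) h g) f = comp1 (arrow2 L) h (comp1 (arrow2 L) g f)" by (auto simp: hom_iff)
next
  fix f A B assume "f \<in> hom (arrow2 L) A B"
  then have f: "square_ok L f" and [simp]: "sqsrc f = A" "sqtrg f = B" by (auto simp: hom_iff)
  note [simp] = square_okD[OF f, simplified]
  show "comp1 (arrow2 L) f (one (arrow2 L) A) = f" by (rule square.equality) simp_all
  show "comp1 (arrow2 L) (one (arrow2 L) B) f = f" by (rule square.equality) simp_all
next
  fix f assume "f \<in> Mor (arrow2 L)"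
  then have f: "square_ok L f" by simp
  note [simp] = square_okD[OF f]
  show "id2 (arrow2 L) f \<in> cells (arrow2 L) f f" using f by (simp add: cells_iff square_cell_ok_def)
next
  fix \<alpha> f g \<beta> h assume "\<alpha> \<in> cells (arrow2 L) f g" "\<beta> \<in> cells (arrow2 L) g h"
  then show "vcomp (arrow2 L) \<beta> \<alpha> \<in> cells (arrow2 L) f h" using square_cell_ok_vcomp[of \<alpha> \<beta>] by (auto simp: cells_iff)
next
  fix \<alpha> f g \<beta> h \<gamma> k assume "\<alpha> \<in> cells (arrow2 L) f g" "\<beta> \<in> cells (arrow2 L) g h" "\<gamma> \<in> cells (arrow2 L) h k"
  then show "vcomp (arrow2 L) (vcomp (arrow2 L) \<gamma> \<beta>) \<alpha> = vcomp (arrow2 L) \<gamma> (vcomp (arrow2 L) \<beta> \<alpha>)"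
    by (auto simp: cells_iff square_cell_okD)
next
  fix \<alpha> f g assume "\<alpha> \<in> cells (arrow2 L) f g"
  then have a: "square_cell_ok L \<alpha>" and [simp]: "scsrc \<alpha> = f" "sctrg \<alpha> = g" by (auto simp: cells_iff)
  note [simp] = square_cell_okD[OF a, simplified]
  show "vcomp (arrow2 L) \<alpha> (id2 (arrow2 L) f) = \<alpha>" by (rule square_cell.equality) simp_all
  show "vcomp (arrow2 L) (id2 (arrow2 L) g) \<alpha> = \<alpha>" by (rule square_cell.equality) simp_all
next
  fix f A B g C \<alpha> f' \<beta> g'
  assume "f \<in> hom (arrow2 L) A B" "g \<in> hom (arrow2 L) B C" "\<alpha> \<in> cells (arrow2 L) f f'" "\<beta> \<in> cells (arrow2 L) g g'"
  then show "hcomp (arrow2 L) \<beta> \<alpha> \<in> cells (arrow2 L) (comp1 (arrow2 L) g f) (comp1 (arrow2 L) g' f')"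
    using square_cell_ok_hcomp[of \<alpha> \<beta>] by (auto simp: hom_iff cells_iff)
next
  fix f A B g C assume "f \<in> hom (arrow2 L) A B" "g \<in> hom (arrow2 L) B C"
  then have "square_ok L f" "square_ok L g" "sqtrg f = sqsrc g" by (auto simp: hom_iff)
  then show "hcomp (arrow2 L) (id2 (arrow2 L) g) (id2 (arrow2 L) f) = id2 (arrow2 L) (comp1 (arrow2 L) g f)" by (simp add: square_okD)
next
  fix f A B g C h D \<alpha> f' \<beta> g' \<gamma> h'
  assume "f \<in> hom (arrow2 L) A B" "g \<in> hom (arrow2 L) B C" "h \<in> hom (arrow2 L) C D"
    "\<alpha> \<in> cells (arrow2 L) f f'" "\<beta> \<in> cells (arrow2 L) g g'" "\<gamma> \<in> cells (arrow2 L) h h'"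
  then have ok: "square_cell_ok L \<alpha>" "square_cell_ok L \<beta>" "square_cell_ok L \<gamma>"
    and [simp]: "scsrc \<alpha> = f" "sctrg \<alpha> = f'" "scsrc \<beta> = g" "sctrg \<beta> = g'" "scsrc \<gamma> = h" "sctrg \<gamma> = h'"
      "sqtrg f = sqsrc g" "sqtrg g = sqsrc h" by (auto simp: hom_iff cells_iff)
  note d [simp] = square_cell_okD[OF ok(1), simplified] square_cell_okD[OF ok(2), simplified] square_cell_okD[OF ok(3), simplified]
  note [simp] = square_okD(3-8)[OF d(1)] square_okD(3-8)[OF d(11)] square_okD(3-8)[OF d(21)]
  show "hcomp (arrow2 L) (hcomp (arrow2 L) \<gamma> \<beta>) \<alpha> = hcomp (arrow2 L) \<gamma> (hcomp (arrow2 L) \<beta> \<alpha>)" by simp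
next
  fix f A B \<alpha> f' assume "f \<in> hom (arrow2 L) A B" "\<alpha> \<in> cells (arrow2 L) f f'"
  then have a: "square_cell_ok L \<alpha>" and [simp]: "scsrc \<alpha> = f" "sctrg \<alpha> = f'" "sqsrc f = A" "sqtrg f = B" by (auto simp: hom_iff cells_iff)
  note d [simp] = square_cell_okD[OF a, simplified]
  note [simp] = square_okD[OF d(1), simplified] square_okD[OF d(2), simplified]
  have 1: "square_comp L f (one (arrow2 L) A) = f" "square_comp L (one (arrow2 L) B) f = f"
    by (rule square.equality; simp)+
  have 2: "square_comp L f' (one (arrow2 L) A) = f'" "square_comp L (one (arrow2 L) B) f' = f'"
    by (rule square.equality; simp)+
  show "hcomp (arrow2 L) \<alpha> (id2 (arrow2 L) (one (arrow2 L) A)) = \<alpha>"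
    using 1 2 by (intro square_cell.equality) simp_all
  show "hcomp (arrow2 L) (id2 (arrow2 L) (one (arrow2 L) B)) \<alpha> = \<alpha>"
    using 1 2 by (intro square_cell.equality) simp_all
qed

text \<open>Compatibility of a 2-cell of squares expresses its domain component, whiskered with the
  target morphism, through its codomain component; faithfulness of that target morphism then
  determines it. The domain projection is treated dually.\<close>

lemma strict_over_cod:
  assumes S: "S \<subseteq> Mor L" "\<And>m. m \<in> S \<Longrightarrow> faithful1 L m"
  shows "strict_over (full_sub (arrow2 L) S) L (trg1 L) sqt sct"
proof -
  interpret A: two_category "arrow2 L" by (rule arrow2_two_category)
  interpret F: two_category "full_sub (arrow2 L) S" by (rule A.full_sub_two_category)
  show ?thesis
  proof unfold_locales
    fix \<alpha> \<beta> assume a: "\<alpha> \<in> Cell (full_sub (arrow2 L) S)" "\<beta> \<in> Cell (full_sub (arrow2 L) S)"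
      and e: "src2 (full_sub (arrow2 L) S) \<alpha> = src2 (full_sub (arrow2 L) S) \<beta>" "trg2 (full_sub (arrow2 L) S) \<alpha> = trg2 (full_sub (arrow2 L) S) \<beta>"
        "sct \<alpha> = sct \<beta>"
    then have ok: "square_cell_ok L \<alpha>" "square_cell_ok L \<beta>" and m: "sqtrg (scsrc \<beta>) \<in> S"
      and e': "scsrc \<alpha> = scsrc \<beta>" "sctrg \<alpha> = sctrg \<beta>" by simp_all
    note d = square_cell_okD[OF ok(1), unfolded e'] square_cell_okD[OF ok(2)]
    note [simp] = d square_okD[OF d(11)] square_okD[OF d(12)]
    have "sqphi (sctrg \<beta>) \<bullet> (id2 L (sqtrg (scsrc \<beta>)) \<star> scs \<alpha>) = sqphi (sctrg \<beta>) \<bullet> (id2 L (sqtrg (scsrc \<beta>)) \<star> scs \<beta>)"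
      using square_cell_ok_eq[OF ok(1)] square_cell_ok_eq[OF ok(2)] e' e(3) by (simp only:)
    then have eq: "id2 L (sqtrg (scsrc \<beta>)) \<star> scs \<alpha> = id2 L (sqtrg (scsrc \<beta>)) \<star> scs \<beta>"
      by (rule iffD1[OF iso2_cancel_left, rotated -1]) simp_all
    have "inj_on (\<lambda>\<gamma>. id2 L (sqtrg (scsrc \<beta>)) \<star> \<gamma>) (cells L (sqs (scsrc \<beta>)) (sqs (sctrg \<beta>)))"
      using S(2)[OF m] square_okD(3-5)[OF d(12)] square_okD(3-5)[OF d(11)] unfolding faithful1_def by (simp add: hom_iff)
    then have "scs \<alpha> = scs \<beta>" by (rule inj_onD) (use eq in \<open>simp_all add: cells_iff\<close>)
    then show "\<alpha> = \<beta>" using e' e(3) by simp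
  qed (auto simp: square_okD square_cell_okD)
qed

lemma strict_over_dom:
  assumes S: "S \<subseteq> Mor L" "\<And>m. m \<in> S \<Longrightarrow> cofaithful1 L m"
  shows "strict_over (full_sub (arrow2 L) S) L (src1 L) sqs scs"
proof -
  interpret A: two_category "arrow2 L" by (rule arrow2_two_category)
  interpret F: two_category "full_sub (arrow2 L) S" by (rule A.full_sub_two_category)
  show ?thesis
  proof unfold_locales
    fix \<alpha> \<beta> assume a: "\<alpha> \<in> Cell (full_sub (arrow2 L) S)" "\<beta> \<in> Cell (full_sub (arrow2 L) S)"
      and e: "src2 (full_sub (arrow2 L) S) \<alpha> = src2 (full_sub (arrow2 L) S) \<beta>" "trg2 (full_sub (arrow2 L) S) \<alpha> = trg2 (full_sub (arrow2 L) S) \<beta>"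
        "scs \<alpha> = scs \<beta>"
    then have ok: "square_cell_ok L \<alpha>" "square_cell_ok L \<beta>" and m: "sqsrc (scsrc \<beta>) \<in> S"
      and e': "scsrc \<alpha> = scsrc \<beta>" "sctrg \<alpha> = sctrg \<beta>" by simp_all
    note d = square_cell_okD[OF ok(1), unfolded e'] square_cell_okD[OF ok(2)]
    note [simp] = d square_okD[OF d(11)] square_okD[OF d(12)]
    have "(sct \<alpha> \<star> id2 L (sqsrc (scsrc \<beta>))) \<bullet> sqphi (scsrc \<beta>) = (sct \<beta> \<star> id2 L (sqsrc (scsrc \<beta>))) \<bullet> sqphi (scsrc \<beta>)"
      using square_cell_ok_eq[OF ok(1)] square_cell_ok_eq[OF ok(2)] e' e(3) by (simp only:)
    then have eq: "sct \<alpha> \<star> id2 L (sqsrc (scsrc \<beta>)) = sct \<beta> \<star> id2 L (sqsrc (scsrc \<beta>))"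
      by (rule iffD1[OF iso2_cancel_right, rotated -1]) simp_all
    have "inj_on (\<lambda>\<gamma>. \<gamma> \<star> id2 L (sqsrc (scsrc \<beta>))) (cells L (sqt (scsrc \<beta>)) (sqt (sctrg \<beta>)))"
      using S(2)[OF m] square_okD(6-8)[OF d(12)] square_okD(6-8)[OF d(11)] unfolding cofaithful1_def by (simp add: hom_iff)
    then have "sct \<alpha> = sct \<beta>" by (rule inj_onD) (use eq in \<open>simp_all add: cells_iff\<close>)
    then show "\<alpha> = \<beta>" using e' e(3) by simp
  qed (auto simp: square_okD square_cell_okD)
qed

end

lemma op_act_left [simp]: "act_left (op2 L) (op_ideal I) = (\<lambda>b x. act_right L I x b)"
  by (simp add: act_right_def act_left_def fun_eq_iff)

text \<open>Stated from the few facts it uses about null data, so that it covers the coreflection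
  conditions as well, with \<open>op_ideal I\<close> over \<open>op2 L\<close>.\<close>

lemma reflects_structures_iff:
  fixes L :: "('o, 'm, 'c) two_cat" (structure)
  assumes "nullity L (null_structures L I) (null_between L I) (act_left L I) ar" and k: "k \<in> Mor L"
    and isos: "\<And>A B \<theta>. \<lbrakk>A \<in> Obj L; B \<in> Obj L\<rbrakk> \<Longrightarrow>
      \<theta> \<in> null_isos I A B \<longleftrightarrow> iso2 L \<theta> \<and> \<theta> \<in> null_cells I A B \<and> inv2 L \<theta> \<in> null_cells I A B"
    and mor: "\<And>A B n. \<lbrakk>A \<in> Obj L; B \<in> Obj L; n \<in> null_mor I A B\<rbrakk> \<Longrightarrow> n \<in> Mor L \<and> src1 L n = A \<and> trg1 L n = B"
    and nu: "\<And>A n b. \<lbrakk>b \<in> Mor L; A \<in> Obj L; n \<in> null_mor I A (src1 L b)\<rbrakk> \<Longrightarrow>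
      iso2 L (nu L I b n (one L A)) \<and> src2 L (nu L I b n (one L A)) = b \<cdot> n"
  shows "reflects_null_mor L I k \<and> reflects_null_cells L I k \<longleftrightarrow>
    reflects_structures L (null_structures L I) (null_between L I) (act_left L I) k"
proof -
  interpret nullity L "null_structures L I" "null_between L I" "act_left L I" ar by fact
  note k [simp]
  let ?NS = "null_structures L I" and ?nc = "null_between L I" and ?al = "act_left L I"
  have NSD: "iso2 L x" "trg2 L x \<in> null_mor I (src1 L (src2 L x)) (trg1 L (src2 L x))" if "x \<in> ?NS" for x
    using that by (simp_all add: null_structures_def)
  have key: "nci L ?nc x (id2 L (k \<cdot> s)) (?al k y) \<longleftrightarrow> nu L I k (trg2 L y) (one L (src1 L s)) \<bullet> (id2 L k \<star> y) \<bullet> inv2 L x \<in> null_isos I (src1 L s) (trg1 L k)"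
    if s: "s \<in> Mor L" "trg1 L s = src1 L k" and x: "x \<in> ?NS" "src2 L x = k \<cdot> s" and y: "y \<in> ?NS" "src2 L y = s" for s x y
  proof -
    note [simp] = s x y NSD(1)[OF x(1)] NSD(1)[OF y(1)]
    have n: "trg2 L y \<in> null_mor I (src1 L s) (src1 L k)" using NSD(2)[OF y(1)] by simp
    then have [simp]: "iso2 L (nu L I k (trg2 L y) (one L (src1 L s)))" "src2 L (nu L I k (trg2 L y) (one L (src1 L s))) = k \<cdot> trg2 L y"
      using nu[OF k _ n] by simp_all
    have [simp]: "trg2 L y \<in> Mor L" "src1 L (trg2 L y) = src1 L s" "trg1 L (trg2 L y) = src1 L k" using mor[OF _ _ n] by simp_all
    have al: "?al k y = nu L I k (trg2 L y) (one L (src1 L s)) \<bullet> (id2 L k \<star> y)" by (simp add: act_left_def)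
    have a: "?al k y \<in> ?NS" "src2 L (?al k y) = k \<cdot> s" using al_NS[of y k] by simp_all
    show ?thesis using a by (simp add: isos nci_def null_between_def) (simp add: al)
  qed
  have 1: "reflects_null_mor L I k \<longleftrightarrow> (\<forall>s x. s \<in> Mor L \<and> trg1 L s = src1 L k \<and> x \<in> ?NS \<and> src2 L x = k \<cdot> s \<longrightarrow>
        (\<exists>y \<in> ?NS. src2 L y = s \<and> nci L ?nc x (id2 L (k \<cdot> s)) (?al k y)))" (is "_ \<longleftrightarrow> ?R")
  proof
    assume r: "reflects_null_mor L I k"
    show ?R
    proof (intro allI impI)
      fix s x assume s: "s \<in> Mor L \<and> trg1 L s = src1 L k \<and> x \<in> ?NS \<and> src2 L x = k \<cdot> s"
      then have "s \<in> hom L (src1 L s) (src1 L k)" "trg2 L x \<in> null_mor I (src1 L s) (trg1 L k)" "x \<in> isos L (k \<cdot> s) (trg2 L x)"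
        using NSD[of x] by (auto simp: hom_iff isos_iff)
      with r obtain p \<psi> where p: "p \<in> null_mor I (src1 L s) (src1 L k)" "\<psi> \<in> isos L s p"
        "nu L I k p (one L (src1 L s)) \<bullet> (id2 L k \<star> \<psi>) \<bullet> inv2 L x \<in> null_isos I (src1 L s) (trg1 L k)"
        unfolding reflects_null_mor_def by blast
      then have "\<psi> \<in> ?NS" "src2 L \<psi> = s" using s by (auto simp: null_structures_def isos_iff)
      with key[of s x \<psi>] p s show "\<exists>y \<in> ?NS. src2 L y = s \<and> nci L ?nc x (id2 L (k \<cdot> s)) (?al k y)"
        by (intro bexI[of _ \<psi>]) (auto simp: isos_iff)
    qed
  next
    assume R: ?R
    show "reflects_null_mor L I k"
      unfolding reflects_null_mor_def
    proof (intro allI ballI)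
      fix D s n \<delta> assume s: "s \<in> hom L D (src1 L k)" and n: "n \<in> null_mor I D (trg1 L k)" and d: "\<delta> \<in> isos L (k \<cdot> s) n"
      then have s': "s \<in> Mor L" "src1 L s = D" "trg1 L s = src1 L k" and dN: "\<delta> \<in> ?NS" "src2 L \<delta> = k \<cdot> s"
        by (auto simp: null_structures_def isos_iff hom_iff)
      with R obtain y where y: "y \<in> ?NS" "src2 L y = s" "nci L ?nc \<delta> (id2 L (k \<cdot> s)) (?al k y)" by blast
      have "trg2 L y \<in> null_mor I D (src1 L k)" "y \<in> isos L s (trg2 L y)" using NSD[OF y(1)] y s' by (auto simp: isos_iff)
      then show "\<exists>p \<in> null_mor I D (src1 L k). \<exists>\<psi> \<in> isos L s p. nu L I k p (one L D) \<bullet> (id2 L k \<star> \<psi>) \<bullet> inv2 L \<delta> \<in> null_isos I D (trg1 L k)"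
        using key[OF s'(1,3) dN y(1,2)] y(3) s' by blast
    qed
  qed
  have 2: "reflects_null_cells L I k \<longleftrightarrow> (\<forall>x y \<alpha>. x \<in> ?NS \<and> y \<in> ?NS \<and> \<alpha> \<in> Cell L \<and> src2 L \<alpha> = src2 L x \<and> trg2 L \<alpha> = src2 L y \<and>
        trg1 L (src2 L x) = src1 L k \<and> ?nc (?al k x) (id2 L k \<star> \<alpha>) (?al k y) \<longrightarrow> ?nc x \<alpha> y)" (is "_ \<longleftrightarrow> ?R")
  proof
    assume r: "reflects_null_cells L I k"
    show ?R
    proof (intro allI impI)
      fix x y \<alpha> assume a: "x \<in> ?NS \<and> y \<in> ?NS \<and> \<alpha> \<in> Cell L \<and> src2 L \<alpha> = src2 L x \<and> trg2 L \<alpha> = src2 L y \<and>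
        trg1 L (src2 L x) = src1 L k \<and> ?nc (?al k x) (id2 L k \<star> \<alpha>) (?al k y)"
      then have [simp]: "x \<in> ?NS" "y \<in> ?NS" "\<alpha> \<in> Cell L" "src2 L \<alpha> = src2 L x" "trg2 L \<alpha> = src2 L y" "trg1 L (src2 L x) = src1 L k"
        and n: "?nc (?al k x) (id2 L k \<star> \<alpha>) (?al k y)" by auto
      have i [simp]: "iso2 L x" "iso2 L y" by (rule NSD; simp)+
      let ?D = "src1 L (src2 L x)"
      have p [simp]: "src1 L (src2 L y) = ?D" "trg1 L (src2 L y) = src1 L k" using src1_trg2[of \<alpha>] trg1_trg2[of \<alpha>] by simp_all
      have nx: "trg2 L x \<in> null_mor I ?D (src1 L k)" and ny: "trg2 L y \<in> null_mor I ?D (src1 L k)"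
        using NSD(2)[of x] NSD(2)[of y] by simp_all
      have [simp]: "iso2 L (nu L I k (trg2 L x) (one L ?D))" "src2 L (nu L I k (trg2 L x) (one L ?D)) = k \<cdot> trg2 L x"
        "iso2 L (nu L I k (trg2 L y) (one L ?D))" "src2 L (nu L I k (trg2 L y) (one L ?D)) = k \<cdot> trg2 L y"
        using nu[OF k _ nx] nu[OF k _ ny] by simp_all
      \<comment> \<open>The given condition speaks of 2-cells between null morphisms, so
        \<open>\<alpha>\<close> is conjugated by its structures to a 2-cell between their
        targets.\<close>
      have "nu L I k (trg2 L y) (one L ?D) \<bullet> (id2 L k \<star> (y \<bullet> \<alpha> \<bullet> inv2 L x)) \<bullet> inv2 L (nu L I k (trg2 L x) (one L ?D)) \<in> null_cells I ?D (trg1 L k)"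
        using n al_NS[of x k] by (simp add: null_between_def) (simp add: act_left_def)
      moreover have "y \<bullet> \<alpha> \<bullet> inv2 L x \<in> cells L (trg2 L x) (trg2 L y)" by (simp add: cells_iff)
      moreover have "?D \<in> Obj L" by simp
      ultimately have "y \<bullet> \<alpha> \<bullet> inv2 L x \<in> null_cells I ?D (src1 L k)"
        using r[unfolded reflects_null_cells_def, rule_format, OF _ nx ny] by blast
      then show "?nc x \<alpha> y" by (simp add: null_between_def)
    qed
  next
    assume R: ?R
    show "reflects_null_cells L I k"
      unfolding reflects_null_cells_def
    proof (intro ballI impI)
      fix D s s' \<mu> assume D: "D \<in> Obj L" and s: "s \<in> null_mor I D (src1 L k)" and s': "s' \<in> null_mor I D (src1 L k)" and m: "\<mu> \<in> cells L s s'"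
        and n: "nu L I k s' (one L D) \<bullet> (id2 L k \<star> \<mu>) \<bullet> inv2 L (nu L I k s (one L D)) \<in> null_cells I D (trg1 L k)"
      have [simp]: "\<mu> \<in> Cell L" "src2 L \<mu> = s" "trg2 L \<mu> = s'" using m by (auto simp: cells_iff)
      have [simp]: "s \<in> Mor L" "src1 L s = D" "trg1 L s = src1 L k" "s' \<in> Mor L" "src1 L s' = D" "trg1 L s' = src1 L k" "D \<in> Obj L"
        using mor[OF D _ s] mor[OF D _ s'] D by simp_all
      have [simp]: "iso2 L (nu L I k s (one L D))" "src2 L (nu L I k s (one L D)) = k \<cdot> s"
        "iso2 L (nu L I k s' (one L D))" "src2 L (nu L I k s' (one L D)) = k \<cdot> s'" using nu[OF k D s] nu[OF k D s'] by simp_all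
      \<comment> \<open>A null morphism carries its identity as a structure, and for these
        structures conjugation leaves \<open>\<mu>\<close> unchanged.\<close>
      have N [simp]: "id2 L s \<in> ?NS" "id2 L s' \<in> ?NS" using s s' by (simp_all add: null_structures_def)
      have a: "?al k (id2 L s) \<in> ?NS" "?al k (id2 L s') \<in> ?NS" using al_NS[of "id2 L s" k] al_NS[of "id2 L s'" k] by simp_all
      have "?nc (?al k (id2 L s)) (id2 L k \<star> \<mu>) (?al k (id2 L s'))"
        using n a by (simp add: null_between_def act_left_def)
      then have "?nc (id2 L s) \<mu> (id2 L s')" by (intro R[rule_format]) simp
      then show "\<mu> \<in> null_cells I D (src1 L k)" by (simp add: null_between_def)
    qed
  qed
  show ?thesis unfolding 1 2 reflects_structures_def by simp
qed

context ideal
begin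

lemma reflects_structures:
  "k \<in> Mor L \<Longrightarrow> reflects_null_mor L I k \<and> reflects_null_cells L I k \<longleftrightarrow> reflects_structures L NS nc al k"
proof (rule reflects_structures_iff[OF nullity])
  fix A n b assume "b \<in> Mor L" "A \<in> Obj L" and n: "n \<in> null_mor I A (src1 L b)"
  then show "iso2 L (nu L I b n (one L A)) \<and> src2 L (nu L I b n (one L A)) = b \<cdot> n"
    using nu_iso[of "one L A" b n] null_mor_hom[OF _ _ n] by simp
qed (use null_mor_hom null_isos_iff in auto)

lemma reflects_structures_op:
  assumes "k \<in> Mor L"
  shows "reflects_null_mor (op2 L) (op_ideal I) k \<and> reflects_null_cells (op2 L) (op_ideal I) k \<longleftrightarrow>
    reflects_structures (op2 L) NS nc (\<lambda>b x. ar x b) k"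
proof -
  interpret nullity L NS nc al ar by (rule nullity)
  have n: "nullity (op2 L) (null_structures (op2 L) (op_ideal I)) (null_between (op2 L) (op_ideal I)) (act_left (op2 L) (op_ideal I)) (\<lambda>x a. al a x)"
    using nullity_op by simp
  have "reflects_null_mor (op2 L) (op_ideal I) k \<and> reflects_null_cells (op2 L) (op_ideal I) k \<longleftrightarrow>
    reflects_structures (op2 L) (null_structures (op2 L) (op_ideal I)) (null_between (op2 L) (op_ideal I)) (act_left (op2 L) (op_ideal I)) k"
  proof (rule reflects_structures_iff[OF n])
    fix A n b assume a: "b \<in> Mor (op2 L)" "A \<in> Obj (op2 L)" and n: "n \<in> null_mor (op_ideal I) A (src1 (op2 L) b)"
    then have n': "n \<in> null_mor I (trg1 L b) A" by simp
    show "iso2 (op2 L) (nu (op2 L) (op_ideal I) b n (one (op2 L) A)) \<and> src2 (op2 L) (nu (op2 L) (op_ideal I) b n (one (op2 L) A)) = b \<cdot>\<^bsub>op2 L\<^esub> n"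
      using nu_iso[of b "one L A" n] null_mor_hom[OF _ _ n'] n' a by simp
  qed (use null_mor_hom null_isos_iff assms in auto)
  then show ?thesis by simp
qed

end

section \<open>From closed 2-ideals to factorization systems\<close>

locale exact_ideal = ideal +
  assumes kernels: "has_two_kernels L I" and cokernels: "has_two_cokernels L I" and closed: "closed_ideal L I"
    and kernels_normal: "kernels_normal L I" and cokernels_normal: "cokernels_normal L I"
    and factorizations: "cokernel_kernel_factorizations L I"

sublocale ideal \<subseteq> nullity L NS nc al ar
  by (rule nullity)

context exact_ideal
begin

definition "EE = {e. is_two_cokernel L I e}"
definition "MM = {m. is_two_kernel L I m}"

lemma EE_iff: "e \<in> EE \<longleftrightarrow> (\<exists>j x. cokernel L NS nc al j e x)"
  by (auto simp: EE_def is_two_cokernel_def two_cokernel)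

lemma MM_iff: "m \<in> MM \<longleftrightarrow> (\<exists>f x. kernel L NS nc ar f m x)"
  by (auto simp: MM_def is_two_kernel_def two_kernel)

lemma MM_reflects: "m \<in> MM \<Longrightarrow> reflects_structures L NS nc al m"
  using closed reflects_structures[of m] kernelD(2) unfolding closed_ideal_def MM_def is_two_kernel_def two_kernel by blast

lemmas cokernel_equivalence = nullity.kernel_equivalence[OF nullity_op, unfolded op2_sel op2_iso2 op2_equivalence1]

lemma factorization_system: "factorization_system L EE MM"
  unfolding factorization_system_def
proof (intro conjI allI ballI impI)
  show "EE \<subseteq> Mor L" using cokernelD(2) by (auto simp: EE_iff)
  show "MM \<subseteq> Mor L" using kernelD(2) by (auto simp: MM_iff)
next
  fix m i assume "m \<in> MM" and i: "equivalence1 L i \<and> trg1 L i = src1 L m"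
  then obtain f x where k: "kernel L NS nc ar f m x" by (auto simp: MM_iff)
  have "m \<in> Mor L" "i \<in> Mor L" using kernelD(2)[OF k] i by simp_all
  then show "m \<cdot> i \<in> MM"
    unfolding MM_iff using kernel_equivalence[OF k, of i "id2 L (m \<cdot> i)" "m \<cdot> i"] i by auto
next
  fix e i assume "e \<in> EE" and i: "equivalence1 L i \<and> src1 L i = trg1 L e"
  then obtain f x where k: "cokernel L NS nc al f e x" by (auto simp: EE_iff)
  have "e \<in> Mor L" "i \<in> Mor L" using cokernelD(2)[OF k] i by simp_all
  then show "i \<cdot> e \<in> EE"
    unfolding EE_iff using cokernel_equivalence[OF k, of i "id2 L (i \<cdot> e)" "i \<cdot> e"] i by auto
next
  fix m m' assume "m \<in> MM" and "isos L m m' \<noteq> {}"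
  then obtain f x \<theta> where k: "kernel L NS nc ar f m x" and t: "iso2 L \<theta>" "src2 L \<theta> = m" "trg2 L \<theta> = m'" unfolding MM_iff ex_in_conv[symmetric] isos_iff by blast
  then show "m' \<in> MM"
    unfolding MM_iff using kernel_equivalence[OF k, of "one L (src1 L m)" \<theta> m'] kernelD(2)[OF k] by auto
next
  fix e e' assume "e \<in> EE" and "isos L e e' \<noteq> {}"
  then obtain f x \<theta> where k: "cokernel L NS nc al f e x" and t: "iso2 L \<theta>" "src2 L \<theta> = e" "trg2 L \<theta> = e'" unfolding EE_iff ex_in_conv[symmetric] isos_iff by blast
  then show "e' \<in> EE"
    unfolding EE_iff using cokernel_equivalence[OF k, of "one L (trg1 L e)" \<theta> e'] cokernelD(2)[OF k] by auto
next
  fix f assume "f \<in> Mor L"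
  then show "\<exists>e\<in>EE. \<exists>m\<in>MM. trg1 L e = src1 L m \<and> isos L f (m \<cdot> e) \<noteq> {}"
    using factorizations by (auto simp: cokernel_kernel_factorizations_def EE_def MM_def)
next
  fix e m assume "e \<in> EE" and m: "m \<in> MM"
  then obtain j x where "cokernel L NS nc al j e x" by (auto simp: EE_iff)
  moreover have "m \<in> Mor L" using m kernelD(2) by (auto simp: MM_iff)
  ultimately show "orthogonal L e m" using orthogonal_cokernel MM_reflects[OF m] by blast
qed

lemma MM_faithful: "m \<in> MM \<Longrightarrow> faithful1 L m"
  unfolding faithful1_def MM_iff by (auto intro!: inj_onI simp: hom_iff cells_iff intro: kernel_faithful)

lemma EE_cofaithful: "e \<in> EE \<Longrightarrow> cofaithful1 L e"
  unfolding cofaithful1_def EE_iff by (auto intro!: inj_onI simp: hom_iff cells_iff intro: cokernel_faithful)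

lemma proper_11: "proper_11 L EE MM"
  using MM_faithful EE_cofaithful by (simp add: proper_11_def)

text \<open>Short exact sequences: one and the same structure \<open>x\<close> exhibits
  \<open>m\<close> as a kernel and \<open>e\<close> as a cokernel. Sharing it is what makes the
  transfer of squares symmetric.\<close>

definition sequences :: "('b \<times> 'b \<times> 'c) set" where
  "sequences = {(m, e, x). kernel L NS nc ar e m x \<and> cokernel L NS nc al m e x}"

text \<open>A morphism of short exact sequences, recorded by its square between the quotients and
  its square between the subobjects; the common side is its component at the middle object.\<close>

definition related :: "'b \<times> 'b \<times> 'c \<Rightarrow> ('b, 'c) square \<Rightarrow> ('b, 'c) square \<Rightarrow> 'b \<times> 'b \<times> 'c \<Rightarrow> bool" where
  "related \<sigma> f r \<sigma>' = (case (\<sigma>, \<sigma>') of ((m, e, x), (m', e', x')) \<Rightarrow>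
     \<sigma> \<in> sequences \<and> \<sigma>' \<in> sequences \<and> square_ok L f \<and> sqsrc f = e \<and> sqtrg f = e' \<and> square_ok L r \<and> sqsrc r = m \<and> sqtrg r = m' \<and>
     sqs f = sqt r \<and> compatible m x e' x' (sqt f) (sqphi f) (sqs r) (sqphi r))"

text \<open>Normality makes \<open>e\<close> a cokernel of its kernel, but for a structure altered
  by a null isomorphism \<open>\<theta>\<close>. The kernel property survives the same alteration by
  \<open>kernel_change\<close>, so both hold for one structure.\<close>

lemma sequence_of_E:
  assumes "e \<in> EE"
  shows "\<exists>m x. (m, e, x) \<in> sequences"
proof -
  have eM: "e \<in> Mor L" using assms cokernelD(2) by (auto simp: EE_iff)
  then obtain k x where k: "kernel L NS nc ar e k x" using kernels by (auto simp: has_two_kernels_def two_kernel)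
  note [simp] = kernelD[OF k]
  obtain \<theta> where t: "\<theta> \<in> null_isos I (src1 L k) (trg1 L e)" "src2 L \<theta> = trg2 L x" and c: "cokernel L NS nc al k e (\<theta> \<bullet> x)"
  proof -
    have "\<exists>n' \<theta>. \<theta> \<in> null_isos I (src1 L k) (trg1 L e) \<inter> cells L (trg2 L x) n' \<and> two_cokernel L I k e n' (\<theta> \<bullet> x)"
      using cokernels_normal[unfolded cokernels_normal_def, rule_format, of e k "trg2 L x" x] assms k by (simp add: EE_def two_kernel)
    then obtain n' \<theta> where "\<theta> \<in> null_isos I (src1 L k) (trg1 L e)" "\<theta> \<in> cells L (trg2 L x) n'" "two_cokernel L I k e n' (\<theta> \<bullet> x)" by blast
    then show thesis by (intro that[of \<theta>]) (simp_all add: cells_iff two_cokernel)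
  qed
  have th: "iso2 L \<theta>" using t null_isos_iff by simp
  have "nci L nc x (id2 L (src2 L x)) (\<theta> \<bullet> x)"
    by (rule nci_null_iso) (use t th NS_iso[of x] in simp_all)
  then have "kernel L NS nc ar e k (\<theta> \<bullet> x)" by (intro kernel_change[OF k]) simp
  with c show ?thesis by (auto simp: sequences_def)
qed

lemma sequence_of_M:
  assumes "m \<in> MM"
  shows "\<exists>e x. (m, e, x) \<in> sequences"
proof -
  have mM: "m \<in> Mor L" using assms kernelD(2) by (auto simp: MM_iff)
  then obtain c x where c: "cokernel L NS nc al m c x" using cokernels by (auto simp: has_two_cokernels_def two_cokernel)
  note [simp] = cokernelD[OF c]
  obtain \<theta> where t: "\<theta> \<in> null_isos I (src1 L m) (trg1 L c)" "src2 L \<theta> = trg2 L x" and k: "kernel L NS nc ar c m (\<theta> \<bullet> x)"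
  proof -
    have "\<exists>n' \<theta>. \<theta> \<in> null_isos I (src1 L m) (trg1 L c) \<inter> cells L (trg2 L x) n' \<and> two_kernel L I c m n' (\<theta> \<bullet> x)"
      using kernels_normal[unfolded kernels_normal_def, rule_format, of m c "trg2 L x" x] assms c by (simp add: MM_def two_cokernel)
    then obtain n' \<theta> where "\<theta> \<in> null_isos I (src1 L m) (trg1 L c)" "\<theta> \<in> cells L (trg2 L x) n'" "two_kernel L I c m n' (\<theta> \<bullet> x)" by blast
    then show thesis by (intro that[of \<theta>]) (simp_all add: cells_iff two_kernel)
  qed
  have th: "iso2 L \<theta>" using t null_isos_iff by simp
  have "nci L nc x (id2 L (src2 L x)) (\<theta> \<bullet> x)"
    by (rule nci_null_iso) (use t th NS_iso[of x] in simp_all)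
  then have "cokernel L NS nc al m c (\<theta> \<bullet> x)"
    using nullity.kernel_change[OF nullity_op c] by simp
  with k show ?thesis by (auto simp: sequences_def)
qed

lemma sequencesD:
  assumes "(m, e, x) \<in> sequences"
  shows "kernel L NS nc ar e m x" "cokernel L NS nc al m e x" "m \<in> MM" "e \<in> EE" "m \<in> Mor L" "e \<in> Mor L" "trg1 L m = src1 L e"
    "x \<in> NS" "src2 L x = e \<cdot> m"
  using assms kernelD[of e m x] by (auto simp: sequences_def MM_iff EE_iff)

text \<open>Lifting along one leg of the span uses the kernel property of the target sequence,
  lifting along the other the cokernel property of the source sequence. The covering axioms come
  from existence and normality of kernels and cokernels.\<close>

lemma span: "span (full_sub (arrow2 L) EE) (full_sub (arrow2 L) MM) L (src1 L) sqs scs (trg1 L) sqt sct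
    sequences (\<lambda>(m, e, x). e) (\<lambda>(m, e, x). m) related"
proof -
  interpret SX: strict_over "full_sub (arrow2 L) EE" L "src1 L" sqs scs
    using factorization_system EE_cofaithful by (intro strict_over_dom) (auto simp: factorization_system_def)
  interpret SY: strict_over "full_sub (arrow2 L) MM" L "trg1 L" sqt sct
    using factorization_system MM_faithful by (intro strict_over_cod) (auto simp: factorization_system_def)
  show ?thesis
  proof unfold_locales
    fix \<sigma> :: "'b \<times> 'b \<times> 'c" assume "\<sigma> \<in> sequences"
    then show "(case \<sigma> of (m, e, x) \<Rightarrow> e) \<in> Obj (full_sub (arrow2 L) EE) \<and> (case \<sigma> of (m, e, x) \<Rightarrow> m) \<in> Obj (full_sub (arrow2 L) MM) \<and>
      src1 L (case \<sigma> of (m, e, x) \<Rightarrow> e) = trg1 L (case \<sigma> of (m, e, x) \<Rightarrow> m)"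
      by (cases \<sigma>) (auto dest: sequencesD)
  next
    fix \<sigma> f r \<sigma>' assume "related \<sigma> f r \<sigma>'"
    then show "\<sigma> \<in> sequences \<and> \<sigma>' \<in> sequences \<and> f \<in> Mor (full_sub (arrow2 L) EE) \<and>
       src1 (full_sub (arrow2 L) EE) f = (case \<sigma> of (m, e, x) \<Rightarrow> e) \<and> trg1 (full_sub (arrow2 L) EE) f = (case \<sigma>' of (m, e, x) \<Rightarrow> e) \<and>
       r \<in> Mor (full_sub (arrow2 L) MM) \<and> src1 (full_sub (arrow2 L) MM) r = (case \<sigma> of (m, e, x) \<Rightarrow> m) \<and>
       trg1 (full_sub (arrow2 L) MM) r = (case \<sigma>' of (m, e, x) \<Rightarrow> m) \<and> sqs f = sqt r"
      by (cases \<sigma>, cases \<sigma>') (auto simp: related_def dest: sequencesD)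
  next
    fix \<sigma> :: "'b \<times> 'b \<times> 'c" assume s: "\<sigma> \<in> sequences"
    obtain m e x where [simp]: "\<sigma> = (m, e, x)" by (cases \<sigma>)
    note d = sequencesD[OF s[simplified]]
    have "square_ok L (one (arrow2 L) e)" "square_ok L (one (arrow2 L) m)" by (rule square_okI; simp add: d)+
    then show "related \<sigma> (one (full_sub (arrow2 L) EE) (case \<sigma> of (m, e, x) \<Rightarrow> e)) (one (full_sub (arrow2 L) MM) (case \<sigma> of (m, e, x) \<Rightarrow> m)) \<sigma>"
      using s d compatible_id[OF d(6,5,7-9)] by (simp add: related_def)
  next
    fix \<sigma> f r \<sigma>' f' r' \<sigma>'' assume r: "related \<sigma> f r \<sigma>'" "related \<sigma>' f' r' \<sigma>''"
    obtain m e x m' e' x' m'' e'' x'' where [simp]: "\<sigma> = (m, e, x)" "\<sigma>' = (m', e', x')" "\<sigma>'' = (m'', e'', x'')" by (cases \<sigma>, cases \<sigma>', cases \<sigma>'')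
    from r have s: "(m, e, x) \<in> sequences" "(m', e', x') \<in> sequences" "(m'', e'', x'') \<in> sequences"
      and o: "square_ok L f" "square_ok L r" "square_ok L f'" "square_ok L r'"
      and e [simp]: "sqsrc f = e" "sqtrg f = e'" "sqsrc r = m" "sqtrg r = m'" "sqsrc f' = e'" "sqtrg f' = e''" "sqsrc r' = m'" "sqtrg r' = m''"
        "sqs f = sqt r" "sqs f' = sqt r'"
      and c: "compatible m x e' x' (sqt f) (sqphi f) (sqs r) (sqphi r)" "compatible m' x' e'' x'' (sqt f') (sqphi f') (sqs r') (sqphi r')"
      by (auto simp: related_def)
    note d = sequencesD[OF s(1)] and d' = sequencesD[OF s(2)] and d'' = sequencesD[OF s(3)]
    have "compatible m x e'' x'' (sqt f' \<cdot> sqt f) ((id2 L (sqt f') \<star> sqphi f) \<bullet> (sqphi f' \<star> id2 L (sqt r)))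
       (sqs r' \<cdot> sqs r) ((id2 L (sqt r') \<star> sqphi r) \<bullet> (sqphi r' \<star> id2 L (sqs r)))"
      by (rule compatible_comp[OF d(5,7-9) d'(5,7-9) d''(5,7-9) _ _ c(1) _ _ c(2)])
        (use o in \<open>simp_all add: square_ok_def\<close>)
    then show "related \<sigma> (comp1 (full_sub (arrow2 L) EE) f' f) (comp1 (full_sub (arrow2 L) MM) r' r) \<sigma>''"
      using s o by (simp add: related_def)
  next
    fix \<sigma> \<sigma>' :: "'b \<times> 'b \<times> 'c" and f assume s: "\<sigma> \<in> sequences" "\<sigma>' \<in> sequences" and f: "f \<in> Mor (full_sub (arrow2 L) EE)"
       "src1 (full_sub (arrow2 L) EE) f = (case \<sigma> of (m, e, x) \<Rightarrow> e)" "trg1 (full_sub (arrow2 L) EE) f = (case \<sigma>' of (m, e, x) \<Rightarrow> e)"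
    obtain m e x m' e' x' where [simp]: "\<sigma> = (m, e, x)" "\<sigma>' = (m', e', x')" by (cases \<sigma>, cases \<sigma>')
    note d = sequencesD[OF s(1)[simplified]] and d' = sequencesD[OF s(2)[simplified]]
    have o: "square_ok L f" and [simp]: "sqsrc f = e" "sqtrg f = e'" using f by simp_all
    obtain u \<psi> where u: "is_square L m m' u (sqs f) \<psi>" "compatible m x e' x' (sqt f) (sqphi f) u \<psi>"
      using compatible_exists[OF d(5,7-9) d'(1), of "sqs f" "sqt f" "sqphi f"] o by (auto simp: square_ok_def)
    then have "related \<sigma> f \<lparr>sqsrc = m, sqtrg = m', sqs = u, sqt = sqs f, sqphi = \<psi>\<rparr> \<sigma>'"
      using s o by (simp add: related_def square_ok_def)
    then show "\<exists>r. related \<sigma> f r \<sigma>'" by blast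
  next
    fix \<sigma> \<sigma>' :: "'b \<times> 'b \<times> 'c" and r assume s: "\<sigma> \<in> sequences" "\<sigma>' \<in> sequences" and f: "r \<in> Mor (full_sub (arrow2 L) MM)"
       "src1 (full_sub (arrow2 L) MM) r = (case \<sigma> of (m, e, x) \<Rightarrow> m)" "trg1 (full_sub (arrow2 L) MM) r = (case \<sigma>' of (m, e, x) \<Rightarrow> m)"
    obtain m e x m' e' x' where [simp]: "\<sigma> = (m, e, x)" "\<sigma>' = (m', e', x')" by (cases \<sigma>, cases \<sigma>')
    note d = sequencesD[OF s(1)[simplified]] and d' = sequencesD[OF s(2)[simplified]]
    have o: "square_ok L r" and [simp]: "sqsrc r = m" "sqtrg r = m'" using f by simp_all
    obtain t \<phi> where u: "is_square L e e' (sqt r) t \<phi>" "compatible m x e' x' t \<phi> (sqs r) (sqphi r)"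
      using compatible_exists'[OF d'(6,7-9) d(2), of "sqs r" "sqt r" "sqphi r"] o by (auto simp: square_ok_def)
    then have "related \<sigma> \<lparr>sqsrc = e, sqtrg = e', sqs = sqt r, sqt = t, sqphi = \<phi>\<rparr> r \<sigma>'"
      using s o by (simp add: related_def square_ok_def)
    then show "\<exists>f. related \<sigma> f r \<sigma>'" by blast
  next
    fix \<sigma> f r \<sigma>' f' r' w assume r: "related \<sigma> f r \<sigma>'" "related \<sigma> f' r' \<sigma>'" and w: "w \<in> cells (full_sub (arrow2 L) EE) f f'"
    obtain m e x m' e' x' where [simp]: "\<sigma> = (m, e, x)" "\<sigma>' = (m', e', x')" by (cases \<sigma>, cases \<sigma>')
    from r have s: "(m, e, x) \<in> sequences" "(m', e', x') \<in> sequences"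
      and o: "square_ok L f" "square_ok L r" "square_ok L f'" "square_ok L r'"
      and e [simp]: "sqsrc f = e" "sqtrg f = e'" "sqsrc r = m" "sqtrg r = m'" "sqsrc f' = e" "sqtrg f' = e'" "sqsrc r' = m" "sqtrg r' = m'"
        "sqs f = sqt r" "sqs f' = sqt r'"
      and c: "compatible m x e' x' (sqt f) (sqphi f) (sqs r) (sqphi r)" "compatible m x e' x' (sqt f') (sqphi f') (sqs r') (sqphi r')"
      by (auto simp: related_def)
    note d = sequencesD[OF s(1)] and d' = sequencesD[OF s(2)]
    have wo: "square_cell_ok L w" and we [simp]: "scsrc w = f" "sctrg w = f'" using w by (auto simp: cells_iff)
    have "\<exists>\<iota> \<in> cells L (sqs r) (sqs r'). sqphi r' \<bullet> (id2 L m' \<star> \<iota>) = (scs w \<star> id2 L m) \<bullet> sqphi r"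
      using square_cell_okD[OF wo] square_cell_ok_eq[OF wo]
      by (intro compatible_cells[OF d(5,7-9) d'(1) _ _ c(1) _ _ c(2), of _ _ _ "sct w"]) (use o in \<open>simp_all add: square_ok_def cells_iff\<close>)
    then obtain \<iota> where i: "\<iota> \<in> cells L (sqs r) (sqs r')" "sqphi r' \<bullet> (id2 L m' \<star> \<iota>) = (scs w \<star> id2 L m) \<bullet> sqphi r" by blast
    have "scs w \<in> cells L (sqt r) (sqt r')" using square_cell_okD(5-7)[OF wo] by (simp add: cells_iff)
    then have ok: "square_cell_ok L \<lparr>scsrc = r, sctrg = r', scs = \<iota>, sct = scs w\<rparr>"
      unfolding square_cell_ok_def square_cell.simps e using o i by blast
    show "\<exists>v\<in>cells (full_sub (arrow2 L) MM) r r'. sct v = scs w"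
      using ok d(3) d'(3) by (intro bexI[of _ "\<lparr>scsrc = r, sctrg = r', scs = \<iota>, sct = scs w\<rparr>"]) (simp_all add: cells_iff)
  next
    fix \<sigma> f r \<sigma>' f' r' v assume r: "related \<sigma> f r \<sigma>'" "related \<sigma> f' r' \<sigma>'" and v: "v \<in> cells (full_sub (arrow2 L) MM) r r'"
    obtain m e x m' e' x' where [simp]: "\<sigma> = (m, e, x)" "\<sigma>' = (m', e', x')" by (cases \<sigma>, cases \<sigma>')
    from r have s: "(m, e, x) \<in> sequences" "(m', e', x') \<in> sequences"
      and o: "square_ok L f" "square_ok L r" "square_ok L f'" "square_ok L r'"
      and e [simp]: "sqsrc f = e" "sqtrg f = e'" "sqsrc r = m" "sqtrg r = m'" "sqsrc f' = e" "sqtrg f' = e'" "sqsrc r' = m" "sqtrg r' = m'"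
        "sqs f = sqt r" "sqs f' = sqt r'"
      and c: "compatible m x e' x' (sqt f) (sqphi f) (sqs r) (sqphi r)" "compatible m x e' x' (sqt f') (sqphi f') (sqs r') (sqphi r')"
      by (auto simp: related_def)
    note d = sequencesD[OF s(1)] and d' = sequencesD[OF s(2)]
    have vo: "square_cell_ok L v" and ve [simp]: "scsrc v = r" "sctrg v = r'" using v by (auto simp: cells_iff)
    have "\<exists>\<mu> \<in> cells L (sqt f) (sqt f'). sqphi f' \<bullet> (id2 L e' \<star> sct v) = (\<mu> \<star> id2 L e) \<bullet> sqphi f"
      using square_cell_okD[OF vo] square_cell_ok_eq[OF vo]
      by (intro compatible_cells'[OF d'(6,7-9) d(2) _ _ c(1) _ _ c(2), of _ _ _ "scs v"]) (use o in \<open>simp_all add: square_ok_def cells_iff\<close>)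
    then obtain \<mu> where i: "\<mu> \<in> cells L (sqt f) (sqt f')" "sqphi f' \<bullet> (id2 L e' \<star> sct v) = (\<mu> \<star> id2 L e) \<bullet> sqphi f" by blast
    have "sct v \<in> cells L (sqs f) (sqs f')" using square_cell_okD(8-10)[OF vo] by (simp add: cells_iff)
    then have ok: "square_cell_ok L \<lparr>scsrc = f, sctrg = f', scs = sct v, sct = \<mu>\<rparr>"
      unfolding square_cell_ok_def square_cell.simps e using o i by blast
    show "\<exists>w\<in>cells (full_sub (arrow2 L) EE) f f'. scs w = sct v"
      using ok d(4) d'(4) by (intro bexI[of _ "\<lparr>scsrc = f, sctrg = f', scs = sct v, sct = \<mu>\<rparr>"]) (simp_all add: cells_iff)
  next
    fix e assume "e \<in> Obj (full_sub (arrow2 L) EE)"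
    then show "\<exists>\<sigma>\<in>sequences. (case \<sigma> of (m, e, x) \<Rightarrow> e) = e" using sequence_of_E[of e] by force
  next
    fix m assume "m \<in> Obj (full_sub (arrow2 L) MM)"
    then show "\<exists>\<sigma>\<in>sequences. (case \<sigma> of (m, e, x) \<Rightarrow> m) = m" using sequence_of_M[of m] by force
  qed
qed

theorem factorization_biequivalence:
  "\<exists>E M K C \<eta> \<epsilon>. factorization_system L E M \<and> proper_11 L E M \<and>
     normal_psfun (full_sub (arrow2 L) E) (full_sub (arrow2 L) M) K \<and>
     normal_psfun (full_sub (arrow2 L) M) (full_sub (arrow2 L) E) C \<and>
     biequivalence_over L (full_sub (arrow2 L) E) (dom2 L E) (full_sub (arrow2 L) M) (cod2 L M) K C \<eta> \<epsilon>"
  using factorization_system proper_11 span.span_biequivalence[OF span] unfolding dom2_def cod2_def by blast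

end

section \<open>From biequivalences to exact systems\<close>

locale over_biequivalence = SX: strict_over X L P0 P1 P2 + SY: strict_over Y L Q0 Q1 Q2
  for X :: "('p, 'q, 'r) two_cat" and Y :: "('s, 't, 'u) two_cat" and L :: "('o, 'm, 'c) two_cat"
    and P0 P1 P2 Q0 Q1 Q2 +
  fixes K C \<eta> \<epsilon>
  assumes biequivalence: "biequivalence_over L X (strict_psfun X L P0 P1 P2) Y (strict_psfun Y L Q0 Q1 Q2) K C \<eta> \<epsilon>"
begin

lemma K_psfun: "pseudofunctor X Y K" and C_psfun: "pseudofunctor Y X C"
  and eta_nat: "pseudonatural Y Y (id_psfun Y) (comp_psfun Y K C) \<eta>" and eps_nat: "pseudonatural X X (comp_psfun X C K) (id_psfun X) \<epsilon>"
  using biequivalence by (simp_all add: biequivalence_over_def pseudonatural_equivalence_def)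

lemma K0 [simp]: "a \<in> Obj X \<Longrightarrow> F0 K a \<in> Obj Y" "a \<in> Obj X \<Longrightarrow> Q0 (F0 K a) = P0 a"
  using pseudofunctor.F0_Obj[OF K_psfun] biequivalence
  by (auto simp: biequivalence_over_def eq_psfun_def comp_psfun_def strict_psfun_def)

lemma C0 [simp]: "b \<in> Obj Y \<Longrightarrow> F0 C b \<in> Obj X" "b \<in> Obj Y \<Longrightarrow> P0 (F0 C b) = Q0 b"
  using pseudofunctor.F0_Obj[OF C_psfun] biequivalence
  by (auto simp: biequivalence_over_def eq_psfun_def comp_psfun_def strict_psfun_def)

lemma K1 [simp]: "f \<in> Mor X \<Longrightarrow> F1 K f \<in> Mor Y" "f \<in> Mor X \<Longrightarrow> src1 Y (F1 K f) = F0 K (src1 X f)" "f \<in> Mor X \<Longrightarrow> trg1 Y (F1 K f) = F0 K (trg1 X f)"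
    "f \<in> Mor X \<Longrightarrow> Q1 (F1 K f) = P1 f"
  using pseudofunctor.F1_hom[OF K_psfun, of f "src1 X f" "trg1 X f"] biequivalence
  by (simp_all add: hom_iff biequivalence_over_def eq_psfun_def comp_psfun_def strict_psfun_def)

lemma C1 [simp]: "f \<in> Mor Y \<Longrightarrow> F1 C f \<in> Mor X" "f \<in> Mor Y \<Longrightarrow> src1 X (F1 C f) = F0 C (src1 Y f)" "f \<in> Mor Y \<Longrightarrow> trg1 X (F1 C f) = F0 C (trg1 Y f)"
    "f \<in> Mor Y \<Longrightarrow> P1 (F1 C f) = Q1 f"
  using pseudofunctor.F1_hom[OF C_psfun, of f "src1 Y f" "trg1 Y f"] biequivalence
  by (simp_all add: hom_iff biequivalence_over_def eq_psfun_def comp_psfun_def strict_psfun_def)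

lemma K2 [simp]: "w \<in> Cell X \<Longrightarrow> F2 K w \<in> Cell Y" "w \<in> Cell X \<Longrightarrow> src2 Y (F2 K w) = F1 K (src2 X w)" "w \<in> Cell X \<Longrightarrow> trg2 Y (F2 K w) = F1 K (trg2 X w)"
    "w \<in> Cell X \<Longrightarrow> Q2 (F2 K w) = P2 w"
  using pseudofunctor.F2_cells[OF K_psfun, of w "src2 X w" "trg2 X w"] biequivalence
  by (simp_all add: cells_iff biequivalence_over_def eq_psfun_def comp_psfun_def strict_psfun_def)

lemma C2 [simp]: "w \<in> Cell Y \<Longrightarrow> F2 C w \<in> Cell X" "w \<in> Cell Y \<Longrightarrow> src2 X (F2 C w) = F1 C (src2 Y w)" "w \<in> Cell Y \<Longrightarrow> trg2 X (F2 C w) = F1 C (trg2 Y w)"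
    "w \<in> Cell Y \<Longrightarrow> P2 (F2 C w) = Q2 w"
  using pseudofunctor.F2_cells[OF C_psfun, of w "src2 Y w" "trg2 Y w"] biequivalence
  by (simp_all add: cells_iff biequivalence_over_def eq_psfun_def comp_psfun_def strict_psfun_def)

lemma eta0 [simp]: "b \<in> Obj Y \<Longrightarrow> equivalence1 Y (T0 \<eta> b)" "b \<in> Obj Y \<Longrightarrow> T0 \<eta> b \<in> Mor Y"
    "b \<in> Obj Y \<Longrightarrow> src1 Y (T0 \<eta> b) = b" "b \<in> Obj Y \<Longrightarrow> trg1 Y (T0 \<eta> b) = F0 K (F0 C b)" "b \<in> Obj Y \<Longrightarrow> Q1 (T0 \<eta> b) = one L (Q0 b)"
  using pseudonatural.T0_hom[OF eta_nat, of b] biequivalence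
  by (simp_all add: hom_iff biequivalence_over_def pseudonatural_equivalence_def comp_psfun_def id_psfun_def strict_psfun_def lies_over_def)

lemma eps0 [simp]: "a \<in> Obj X \<Longrightarrow> equivalence1 X (T0 \<epsilon> a)" "a \<in> Obj X \<Longrightarrow> T0 \<epsilon> a \<in> Mor X"
    "a \<in> Obj X \<Longrightarrow> src1 X (T0 \<epsilon> a) = F0 C (F0 K a)" "a \<in> Obj X \<Longrightarrow> trg1 X (T0 \<epsilon> a) = a" "a \<in> Obj X \<Longrightarrow> P1 (T0 \<epsilon> a) = one L (P0 a)"
  using pseudonatural.T0_hom[OF eps_nat, of a] biequivalence
  by (simp_all add: hom_iff biequivalence_over_def pseudonatural_equivalence_def comp_psfun_def id_psfun_def strict_psfun_def lies_over_def)

lemma eta1 [simp]: "f \<in> Mor Y \<Longrightarrow> iso2 Y (T1 \<eta> f)"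
    "f \<in> Mor Y \<Longrightarrow> src2 Y (T1 \<eta> f) = comp1 Y (F1 K (F1 C f)) (T0 \<eta> (src1 Y f))"
    "f \<in> Mor Y \<Longrightarrow> trg2 Y (T1 \<eta> f) = comp1 Y (T0 \<eta> (trg1 Y f)) f" "f \<in> Mor Y \<Longrightarrow> Q2 (T1 \<eta> f) = id2 L (Q1 f)"
  using pseudonatural.T1_isos[OF eta_nat, of f "src1 Y f" "trg1 Y f"] biequivalence
  by (simp_all add: hom_iff isos_iff biequivalence_over_def comp_psfun_def id_psfun_def strict_psfun_def lies_over_def)

lemma eps1 [simp]: "f \<in> Mor X \<Longrightarrow> iso2 X (T1 \<epsilon> f)"
    "f \<in> Mor X \<Longrightarrow> src2 X (T1 \<epsilon> f) = comp1 X f (T0 \<epsilon> (src1 X f))"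
    "f \<in> Mor X \<Longrightarrow> trg2 X (T1 \<epsilon> f) = comp1 X (T0 \<epsilon> (trg1 X f)) (F1 C (F1 K f))" "f \<in> Mor X \<Longrightarrow> P2 (T1 \<epsilon> f) = id2 L (P1 f)"
  using pseudonatural.T1_isos[OF eps_nat, of f "src1 X f" "trg1 X f"] biequivalence
  by (simp_all add: hom_iff isos_iff biequivalence_over_def comp_psfun_def id_psfun_def strict_psfun_def lies_over_def)

lemma Q2_inv2:
  assumes "iso2 Y v"
  shows "iso2 L (Q2 v) \<and> inv2 L (Q2 v) = Q2 (inv2 Y v)"
proof (rule SX.L.inv2_eq)
  have "vcomp L (Q2 (inv2 Y v)) (Q2 v) = Q2 (vcomp Y (inv2 Y v) v)" using assms by (subst SY.P2_vcomp) simp_all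
  then show "vcomp L (Q2 (inv2 Y v)) (Q2 v) = id2 L (src2 L (Q2 v))" using assms by simp
  have "vcomp L (Q2 v) (Q2 (inv2 Y v)) = Q2 (vcomp Y v (inv2 Y v))" using assms by (subst SY.P2_vcomp) simp_all
  then show "vcomp L (Q2 v) (Q2 (inv2 Y v)) = id2 L (trg2 L (Q2 v))" using assms by simp
qed (use assms in simp_all)

lemma P2_inv2:
  assumes "iso2 X v"
  shows "iso2 L (P2 v) \<and> inv2 L (P2 v) = P2 (inv2 X v)"
proof (rule SX.L.inv2_eq)
  have "vcomp L (P2 (inv2 X v)) (P2 v) = P2 (vcomp X (inv2 X v) v)" using assms by (subst SX.P2_vcomp) simp_all
  then show "vcomp L (P2 (inv2 X v)) (P2 v) = id2 L (src2 L (P2 v))" using assms by simp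
  have "vcomp L (P2 v) (P2 (inv2 X v)) = P2 (vcomp X v (inv2 X v))" using assms by (subst SX.P2_vcomp) simp_all
  then show "vcomp L (P2 v) (P2 (inv2 X v)) = id2 L (trg2 L (P2 v))" using assms by simp
qed (use assms in simp_all)

lemma eta1_inv [simp]: "f \<in> Mor Y \<Longrightarrow> Q2 (inv2 Y (T1 \<eta> f)) = id2 L (Q1 f)"
  using Q2_inv2[of "T1 \<eta> f"] by simp

lemma eps1_inv [simp]: "f \<in> Mor X \<Longrightarrow> P2 (inv2 X (T1 \<epsilon> f)) = id2 L (P1 f)"
  using P2_inv2[of "T1 \<epsilon> f"] by simp

text \<open>The formula for transposition along an adjunction with counit \<open>\<epsilon>\<close>.
  No triangle identities are available, so this and \<open>transpose_m\<close> need not be mutually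
  inverse; what is shown instead is that each preserves and reflects which 2-cells of
  \<open>L\<close> lift.\<close>

definition transpose_e :: "'p \<Rightarrow> 't \<Rightarrow> 'q" where
  "transpose_e a y = comp1 X (T0 \<epsilon> a) (F1 C y)"

definition transpose_m :: "'s \<Rightarrow> 'q \<Rightarrow> 't" where
  "transpose_m b x = comp1 Y (F1 K x) (T0 \<eta> b)"

lemma transpose_e [simp]:
  assumes "a \<in> Obj X" "y \<in> Mor Y" "trg1 Y y = F0 K a"
  shows "transpose_e a y \<in> Mor X" "src1 X (transpose_e a y) = F0 C (src1 Y y)" "trg1 X (transpose_e a y) = a" "P1 (transpose_e a y) = Q1 y"
  using assms by (simp_all add: transpose_e_def)

lemma transpose_m [simp]:
  assumes "b \<in> Obj Y" "x \<in> Mor X" "src1 X x = F0 C b"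
  shows "transpose_m b x \<in> Mor Y" "src1 Y (transpose_m b x) = b" "trg1 Y (transpose_m b x) = F0 K (trg1 X x)" "Q1 (transpose_m b x) = P1 x"
  using assms by (simp_all add: transpose_m_def)

text \<open>A 2-cell over \<open>\<kappa>\<close> between the transposes is cancelled against the
  equivalence \<open>T0 \<epsilon> a\<close>, sent back by \<open>K\<close>, conjugated by the
  naturality 2-cells of \<open>\<eta>\<close>, and cancelled against \<open>T0 \<eta>\<close>.
  Everything inserted on the way lies over identities, so the image in \<open>L\<close> stays
  \<open>\<kappa>\<close>.\<close>

lemma lift_e_iff:
  assumes a [simp]: "a \<in> Obj X" and y [simp]: "y \<in> Mor Y" "trg1 Y y = F0 K a" "y' \<in> Mor Y" "trg1 Y y' = F0 K a" "src1 Y y' = src1 Y y"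
  shows "(\<exists>w \<in> cells X (transpose_e a y) (transpose_e a y'). P2 w = \<kappa>) \<longleftrightarrow> (\<exists>v \<in> cells Y y y'. Q2 v = \<kappa>)"
proof
  assume "\<exists>v \<in> cells Y y y'. Q2 v = \<kappa>"
  then obtain v where [simp]: "v \<in> Cell Y" "src2 Y v = y" "trg2 Y v = y'" and k: "Q2 v = \<kappa>" by (auto simp: cells_iff)
  have "Q0 (F0 K a) = P0 a" by simp
  then have "P2 (hcomp X (id2 X (T0 \<epsilon> a)) (F2 C v)) = Q2 v" by simp
  then show "\<exists>w \<in> cells X (transpose_e a y) (transpose_e a y'). P2 w = \<kappa>"
    using k by (intro bexI[of _ "hcomp X (id2 X (T0 \<epsilon> a)) (F2 C v)"]) (simp_all add: cells_iff transpose_e_def)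
next
  assume "\<exists>w \<in> cells X (transpose_e a y) (transpose_e a y'). P2 w = \<kappa>"
  then obtain w where w [simp]: "w \<in> Cell X" "src2 X w = comp1 X (T0 \<epsilon> a) (F1 C y)" "trg2 X w = comp1 X (T0 \<epsilon> a) (F1 C y')" and k: "P2 w = \<kappa>"
    by (auto simp: cells_iff transpose_e_def)
  obtain w' where w' [simp]: "w' \<in> Cell X" "src2 X w' = F1 C y" "trg2 X w' = F1 C y'" and ew: "hcomp X (id2 X (T0 \<epsilon> a)) w' = w"
    by (rule SX.X.equivalence1_full[of "T0 \<epsilon> a" "F1 C y" "F1 C y'" w]) simp_all
  have kw: "P2 w' = \<kappa>" unfolding k[symmetric] ew[symmetric] by simp
  let ?b = "src1 Y y" and ?e = "T0 \<eta> (F0 K a)"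
  have b [simp]: "?b \<in> Obj Y" by simp
  \<comment> \<open>Naturality of \<open>\<eta>\<close> replaces the composite of \<open>K\<close>
    after \<open>C\<close> on \<open>y\<close> and \<open>y'\<close> by \<open>y\<close> and
    \<open>y'\<close> themselves, at the price of an equivalence in front.\<close>
  let ?v = "vcomp Y (T1 \<eta> y') (vcomp Y (hcomp Y (F2 K w') (id2 Y (T0 \<eta> ?b))) (inv2 Y (T1 \<eta> y)))"
  have v: "?v \<in> Cell Y" "src2 Y ?v = comp1 Y ?e y" "trg2 Y ?v = comp1 Y ?e y'" by simp_all
  have Qv: "Q2 ?v = P2 w'" by simp
  obtain v' where v' [simp]: "v' \<in> Cell Y" "src2 Y v' = y" "trg2 Y v' = y'" and ev: "hcomp Y (id2 Y ?e) v' = ?v"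
    by (rule SY.X.equivalence1_full[of ?e y y' ?v]) (use v in simp_all)
  have "Q2 v' = Q2 (hcomp Y (id2 Y ?e) v')" by simp
  then have "Q2 v' = \<kappa>" unfolding ev Qv kw .
  then show "\<exists>v \<in> cells Y y y'. Q2 v = \<kappa>" by (intro bexI[of _ v']) (simp_all add: cells_iff)
qed

lemma lift_m_iff:
  assumes b [simp]: "b \<in> Obj Y" and x [simp]: "x \<in> Mor X" "src1 X x = F0 C b" "x' \<in> Mor X" "src1 X x' = F0 C b" "trg1 X x' = trg1 X x"
  shows "(\<exists>v \<in> cells Y (transpose_m b x) (transpose_m b x'). Q2 v = \<kappa>) \<longleftrightarrow> (\<exists>w \<in> cells X x x'. P2 w = \<kappa>)"
proof
  assume "\<exists>w \<in> cells X x x'. P2 w = \<kappa>"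
  then obtain w where [simp]: "w \<in> Cell X" "src2 X w = x" "trg2 X w = x'" and k: "P2 w = \<kappa>" by (auto simp: cells_iff)
  have "P0 (F0 C b) = Q0 b" by simp
  then have "Q2 (hcomp Y (F2 K w) (id2 Y (T0 \<eta> b))) = P2 w" by simp
  then show "\<exists>v \<in> cells Y (transpose_m b x) (transpose_m b x'). Q2 v = \<kappa>"
    using k by (intro bexI[of _ "hcomp Y (F2 K w) (id2 Y (T0 \<eta> b))"]) (simp_all add: cells_iff transpose_m_def)
next
  assume "\<exists>v \<in> cells Y (transpose_m b x) (transpose_m b x'). Q2 v = \<kappa>"
  then obtain v where v [simp]: "v \<in> Cell Y" "src2 Y v = comp1 Y (F1 K x) (T0 \<eta> b)" "trg2 Y v = comp1 Y (F1 K x') (T0 \<eta> b)" and k: "Q2 v = \<kappa>"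
    by (auto simp: cells_iff transpose_m_def)
  obtain v' where v' [simp]: "v' \<in> Cell Y" "src2 Y v' = F1 K x" "trg2 Y v' = F1 K x'" and ev: "hcomp Y v' (id2 Y (T0 \<eta> b)) = v"
    by (rule equivalence1_cofull[OF SY.X.two_category_axioms, of "T0 \<eta> b" "F1 K x" "F1 K x'" v]) simp_all
  have kv: "Q2 v' = \<kappa>" unfolding k[symmetric] ev[symmetric] by simp
  let ?a = "trg1 X x" and ?e = "T0 \<epsilon> (F0 C b)"
  have a [simp]: "?a \<in> Obj X" by simp
  let ?w = "vcomp X (inv2 X (T1 \<epsilon> x')) (vcomp X (hcomp X (id2 X (T0 \<epsilon> ?a)) (F2 C v')) (T1 \<epsilon> x))"
  have w: "?w \<in> Cell X" "src2 X ?w = comp1 X x ?e" "trg2 X ?w = comp1 X x' ?e" by simp_all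
  have Pw: "P2 ?w = Q2 v'" by simp
  obtain w' where w' [simp]: "w' \<in> Cell X" "src2 X w' = x" "trg2 X w' = x'" and ew: "hcomp X w' (id2 X ?e) = ?w"
    by (rule equivalence1_cofull[OF SX.X.two_category_axioms, of ?e x x' ?w]) (use w in simp_all)
  have "P2 w' = P2 (hcomp X w' (id2 X ?e))" by simp
  then have "P2 w' = \<kappa>" unfolding ew Pw kv .
  then show "\<exists>w \<in> cells X x x'. P2 w = \<kappa>" by (intro bexI[of _ w']) (simp_all add: cells_iff)
qed

end

section \<open>The exact system of a biequivalence over the base\<close>

context two_category
begin

lemma iso2_arrow2:
  assumes "iso2 (full_sub (arrow2 L) S) w"
  shows "iso2 L (scs w)" "iso2 L (sct w)"
proof -
  obtain v where v: "square_cell_ok L w" "square_cell_ok L v" "scsrc v = sctrg w" "sctrg v = scsrc w"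
    and e: "scs v \<bullet> scs w = id2 L (sqs (scsrc w))" "sct v \<bullet> sct w = id2 L (sqt (scsrc w))"
     "scs w \<bullet> scs v = id2 L (sqs (sctrg w))" "sct w \<bullet> sct v = id2 L (sqt (sctrg w))"
    using assms by (auto simp: iso2_def is_inv2_def cells_iff)
  note d = square_cell_okD[OF v(1)] square_cell_okD[OF v(2), unfolded v(3,4)]
  show "iso2 L (scs w)" using inv2_eq[of "scs w" "scs v"] d e by simp
  show "iso2 L (sct w)" using inv2_eq[of "sct w" "sct v"] d e by simp
qed

lemma equivalence1_arrow2:
  assumes "equivalence1 (full_sub (arrow2 L) S) q"
  shows "equivalence1 L (sqs q)" "equivalence1 L (sqt q)"
proof -
  interpret A: two_category "arrow2 L" by (rule arrow2_two_category)
  interpret F: two_category "full_sub (arrow2 L) S" by (rule A.full_sub_two_category)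
  have q: "square_ok L q" using F.equivalence1_Mor[OF assms] by simp
  obtain g v w where go: "square_ok L g" and g: "square_ok L g" "sqsrc g = sqtrg q" "sqtrg g = sqsrc q"
    "iso2 (full_sub (arrow2 L) S) v" "scsrc v = square_comp L g q" "sctrg v = one (arrow2 L) (sqsrc q)"
    "iso2 (full_sub (arrow2 L) S) w" "scsrc w = square_comp L q g" "sctrg w = one (arrow2 L) (sqtrg q)"
    by (rule F.equivalence1D[OF assms]) auto
  have vo: "square_cell_ok L v" "square_cell_ok L w" using g(4,7) by (simp_all add: iso2_def is_inv2_def)
  note qd = square_okD[OF q] and gd = square_okD[OF go]
  note i = iso2_arrow2[OF g(4)] iso2_arrow2[OF g(7)]
  note vd = square_cell_okD(5-10)[OF vo(1)] and wd = square_cell_okD(5-10)[OF vo(2)]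
  show "equivalence1 L (sqs q)"
    by (rule equivalence1I[of _ "sqs g" "scs v" "scs w"]) (use qd gd i vd wd g(2,3,5,6,8,9) in simp_all)
  show "equivalence1 L (sqt q)"
    by (rule equivalence1I[of _ "sqt g" "sct v" "sct w"]) (use qd gd i vd wd g(2,3,5,6,8,9) in simp_all)
qed

text \<open>Transposition supplies the passage between the two kinds of squares. As everything lies
  over \<open>L\<close>, the side in \<open>L\<close> is unchanged, and \<open>lift_e_iff\<close>
  and \<open>lift_m_iff\<close> become the comparison of liftable 2-cells.\<close>

lemma exact_system_of_biequivalence:
  assumes fs: "factorization_system L E M" and pr: "proper_11 L E M"
    and bi: "biequivalence_over L (full_sub (arrow2 L) E) (dom2 L E) (full_sub (arrow2 L) M) (cod2 L M) K C \<eta> \<epsilon>"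
  shows "exact_system L E M (F0 K) (F0 C)"
proof -
  interpret proper_factorization L E M using fs pr by unfold_locales
  let ?X = "full_sub (arrow2 L) E" and ?Y = "full_sub (arrow2 L) M"
  interpret SX: strict_over ?X L "src1 L" sqs scs
    using fs pr by (intro strict_over_dom) (auto simp: factorization_system_def proper_11_def)
  interpret SY: strict_over ?Y L "trg1 L" sqt sct
    using fs pr by (intro strict_over_cod) (auto simp: factorization_system_def proper_11_def)
  interpret over_biequivalence ?X ?Y L "src1 L" sqs scs "trg1 L" sqt sct K C \<eta> \<epsilon>
    using bi by unfold_locales (simp add: dom2_def cod2_def)
  have OX: "e \<in> Obj ?X \<longleftrightarrow> e \<in> E" for e by auto
  have OY: "m \<in> Obj ?Y \<longleftrightarrow> m \<in> M" for m by auto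
  have K: "F0 K e \<in> M" "trg1 L (F0 K e) = src1 L e" if "e \<in> E" for e
    using K0[of e] that by auto
  have C: "F0 C m \<in> E" "src1 L (F0 C m) = trg1 L m" if "m \<in> M" for m
    using C0[of m] that by auto
  have MX: "x \<in> Mor ?X \<longleftrightarrow> square_ok L x \<and> sqsrc x \<in> E \<and> sqtrg x \<in> E" for x by simp
  have MY: "y \<in> Mor ?Y \<longleftrightarrow> square_ok L y \<and> sqsrc y \<in> M \<and> sqtrg y \<in> M" for y by simp
  have es: "estruct L (sqsrc x) (sqtrg x) (sqs x) (sqt x) (sqphi x)" if "square_ok L x" for x
    using square_okD[OF that] by (simp add: estruct_def)
  have ms: "mstruct L (sqtrg y) (sqsrc y) (sqt y) (sqs y) (inv2 L (sqphi y))" if "square_ok L y" for y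
    using square_okD[OF that] by (simp add: mstruct_def)
  \<comment> \<open>A 2-cell of squares over \<open>\<kappa>\<close> is the same as a solution of
    the lifting problem; this translates the statements about the 2-category of squares into
    statements about \<open>L\<close>.\<close>
  have el: "elift L (sqsrc x) (sqtrg x) \<kappa> (sqt x) (sqphi x) (sqt x') (sqphi x') \<longleftrightarrow> (\<exists>w \<in> cells ?X x x'. scs w = \<kappa>)"
    if x: "square_ok L x" "square_ok L x'" and e: "sqsrc x' = sqsrc x" "sqtrg x' = sqtrg x" "sqsrc x \<in> E" "sqtrg x \<in> E" and k: "\<kappa> \<in> cells L (sqs x) (sqs x')" for x x' \<kappa>
  proof
    assume "elift L (sqsrc x) (sqtrg x) \<kappa> (sqt x) (sqphi x) (sqt x') (sqphi x')"
    then obtain \<tau> where t: "\<tau> \<in> cells L (sqt x) (sqt x')" and eq: "sqphi x' \<bullet> (id2 L (sqtrg x) \<star> \<kappa>) = (\<tau> \<star> id2 L (sqsrc x)) \<bullet> sqphi x"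
      by (auto simp: elift_def)
    have "square_cell_ok L \<lparr>scsrc = x, sctrg = x', scs = \<kappa>, sct = \<tau>\<rparr>"
      unfolding square_cell_ok_def square_cell.simps using x e k t eq by simp
    then show "\<exists>w \<in> cells ?X x x'. scs w = \<kappa>"
      using e by (intro bexI[of _ "\<lparr>scsrc = x, sctrg = x', scs = \<kappa>, sct = \<tau>\<rparr>"]) (simp_all add: cells_iff)
  next
    assume "\<exists>w \<in> cells ?X x x'. scs w = \<kappa>"
    then obtain w where w: "square_cell_ok L w" "scsrc w = x" "sctrg w = x'" "scs w = \<kappa>" by (auto simp: cells_iff)
    then show "elift L (sqsrc x) (sqtrg x) \<kappa> (sqt x) (sqphi x) (sqt x') (sqphi x')"
      unfolding elift_def square_cell_ok_def by blast
  qed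
  have ml: "mlift L (sqtrg y) (sqsrc y) \<kappa> (sqs y) (inv2 L (sqphi y)) (sqs y') (inv2 L (sqphi y')) \<longleftrightarrow> (\<exists>v \<in> cells ?Y y y'. sct v = \<kappa>)"
    if y: "square_ok L y" "square_ok L y'" and e: "sqsrc y' = sqsrc y" "sqtrg y' = sqtrg y" "sqsrc y \<in> M" "sqtrg y \<in> M" and k: "\<kappa> \<in> cells L (sqt y) (sqt y')" for y y' \<kappa>
  proof -
    note [simp] = square_okD[OF y(1)] square_okD[OF y(2), unfolded e]
    have [simp]: "\<kappa> \<in> Cell L" "src2 L \<kappa> = sqt y" "trg2 L \<kappa> = sqt y'" using k by (simp_all add: cells_iff)
    have eq: "inv2 L (sqphi y') \<bullet> (\<kappa> \<star> id2 L (sqsrc y)) = (id2 L (sqtrg y) \<star> \<upsilon>) \<bullet> inv2 L (sqphi y)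
       \<longleftrightarrow> sqphi y' \<bullet> (id2 L (sqtrg y) \<star> \<upsilon>) = (\<kappa> \<star> id2 L (sqsrc y)) \<bullet> sqphi y" if "\<upsilon> \<in> cells L (sqs y) (sqs y')" for \<upsilon>
    proof -
      have [simp]: "\<upsilon> \<in> Cell L" "src2 L \<upsilon> = sqs y" "trg2 L \<upsilon> = sqs y'" using that by (simp_all add: cells_iff)
      have "sqphi y' \<bullet> (id2 L (sqtrg y) \<star> \<upsilon>) = (\<kappa> \<star> id2 L (sqsrc y)) \<bullet> sqphi y"
        if h: "inv2 L (sqphi y') \<bullet> (\<kappa> \<star> id2 L (sqsrc y)) = (id2 L (sqtrg y) \<star> \<upsilon>) \<bullet> inv2 L (sqphi y)"
        using arg_cong[OF h, of "\<lambda>\<gamma>. sqphi y' \<bullet> \<gamma> \<bullet> sqphi y"] by simp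
      moreover have "inv2 L (sqphi y') \<bullet> (\<kappa> \<star> id2 L (sqsrc y)) = (id2 L (sqtrg y) \<star> \<upsilon>) \<bullet> inv2 L (sqphi y)"
        if h: "sqphi y' \<bullet> (id2 L (sqtrg y) \<star> \<upsilon>) = (\<kappa> \<star> id2 L (sqsrc y)) \<bullet> sqphi y"
        using arg_cong[OF h, of "\<lambda>\<gamma>. inv2 L (sqphi y') \<bullet> \<gamma> \<bullet> inv2 L (sqphi y)"] by simp
      ultimately show ?thesis by blast
    qed
    show ?thesis
    proof
      assume "mlift L (sqtrg y) (sqsrc y) \<kappa> (sqs y) (inv2 L (sqphi y)) (sqs y') (inv2 L (sqphi y'))"
      then obtain \<upsilon> where t: "\<upsilon> \<in> cells L (sqs y) (sqs y')" and q: "sqphi y' \<bullet> (id2 L (sqtrg y) \<star> \<upsilon>) = (\<kappa> \<star> id2 L (sqsrc y)) \<bullet> sqphi y"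
        unfolding mlift_def using eq by blast
      have "square_cell_ok L \<lparr>scsrc = y, sctrg = y', scs = \<upsilon>, sct = \<kappa>\<rparr>"
        unfolding square_cell_ok_def square_cell.simps using y e k t q by simp
      then show "\<exists>v \<in> cells ?Y y y'. sct v = \<kappa>"
        using e by (intro bexI[of _ "\<lparr>scsrc = y, sctrg = y', scs = \<upsilon>, sct = \<kappa>\<rparr>"]) (simp_all add: cells_iff)
    next
      assume "\<exists>v \<in> cells ?Y y y'. sct v = \<kappa>"
      then obtain v where v: "square_cell_ok L v" "scsrc v = y" "sctrg v = y'" "sct v = \<kappa>" by (auto simp: cells_iff)
      then have "scs v \<in> cells L (sqs y) (sqs y')" "sqphi y' \<bullet> (id2 L (sqtrg y) \<star> scs v) = (\<kappa> \<star> id2 L (sqsrc y)) \<bullet> sqphi y"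
        unfolding square_cell_ok_def by blast+
      then show "mlift L (sqtrg y) (sqsrc y) \<kappa> (sqs y) (inv2 L (sqphi y)) (sqs y') (inv2 L (sqphi y'))"
        unfolding mlift_def using eq by blast
    qed
  qed
  show ?thesis
  proof unfold_locales
    fix e assume "e \<in> E" then show "F0 K e \<in> M \<and> trg1 L (F0 K e) = src1 L e" using K by simp
  next
    fix m assume "m \<in> M" then show "F0 C m \<in> E \<and> src1 L (F0 C m) = trg1 L m" using C by simp
  next
    fix e assume e: "e \<in> E"
    then have o: "e \<in> Obj ?X" using OX by blast
    \<comment> \<open>The counit at \<open>e\<close> lies over an identity, so the square has an
      identity between the domains and its filling is a 2-cell from \<open>e\<close> to its other
      side after \<open>cok (ker e)\<close>. That side is an equivalence because the square
      is.\<close>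
    let ?q = "T0 \<epsilon> e"
    have q: "square_ok L ?q" and qs: "sqsrc ?q = F0 C (F0 K e)" "sqtrg ?q = e" "sqs ?q = one L (src1 L e)"
      using eps0[OF o] by simp_all
    note d = square_okD[OF q, unfolded qs]
    show "\<exists>r \<theta>. equivalence1 L r \<and> src1 L r = trg1 L (F0 C (F0 K e)) \<and> trg1 L r = trg1 L e \<and>
      iso2 L \<theta> \<and> src2 L \<theta> = e \<and> trg2 L \<theta> = r \<cdot> F0 C (F0 K e)"
      using equivalence1_arrow2(2)[OF eps0(1)[OF o]] d by (intro exI[of _ "sqt ?q"] exI[of _ "sqphi ?q"]) simp
  next
    fix m assume m: "m \<in> M"
    then have o: "m \<in> Obj ?Y" using OY by blast
    let ?q = "T0 \<eta> m"
    have q: "square_ok L ?q" and qs: "sqtrg ?q = F0 K (F0 C m)" "sqsrc ?q = m" "sqt ?q = one L (trg1 L m)"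
      using eta0[OF o] by simp_all
    note d = square_okD[OF q, unfolded qs]
    show "\<exists>r \<theta>. equivalence1 L r \<and> trg1 L r = src1 L (F0 K (F0 C m)) \<and> src1 L r = src1 L m \<and>
      iso2 L \<theta> \<and> src2 L \<theta> = m \<and> trg2 L \<theta> = F0 K (F0 C m) \<cdot> r"
      using equivalence1_arrow2(1)[OF eta0(1)[OF o]] d by (intro exI[of _ "sqs ?q"] exI[of _ "inv2 L (sqphi ?q)"]) simp
  next
    fix m e s s' u \<chi> u' \<chi>'
    assume m: "m \<in> M" and e: "e \<in> E" and s: "s \<in> Mor L" "src1 L s = trg1 L m" "trg1 L s = src1 L e"
       "s' \<in> Mor L" "src1 L s' = trg1 L m" "trg1 L s' = src1 L e" and u: "mstruct L (F0 K e) m s u \<chi>" "mstruct L (F0 K e) m s' u' \<chi>'"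
    note [simp] = m e s K[OF e] C[OF m] M_Mor[OF m] E_Mor[OF e] M_Mor[OF K(1)[OF e]]
    \<comment> \<open>The 2-cell of an \<open>mstruct\<close> is the inverse of a filling, so the
      squares are built with inverted 2-cells; their transposes are squares out of
      \<open>F0 C m\<close> over the same \<open>s\<close> and \<open>s'\<close>.\<close>
    define y y' where y: "y = \<lparr>sqsrc = m, sqtrg = F0 K e, sqs = u, sqt = s, sqphi = inv2 L \<chi>\<rparr>" "y' = \<lparr>sqsrc = m, sqtrg = F0 K e, sqs = u', sqt = s', sqphi = inv2 L \<chi>'\<rparr>"
    have ok: "square_ok L y" "square_ok L y'" using u by (auto simp: y mstruct_def intro!: square_okI)
    have ys [simp]: "sqsrc y = m" "sqtrg y = F0 K e" "sqs y = u" "sqt y = s" "sqphi y = inv2 L \<chi>"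
      "sqsrc y' = m" "sqtrg y' = F0 K e" "sqs y' = u'" "sqt y' = s'" "sqphi y' = inv2 L \<chi>'" by (simp_all add: y)
    have [simp]: "inv2 L (inv2 L \<chi>) = \<chi>" "inv2 L (inv2 L \<chi>') = \<chi>'" using u by (auto simp: mstruct_def)
    have oe: "e \<in> Obj ?X" using e OX by blast
    have yM: "y \<in> Mor ?Y" "trg1 ?Y y = F0 K e" "y' \<in> Mor ?Y" "trg1 ?Y y' = F0 K e" "src1 ?Y y' = src1 ?Y y" using ok by simp_all
    define x x' where x: "x = transpose_e e y" "x' = transpose_e e y'"
    have xs: "square_ok L x" "sqsrc x = F0 C m" "sqtrg x = e" "sqs x = s" "square_ok L x'" "sqsrc x' = F0 C m" "sqtrg x' = e" "sqs x' = s'"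
      using transpose_e[OF oe yM(1,2)] transpose_e[OF oe yM(3,4)] by (simp_all add: x)
    have 1: "estruct L (F0 C m) e s (sqt x) (sqphi x)" "estruct L (F0 C m) e s' (sqt x') (sqphi x')"
      using es[OF xs(1)] es[OF xs(5)] xs by simp_all
    have 2: "elift L (F0 C m) e \<kappa> (sqt x) (sqphi x) (sqt x') (sqphi x') \<longleftrightarrow> mlift L (F0 K e) m \<kappa> u \<chi> u' \<chi>'" if k: "\<kappa> \<in> cells L s s'" for \<kappa>
      using el[OF xs(1,5), of \<kappa>] ml[OF ok, of \<kappa>] lift_e_iff[OF oe yM, of \<kappa>] k xs by (simp add: x)
    show "\<exists>t \<phi> t' \<phi>'. estruct L (F0 C m) e s t \<phi> \<and> estruct L (F0 C m) e s' t' \<phi>' \<and>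
      (\<forall>\<kappa>\<in>cells L s s'. elift L (F0 C m) e \<kappa> t \<phi> t' \<phi>' \<longleftrightarrow> mlift L (F0 K e) m \<kappa> u \<chi> u' \<chi>')"
      using 1 2 by blast
  next
    fix m e s s' t \<phi> t' \<phi>'
    assume m: "m \<in> M" and e: "e \<in> E" and s: "s \<in> Mor L" "src1 L s = trg1 L m" "trg1 L s = src1 L e"
       "s' \<in> Mor L" "src1 L s' = trg1 L m" "trg1 L s' = src1 L e" and u: "estruct L (F0 C m) e s t \<phi>" "estruct L (F0 C m) e s' t' \<phi>'"
    note [simp] = m e s K[OF e] C[OF m] M_Mor[OF m] E_Mor[OF e] E_Mor[OF C(1)[OF m]]
    define x x' where x: "x = \<lparr>sqsrc = F0 C m, sqtrg = e, sqs = s, sqt = t, sqphi = \<phi>\<rparr>" "x' = \<lparr>sqsrc = F0 C m, sqtrg = e, sqs = s', sqt = t', sqphi = \<phi>'\<rparr>"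
    have ok: "square_ok L x" "square_ok L x'" using u by (auto simp: x estruct_def intro!: square_okI)
    have xs [simp]: "sqsrc x = F0 C m" "sqtrg x = e" "sqs x = s" "sqt x = t" "sqphi x = \<phi>"
      "sqsrc x' = F0 C m" "sqtrg x' = e" "sqs x' = s'" "sqt x' = t'" "sqphi x' = \<phi>'" by (simp_all add: x)
    have om: "m \<in> Obj ?Y" using m OY by blast
    have xM: "x \<in> Mor ?X" "src1 ?X x = F0 C m" "x' \<in> Mor ?X" "src1 ?X x' = F0 C m" "trg1 ?X x' = trg1 ?X x" using ok by simp_all
    define y y' where y: "y = transpose_m m x" "y' = transpose_m m x'"
    have ys: "square_ok L y" "sqtrg y = F0 K e" "sqsrc y = m" "sqt y = s" "square_ok L y'" "sqtrg y' = F0 K e" "sqsrc y' = m" "sqt y' = s'"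
      using transpose_m[OF om xM(1,2)] transpose_m[OF om xM(3,4)] by (simp_all add: y)
    have 1: "mstruct L (F0 K e) m s (sqs y) (inv2 L (sqphi y))" "mstruct L (F0 K e) m s' (sqs y') (inv2 L (sqphi y'))"
      using ms[OF ys(1)] ms[OF ys(5)] ys by simp_all
    have 2: "mlift L (F0 K e) m \<kappa> (sqs y) (inv2 L (sqphi y)) (sqs y') (inv2 L (sqphi y')) \<longleftrightarrow> elift L (F0 C m) e \<kappa> t \<phi> t' \<phi>'" if k: "\<kappa> \<in> cells L s s'" for \<kappa>
      using ml[OF ys(1,5), of \<kappa>] el[OF ok, of \<kappa>] lift_m_iff[OF om xM, of \<kappa>] k ys by (simp add: y)
    show "\<exists>u \<chi> u' \<chi>'. mstruct L (F0 K e) m s u \<chi> \<and> mstruct L (F0 K e) m s' u' \<chi>' \<and>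
      (\<forall>\<kappa>\<in>cells L s s'. mlift L (F0 K e) m \<kappa> u \<chi> u' \<chi>' \<longleftrightarrow> elift L (F0 C m) e \<kappa> t \<phi> t' \<phi>')"
      using 1 2 by blast
  qed
qed

end

section \<open>Categories form a 2-category\<close>

lemma func_eqI:
  assumes "cat_functor F" "cat_functor G" "fdom F = fdom G" "fcod F = fcod G"
    and "\<And>x. x \<in> cobj (fdom F) \<Longrightarrow> fob F x = fob G x" "\<And>s. s \<in> carr (fdom F) \<Longrightarrow> far F s = far G s"
  shows "F = G"
proof -
  interpret F: cat_functor F by fact
  interpret G: cat_functor G by fact
  have "fob F = fob G" using F.fob_extensional G.fob_extensional assms(3,5) by (auto intro: extensionalityI)
  moreover have "far F = far G" using F.far_extensional G.far_extensional assms(3,6) by (auto intro: extensionalityI)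
  ultimately show ?thesis using assms(3,4) by simp
qed

lemma nattrans_eqI:
  assumes "natural_transformation R" "natural_transformation S" "nsrc R = nsrc S" "ntrg R = ntrg S"
    and "\<And>x. x \<in> cobj (fdom (nsrc R)) \<Longrightarrow> ncomp R x = ncomp S x"
  shows "R = S"
proof -
  interpret R: natural_transformation R by fact
  interpret S: natural_transformation S by fact
  have "ncomp R = ncomp S" using R.ncomp_extensional S.ncomp_extensional assms(3,5) by (auto intro: extensionalityI)
  then show ?thesis using assms(3,4) by simp
qed

context cat_functor
begin

lemma far_carr: "s \<in> carr (fdom F) \<Longrightarrow> far F s \<in> carr (fcod F) \<and> cdom (fcod F) (far F s) = fob F (cdom (fdom F) s) \<and> ccod (fcod F) (far F s) = fob F (ccod (fdom F) s)"
  using far_chom[of s "cdom (fdom F) s" "ccod (fdom F) s"] by (simp add: chom_def)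

end

lemma functor_one: "category X \<Longrightarrow> cat_functor (one Cat X)"
proof -
  assume "category X"
  then interpret category X .
  show "cat_functor (one Cat X)"
  proof (rule cat_functor.intro)
    show "category (fdom (one Cat X))" "category (fcod (one Cat X))" by (simp_all add: category_axioms)
    show "fob (one Cat X) \<in> extensional (cobj (fdom (one Cat X)))" "far (one Cat X) \<in> extensional (carr (fdom (one Cat X)))"
      by (simp_all add: Cat_def)
    fix x assume x: "x \<in> cobj (fdom (one Cat X))"
    then show "fob (one Cat X) x \<in> cobj (fcod (one Cat X))" by simp
    show "far (one Cat X) (cid (fdom (one Cat X)) x) = cid (fcod (one Cat X)) (fob (one Cat X) x)"
      using x cid_chom[of x] by (simp add: chom_def)
  next
    fix s x y assume s: "s \<in> chom (fdom (one Cat X)) x y"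
    then show "far (one Cat X) s \<in> chom (fcod (one Cat X)) (fob (one Cat X) x) (fob (one Cat X) y)"
      using carr_bd[of s] by (auto simp: chom_def)
    fix t z assume t: "t \<in> chom (fdom (one Cat X)) y z"
    show "far (one Cat X) (ccomp (fdom (one Cat X)) t s) = ccomp (fcod (one Cat X)) (far (one Cat X) t) (far (one Cat X) s)"
      using s t ccomp_chom[of s x y t z] by (simp add: chom_def)
  qed
qed

lemma functor_comp:
  assumes "cat_functor F" "cat_functor G" and GF: "fdom G = fcod F"
  shows "cat_functor (comp1 Cat G F)"
proof -
  interpret F: cat_functor F by fact
  interpret G: cat_functor G by fact
  interpret D: category "fdom F" by (rule F.fdom_category)
  show ?thesis
  proof (rule cat_functor.intro)
    show "category (fdom (comp1 Cat G F))" "category (fcod (comp1 Cat G F))"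
      by (simp_all add: F.fdom_category G.fcod_category)
    show "fob (comp1 Cat G F) \<in> extensional (cobj (fdom (comp1 Cat G F)))" "far (comp1 Cat G F) \<in> extensional (carr (fdom (comp1 Cat G F)))"
      by (simp_all add: Cat_def)
    fix x assume x: "x \<in> cobj (fdom (comp1 Cat G F))"
    then show "fob (comp1 Cat G F) x \<in> cobj (fcod (comp1 Cat G F))" using F.fob_cobj G.fob_cobj GF by simp
    show "far (comp1 Cat G F) (cid (fdom (comp1 Cat G F)) x) = cid (fcod (comp1 Cat G F)) (fob (comp1 Cat G F) x)"
      using x D.cid_chom[of x] F.far_cid[of x] G.far_cid[of "fob F x"] F.fob_cobj[of x] GF by (simp add: chom_def)
  next
    fix s x y assume s: "s \<in> chom (fdom (comp1 Cat G F)) x y"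
    then show "far (comp1 Cat G F) s \<in> chom (fcod (comp1 Cat G F)) (fob (comp1 Cat G F) x) (fob (comp1 Cat G F) y)"
      using D.carr_bd[of s] F.far_carr[of s] G.far_carr[of "far F s"] GF by (auto simp: chom_def)
    fix t z assume t: "t \<in> chom (fdom (comp1 Cat G F)) y z"
    have "far F s \<in> chom (fdom G) (fob F x) (fob F y)" "far F t \<in> chom (fdom G) (fob F y) (fob F z)"
      using F.far_chom s t GF by simp_all
    then show "far (comp1 Cat G F) (ccomp (fdom (comp1 Cat G F)) t s) = ccomp (fcod (comp1 Cat G F)) (far (comp1 Cat G F) t) (far (comp1 Cat G F) s)"
      using s t D.ccomp_chom[of s x y t z] F.far_ccomp[of s x y t z] G.far_ccomp[of "far F s" "fob F x" "fob F y" "far F t" "fob F z"] GF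
      by (simp add: chom_def)
  qed
qed

lemma nattrans_id: "cat_functor F \<Longrightarrow> natural_transformation (id2 Cat F)"
proof -
  assume "cat_functor F"
  then interpret F: cat_functor F .
  interpret D: category "fdom F" by (rule F.fdom_category)
  interpret C: category "fcod F" by (rule F.fcod_category)
  show ?thesis
  proof (rule natural_transformation.intro)
    show "ncomp (id2 Cat F) \<in> extensional (cobj (fdom (nsrc (id2 Cat F))))" by (simp add: Cat_def)
    fix x assume "x \<in> cobj (fdom (nsrc (id2 Cat F)))"
    then show "ncomp (id2 Cat F) x \<in> chom (fcod (nsrc (id2 Cat F))) (fob (nsrc (id2 Cat F)) x) (fob (ntrg (id2 Cat F)) x)"
      using F.fob_cobj C.cid_chom by simp
  next
    fix s x y assume s: "s \<in> chom (fdom (nsrc (id2 Cat F))) x y"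
    then have "x \<in> cobj (fdom F)" "y \<in> cobj (fdom F)" using D.carr_bd[of s] by (auto simp: chom_def)
    then show "ccomp (fcod (nsrc (id2 Cat F))) (ncomp (id2 Cat F) y) (far (nsrc (id2 Cat F)) s) = ccomp (fcod (nsrc (id2 Cat F))) (far (ntrg (id2 Cat F)) s) (ncomp (id2 Cat F) x)"
      using s F.far_chom[of s x y] C.cid_ccomp[of "far F s" "fob F x" "fob F y"] C.ccomp_cid[of "far F s" "fob F x" "fob F y"] by simp
  qed (simp_all add: F.cat_functor_axioms)
qed

context natural_transformation
begin

lemma D: "category (fdom (nsrc S))" and C: "category (fcod (nsrc S))"
  using nsrc_functor by (simp_all add: cat_functor_def)

end

lemma nattrans_vcomp:
  assumes "natural_transformation S" "natural_transformation R" and RS: "nsrc R = ntrg S"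
  shows "natural_transformation (vcomp Cat R S)"
proof -
  interpret R: natural_transformation R by fact
  interpret S: natural_transformation S by fact
  interpret D: category "fdom (nsrc S)" by (rule S.D)
  interpret C: category "fcod (nsrc S)" by (rule S.C)
  interpret F: cat_functor "nsrc S" by (rule S.nsrc_functor)
  interpret G: cat_functor "ntrg S" by (rule S.ntrg_functor)
  interpret J: cat_functor "ntrg R" by (rule R.ntrg_functor)
  have eq: "fdom (ntrg S) = fdom (nsrc S)" "fcod (ntrg S) = fcod (nsrc S)" "fdom (ntrg R) = fdom (nsrc S)" "fcod (ntrg R) = fcod (nsrc S)"
    using R.fdom_eq R.fcod_eq S.fdom_eq S.fcod_eq RS by simp_all
  have cm: "ncomp S x \<in> chom (fcod (nsrc S)) (fob (nsrc S) x) (fob (ntrg S) x)"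
    "ncomp R x \<in> chom (fcod (nsrc S)) (fob (ntrg S) x) (fob (ntrg R) x)" if "x \<in> cobj (fdom (nsrc S))" for x
    using that S.ncomp_chom[of x] R.ncomp_chom[of x] by (simp_all add: RS eq)
  show ?thesis
  proof (rule natural_transformation.intro)
    show "ncomp (vcomp Cat R S) \<in> extensional (cobj (fdom (nsrc (vcomp Cat R S))))" by (simp add: Cat_def)
    fix x assume "x \<in> cobj (fdom (nsrc (vcomp Cat R S)))"
    then show "ncomp (vcomp Cat R S) x \<in> chom (fcod (nsrc (vcomp Cat R S))) (fob (nsrc (vcomp Cat R S)) x) (fob (ntrg (vcomp Cat R S)) x)"
      using C.ccomp_chom[OF cm] by simp
  next
    fix s x y assume "s \<in> chom (fdom (nsrc (vcomp Cat R S))) x y"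
    then have s: "s \<in> chom (fdom (nsrc S)) x y" by simp
    then have xy: "x \<in> cobj (fdom (nsrc S))" "y \<in> cobj (fdom (nsrc S))" using D.carr_bd[of s] by (auto simp: chom_def)
    note f = F.far_chom[OF s] and g = G.far_chom[of s x y, unfolded eq, OF s] and j = J.far_chom[of s x y, unfolded eq, OF s]
    note cx = cm[OF xy(1)] and cy = cm[OF xy(2)]
    have 1: "ccomp (fcod (nsrc S)) (ncomp S y) (far (nsrc S) s) = ccomp (fcod (nsrc S)) (far (ntrg S) s) (ncomp S x)"
      by (rule S.natural[OF s])
    have 2: "ccomp (fcod (nsrc S)) (ncomp R y) (far (ntrg S) s) = ccomp (fcod (nsrc S)) (far (ntrg R) s) (ncomp R x)"
      using R.natural[of s x y] s by (simp add: RS eq)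
    have "ccomp (fcod (nsrc S)) (ccomp (fcod (nsrc S)) (ncomp R y) (ncomp S y)) (far (nsrc S) s)
      = ccomp (fcod (nsrc S)) (ccomp (fcod (nsrc S)) (ncomp R y) (far (ntrg S) s)) (ncomp S x)"
      using C.ccomp_assoc[OF f cy] C.ccomp_assoc[OF cx(1) g cy(2)] 1 by simp
    also have "\<dots> = ccomp (fcod (nsrc S)) (far (ntrg R) s) (ccomp (fcod (nsrc S)) (ncomp R x) (ncomp S x))"
      unfolding 2 by (rule C.ccomp_assoc[OF cx j])
    finally show "ccomp (fcod (nsrc (vcomp Cat R S))) (ncomp (vcomp Cat R S) y) (far (nsrc (vcomp Cat R S)) s)
      = ccomp (fcod (nsrc (vcomp Cat R S))) (far (ntrg (vcomp Cat R S)) s) (ncomp (vcomp Cat R S) x)" using xy by simp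
  qed (simp_all add: S.nsrc_functor R.ntrg_functor eq)
qed

lemma nattrans_hcomp:
  assumes "natural_transformation S" "natural_transformation R" and RS: "fdom (nsrc R) = fcod (nsrc S)"
  shows "natural_transformation (hcomp Cat R S)"
proof -
  interpret R: natural_transformation R by fact
  interpret S: natural_transformation S by fact
  interpret D: category "fdom (nsrc S)" by (rule S.D)
  interpret C: category "fcod (nsrc S)" by (rule S.C)
  interpret E: category "fcod (nsrc R)" by (rule R.C)
  interpret F: cat_functor "nsrc S" by (rule S.nsrc_functor)
  interpret G: cat_functor "ntrg S" by (rule S.ntrg_functor)
  interpret F': cat_functor "nsrc R" by (rule R.nsrc_functor)
  interpret G': cat_functor "ntrg R" by (rule R.ntrg_functor)
  have eq: "fdom (ntrg S) = fdom (nsrc S)" "fcod (ntrg S) = fcod (nsrc S)" "fdom (ntrg R) = fcod (nsrc S)" "fcod (ntrg R) = fcod (nsrc R)"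
    using R.fdom_eq R.fcod_eq S.fdom_eq S.fcod_eq RS by simp_all
  have cm: "far (nsrc R) (ncomp S x) \<in> chom (fcod (nsrc R)) (fob (nsrc R) (fob (nsrc S) x)) (fob (nsrc R) (fob (ntrg S) x))"
    "ncomp R (fob (ntrg S) x) \<in> chom (fcod (nsrc R)) (fob (nsrc R) (fob (ntrg S) x)) (fob (ntrg R) (fob (ntrg S) x))" if "x \<in> cobj (fdom (nsrc S))" for x
    using that S.ncomp_chom[of x] R.ncomp_chom[of "fob (ntrg S) x"] F'.far_chom[of "ncomp S x"] G.fob_cobj[of x] by (simp_all add: RS eq)
  show ?thesis
  proof (rule natural_transformation.intro)
    show "ncomp (hcomp Cat R S) \<in> extensional (cobj (fdom (nsrc (hcomp Cat R S))))" by (simp add: Cat_def)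
    show "cat_functor (nsrc (hcomp Cat R S))" "cat_functor (ntrg (hcomp Cat R S))"
      by (simp_all add: functor_comp S.nsrc_functor R.nsrc_functor S.ntrg_functor R.ntrg_functor RS eq)
    fix x assume "x \<in> cobj (fdom (nsrc (hcomp Cat R S)))"
    then show "ncomp (hcomp Cat R S) x \<in> chom (fcod (nsrc (hcomp Cat R S))) (fob (nsrc (hcomp Cat R S)) x) (fob (ntrg (hcomp Cat R S)) x)"
      using E.ccomp_chom[OF cm] by (simp add: eq)
  next
    fix s x y assume "s \<in> chom (fdom (nsrc (hcomp Cat R S))) x y"
    then have s: "s \<in> chom (fdom (nsrc S)) x y" by simp
    then have xy: "x \<in> cobj (fdom (nsrc S))" "y \<in> cobj (fdom (nsrc S))" and sc: "s \<in> carr (fdom (nsrc S))" using D.carr_bd[of s] by (auto simp: chom_def)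
    note f = F.far_chom[OF s] and g = G.far_chom[of s x y, unfolded eq, OF s]
    note f' = F'.far_chom[of "far (nsrc S) s", unfolded RS, OF f] and g' = F'.far_chom[of "far (ntrg S) s", unfolded RS, OF g]
      and h' = G'.far_chom[of "far (ntrg S) s", unfolded eq, OF g]
    note cx = cm[OF xy(1)] and cy = cm[OF xy(2)]
    let ?c = "ccomp (fcod (nsrc R))"
    have "ccomp (fcod (nsrc S)) (ncomp S y) (far (nsrc S) s) = ccomp (fcod (nsrc S)) (far (ntrg S) s) (ncomp S x)"
      by (rule S.natural[OF s])
    then have 1: "?c (far (nsrc R) (ncomp S y)) (far (nsrc R) (far (nsrc S) s)) = ?c (far (nsrc R) (far (ntrg S) s)) (far (nsrc R) (ncomp S x))"
      using F'.far_ccomp[unfolded RS, OF f S.ncomp_chom[OF xy(2)]] F'.far_ccomp[unfolded RS, OF S.ncomp_chom[OF xy(1)] g] by simp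
    have 2: "?c (ncomp R (fob (ntrg S) y)) (far (nsrc R) (far (ntrg S) s)) = ?c (far (ntrg R) (far (ntrg S) s)) (ncomp R (fob (ntrg S) x))"
      using R.natural[unfolded RS, OF g] .
    have "?c (?c (ncomp R (fob (ntrg S) y)) (far (nsrc R) (ncomp S y))) (far (nsrc R) (far (nsrc S) s))
      = ?c (?c (ncomp R (fob (ntrg S) y)) (far (nsrc R) (far (ntrg S) s))) (far (nsrc R) (ncomp S x))"
      using E.ccomp_assoc[OF f' cy] E.ccomp_assoc[OF cx(1) g' cy(2)] 1 by simp
    also have "\<dots> = ?c (far (ntrg R) (far (ntrg S) s)) (?c (ncomp R (fob (ntrg S) x)) (far (nsrc R) (ncomp S x)))"
      unfolding 2 by (rule E.ccomp_assoc[OF cx h'])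
    finally show "ccomp (fcod (nsrc (hcomp Cat R S))) (ncomp (hcomp Cat R S) y) (far (nsrc (hcomp Cat R S)) s)
      = ccomp (fcod (nsrc (hcomp Cat R S))) (far (ntrg (hcomp Cat R S)) s) (ncomp (hcomp Cat R S) x)" using xy sc by (simp add: eq)
  qed (simp_all add: eq)
qed

lemma hom_Cat: "F \<in> hom Cat X Y \<longleftrightarrow> cat_functor F \<and> fdom F = X \<and> fcod F = Y"
  by (simp add: hom_def Cat_sel)

lemma cells_Cat: "S \<in> cells Cat F G \<longleftrightarrow> natural_transformation S \<and> nsrc S = F \<and> ntrg S = G"
  by (simp add: cells_def Cat_sel)

text \<open>The 2-ideal constructed below consists of strict 2-functors and a strict transformation
  with values in \<open>Cat\<close>. That identity constraints satisfy the pseudofunctor and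
  pseudonaturality axioms is an application of the 2-category laws of \<open>Cat\<close>.\<close>

lemma Cat_two_category: "two_category Cat"
proof (rule two_category.intro)
  fix f assume "f \<in> Mor Cat"
  then show "src1 Cat f \<in> Obj Cat \<and> trg1 Cat f \<in> Obj Cat" by (simp add: Cat_def cat_functor_def)
next
  fix R assume "R \<in> Cell Cat"
  then interpret natural_transformation R by (simp add: Cat_def)
  show "src2 Cat R \<in> Mor Cat \<and> trg2 Cat R \<in> Mor Cat"
    "src1 Cat (src2 Cat R) = src1 Cat (trg2 Cat R) \<and> trg1 Cat (src2 Cat R) = trg1 Cat (trg2 Cat R)"
    by (simp_all add: Cat_sel nsrc_functor ntrg_functor fdom_eq fcod_eq)
next
  fix A assume "A \<in> Obj Cat"
  then show "one Cat A \<in> hom Cat A A" unfolding hom_Cat using functor_one[of A] by (simp add: Cat_def)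
next
  fix F A B G C assume F: "F \<in> hom Cat A B" and G: "G \<in> hom Cat B C"
  then show GF: "comp1 Cat G F \<in> hom Cat A C" unfolding hom_Cat by (simp add: functor_comp)
  interpret F: cat_functor F using F hom_Cat by blast
  interpret G: cat_functor G using G hom_Cat by blast
  have e: "fdom F = A" "fcod F = B" "fdom G = B" "fcod G = C" using F G by (simp_all add: hom_Cat)
  show "hcomp Cat (id2 Cat G) (id2 Cat F) = id2 Cat (comp1 Cat G F)"
  proof (rule nattrans_eqI)
    interpret category C using G.fcod_category e by simp
    fix x assume "x \<in> cobj (fdom (nsrc (hcomp Cat (id2 Cat G) (id2 Cat F))))"
    then have x: "x \<in> cobj A" using e by simp
    have "fob F x \<in> cobj B" "fob G (fob F x) \<in> cobj C" using F.fob_cobj[of x] G.fob_cobj[of "fob F x"] x e by simp_all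
    then show "ncomp (hcomp Cat (id2 Cat G) (id2 Cat F)) x = ncomp (id2 Cat (comp1 Cat G F)) x"
      using x G.far_cid[of "fob F x"] ccomp_cid[OF cid_chom] by (simp add: e)
  qed (use GF in \<open>simp_all add: nattrans_id nattrans_hcomp F.cat_functor_axioms G.cat_functor_axioms e hom_Cat\<close>)
  fix H D assume H: "H \<in> hom Cat C D"
  show "comp1 Cat (comp1 Cat H G) F = comp1 Cat H (comp1 Cat G F)"
    by (rule func_eqI) (use F.fob_cobj F.far_carr F G H in \<open>simp_all add: functor_comp hom_Cat\<close>)
next
  fix F A B assume "F \<in> hom Cat A B"
  then have F: "cat_functor F" "fdom F = A" "fcod F = B" by (simp_all add: hom_Cat)
  then have c: "category A" "category B" by (auto simp: cat_functor_def)
  note d = cat_functor.fob_cobj[OF F(1)] cat_functor.far_carr[OF F(1)]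
  show "comp1 Cat F (one Cat A) = F"
    by (rule func_eqI) (use d in \<open>simp_all add: functor_comp functor_one F c\<close>)
  show "comp1 Cat (one Cat B) F = F"
    by (rule func_eqI) (use d in \<open>simp_all add: functor_comp functor_one F c\<close>)
next
  fix F assume "F \<in> Mor (Cat :: (('a, 'b) cat, ('a, 'b) func, ('a, 'b) nattrans) two_cat)"
  then show "id2 Cat F \<in> cells Cat F F" unfolding cells_Cat by (simp add: Cat_sel nattrans_id)
next
  fix R F G S J assume R: "R \<in> cells Cat F G" and S: "S \<in> cells Cat G J"
  then show SR: "vcomp Cat S R \<in> cells Cat F J" unfolding cells_Cat by (simp add: nattrans_vcomp)
  interpret R: natural_transformation R using R cells_Cat by blast
  interpret S: natural_transformation S using S cells_Cat by blast
  interpret C: category "fcod F" using R.C R by (simp add: cells_Cat)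
  fix U J' assume U: "U \<in> cells Cat J J'"
  interpret U: natural_transformation U using U cells_Cat by blast
  have e: "nsrc R = F" "ntrg R = G" "nsrc S = G" "ntrg S = J" "nsrc U = J" "ntrg U = J'" using R S U by (simp_all add: cells_Cat)
  have d: "fdom G = fdom F" "fdom J = fdom F" "fcod G = fcod F" "fcod J = fcod F"
    using R.fdom_eq R.fcod_eq S.fdom_eq S.fcod_eq e by simp_all
  show "vcomp Cat (vcomp Cat U S) R = vcomp Cat U (vcomp Cat S R)"
  proof (rule nattrans_eqI)
    fix x assume "x \<in> cobj (fdom (nsrc (vcomp Cat (vcomp Cat U S) R)))"
    then have x: "x \<in> cobj (fdom F)" by (simp add: e)
    show "ncomp (vcomp Cat (vcomp Cat U S) R) x = ncomp (vcomp Cat U (vcomp Cat S R)) x"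
      using C.ccomp_assoc[of "ncomp R x" "fob F x" "fob G x" "ncomp S x" "fob J x" "ncomp U x" "fob J' x"]
        R.ncomp_chom[of x] S.ncomp_chom[of x] U.ncomp_chom[of x] x by (simp add: e d)
  qed (simp_all add: nattrans_vcomp R.natural_transformation_axioms S.natural_transformation_axioms U.natural_transformation_axioms e)
next
  fix R F G assume R: "R \<in> cells Cat F G"
  interpret R: natural_transformation R using R cells_Cat by blast
  interpret C: category "fcod F" using R.C R by (simp add: cells_Cat)
  have e: "nsrc R = F" "ntrg R = G" using R by (simp_all add: cells_Cat)
  have d: "fdom G = fdom F" "fcod G = fcod F" using R.fdom_eq R.fcod_eq e by simp_all
  have FG: "cat_functor F" "cat_functor G" using R.nsrc_functor R.ntrg_functor e by simp_all
  have c: "ncomp R x \<in> chom (fcod F) (fob F x) (fob G x)" if "x \<in> cobj (fdom F)" for x using R.ncomp_chom[of x] that e by simp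
  show "vcomp Cat R (id2 Cat F) = R"
    by (rule nattrans_eqI) (use C.ccomp_cid[OF c] in \<open>simp_all add: nattrans_vcomp nattrans_id R.natural_transformation_axioms e d FG\<close>)
  show "vcomp Cat (id2 Cat G) R = R"
    by (rule nattrans_eqI) (use C.cid_ccomp[OF c] in \<open>simp_all add: nattrans_vcomp nattrans_id R.natural_transformation_axioms e d FG\<close>)
next
  fix F A B F' R assume F: "F \<in> hom Cat A B" and R: "R \<in> cells Cat F F'"
  interpret R: natural_transformation R using R cells_Cat by blast
  interpret F: cat_functor F using F hom_Cat by blast
  interpret F': cat_functor F' using R cells_Cat R.ntrg_functor by metis
  interpret A: category A using F.fdom_category F by (simp add: hom_Cat)
  interpret C: category B using F.fcod_category F by (simp add: hom_Cat)
  have e: "nsrc R = F" "ntrg R = F'" "fdom F = A" "fcod F = B" using R F by (simp_all add: cells_Cat hom_Cat)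
  have d: "fdom F' = A" "fcod F' = B" using R.fdom_eq R.fcod_eq e by simp_all
  have c: "ncomp R x \<in> chom B (fob F x) (fob F' x)" if "x \<in> cobj A" for x using R.ncomp_chom[of x] that e by simp
  have c': "ncomp R x \<in> carr B" if "x \<in> cobj A" for x using c[OF that] by (simp add: chom_def)
  note n = nattrans_hcomp nattrans_id functor_one A.category_axioms C.category_axioms R.natural_transformation_axioms F.cat_functor_axioms F'.cat_functor_axioms
  have o: "comp1 Cat F (one Cat A) = F" "comp1 Cat (one Cat B) F = F" "comp1 Cat F' (one Cat A) = F'" "comp1 Cat (one Cat B) F' = F'"
    by (rule func_eqI; use F.fob_cobj F.far_carr F'.fob_cobj F'.far_carr in \<open>simp add: functor_comp n e d\<close>)+
  have far: "far F (cid A x) = cid B (fob F x)" "fob F' x \<in> cobj B" if "x \<in> cobj A" for x using F.far_cid[of x] F'.fob_cobj[of x] that e d by simp_all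
  show "hcomp Cat R (id2 Cat (one Cat A)) = R"
    by (rule nattrans_eqI) (use C.ccomp_cid[OF c] far in \<open>simp_all add: n e d o\<close>)
  show "hcomp Cat (id2 Cat (one Cat B)) R = R"
    by (rule nattrans_eqI) (use C.cid_ccomp[OF c] far c' in \<open>simp_all add: n e d o\<close>)
next
  fix F A B G C R F' S G'
  assume F: "F \<in> hom Cat A B" and G: "G \<in> hom Cat B C" and R: "R \<in> cells Cat F F'" and S: "S \<in> cells Cat G G'"
  then show "hcomp Cat S R \<in> cells Cat (comp1 Cat G F) (comp1 Cat G' F')"
    unfolding cells_Cat hom_Cat by (simp add: nattrans_hcomp)
  interpret R: natural_transformation R using R cells_Cat by blast
  interpret S: natural_transformation S using S cells_Cat by blast
  interpret C: category C using S.C S G by (simp add: cells_Cat hom_Cat)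
  have e: "nsrc R = F" "ntrg R = F'" "nsrc S = G" "ntrg S = G'" "fdom F = A" "fcod F = B" "fdom G = B" "fcod G = C"
    using F G R S by (simp_all add: cells_Cat hom_Cat)
  have d: "fdom F' = A" "fcod F' = B" "fdom G' = B" "fcod G' = C" using R.fdom_eq R.fcod_eq S.fdom_eq S.fcod_eq e by simp_all
  interpret G: cat_functor G using S.nsrc_functor e by simp
  interpret G': cat_functor G' using S.ntrg_functor e by simp
  interpret F': cat_functor F' using R.ntrg_functor e by simp
  {
    fix R' F'' S' G'' assume R': "R' \<in> cells Cat F' F''" and S': "S' \<in> cells Cat G' G''"
    interpret R': natural_transformation R' using R' cells_Cat by blast
    interpret S': natural_transformation S' using S' cells_Cat by blast
    have e': "nsrc R' = F'" "ntrg R' = F''" "nsrc S' = G'" "ntrg S' = G''" using R' S' by (simp_all add: cells_Cat)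
    have d': "fdom F'' = A" "fcod F'' = B" "fdom G'' = B" "fcod G'' = C" using R'.fdom_eq R'.fcod_eq S'.fdom_eq S'.fcod_eq e' d by simp_all
    interpret F'': cat_functor F'' using R'.ntrg_functor e' by simp
    show "hcomp Cat (vcomp Cat S' S) (vcomp Cat R' R) = vcomp Cat (hcomp Cat S' R') (hcomp Cat S R)"
    proof (rule nattrans_eqI)
      fix x assume "x \<in> cobj (fdom (nsrc (hcomp Cat (vcomp Cat S' S) (vcomp Cat R' R))))"
      then have x: "x \<in> cobj A" by (simp add: e)
      have o: "fob F' x \<in> cobj B" "fob F'' x \<in> cobj B" using x F'.fob_cobj[of x] F''.fob_cobj[of x] d d' by simp_all
      have r: "ncomp R x \<in> chom B (fob F x) (fob F' x)" "ncomp R' x \<in> chom B (fob F' x) (fob F'' x)"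
        using R.ncomp_chom[of x] R'.ncomp_chom[of x] x by (simp_all add: e e' d)
      have s: "ncomp S (fob F' x) \<in> chom C (fob G (fob F' x)) (fob G' (fob F' x))" "ncomp S (fob F'' x) \<in> chom C (fob G (fob F'' x)) (fob G' (fob F'' x))"
        "ncomp S' (fob F'' x) \<in> chom C (fob G' (fob F'' x)) (fob G'' (fob F'' x))"
        using S.ncomp_chom[of "fob F' x"] S.ncomp_chom[of "fob F'' x"] S'.ncomp_chom[of "fob F'' x"] o by (simp_all add: e e' d)
      have g: "far G (ncomp R x) \<in> chom C (fob G (fob F x)) (fob G (fob F' x))" "far G (ncomp R' x) \<in> chom C (fob G (fob F' x)) (fob G (fob F'' x))"
        "far G' (ncomp R' x) \<in> chom C (fob G' (fob F' x)) (fob G' (fob F'' x))"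
        using G.far_chom[of "ncomp R x"] G.far_chom[of "ncomp R' x"] G'.far_chom[of "ncomp R' x"] r by (simp_all add: e d)
      have 1: "far G (ccomp B (ncomp R' x) (ncomp R x)) = ccomp C (far G (ncomp R' x)) (far G (ncomp R x))"
        using G.far_ccomp[of "ncomp R x" _ _ "ncomp R' x"] r by (simp add: e)
      \<comment> \<open>Naturality of \<open>S\<close> at the component of \<open>R'\<close>, which
        exchanges the two middle factors; the remaining manipulations are associativity.\<close>
      have 2: "ccomp C (ncomp S (fob F'' x)) (far G (ncomp R' x)) = ccomp C (far G' (ncomp R' x)) (ncomp S (fob F' x))"
        using S.natural[of "ncomp R' x"] r by (simp add: e)
      have "ccomp C (ccomp C (ncomp S' (fob F'' x)) (ncomp S (fob F'' x))) (ccomp C (far G (ncomp R' x)) (far G (ncomp R x)))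
        = ccomp C (ncomp S' (fob F'' x)) (ccomp C (ccomp C (ncomp S (fob F'' x)) (far G (ncomp R' x))) (far G (ncomp R x)))"
        by (simp only: C.ccomp_assoc[OF C.ccomp_chom[OF g(1,2)] s(2,3)] C.ccomp_assoc[OF g(1,2) s(2)])
      also have "\<dots> = ccomp C (ccomp C (ncomp S' (fob F'' x)) (far G' (ncomp R' x))) (ccomp C (ncomp S (fob F' x)) (far G (ncomp R x)))"
        unfolding 2 by (simp only: C.ccomp_assoc[OF C.ccomp_chom[OF g(1) s(1)] g(3) s(3)] C.ccomp_assoc[OF g(1) s(1) g(3)])
      finally show "ncomp (hcomp Cat (vcomp Cat S' S) (vcomp Cat R' R)) x = ncomp (vcomp Cat (hcomp Cat S' R') (hcomp Cat S R)) x"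
        using x o by (simp add: e e' d d' 1)
    qed (simp_all add: nattrans_vcomp nattrans_hcomp R.natural_transformation_axioms S.natural_transformation_axioms R'.natural_transformation_axioms S'.natural_transformation_axioms e e' d d')
  next
    fix H D U H' assume H: "H \<in> hom Cat C D" and U: "U \<in> cells Cat H H'"
    interpret U: natural_transformation U using U cells_Cat by blast
    have e': "nsrc U = H" "ntrg U = H'" "fdom H = C" "fcod H = D" using H U by (simp_all add: cells_Cat hom_Cat)
    have d': "fdom H' = C" "fcod H' = D" using U.fdom_eq U.fcod_eq e' by simp_all
    interpret H: cat_functor H using U.nsrc_functor e' by simp
    interpret H': cat_functor H' using U.ntrg_functor e' by simp
    interpret D: category D using H.fcod_category e' by simp
    interpret F: cat_functor F using R.nsrc_functor e by simp
    note n = functor_comp nattrans_hcomp R.natural_transformation_axioms S.natural_transformation_axioms U.natural_transformation_axioms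
      F.cat_functor_axioms F'.cat_functor_axioms G.cat_functor_axioms G'.cat_functor_axioms H.cat_functor_axioms H'.cat_functor_axioms e e' d d'
    have o: "comp1 Cat (comp1 Cat H G) F = comp1 Cat H (comp1 Cat G F)" "comp1 Cat (comp1 Cat H' G') F' = comp1 Cat H' (comp1 Cat G' F')"
      by (rule func_eqI; use F.fob_cobj F.far_carr F'.fob_cobj F'.far_carr in \<open>simp add: n\<close>)+
    show "hcomp Cat (hcomp Cat U S) R = hcomp Cat U (hcomp Cat S R)"
    proof (rule nattrans_eqI)
      fix x assume "x \<in> cobj (fdom (nsrc (hcomp Cat (hcomp Cat U S) R)))"
      then have x: "x \<in> cobj A" by (simp add: e)
      have o: "fob F' x \<in> cobj B" "fob G' (fob F' x) \<in> cobj C" using x F'.fob_cobj[of x] G'.fob_cobj[of "fob F' x"] d by simp_all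
      have r: "ncomp R x \<in> chom B (fob F x) (fob F' x)" using R.ncomp_chom[of x] x by (simp add: e)
      have g: "far G (ncomp R x) \<in> chom C (fob G (fob F x)) (fob G (fob F' x))" "ncomp S (fob F' x) \<in> chom C (fob G (fob F' x)) (fob G' (fob F' x))"
        using G.far_chom[of "ncomp R x"] r S.ncomp_chom[of "fob F' x"] o by (simp_all add: e)
      have h: "far H (far G (ncomp R x)) \<in> chom D (fob H (fob G (fob F x))) (fob H (fob G (fob F' x)))"
        "far H (ncomp S (fob F' x)) \<in> chom D (fob H (fob G (fob F' x))) (fob H (fob G' (fob F' x)))"
        "ncomp U (fob G' (fob F' x)) \<in> chom D (fob H (fob G' (fob F' x))) (fob H' (fob G' (fob F' x)))"
        using H.far_chom[of "far G (ncomp R x)"] H.far_chom[of "ncomp S (fob F' x)"] g U.ncomp_chom[of "fob G' (fob F' x)"] o by (simp_all add: e')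
      have 1: "far H (ccomp C (ncomp S (fob F' x)) (far G (ncomp R x))) = ccomp D (far H (ncomp S (fob F' x))) (far H (far G (ncomp R x)))"
        using H.far_ccomp[of "far G (ncomp R x)"] g by (simp add: e')
      have c: "ncomp R x \<in> carr B" using r by (simp add: chom_def)
      show "ncomp (hcomp Cat (hcomp Cat U S) R) x = ncomp (hcomp Cat U (hcomp Cat S R)) x"
        using D.ccomp_assoc[OF h] x o c by (simp add: e e' d 1)
    qed (simp_all add: n o)
  }
qed

section \<open>2-ideals with a strict action\<close>

lemma Cat_Obj: "Obj Cat = Collect category"
  by (simp add: Cat_def)

lemma prod2_two_category:
  assumes "two_category L" "two_category M"
  shows "two_category (prod2 L M)"
proof -
  interpret L: two_category L by fact
  interpret M: two_category M by fact
  have h: "hom (prod2 L M) A B = hom L (fst A) (fst B) \<times> hom M (snd A) (snd B)" for A B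
    by (cases A; cases B) (auto simp: hom_def prod2_def)
  have c: "cells (prod2 L M) A B = cells L (fst A) (fst B) \<times> cells M (snd A) (snd B)" for A B
    by (cases A; cases B) (auto simp: cells_def prod2_def)
  have o: "id2 (prod2 L M) = map_prod (id2 L) (id2 M)" "one (prod2 L M) = map_prod (one L) (one M)"
    "vcomp (prod2 L M) \<beta> \<alpha> = (vcomp L (fst \<beta>) (fst \<alpha>), vcomp M (snd \<beta>) (snd \<alpha>))"
    "hcomp (prod2 L M) \<beta> \<alpha> = (hcomp L (fst \<beta>) (fst \<alpha>), hcomp M (snd \<beta>) (snd \<alpha>))"
    "comp1 (prod2 L M) g f = (comp1 L (fst g) (fst f), comp1 M (snd g) (snd f))"
    "src1 (prod2 L M) = map_prod (src1 L) (src1 M)" "trg1 (prod2 L M) = map_prod (trg1 L) (trg1 M)"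
    "src2 (prod2 L M) = map_prod (src2 L) (src2 M)" "trg2 (prod2 L M) = map_prod (trg2 L) (trg2 M)" for \<alpha> \<beta> f g
    by (simp_all add: prod2_def split_def)
  show ?thesis
    by (rule two_category.intro) (auto simp: h c o hom_iff cells_iff L.interchange' M.interchange')
qed

lemma strict_psfun_sel [simp]:
  "F0 (strict_psfun A B x0 x1 x2) = x0" "F1 (strict_psfun A B x0 x1 x2) = x1" "F2 (strict_psfun A B x0 x1 x2) = x2"
  "Fcomp (strict_psfun A B x0 x1 x2) g f = id2 B (x1 (comp1 A g f))" "Funit (strict_psfun A B x0 x1 x2) a = id2 B (one B (x0 a))"
  by (simp_all add: strict_psfun_def)

lemma strict_pseudofunctor:
  assumes "two_category A" "two_category B"
    and x0: "\<And>a. a \<in> Obj A \<Longrightarrow> x0 a \<in> Obj B \<and> x1 (one A a) = one B (x0 a)"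
    and x1: "\<And>f. f \<in> Mor A \<Longrightarrow> x1 f \<in> Mor B \<and> src1 B (x1 f) = x0 (src1 A f) \<and> trg1 B (x1 f) = x0 (trg1 A f) \<and> x2 (id2 A f) = id2 B (x1 f)"
    and x1_comp: "\<And>f g. \<lbrakk>f \<in> Mor A; g \<in> Mor A; trg1 A f = src1 A g\<rbrakk> \<Longrightarrow> x1 (comp1 A g f) = comp1 B (x1 g) (x1 f)"
    and x2: "\<And>\<alpha>. \<alpha> \<in> Cell A \<Longrightarrow> x2 \<alpha> \<in> Cell B \<and> src2 B (x2 \<alpha>) = x1 (src2 A \<alpha>) \<and> trg2 B (x2 \<alpha>) = x1 (trg2 A \<alpha>)"
    and x2_vcomp: "\<And>\<alpha> \<beta>. \<lbrakk>\<alpha> \<in> Cell A; \<beta> \<in> Cell A; trg2 A \<alpha> = src2 A \<beta>\<rbrakk> \<Longrightarrow> x2 (vcomp A \<beta> \<alpha>) = vcomp B (x2 \<beta>) (x2 \<alpha>)"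
    and x2_hcomp: "\<And>\<alpha> \<beta>. \<lbrakk>\<alpha> \<in> Cell A; \<beta> \<in> Cell A; trg1 A (src2 A \<alpha>) = src1 A (src2 A \<beta>)\<rbrakk> \<Longrightarrow> x2 (hcomp A \<beta> \<alpha>) = hcomp B (x2 \<beta>) (x2 \<alpha>)"
  shows "pseudofunctor A B (strict_psfun A B x0 x1 x2)" "normal_psfun A B (strict_psfun A B x0 x1 x2)"
proof -
  interpret A: two_category A by fact
  interpret B: two_category B by fact
  have x0': "x0 a \<in> Obj B" "x1 (one A a) = one B (x0 a)" if "a \<in> Obj A" for a using x0[OF that] by simp_all
  have x1': "x1 f \<in> Mor B" "src1 B (x1 f) = x0 (src1 A f)" "trg1 B (x1 f) = x0 (trg1 A f)" "x2 (id2 A f) = id2 B (x1 f)" if "f \<in> Mor A" for f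
    using x1[OF that] by simp_all
  have x2': "x2 \<alpha> \<in> Cell B" "src2 B (x2 \<alpha>) = x1 (src2 A \<alpha>)" "trg2 B (x2 \<alpha>) = x1 (trg2 A \<alpha>)" if "\<alpha> \<in> Cell A" for \<alpha>
    using x2[OF that] by simp_all
  show "pseudofunctor A B (strict_psfun A B x0 x1 x2)"
    by (rule pseudofunctor.intro) (auto simp: hom_iff cells_iff isos_iff x0' x1' x2' x1_comp x2_vcomp x2_hcomp)
  show "normal_psfun A B (strict_psfun A B x0 x1 x2)"
    by (simp add: normal_psfun_def x0')
qed

lemma strict_pseudonatural:
  assumes "two_category A" "two_category B"
    and F: "pseudofunctor A B (strict_psfun A B x0 x1 x2)" and G: "pseudofunctor A B (strict_psfun A B y0 y1 y2)"
    and x1_one: "\<And>a. a \<in> Obj A \<Longrightarrow> x1 (one A a) = one B (x0 a)" "\<And>a. a \<in> Obj A \<Longrightarrow> y1 (one A a) = one B (y0 a)"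
    and x1_comp: "\<And>f g. \<lbrakk>f \<in> Mor A; g \<in> Mor A; trg1 A f = src1 A g\<rbrakk> \<Longrightarrow> x1 (comp1 A g f) = comp1 B (x1 g) (x1 f)"
       "\<And>f g. \<lbrakk>f \<in> Mor A; g \<in> Mor A; trg1 A f = src1 A g\<rbrakk> \<Longrightarrow> y1 (comp1 A g f) = comp1 B (y1 g) (y1 f)"
    and t: "\<And>a. a \<in> Obj A \<Longrightarrow> t a \<in> Mor B \<and> src1 B (t a) = x0 a \<and> trg1 B (t a) = y0 a"
    and t1: "\<And>f. f \<in> Mor A \<Longrightarrow> comp1 B (t (trg1 A f)) (x1 f) = comp1 B (y1 f) (t (src1 A f))"
    and t2: "\<And>\<alpha>. \<alpha> \<in> Cell A \<Longrightarrow> hcomp B (id2 B (t (trg1 A (src2 A \<alpha>)))) (x2 \<alpha>) = hcomp B (y2 \<alpha>) (id2 B (t (src1 A (src2 A \<alpha>))))"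
  shows "pseudonatural A B (strict_psfun A B x0 x1 x2) (strict_psfun A B y0 y1 y2) \<lparr>T0 = t, T1 = \<lambda>f. id2 B (comp1 B (y1 f) (t (src1 A f)))\<rparr>"
proof -
  interpret A: two_category A by fact
  interpret B: two_category B by fact
  interpret F: pseudofunctor A B "strict_psfun A B x0 x1 x2" by fact
  interpret G: pseudofunctor A B "strict_psfun A B y0 y1 y2" by fact
  have o: "x0 a \<in> Obj B" "y0 a \<in> Obj B" if "a \<in> Obj A" for a using F.F0_Obj[OF that] G.F0_Obj[OF that] by simp_all
  have m: "x1 f \<in> Mor B" "src1 B (x1 f) = x0 (src1 A f)" "trg1 B (x1 f) = x0 (trg1 A f)"
     "y1 f \<in> Mor B" "src1 B (y1 f) = y0 (src1 A f)" "trg1 B (y1 f) = y0 (trg1 A f)" if "f \<in> Mor A" for f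
    using F.F1_hom[of f "src1 A f" "trg1 A f"] G.F1_hom[of f "src1 A f" "trg1 A f"] that by (simp_all add: hom_iff)
  have c: "x2 f \<in> Cell B" "src2 B (x2 f) = x1 (src2 A f)" "trg2 B (x2 f) = x1 (trg2 A f)"
     "y2 f \<in> Cell B" "src2 B (y2 f) = y1 (src2 A f)" "trg2 B (y2 f) = y1 (trg2 A f)" if "f \<in> Cell A" for f
    using F.F2_cells[of f "src2 A f" "trg2 A f"] G.F2_cells[of f "src2 A f" "trg2 A f"] that by (simp_all add: cells_iff)
  have t': "t a \<in> Mor B" "src1 B (t a) = x0 a" "trg1 B (t a) = y0 a" if "a \<in> Obj A" for a using t[OF that] by simp_all
  let ?F = "strict_psfun A B x0 x1 x2" and ?G = "strict_psfun A B y0 y1 y2" and ?T = "\<lparr>T0 = t, T1 = \<lambda>f. id2 B (comp1 B (y1 f) (t (src1 A f)))\<rparr>"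
  show ?thesis
  proof (rule pseudonatural.intro)
    fix f a b assume f: "f \<in> hom A a b"
    then show "T1 ?T f \<in> isos B (comp1 B (F1 ?G f) (T0 ?T a))
       (comp1 B (T0 ?T b) (F1 ?F f))"
      using t1[of f] by (auto simp: hom_iff isos_iff m t')
  next
    fix f a b \<alpha> f' assume f: "f \<in> hom A a b" and \<alpha>: "\<alpha> \<in> cells A f f'"
    then show "vcomp B (T1 ?T f') (hcomp B (F2 ?G \<alpha>) (id2 B (T0 ?T a)))
       = vcomp B (hcomp B (id2 B (T0 ?T b)) (F2 ?F \<alpha>)) (T1 ?T f)"
      using t2[of \<alpha>] by (auto simp: hom_iff cells_iff m c t')
  next
    fix f a b g c assume f: "f \<in> hom A a b" and g: "g \<in> hom A b c"
    then have [simp]: "f \<in> Mor A" "g \<in> Mor A" "trg1 A f = src1 A g" and e: "src1 A f = a" "src1 A g = b" "trg1 A g = c" by (simp_all add: hom_iff)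
    have 1: "comp1 B (t c) (x1 g) = comp1 B (y1 g) (t b)" "comp1 B (t b) (x1 f) = comp1 B (y1 f) (t a)" using t1[of f] t1[of g] by (simp_all add: e)
    have ab: "a \<in> Obj A" "b \<in> Obj A" "c \<in> Obj A" using A.Mor_bd[of f] A.Mor_bd[of g] e by auto
    note [simp] = m[of f] m[of g] t'[OF ab(1)] t'[OF ab(2)] t'[OF ab(3)]
    have 2: "comp1 B (t c) (comp1 B (x1 g) (x1 f)) = comp1 B (comp1 B (t c) (x1 g)) (x1 f)" by (simp add: e)
    have 3: "comp1 B (t c) (comp1 B (x1 g) (x1 f)) = comp1 B (y1 g) (comp1 B (y1 f) (t a))" unfolding 2 1 using 1(2) by (simp add: e)
    show "vcomp B (T1 ?T (comp1 A g f)) (hcomp B (Fcomp ?G g f) (id2 B (T0 ?T a)))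
       = vcomp B (hcomp B (id2 B (T0 ?T c)) (Fcomp ?F g f))
         (vcomp B (hcomp B (T1 ?T g) (id2 B (F1 ?F f))) (hcomp B (id2 B (F1 ?G g)) (T1 ?T f)))"
      using 1 3 by (simp add: e x1_comp)
  qed (auto simp: hom_iff t' x1_one o)
qed

section \<open>Sub-2-functors of Hom closed under the action\<close>

definition subhom :: "('o, 'm, 'c) two_cat \<Rightarrow> 'm set \<Rightarrow> 'c set \<Rightarrow> 'o \<Rightarrow> 'o \<Rightarrow> ('m, 'c) cat" where
  "subhom L S U A B = \<lparr>cobj = {f \<in> S. src1 L f = A \<and> trg1 L f = B},
     carr = {\<theta> \<in> U. src1 L (src2 L \<theta>) = A \<and> trg1 L (src2 L \<theta>) = B},
     cdom = src2 L, ccod = trg2 L, cid = id2 L, ccomp = vcomp L\<rparr>"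

definition subhom_func :: "('o, 'm, 'c) two_cat \<Rightarrow> 'm set \<Rightarrow> 'c set \<Rightarrow> 'm \<Rightarrow> 'm \<Rightarrow> ('m, 'c) func" where
  "subhom_func L S U a b = \<lparr>
     fdom = subhom L S U (trg1 L a) (src1 L b), fcod = subhom L S U (src1 L a) (trg1 L b),
     fob = restrict (\<lambda>n. b \<cdot>\<^bsub>L\<^esub> n \<cdot>\<^bsub>L\<^esub> a) (cobj (subhom L S U (trg1 L a) (src1 L b))),
     far = restrict (\<lambda>\<theta>. id2 L b \<star>\<^bsub>L\<^esub> \<theta> \<star>\<^bsub>L\<^esub> id2 L a) (carr (subhom L S U (trg1 L a) (src1 L b)))\<rparr>"

definition subhom_nattrans :: "('o, 'm, 'c) two_cat \<Rightarrow> 'm set \<Rightarrow> 'c set \<Rightarrow> 'c \<Rightarrow> 'c \<Rightarrow> ('m, 'c) nattrans" where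
  "subhom_nattrans L S U \<alpha> \<beta> = \<lparr>
     nsrc = subhom_func L S U (src2 L \<alpha>) (src2 L \<beta>), ntrg = subhom_func L S U (trg2 L \<alpha>) (trg2 L \<beta>),
     ncomp = restrict (\<lambda>n. \<beta> \<star>\<^bsub>L\<^esub> id2 L n \<star>\<^bsub>L\<^esub> \<alpha>)
       (cobj (subhom L S U (trg1 L (src2 L \<alpha>)) (src1 L (src2 L \<beta>))))\<rparr>"

definition subhom_psfun :: "('o, 'm, 'c) two_cat \<Rightarrow> 'm set \<Rightarrow> 'c set \<Rightarrow>
    ('o \<times> 'o, 'm \<times> 'm, 'c \<times> 'c, ('m, 'c) cat, ('m, 'c) func, ('m, 'c) nattrans) psfun" where
  "subhom_psfun L S U = strict_psfun (prod2 (op2 L) L) Cat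
     (\<lambda>(A, B). subhom L S U A B) (\<lambda>(a, b). subhom_func L S U a b) (\<lambda>(\<alpha>, \<beta>). subhom_nattrans L S U \<alpha> \<beta>)"

text \<open>With all morphisms and all 2-cells the construction is the Hom 2-functor itself, so
  functoriality of Hom is an instance of the general proof and the inclusion runs between two
  instances of one construction.\<close>

lemma (in two_category) subhom_psfun_total: "subhom_psfun L (Mor L) (Cell L) = hom_psfun L"
proof -
  have 1: "subhom L (Mor L) (Cell L) A B = hom_cat L A B" for A B
    using Cell_bd by (auto simp: subhom_def hom_cat_def hom_def)
  have 2: "subhom_func L (Mor L) (Cell L) a b = hom_func L a b" for a b
    by (simp add: subhom_func_def hom_func_def 1)
  have "subhom_nattrans L (Mor L) (Cell L) \<alpha> \<beta> = hom_nattrans L \<alpha> \<beta>" for \<alpha> \<beta>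
    by (simp add: subhom_nattrans_def hom_nattrans_def 1 2)
  then show ?thesis by (simp add: subhom_psfun_def hom_psfun_def 1 2)
qed

lemma subhom_sel [simp]:
  "cobj (subhom L S U A B) = {f \<in> S. src1 L f = A \<and> trg1 L f = B}"
  "carr (subhom L S U A B) = {\<theta> \<in> U. src1 L (src2 L \<theta>) = A \<and> trg1 L (src2 L \<theta>) = B}"
  "cdom (subhom L S U A B) = src2 L" "ccod (subhom L S U A B) = trg2 L" "cid (subhom L S U A B) = id2 L"
  "ccomp (subhom L S U A B) = vcomp L"
  by (simp_all add: subhom_def)

lemma subhom_func_sel [simp]:
  "fdom (subhom_func L S U a b) = subhom L S U (trg1 L a) (src1 L b)"
  "fcod (subhom_func L S U a b) = subhom L S U (src1 L a) (trg1 L b)"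
  "\<lbrakk>n \<in> S; src1 L n = trg1 L a; trg1 L n = src1 L b\<rbrakk> \<Longrightarrow> fob (subhom_func L S U a b) n = b \<cdot>\<^bsub>L\<^esub> n \<cdot>\<^bsub>L\<^esub> a"
  "\<lbrakk>\<theta> \<in> U; src1 L (src2 L \<theta>) = trg1 L a; trg1 L (src2 L \<theta>) = src1 L b\<rbrakk> \<Longrightarrow> far (subhom_func L S U a b) \<theta> = id2 L b \<star>\<^bsub>L\<^esub> \<theta> \<star>\<^bsub>L\<^esub> id2 L a"
  by (simp_all add: subhom_func_def)

lemma subhom_nattrans_sel [simp]:
  "nsrc (subhom_nattrans L S U \<alpha> \<beta>) = subhom_func L S U (src2 L \<alpha>) (src2 L \<beta>)"
  "ntrg (subhom_nattrans L S U \<alpha> \<beta>) = subhom_func L S U (trg2 L \<alpha>) (trg2 L \<beta>)"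
  "\<lbrakk>n \<in> S; src1 L n = trg1 L (src2 L \<alpha>); trg1 L n = src1 L (src2 L \<beta>)\<rbrakk> \<Longrightarrow> ncomp (subhom_nattrans L S U \<alpha> \<beta>) n = \<beta> \<star>\<^bsub>L\<^esub> id2 L n \<star>\<^bsub>L\<^esub> \<alpha>"
  by (simp_all add: subhom_nattrans_def)

text \<open>Closure under the action of all pairs of 2-cells; for identities \<open>\<alpha>\<close>, \<open>\<beta>\<close> this gives the closure of
  \<open>S\<close> under composition.\<close>

locale strict_ideal = two_category L for L :: "('o, 'm, 'c) two_cat" (structure) +
  fixes S :: "'m set" and U :: "'c set"
  assumes S_Mor [simp]: "f \<in> S \<Longrightarrow> f \<in> Mor L"
    and U_Cell: "\<theta> \<in> U \<Longrightarrow> \<theta> \<in> Cell L \<and> src2 L \<theta> \<in> S \<and> trg2 L \<theta> \<in> S"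
    and U_id2 [simp]: "f \<in> S \<Longrightarrow> id2 L f \<in> U"
    and U_vcomp [simp]: "\<lbrakk>\<theta> \<in> U; \<theta>' \<in> U; trg2 L \<theta> = src2 L \<theta>'\<rbrakk> \<Longrightarrow> \<theta>' \<bullet> \<theta> \<in> U"
    and U_hcomp [simp]: "\<lbrakk>\<theta> \<in> U; \<alpha> \<in> Cell L; \<beta> \<in> Cell L; trg1 L (src2 L \<alpha>) = src1 L (src2 L \<theta>); src1 L (src2 L \<beta>) = trg1 L (src2 L \<theta>)\<rbrakk>
      \<Longrightarrow> \<beta> \<star> \<theta> \<star> \<alpha> \<in> U"
begin

lemma U_Cell' [simp]: "\<theta> \<in> U \<Longrightarrow> \<theta> \<in> Cell L" "\<theta> \<in> U \<Longrightarrow> src2 L \<theta> \<in> S" "\<theta> \<in> U \<Longrightarrow> trg2 L \<theta> \<in> S"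
  using U_Cell by simp_all

lemma S_comp [simp]:
  assumes "f \<in> S" "a \<in> Mor L" "b \<in> Mor L" "trg1 L a = src1 L f" "src1 L b = trg1 L f"
  shows "b \<cdot> f \<cdot> a \<in> S"
  using U_Cell'(2)[OF U_hcomp[of "id2 L f" "id2 L a" "id2 L b"]] assms by simp

lemma subhom_category: "category (subhom L S U A B)"
  by (rule category.intro) (auto simp: chom_def)

lemma subhom_functor:
  assumes "a \<in> Mor L" "b \<in> Mor L"
  shows "cat_functor (subhom_func L S U a b)"
  by (rule cat_functor.intro) (use assms in \<open>auto simp: chom_def subhom_category exch\<close>, simp_all add: subhom_func_def)

lemma subhom_natural:
  assumes "\<alpha> \<in> Cell L" "\<beta> \<in> Cell L"
  shows "natural_transformation (subhom_nattrans L S U \<alpha> \<beta>)"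
proof (rule natural_transformation.intro)
  show "ncomp (subhom_nattrans L S U \<alpha> \<beta>) \<in> extensional (cobj (fdom (nsrc (subhom_nattrans L S U \<alpha> \<beta>))))"
    by (simp add: subhom_nattrans_def)
qed (use assms in \<open>auto simp: chom_def subhom_functor interchange'[symmetric]\<close>)

abbreviation P where "P \<equiv> prod2 (op2 L) L"

lemma P_two_category: "two_category P"
  by (rule prod2_two_category[OF op2_two_category two_category_axioms])

lemma subhom_func_one: "subhom_func L S U (one L A) (one L B) = one Cat (subhom L S U A B)" if "A \<in> Obj L" "B \<in> Obj L"
  by (rule func_eqI) (use that in \<open>auto simp: subhom_functor functor_one subhom_category\<close>)

lemma subhom_func_comp:
  assumes "a \<in> Mor L" "b \<in> Mor L" "a' \<in> Mor L" "b' \<in> Mor L" "src1 L a = trg1 L a'" "trg1 L b = src1 L b'"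
  shows "subhom_func L S U (a \<cdot> a') (b' \<cdot> b) = comp1 Cat (subhom_func L S U a' b') (subhom_func L S U a b)"
  by (rule func_eqI) (use assms in \<open>auto simp: subhom_functor functor_comp\<close>)

lemma subhom_nattrans_id:
  assumes "a \<in> Mor L" "b \<in> Mor L"
  shows "subhom_nattrans L S U (id2 L a) (id2 L b) = id2 Cat (subhom_func L S U a b)"
  by (rule nattrans_eqI) (use assms in \<open>auto simp: subhom_functor subhom_natural nattrans_id\<close>)

lemma subhom_nattrans_vcomp:
  assumes "\<alpha> \<in> Cell L" "\<beta> \<in> Cell L" "\<alpha>' \<in> Cell L" "\<beta>' \<in> Cell L" "src2 L \<alpha>' = trg2 L \<alpha>" "src2 L \<beta>' = trg2 L \<beta>"
  shows "subhom_nattrans L S U (\<alpha>' \<bullet> \<alpha>) (\<beta>' \<bullet> \<beta>) = vcomp Cat (subhom_nattrans L S U \<alpha>' \<beta>') (subhom_nattrans L S U \<alpha> \<beta>)"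
  by (rule nattrans_eqI) (use assms in \<open>auto simp: subhom_natural nattrans_vcomp interchange'\<close>)

lemma subhom_nattrans_hcomp:
  assumes "\<alpha> \<in> Cell L" "\<beta> \<in> Cell L" "\<alpha>' \<in> Cell L" "\<beta>' \<in> Cell L"
    "src1 L (src2 L \<alpha>) = trg1 L (src2 L \<alpha>')" "trg1 L (src2 L \<beta>) = src1 L (src2 L \<beta>')"
  shows "subhom_nattrans L S U (\<alpha> \<star> \<alpha>') (\<beta>' \<star> \<beta>) = hcomp Cat (subhom_nattrans L S U \<alpha>' \<beta>') (subhom_nattrans L S U \<alpha> \<beta>)"
proof (rule nattrans_eqI)
  fix x assume "x \<in> cobj (fdom (nsrc (subhom_nattrans L S U (\<alpha> \<star> \<alpha>') (\<beta>' \<star> \<beta>))))"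
  then have x: "x \<in> S" "src1 L x = trg1 L (src2 L \<alpha>)" "trg1 L x = src1 L (src2 L \<beta>)" using assms by auto
  \<comment> \<open>A component of a horizontal composite in \<open>Cat\<close> is a component after
    an image under a functor; this equation contracts that vertical composite to one horizontal
    composite in \<open>L\<close>.\<close>
  have "(id2 L (trg2 L \<beta> \<cdot> x \<cdot> trg2 L \<alpha>) \<star> \<alpha>') \<bullet> (\<beta> \<star> id2 L x \<star> \<alpha> \<star> id2 L (src2 L \<alpha>')) = \<beta> \<star> id2 L x \<star> \<alpha> \<star> \<alpha>'"
    using hcomp_wl_wr[of \<alpha>' "\<beta> \<star> id2 L x \<star> \<alpha>"] assms x by simp
  then show "ncomp (subhom_nattrans L S U (\<alpha> \<star> \<alpha>') (\<beta>' \<star> \<beta>)) x = ncomp (hcomp Cat (subhom_nattrans L S U \<alpha>' \<beta>') (subhom_nattrans L S U \<alpha> \<beta>)) x"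
    using assms x by (simp add: interchange'[symmetric] del: wl_vcomp wr_vcomp)
qed (use assms in \<open>auto simp: subhom_natural nattrans_hcomp subhom_func_comp\<close>)

lemma subhom_pseudofunctor: "pseudofunctor P Cat (subhom_psfun L S U)" "normal_psfun P Cat (subhom_psfun L S U)"
  unfolding subhom_psfun_def
  by (rule strict_pseudofunctor[OF P_two_category Cat_two_category];
      auto simp: Cat_sel Cat_Obj subhom_func_one subhom_func_comp subhom_functor subhom_natural subhom_category
        subhom_nattrans_id subhom_nattrans_vcomp subhom_nattrans_hcomp op2_sel)+

lemma strict_ideal_total: "strict_ideal L (Mor L) (Cell L)"
  by (unfold_locales; simp)

definition strict_inclusion :: "'o \<times> 'o \<Rightarrow> ('m, 'c) func" where
  "strict_inclusion = (\<lambda>(A, B). \<lparr>fdom = subhom L S U A B, fcod = subhom L (Mor L) (Cell L) A B,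
     fob = restrict (\<lambda>f. f) (cobj (subhom L S U A B)), far = restrict (\<lambda>\<theta>. \<theta>) (carr (subhom L S U A B))\<rparr>)"

lemma strict_inclusion_sel [simp]:
  "fdom (strict_inclusion (A, B)) = subhom L S U A B" "fcod (strict_inclusion (A, B)) = subhom L (Mor L) (Cell L) A B"
  "\<lbrakk>f \<in> S; src1 L f = A; trg1 L f = B\<rbrakk> \<Longrightarrow> fob (strict_inclusion (A, B)) f = f"
  "\<lbrakk>\<theta> \<in> U; src1 L (src2 L \<theta>) = A; trg1 L (src2 L \<theta>) = B\<rbrakk> \<Longrightarrow> far (strict_inclusion (A, B)) \<theta> = \<theta>"
  by (simp_all add: strict_inclusion_def)

lemma strict_inclusion_functor: "cat_functor (strict_inclusion (A, B))"
proof -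
  interpret M: strict_ideal L "Mor L" "Cell L" by (rule strict_ideal_total)
  show ?thesis
    by (rule cat_functor.intro) (auto simp: chom_def subhom_category M.subhom_category, simp_all add: strict_inclusion_def)
qed

text \<open>The pseudonaturality 2-cells are identities, so the null morphism induced by
  \<open>b\<close>, \<open>n\<close>, \<open>a\<close> is the plain composite; this is possible
  because the chosen null morphisms are closed under composition.\<close>

definition strict_two_ideal :: "('o, 'm, 'c) ideal" where
  "strict_two_ideal = \<lparr>idN = subhom_psfun L S U, idnu = \<lparr>T0 = strict_inclusion,
     T1 = \<lambda>ab. id2 Cat (comp1 Cat ((\<lambda>(a, b). subhom_func L (Mor L) (Cell L) a b) ab) (strict_inclusion (src1 P ab)))\<rparr>\<rparr>"

lemma strict_two_ideal: "two_ideal L strict_two_ideal"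
proof -
  interpret M: strict_ideal L "Mor L" "Cell L" by (rule strict_ideal_total)
  note n = subhom_functor M.subhom_functor strict_inclusion_functor functor_comp subhom_natural M.subhom_natural nattrans_hcomp nattrans_id
  have f: "comp1 Cat (strict_inclusion (src1 L a, trg1 L b)) (subhom_func L S U a b) = comp1 Cat (subhom_func L (Mor L) (Cell L) a b) (strict_inclusion (trg1 L a, src1 L b))"
    if "a \<in> Mor L" "b \<in> Mor L" for a b
    by (rule func_eqI) (use that in \<open>auto simp: n\<close>)
  have t: "hcomp Cat (id2 Cat (strict_inclusion (src1 L (src2 L \<alpha>), trg1 L (src2 L \<beta>)))) (subhom_nattrans L S U \<alpha> \<beta>)
      = hcomp Cat (subhom_nattrans L (Mor L) (Cell L) \<alpha> \<beta>) (id2 Cat (strict_inclusion (trg1 L (src2 L \<alpha>), src1 L (src2 L \<beta>))))"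
    if ab: "\<alpha> \<in> Cell L" "\<beta> \<in> Cell L" for \<alpha> \<beta>
    by (rule nattrans_eqI) (use ab f[of "src2 L \<alpha>" "src2 L \<beta>"] f[of "trg2 L \<alpha>" "trg2 L \<beta>"] in \<open>auto simp: n\<close>)
  have "pseudonatural P Cat (subhom_psfun L S U) (subhom_psfun L (Mor L) (Cell L)) (idnu strict_two_ideal)"
    unfolding strict_two_ideal_def ideal.simps subhom_psfun_def
    by (rule strict_pseudonatural[OF P_two_category Cat_two_category subhom_pseudofunctor(1)[unfolded subhom_psfun_def] M.subhom_pseudofunctor(1)[unfolded subhom_psfun_def]])
      (auto simp: Cat_sel f t strict_inclusion_functor subhom_func_one subhom_func_comp M.subhom_func_one M.subhom_func_comp)
  moreover have "injective_on_objects (strict_inclusion (A, B)) \<and> faithful_functor (strict_inclusion (A, B))" for A B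
    by (auto simp: injective_on_objects_def faithful_functor_def inj_on_def chom_def)
  ultimately show ?thesis
    using subhom_pseudofunctor by (simp add: two_ideal_def subhom_psfun_total) (simp add: strict_two_ideal_def)
qed

lemma null_mor_strict: "null_mor strict_two_ideal A B = {f \<in> S. src1 L f = A \<and> trg1 L f = B}"
  by (auto simp: null_mor_def strict_two_ideal_def subhom_psfun_def image_iff)

lemma null_cells_strict: "null_cells strict_two_ideal A B = {\<theta> \<in> U. src1 L (src2 L \<theta>) = A \<and> trg1 L (src2 L \<theta>) = B}"
  by (auto simp: null_cells_def strict_two_ideal_def subhom_psfun_def image_iff)

end

section \<open>From factorization systems to closed 2-ideals\<close>

locale exact_nullity_ideal = ideal L I + exact_nullity L E M ker cok "null_structures L I" "null_between L I" "act_left L I" "act_right L I"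
  for L :: "('o, 'm, 'c) two_cat" (structure) and I E M ker cok
begin

sublocale op: exact_nullity "op2 L" M E cok ker NS nc "\<lambda>b x. ar x b" "\<lambda>x a. al a x"
  by (rule exact_nullity_op)

lemma is_two_kernel_iff: "is_two_kernel L I m \<longleftrightarrow> m \<in> M"
proof
  assume "is_two_kernel L I m"
  then show "m \<in> M" unfolding is_two_kernel_def two_kernel using kernel_M by blast
next
  assume "m \<in> M"
  then obtain x where "kernel L NS nc ar (cok m) m x" by (rule kernel_cok)
  then show "is_two_kernel L I m" unfolding is_two_kernel_def two_kernel by blast
qed

lemma is_two_cokernel_iff: "is_two_cokernel L I e \<longleftrightarrow> e \<in> E"
proof
  assume "is_two_cokernel L I e"
  then show "e \<in> E" unfolding is_two_cokernel_def two_cokernel using op.kernel_M by blast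
next
  assume "e \<in> E"
  then obtain x where "cokernel L NS nc al (ker e) e x" by (rule op.kernel_cok)
  then show "is_two_cokernel L I e" unfolding is_two_cokernel_def two_cokernel by blast
qed

text \<open>The null isomorphism demanded by the normality conditions can be an identity here, since
  \<open>kernel_of_cokernel\<close> and its dual keep the structure 2-cell.\<close>

lemma id2_null_isos:
  assumes "x \<in> NS"
  shows "id2 L (trg2 L x) \<in> null_isos I (src1 L (src2 L x)) (trg1 L (src2 L x)) \<inter> cells L (trg2 L x) (trg2 L x)"
  using NS_bd[OF assms] null_cells_id[OF _ _ NS_bd(2)[OF assms]] by (simp add: null_isos_iff cells_iff)

lemma exact_ideal: "exact_ideal L I"
proof unfold_locales
  show "has_two_kernels L I"
    unfolding has_two_kernels_def two_kernel using kernel_exists by blast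
  show "has_two_cokernels L I"
    unfolding has_two_cokernels_def two_cokernel using op.kernel_exists by (metis op2_sel(2))
  show "closed_ideal L I"
    unfolding closed_ideal_def is_two_kernel_iff is_two_cokernel_iff
    using reflects_structures reflects_structures_op reflects_structures_M op.reflects_structures_M M_Mor E_Mor by blast
  show "kernels_normal L I"
    unfolding kernels_normal_def is_two_kernel_iff two_kernel two_cokernel
  proof (intro allI impI)
    fix m c n \<alpha> assume a: "m \<in> M \<and> cokernel L NS nc al m c \<alpha> \<and> trg2 L \<alpha> = n"
    then have c: "cokernel L NS nc al m c \<alpha>" by blast
    have k: "kernel L NS nc ar c m \<alpha>" using kernel_of_cokernel[OF _ c] a by blast
    note [simp] = kernelD[OF k] NS_bd(1)[OF kernelD(4)[OF k]]
    show "\<exists>n' \<theta>. \<theta> \<in> null_isos I (src1 L m) (trg1 L c) \<inter> cells L n n' \<and> kernel L NS nc ar c m (\<theta> \<bullet> \<alpha>) \<and> trg2 L (\<theta> \<bullet> \<alpha>) = n'"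
      using id2_null_isos[OF kernelD(4)[OF k]] a k by (intro exI[of _ n] exI[of _ "id2 L n"]) auto
  qed
  show "cokernels_normal L I"
    unfolding cokernels_normal_def is_two_cokernel_iff two_kernel two_cokernel
  proof (intro allI impI)
    fix e k n \<alpha> assume a: "e \<in> E \<and> kernel L NS nc ar e k \<alpha> \<and> trg2 L \<alpha> = n"
    then have k: "kernel L NS nc ar e k \<alpha>" by blast
    have c: "cokernel L NS nc al k e \<alpha>" using op.kernel_of_cokernel[of e k \<alpha>] a by simp
    note [simp] = kernelD[OF k] NS_bd(1)[OF kernelD(4)[OF k]]
    show "\<exists>n' \<theta>. \<theta> \<in> null_isos I (src1 L k) (trg1 L e) \<inter> cells L n n' \<and> cokernel L NS nc al k e (\<theta> \<bullet> \<alpha>) \<and> trg2 L (\<theta> \<bullet> \<alpha>) = n'"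
      using id2_null_isos[OF kernelD(4)[OF k]] a c by (intro exI[of _ n] exI[of _ "id2 L n"]) auto
  qed
  show "cokernel_kernel_factorizations L I"
    unfolding cokernel_kernel_factorizations_def is_two_kernel_iff is_two_cokernel_iff
    using factorization unfolding factorization_system_def by blast
qed

end

context exact_system
begin

text \<open>The composite of \<open>\<beta>\<close>, \<open>\<theta>\<close> and
  \<open>\<alpha>\<close> splits vertically into whiskerings. The part containing
  \<open>\<theta>\<close> is null because \<open>\<theta>\<close> is, and the others because they
  whisker an arbitrary 2-cell with a null morphism.\<close>

lemma strict_ideal: "strict_ideal L {f. isnull L cok f} {\<kappa>. ncell L cok \<kappa>}"
proof unfold_locales
  fix \<theta> \<alpha> \<beta> assume t: "\<theta> \<in> {\<kappa>. ncell L cok \<kappa>}" and a [simp]: "\<alpha> \<in> Cell L" "\<beta> \<in> Cell L"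
    "trg1 L (src2 L \<alpha>) = src1 L (src2 L \<theta>)" "src1 L (src2 L \<beta>) = trg1 L (src2 L \<theta>)"
  have [simp]: "\<theta> \<in> Cell L" and n: "isnull L cok (src2 L \<theta>)" "isnull L cok (trg2 L \<theta>)" "ncell L cok \<theta>" using t ncell_null by auto
  have 1: "ncell L cok (\<theta> \<star> id2 L (src2 L \<alpha>))" by (rule ncell_pre) (simp_all add: n)
  have 2: "ncell L cok (id2 L (trg2 L \<theta>) \<star> \<alpha>)" by (rule ncell_whisker_left) (simp_all add: n)
  have 3: "\<theta> \<star> \<alpha> = (id2 L (trg2 L \<theta>) \<star> \<alpha>) \<bullet> (\<theta> \<star> id2 L (src2 L \<alpha>))" by (rule hcomp_wl_wr) simp_all
  have 4: "ncell L cok (\<theta> \<star> \<alpha>)" unfolding 3 by (rule ncell_vcomp[OF 1 2]) simp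
  have 5: "ncell L cok (id2 L (src2 L \<beta>) \<star> \<theta> \<star> \<alpha>)" by (rule ncell_post[OF 4]) simp_all
  have 6: "ncell L cok (\<beta> \<star> id2 L (trg2 L \<theta> \<cdot> trg2 L \<alpha>))"
    by (rule ncell_whisker_right) (use ncell_null[OF 4] in simp_all)
  have 7: "\<beta> \<star> \<theta> \<star> \<alpha> = (\<beta> \<star> id2 L (trg2 L (\<theta> \<star> \<alpha>))) \<bullet> (id2 L (src2 L \<beta>) \<star> \<theta> \<star> \<alpha>)" by (rule hcomp_wr_wl) simp_all
  show "\<beta> \<star> \<theta> \<star> \<alpha> \<in> {\<kappa>. ncell L cok \<kappa>}" unfolding 7 mem_Collect_eq by (rule ncell_vcomp[OF 5]) (use 6 in simp_all)
qed (use isnull_Mor ncell_null ncell_id ncell_vcomp in auto)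

theorem exists_exact_ideal: "\<exists>I. exact_ideal L I"
proof -
  interpret S: strict_ideal L "{f. isnull L cok f}" "{\<kappa>. ncell L cok \<kappa>}" by (rule strict_ideal)
  define I where "I = S.strict_two_ideal"
  interpret ideal L I unfolding I_def by unfold_locales (rule S.strict_two_ideal)
  have m: "null_mor I A B = {f. isnull L cok f \<and> src1 L f = A \<and> trg1 L f = B}" for A B
    by (simp add: I_def S.null_mor_strict)
  have c: "null_cells I A B = {\<kappa>. ncell L cok \<kappa> \<and> src1 L (src2 L \<kappa>) = A \<and> trg1 L (src2 L \<kappa>) = B}" for A B
    by (simp add: I_def S.null_cells_strict)
  \<comment> \<open>Null morphisms are closed under isomorphism, so every invertible 2-cell out of a
    null morphism has a null target and is a structure.\<close>
  have NS_iff: "x \<in> NS \<longleftrightarrow> iso2 L x \<and> isnull L cok (src2 L x)" for x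
    using isnull_iso[of "src2 L x" x "trg2 L x"] isnull_iso[of "trg2 L x" "inv2 L x" "src2 L x"] src1_trg2[of x] trg1_trg2[of x]
    by (auto simp: null_structures_def m)
  \<comment> \<open>The structures \<open>x\<close> and \<open>y\<close> and their inverses are
    invertible 2-cells between null morphisms, hence null themselves; conjugating by them does not
    affect whether \<open>\<kappa>\<close> is null.\<close>
  have nc_iff: "nc x \<kappa> y \<longleftrightarrow> x \<in> NS \<and> y \<in> NS \<and> \<kappa> \<in> Cell L \<and> src2 L \<kappa> = src2 L x \<and> trg2 L \<kappa> = src2 L y \<and> ncell L cok \<kappa>" for x \<kappa> y
  proof (cases "x \<in> NS \<and> y \<in> NS \<and> \<kappa> \<in> Cell L \<and> src2 L \<kappa> = src2 L x \<and> trg2 L \<kappa> = src2 L y")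
    case True
    then have [simp]: "\<kappa> \<in> Cell L" "src2 L \<kappa> = src2 L x" "trg2 L \<kappa> = src2 L y" and xy: "x \<in> NS" "y \<in> NS" by auto
    then have [simp]: "iso2 L x" "iso2 L y" and n: "isnull L cok (src2 L x)" "isnull L cok (src2 L y)" by (simp_all add: NS_iff)
    have n': "isnull L cok (trg2 L x)" "isnull L cok (trg2 L y)" using isnull_iso[OF n(1), of x] isnull_iso[OF n(2), of y] by simp_all
    have i: "ncell L cok x" "ncell L cok y" "ncell L cok (inv2 L x)" "ncell L cok (inv2 L y)"
      by (rule ncell_iso; use n n' in simp)+
    have "ncell L cok (y \<bullet> \<kappa> \<bullet> inv2 L x) \<longleftrightarrow> ncell L cok \<kappa>"
    proof
      assume "ncell L cok \<kappa>"
      then show "ncell L cok (y \<bullet> \<kappa> \<bullet> inv2 L x)" using i by (intro ncell_vcomp) simp_all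
    next
      assume "ncell L cok (y \<bullet> \<kappa> \<bullet> inv2 L x)"
      from ncell_vcomp[OF ncell_vcomp[OF i(1) this] i(4)] have "ncell L cok (inv2 L y \<bullet> (y \<bullet> \<kappa> \<bullet> inv2 L x) \<bullet> x)"
        by simp
      then show "ncell L cok \<kappa>" by simp
    qed
    then show ?thesis using xy by (simp add: null_between_def c)
  qed (auto simp: null_between_def)
  interpret exact_nullity_ideal L I E M ker cok
    by unfold_locales (rule NS_iff nc_iff)+
  show ?thesis using exact_ideal by blast
qed

end

theorem theorem3p4:
  fixes L :: "('o, 'm, 'c) two_cat"
  assumes "two_category L"
  shows
    "(\<exists>E M K C \<eta> \<epsilon>.
        factorization_system L E M \<and> proper_11 L E M \<and>
        normal_psfun (full_sub (arrow2 L) E) (full_sub (arrow2 L) M) K \<and>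
        normal_psfun (full_sub (arrow2 L) M) (full_sub (arrow2 L) E) C \<and>
        biequivalence_over L (full_sub (arrow2 L) E) (dom2 L E) (full_sub (arrow2 L) M) (cod2 L M)
          K C \<eta> \<epsilon>)
     \<longleftrightarrow>
     (\<exists>I. two_ideal L I \<and>
        has_two_kernels L I \<and> has_two_cokernels L I \<and>
        closed_ideal L I \<and>
        kernels_normal L I \<and> cokernels_normal L I \<and>
        cokernel_kernel_factorizations L I)" (is "?F \<longleftrightarrow> ?N")
proof
  assume ?F
  then obtain E M K C \<eta> \<epsilon> where f: "factorization_system L E M" "proper_11 L E M"
    and b: "biequivalence_over L (full_sub (arrow2 L) E) (dom2 L E) (full_sub (arrow2 L) M) (cod2 L M) K C \<eta> \<epsilon>"
    by blast
  obtain I where "exact_ideal L I"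
    using exact_system.exists_exact_ideal[OF two_category.exact_system_of_biequivalence[OF assms f b]] by blast
  then interpret exact_ideal L I .
  show ?N using ideal kernels cokernels closed kernels_normal cokernels_normal factorizations by blast
next
  assume ?N
  then obtain I where "two_ideal L I" "has_two_kernels L I" "has_two_cokernels L I" "closed_ideal L I"
    "kernels_normal L I" "cokernels_normal L I" "cokernel_kernel_factorizations L I"
    by blast
  then interpret exact_ideal L I
    using assms by (simp add: exact_ideal_def exact_ideal_axioms_def ideal_def ideal_axioms_def)
  show ?F by (rule factorization_biequivalence)
qed

end
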